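(* Let $n\le m$. There is a constant $c_1=c_1(n)>0$, depending only on $n$, such that the following holds. Let $\Omega\subset\mathbb{R}^n$ be a domain, let $\omega$ be a bounded $n$-volume form in $\mathbb{R}^m$, and let $f:\Omega\to\mathbb{R}^m$ be a finite distortion $\omega$-curve with distortion function $K_f$ such that the pair $(f,\omega)$ satisfies condition (D). Put $c=c(n,\omega)=\dfrac{n|\omega|_{\ell_1}}{c_1|\omega|_{inf}}$. If $\exp(\lambda K_f)\in L^1_{loc}(\Omega)$ for some $\lambda>c$, then there is a continuous and almost everywhere differentiable representative of $f$. Moreover, this representative has Lusin's (N) property, that is, it maps sets of zero $n$-dimensional Lebesgue measure to sets of zero $n$-dimensional measure.
   Context: An $n$-volume form on $\mathbb{R}^m$ is a smooth, non-vanishing, closed differential $n$-form $\omega=\sum_I\phi_I\,dx_I$, the sum being over multi-indices $I=(i_1,\dots,i_n)$, $1\le i_1<\dots<i_n\le m$, with $dx_I=dx_{i_1}\wedge\dots\wedge dx_{i_n}$. It is called bounded if all the (not identically zero) functions $\phi_I$ are bounded on $\mathbb{R}^m$ and there is a constant $c>0$ such that for every $x\in\mathbb{R}^m$ there is a multi-index $I_x$ with $|\phi_{I_x}(x)|>c$. The pointwise comass norm is $\|\omega\|(p)=\sup\{|\omega_p(v_1,\dots,v_n)|: v_1,\dots,v_n\in\mathbb{R}^m,\ |v_i|\le 1\}$. Set $|\omega|_{\ell_1}=\sup_{x\in\mathbb{R}^m}\sum_I|\phi_I(x)|$ and $|\omega|_{inf}=\inf\{\|\omega\|(x):x\in\mathbb{R}^m\}$.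 Let $H_\omega$ be the set of multi-indices $I$ such that $\phi_I$ is not identically zero. For a Sobolev map $f$ and an $n$-form $\eta$, $\star f^*\eta$ denotes the real-valued function with $(\star f^*\eta)\,dx_1\wedge\dots\wedge dx_n=f^*\eta$ (pullback computed with weak derivatives). $|Df(x)|$ is the operator norm of the weak differential. Finite distortion $\omega$-curve: a map $f\in W^{1,1}_{loc}(\Omega,\mathbb{R}^m)$ such that $\star f^*\omega\in L^1_{loc}(\Omega)$ and there is a measurable function $K_f\ge 1$, finite almost everywhere (the distortion function), with $(\|\omega\|\circ f)(x)\,|Df(x)|^n\le K_f(x)\,(\star f^*\omega)(x)$ for almost every $x\in\Omega$. Condition (D): let $E_f$ be the set of $x\in\Omega$ for which there exists a sequence $x_k\to x$ such that $\star f^*dx_I(x_k)\to\infty$ for some $I\in H_\omega$. The pair $(f,\omega)$ satisfies condition (D) if $E_f$ can be covered by countably many open balls $\{B_i\}_{i=1}^\infty$ such that on each $B_i$ there is a multi-index $I_i\in H_\omega$ with $\star f^*dx_{I_i}\ge\max_{I\in H_\omega}\{\star f^*dx_I\}$. In the target $\mathbb{R}^m$, $n$-dimensional measure means the Hausdorff measure $\mathcal{H}^n$. *)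

theory Defs
  imports "HOL-Analysis.Analysis"
begin

section \<open>The target space\<close>

text \<open>
  The target dimension \<open>m\<close> has to be quantified after a constant that depends only on \<open>n\<close>, so
  it cannot be a type.  The space of dimension \<open>m\<close> is the carrier of the library topology
  \<^term>\<open>Euclidean_space m\<close>, that is, the functions on the naturals that vanish from \<open>m\<close>
  on; coordinates are numbered from \<open>0\<close>.  Its Euclidean norm is
  \<^term>\<open>\<lambda>x. L2_set x {..<m}\<close>.  The domain dimension \<open>n\<close> is \<open>CARD('n)\<close>, and the linear order on
  \<open>'n\<close> says in which order the coordinates of the domain are taken.
\<close>

abbreviation Rm :: "nat \<Rightarrow> (nat \<Rightarrow> real) set" where
  "Rm m \<equiv> topspace (Euclidean_space m)"

definition partial :: "nat \<Rightarrow> ((nat \<Rightarrow> real) \<Rightarrow> real) \<Rightarrow> (nat \<Rightarrow> real) \<Rightarrow> real" where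
  "partial i u x = deriv (\<lambda>t. u (x(i := t))) (x i)"

primrec Ck_Rm :: "nat \<Rightarrow> nat \<Rightarrow> ((nat \<Rightarrow> real) \<Rightarrow> real) \<Rightarrow> bool" where
  "Ck_Rm m 0 u \<longleftrightarrow> continuous_map (Euclidean_space m) euclideanreal u"
| "Ck_Rm m (Suc k) u \<longleftrightarrow> continuous_map (Euclidean_space m) euclideanreal u \<and>
     (\<forall>i<m. (\<forall>x\<in>Rm m. (\<lambda>t. u (x(i := t))) field_differentiable at (x i)) \<and>
            Ck_Rm m k (partial i u))"

definition smooth_Rm :: "nat \<Rightarrow> ((nat \<Rightarrow> real) \<Rightarrow> real) \<Rightarrow> bool" where
  "smooth_Rm m u \<longleftrightarrow> (\<forall>k. Ck_Rm m k u)"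


section \<open>Differential forms\<close>

text \<open>
  A multi-index \<open>(i\<^sub>1 < \<dots> < i\<^sub>n)\<close> is a strictly increasing map from \<open>'n\<close> to \<open>{..<m}\<close>, and the form
  \<open>\<omega> = (\<Sum>I. \<phi>\<^sub>I dx\<^sub>I)\<close> is given by its coefficient functions \<open>\<phi>\<close>.
\<close>

type_synonym 'n form = "('n \<Rightarrow> nat) \<Rightarrow> (nat \<Rightarrow> real) \<Rightarrow> real"

definition multi_indices :: "nat \<Rightarrow> ('n::{finite,linorder} \<Rightarrow> nat) set" where
  "multi_indices m = {I. strict_mono I \<and> range I \<subseteq> {..<m}}"

definition dx :: "('n::{finite,linorder} \<Rightarrow> nat) \<Rightarrow> ('n \<Rightarrow> nat \<Rightarrow> real) \<Rightarrow> real" where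
  "dx I v = det (\<chi> k l. v l (I k))"

definition form_at ::
    "nat \<Rightarrow> 'n::{finite,linorder} form \<Rightarrow> (nat \<Rightarrow> real) \<Rightarrow> ('n \<Rightarrow> nat \<Rightarrow> real) \<Rightarrow> real" where
  "form_at m \<phi> p v = (\<Sum>I\<in>multi_indices m. \<phi> I p * dx I v)"

text \<open>
  For \<open>J = (j\<^sub>0 < \<dots> < j\<^sub>n)\<close>, \<open>face J l\<close> is the multi-index obtained by omitting \<open>j\<^sub>l\<close>.  Since
  \<open>dx\<close> of \<open>j\<^sub>l\<close> wedged with \<open>dx\<close> of \<open>face J l\<close> is \<open>(-1)^l\<close> times \<open>dx\<^sub>J\<close>, \<open>ext_deriv \<phi> J\<close> is the
  coefficient of \<open>dx\<^sub>J\<close> in \<open>d\<omega> = (\<Sum>I. \<Sum>i. \<partial>\<^sub>i \<phi>\<^sub>I dx\<^sub>i \<and> dx\<^sub>I)\<close>.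
\<close>

definition face :: "(nat \<Rightarrow> nat) \<Rightarrow> nat \<Rightarrow> 'n::{finite,linorder} \<Rightarrow> nat" where
  "face J l k = (let r = card {i. i < k} in J (if r < l then r else Suc r))"

definition ext_deriv ::
    "'n::{finite,linorder} form \<Rightarrow> (nat \<Rightarrow> nat) \<Rightarrow> (nat \<Rightarrow> real) \<Rightarrow> real" where
  "ext_deriv \<phi> J x = (\<Sum>l\<le>CARD('n). (-1) ^ l * partial (J l) (\<phi> (face J l)) x)"

definition closed_form :: "nat \<Rightarrow> 'n::{finite,linorder} form \<Rightarrow> bool" where
  "closed_form m \<phi> \<longleftrightarrow>
     (\<forall>J. strict_mono_on {..CARD('n)} J \<and> J ` {..CARD('n)} \<subseteq> {..<m} \<longrightarrow>
          (\<forall>x\<in>Rm m. ext_deriv \<phi> J x = 0))"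

definition volume_form :: "nat \<Rightarrow> 'n::{finite,linorder} form \<Rightarrow> bool" where
  "volume_form m \<phi> \<longleftrightarrow>
     (\<forall>I\<in>multi_indices m. smooth_Rm m (\<phi> I)) \<and>
     (\<forall>x\<in>Rm m. \<exists>I\<in>multi_indices m. \<phi> I x \<noteq> 0) \<and>
     closed_form m \<phi>"

definition bounded_volume_form :: "nat \<Rightarrow> 'n::{finite,linorder} form \<Rightarrow> bool" where
  "bounded_volume_form m \<phi> \<longleftrightarrow>
     volume_form m \<phi> \<and>
     (\<forall>I\<in>multi_indices m. bounded (\<phi> I ` Rm m)) \<and>
     (\<exists>c>0. \<forall>x\<in>Rm m. \<exists>I\<in>multi_indices m. \<bar>\<phi> I x\<bar> > c)"

text \<open>The supremum in \<open>l1_norm\<close> is meaningful for forms with bounded coefficients only.\<close>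

definition comass :: "nat \<Rightarrow> 'n::{finite,linorder} form \<Rightarrow> (nat \<Rightarrow> real) \<Rightarrow> real" where
  "comass m \<phi> p =
     (SUP v\<in>{v. \<forall>k. v k \<in> Rm m \<and> L2_set (v k) {..<m} \<le> 1}. \<bar>form_at m \<phi> p v\<bar>)"

definition l1_norm :: "nat \<Rightarrow> 'n::{finite,linorder} form \<Rightarrow> real" where
  "l1_norm m \<phi> = (SUP x\<in>Rm m. \<Sum>I\<in>multi_indices m. \<bar>\<phi> I x\<bar>)"

definition inf_norm :: "nat \<Rightarrow> 'n::{finite,linorder} form \<Rightarrow> real" where
  "inf_norm m \<phi> = (INF x\<in>Rm m. comass m \<phi> x)"

definition H_form :: "nat \<Rightarrow> 'n::{finite,linorder} form \<Rightarrow> ('n \<Rightarrow> nat) set" where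
  "H_form m \<phi> = {I \<in> multi_indices m. \<exists>x\<in>Rm m. \<phi> I x \<noteq> 0}"


section \<open>Sobolev maps\<close>

definition L1_loc :: "(real ^ 'n) set \<Rightarrow> (real ^ 'n \<Rightarrow> real) \<Rightarrow> bool" where
  "L1_loc \<Omega> u \<longleftrightarrow> (\<forall>C. compact C \<and> C \<subseteq> \<Omega> \<longrightarrow> set_integrable lebesgue C u)"

primrec Ck :: "nat \<Rightarrow> (real ^ 'n \<Rightarrow> real) \<Rightarrow> bool" where
  "Ck 0 u \<longleftrightarrow> continuous_on UNIV u"
| "Ck (Suc k) u \<longleftrightarrow> (\<forall>x. u differentiable (at x)) \<and>
     (\<forall>j. Ck k (\<lambda>x. frechet_derivative u (at x) (axis j 1)))"

definition test_function :: "(real ^ 'n) set \<Rightarrow> (real ^ 'n \<Rightarrow> real) \<Rightarrow> bool" where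
  "test_function \<Omega> \<psi> \<longleftrightarrow>
     (\<forall>k. Ck k \<psi>) \<and> compact (closure {x. \<psi> x \<noteq> 0}) \<and> closure {x. \<psi> x \<noteq> 0} \<subseteq> \<Omega>"

definition weak_partial ::
    "(real ^ 'n) set \<Rightarrow> 'n \<Rightarrow> (real ^ 'n \<Rightarrow> real) \<Rightarrow> (real ^ 'n \<Rightarrow> real) \<Rightarrow> bool" where
  "weak_partial \<Omega> j u w \<longleftrightarrow>
     (\<forall>\<psi>. test_function \<Omega> \<psi> \<longrightarrow>
        (LINT x:\<Omega>|lebesgue. u x * frechet_derivative \<psi> (at x) (axis j 1)) =
        - (LINT x:\<Omega>|lebesgue. w x * \<psi> x))"

text \<open>
  \<open>W11_loc \<Omega> m f D\<close>: \<open>f\<close> is a local Sobolev map on \<open>\<Omega>\<close> with values in the space of dimension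
  \<open>m\<close>, and \<open>D\<close> is a representative of its weak differential, \<open>D x j\<close> being the vector of the
  weak partial derivatives of \<open>f\<close> in direction \<open>j\<close> at \<open>x\<close>.  As weak derivatives are determined
  only up to null sets, the representative is kept explicit.
\<close>

definition W11_loc ::
    "(real ^ 'n) set \<Rightarrow> nat \<Rightarrow> (real ^ 'n \<Rightarrow> nat \<Rightarrow> real) \<Rightarrow> (real ^ 'n \<Rightarrow> 'n \<Rightarrow> nat \<Rightarrow> real) \<Rightarrow> bool"
  where
  "W11_loc \<Omega> m f D \<longleftrightarrow>
     f ` \<Omega> \<subseteq> Rm m \<and>
     (\<forall>i<m. L1_loc \<Omega> (\<lambda>x. f x i) \<and>
        (\<forall>j. L1_loc \<Omega> (\<lambda>x. D x j i) \<and> weak_partial \<Omega> j (\<lambda>x. f x i) (\<lambda>x. D x j i)))"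

text \<open>The operator norm of the linear map that sends the \<open>j\<close>-th unit vector to \<open>A j\<close>.\<close>

definition op_norm :: "nat \<Rightarrow> ('n::finite \<Rightarrow> nat \<Rightarrow> real) \<Rightarrow> real" where
  "op_norm m A =
     (SUP v\<in>{v :: real ^ 'n. norm v \<le> 1}. L2_set (\<lambda>i. \<Sum>j\<in>UNIV. v $ j * A j i) {..<m})"

definition star_pullback ::
    "nat \<Rightarrow> 'n form \<Rightarrow> (real ^ 'n::{finite,linorder} \<Rightarrow> nat \<Rightarrow> real) \<Rightarrow>
     (real ^ 'n::{finite,linorder} \<Rightarrow> 'n \<Rightarrow> nat \<Rightarrow> real) \<Rightarrow> real ^ 'n::{finite,linorder} \<Rightarrow> real" where
  "star_pullback m \<phi> f D x = form_at m \<phi> (f x) (D x)"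

text \<open>
  The distortion function takes values in the extended reals because it need only be finite
  almost everywhere.
\<close>

definition finite_distortion_curve ::
    "(real ^ 'n::{finite,linorder}) set \<Rightarrow> nat \<Rightarrow> 'n form \<Rightarrow> (real ^ 'n::{finite,linorder} \<Rightarrow> nat \<Rightarrow> real) \<Rightarrow>
     (real ^ 'n::{finite,linorder} \<Rightarrow> 'n \<Rightarrow> nat \<Rightarrow> real) \<Rightarrow> (real ^ 'n::{finite,linorder} \<Rightarrow> ereal) \<Rightarrow> bool" where
  "finite_distortion_curve \<Omega> m \<phi> f D K \<longleftrightarrow>
     W11_loc \<Omega> m f D \<and>
     L1_loc \<Omega> (star_pullback m \<phi> f D) \<and>
     K \<in> borel_measurable (lebesgue_on \<Omega>) \<and>
     (\<forall>x\<in>\<Omega>. 1 \<le> K x) \<and>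
     (AE x in lebesgue_on \<Omega>. K x < \<infinity>) \<and>
     (AE x in lebesgue_on \<Omega>.
        ereal (comass m \<phi> (f x) * op_norm m (D x) ^ CARD('n)) \<le>
        K x * ereal (star_pullback m \<phi> f D x))"

text \<open>Here \<open>dx I (D x)\<close> is the Hodge star of the pullback of \<open>dx\<^sub>I\<close> at \<open>x\<close>.\<close>

definition exceptional_set ::
    "(real ^ 'n::{finite,linorder}) set \<Rightarrow> nat \<Rightarrow> 'n form \<Rightarrow>
     (real ^ 'n::{finite,linorder} \<Rightarrow> 'n \<Rightarrow> nat \<Rightarrow> real) \<Rightarrow> (real ^ 'n::{finite,linorder}) set" where
  "exceptional_set \<Omega> m \<phi> D =
     {x \<in> \<Omega>. \<exists>X I. (\<forall>k. X k \<in> \<Omega>) \<and> X \<longlonglongrightarrow> x \<and> I \<in> H_form m \<phi> \<and>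
        filterlim (\<lambda>k. dx I (D (X k))) at_top sequentially}"

text \<open>
  The functions compared on the balls are determined only almost everywhere, hence the comparison
  is almost everywhere, on the part of the ball that lies in \<open>\<Omega>\<close>.  If the exceptional set is
  empty, the empty family of balls covers it.
\<close>

definition condition_D ::
    "(real ^ 'n::{finite,linorder}) set \<Rightarrow> nat \<Rightarrow> 'n form \<Rightarrow>
     (real ^ 'n::{finite,linorder} \<Rightarrow> 'n \<Rightarrow> nat \<Rightarrow> real) \<Rightarrow> bool" where
  "condition_D \<Omega> m \<phi> D \<longleftrightarrow>
     (\<exists>\<B>. countable \<B> \<and> exceptional_set \<Omega> m \<phi> D \<subseteq> \<Union>\<B> \<and>
        (\<forall>B\<in>\<B>. (\<exists>a r. r > 0 \<and> B = ball a r) \<and>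
           (\<exists>I\<in>H_form m \<phi>. AE x in lebesgue_on (B \<inter> \<Omega>).
              dx I (D x) \<ge> Max ((\<lambda>J. dx J (D x)) ` H_form m \<phi>))))"


section \<open>Properties of the representative\<close>

definition differentiable_Rm ::
    "nat \<Rightarrow> (real ^ 'n \<Rightarrow> nat \<Rightarrow> real) \<Rightarrow> real ^ 'n \<Rightarrow> bool" where
  "differentiable_Rm m g x \<longleftrightarrow>
     (\<exists>A :: 'n \<Rightarrow> nat \<Rightarrow> real.
        ((\<lambda>y. L2_set (\<lambda>i. g y i - g x i - (\<Sum>j\<in>UNIV. (y - x) $ j * A j i)) {..<m} / norm (y - x))
           \<longlongrightarrow> 0) (at x))"

definition diam_Rm :: "nat \<Rightarrow> (nat \<Rightarrow> real) set \<Rightarrow> ennreal" where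
  "diam_Rm m A = (SUP x\<in>A. SUP y\<in>A. ennreal (L2_set (\<lambda>i. x i - y i) {..<m}))"

text \<open>
  The \<open>s\<close>-dimensional Hausdorff measure on the space of dimension \<open>m\<close>, for \<open>s \<ge> 1\<close>, with the
  usual normalising constant.
\<close>

definition hausdorff_measure :: "nat \<Rightarrow> nat \<Rightarrow> (nat \<Rightarrow> real) set \<Rightarrow> ennreal" where
  "hausdorff_measure m s E =
     (SUP \<delta>\<in>{0<..}. INF A\<in>{A :: nat \<Rightarrow> (nat \<Rightarrow> real) set.
          E \<subseteq> (\<Union>i. A i) \<and> (\<forall>i. A i \<subseteq> Rm m \<and> diam_Rm m (A i) \<le> \<delta>)}.
        \<Sum>i. ennreal (unit_ball_vol (real s) / 2 ^ s) * diam_Rm m (A i) ^ s)"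

definition lusin_N :: "(real ^ 'n) set \<Rightarrow> nat \<Rightarrow> (real ^ 'n \<Rightarrow> nat \<Rightarrow> real) \<Rightarrow> bool" where
  "lusin_N \<Omega> m g \<longleftrightarrow>
     (\<forall>N. N \<subseteq> \<Omega> \<and> N \<in> null_sets lebesgue \<longrightarrow> hausdorff_measure m CARD('n) (g ` N) = 0)"

end

theory Submission
  imports Defs
begin

text \<open>
On a small cube let \<open>h\<close> be the largest entry of the differential. The Lipschitz truncation of the curve at
height \<open>2 ^ k\<close> agrees with it wherever the maximal function of \<open>h\<close> is at most \<open>2 ^ k\<close>, and the homotopy
formula for a closed form compares the pullbacks under two truncations through boundary terms only. Hence
the integral of the Jacobian over \<open>h > 2 ^ k\<close> is at most \<open>(2 ^ k) ^ (n - 1)\<close> times the integral of \<open>h\<close> over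
\<open>h > 2 ^ k / 2\<close>, up to constants and a small error on a larger cube. Summed over \<open>k\<close> with weights that are powers
of \<open>k\<close>, these inequalities and the distortion inequality yield, by absorption, local integrability of
\<open>h ^ n * ln (1 + h) ^ (2 * n)\<close>; the exponential integrability of the distortion is what makes the absorption
possible. The logarithmic gain makes the telescoping sum of oscillations along chains of shrinking cubes
converge, with an oscillation controlled by an integrable density; continuity, differentiability almost
everywhere and Lusin's condition follow. For \<open>n = 1\<close> the density is \<open>h\<close> itself.
\<close>

text \<open>The pullback cannot be integrated by parts directly: the map is only in W^{1,1}, its
  Jacobian only integrable, and the coefficients of the form depend on the map, so subtracting a
  constant from it is of no use. Two truncations at levels \<open>k < l\<close> can be compared
  instead. The error at the upper level vanishes along a sequence of levels because
  \<open>h ^ n / log h\<close> is integrable, which the distortion inequality and the exponential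
  hypothesis give at once. The boundary term is the difference of two maps times
  \<open>n - 1\<close> derivatives; as the truncations are made to oscillate by a power of their
  height less than one, it is controlled by a power of the maximal function below \<open>n\<close>,
  for which integrability is available. In the absorption, the weights \<open>k ^ (2 * n)\<close>
  give the left side one more logarithm than the right side. Where \<open>K\<close> is at most
  \<open>eps\<close> times the level this surplus pays for the distortion; elsewhere the exponential
  does, at the rate \<open>n * ln 2 / eps\<close>. The absorption bounds \<open>eps\<close> from
  above in terms of the two norms of the form, and the rate must stay below \<open>l\<close>:
  together these give the threshold and the constant \<open>c1\<close>.\<close>

lemmas int_add = Bochner_Integration.integrable_add
  and int_diff = Bochner_Integration.integrable_diff
  and int_sum = Bochner_Integration.integrable_sum
  and int_bound = Bochner_Integration.integrable_bound
  and int_max = Bochner_Integration.integrable_max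
  and lint_add = Bochner_Integration.integral_add
  and lint_diff = Bochner_Integration.integral_diff
  and lint_sum = Bochner_Integration.integral_sum
  and lint_cong = Bochner_Integration.integral_cong

abbreviation ind :: "'a set \<Rightarrow> 'a \<Rightarrow> 'b::zero_neq_one" where "ind \<equiv> indicator"

abbreviation L1 :: "('a::euclidean_space \<Rightarrow> real) \<Rightarrow> bool" where "L1 \<equiv> integrable lebesgue"

abbreviation lint :: "('a::euclidean_space \<Rightarrow> real) \<Rightarrow> real" (binder "LI " 60)
  where "lint \<equiv> integral\<^sup>L lebesgue"

abbreviation vol :: "'a::euclidean_space set \<Rightarrow> real" where "vol \<equiv> measure lebesgue"

abbreviation bml :: "('a::euclidean_space \<Rightarrow> real) set" where "bml \<equiv> borel_measurable lebesgue"

notation tendsto (infixr "--->" 55)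

abbreviation seq_limit :: "(nat \<Rightarrow> 'a::topological_space) \<Rightarrow> 'a \<Rightarrow> bool" (infix "---->" 60)
  where "X ----> l \<equiv> (X ---> l) sequentially"

abbreviation cont where "cont \<equiv> continuous_on UNIV"

abbreviation hrd (infix "hrd" 50) where "f hrd D \<equiv> (f has_real_derivative D)"

abbreviation lm where "lm \<equiv> lebesgue :: 'a::euclidean_space measure"

abbreviation sh :: "real ^ 'n::finite \<Rightarrow> real \<Rightarrow> 'n \<Rightarrow> real ^ 'n" where "sh x s j \<equiv> x + s *\<^sub>R axis j 1"

abbreviation pd :: "(real ^ 'n::finite \<Rightarrow> real) \<Rightarrow> real ^ 'n \<Rightarrow> 'n \<Rightarrow> real"
  where "pd f x j \<equiv> frechet_derivative f (at x) (axis j 1)"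

lemmas slint_def = set_lebesgue_integral_def

section \<open>Smooth functions of one variable\<close>

text \<open>The derivative enters as a witness rather than as \<open>deriv\<close>, so that closure
  under sums and products is a plain induction.\<close>

primrec smooth1 :: "nat => (real => real) => bool" where
 "smooth1 0 b \<longleftrightarrow> cont b"
| "smooth1 (Suc k) b \<longleftrightarrow> (\<exists>b'. (\<forall>t. (b hrd b' t) (at t)) \<and> smooth1 k b')"

definition smooth :: "(real => real) => bool" where
 "smooth b \<longleftrightarrow> (\<forall>k. smooth1 k b)"

lemma smooth1_SucI:
 "(!!t. (b hrd b' t) (at t)) ==> smooth1 k b' ==> smooth1 (Suc k) b"
 unfolding smooth1.simps by (intro exI[of _ b']) simp

lemma smooth1_continuous: "smooth1 k b ==> cont b"
 by (cases k) (auto intro: DERIV_continuous_on)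

lemma smooth1_Suc_D: "smooth1 (Suc k) b ==> smooth1 k b"
proof (induction k arbitrary: b)
 case 0
 then show ?case by (auto intro: DERIV_continuous_on)
next
 case (Suc k)
 then show ?case by (metis smooth1.simps(2))
qed

lemma smooth1_const: "smooth1 k (%t. c)"
 by (induction k arbitrary: c) (auto intro!: exI[of _ "%t. 0"])

lemma smooth1_add: "smooth1 k f ==> smooth1 k g ==> smooth1 k (%t. f t + g t)"
proof (induction k arbitrary: f g)
 case 0
 then show ?case by (auto intro: continuous_intros)
next
 case (Suc k)
 then obtain f' g' where "\<forall>t. (f hrd f' t) (at t)" "smooth1 k f'"
  "\<forall>t. (g hrd g' t) (at t)" "smooth1 k g'" by auto
 then show ?case using Suc.IH[of f' g'] by (auto intro!: exI[of _ "%t. f' t + g' t"] DERIV_add)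
qed

lemma smooth1_mult: "smooth1 k f ==> smooth1 k g ==> smooth1 k (%t. f t * g t)"
proof (induction k arbitrary: f g)
 case 0
 then show ?case by (auto intro: continuous_intros)
next
 case (Suc k)
 then obtain f' g' where D: "\<forall>t. (f hrd f' t) (at t)" "smooth1 k f'"
  "\<forall>t. (g hrd g' t) (at t)" "smooth1 k g'" by auto
 have "smooth1 k f" "smooth1 k g" using Suc.prems smooth1_Suc_D by blast+
 then have "smooth1 k (%t. f' t * g t + g' t * f t)" using D Suc.IH by (intro smooth1_add) auto
 then show ?case using D by (auto intro!: exI[of _ "%t. f' t * g t + g' t * f t"] DERIV_mult)
qed

lemma smooth1_affine: "smooth1 k f ==> smooth1 k (%t. f (a * t + c))"
proof (induction k arbitrary: f)
 case 0
 then show ?case by (auto intro!: continuous_on_compose2[of UNIV f] continuous_intros)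
next
 case (Suc k)
 then obtain f' where D: "\<forall>t. (f hrd f' t) (at t)" "smooth1 k f'" by auto
 have "((%t. f (a * t + c)) hrd f' (a * t + c) * a) (at t)" for t
  by (rule DERIV_chain2[of f]) (auto intro!: derivative_eq_intros simp: D)
 moreover have "smooth1 k (%t. f' (a * t + c) * a)"
  using Suc.IH[OF D(2)] smooth1_const[of k a] by (rule smooth1_mult)
 ultimately show ?case by (rule smooth1_SucI)
qed

lemma smooth_continuous: "smooth b ==> cont b"
 unfolding smooth_def using smooth1_continuous by blast

lemma smooth_DERIV: "smooth b ==> (b hrd deriv b t) (at t)"
 unfolding smooth_def by (metis DERIV_imp_deriv smooth1.simps(2))

lemma smooth_deriv: assumes "smooth b" shows "smooth (deriv b)"
 unfolding smooth_def by (metis smooth_def assms smooth1.simps(2) DERIV_imp_deriv ext add_0)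

lemma smooth_primitive:
 assumes "smooth b" "!!t. (B hrd b t) (at t)" shows "smooth B"
 unfolding smooth_def
proof
 fix k show "smooth1 k B" using assms by (cases k) (auto simp: smooth_def intro: DERIV_continuous_on)
qed

lemma smooth_const: "smooth (%t. c)"
 by (simp add: smooth_def smooth1_const)

lemma smooth_add: "smooth f ==> smooth g ==> smooth (%t. f t + g t)"
 by (simp add: smooth_def smooth1_add)

lemma smooth_mult: "smooth f ==> smooth g ==> smooth (%t. f t * g t)"
 by (simp add: smooth_def smooth1_mult)

lemma smooth_affine: "smooth f ==> smooth (%t. f (a * t + c))"
 by (simp add: smooth_def smooth1_affine)

lemma smooth_diff: assumes "smooth f" "smooth g" shows "smooth (%t. f t - g t)"
 using smooth_add[OF assms(1) smooth_mult[OF smooth_const[of "-1"] assms(2)]] by simp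

lemma smooth_scale: assumes "smooth f" shows "smooth (%t. f ((t - c) / r) / d)"
 using smooth_mult[OF smooth_affine[OF assms, of "1/r" "-c/r"] smooth_const[of "1/d"]]
 by (simp add: field_simps diff_divide_distrib)

lemma smooth_scale': assumes "smooth f" shows "smooth (%t. f ((t - c) / r))"
 using smooth_scale[OF assms, of c r 1] by simp


section \<open>A flat function, a bump of mass one and its primitive\<close>

definition flat_exp :: "nat => real => real" where
 "flat_exp k t = (if t > 0 then (1 / t) ^ k * exp (- (1 / t)) else 0)"

text \<open>The powers of \<open>1 / t\<close> belong to the family because differentiating
  \<open>exp (- (1 / t))\<close> produces them: derivatives are linear combinations of members,
  which gives smoothness of every member at once.\<close>

lemma flat_exp_DERIV:
 "(flat_exp k hrd flat_exp (Suc (Suc k)) t - real k * flat_exp (Suc k) t) (at t)"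
proof -
 consider "t > 0" | "t < 0" | "t = 0" by linarith
 then show ?thesis
 proof cases
  case 1
  have "((%t. (1 / t) ^ k * exp (- (1 / t))) hrd
    flat_exp (Suc (Suc k)) t - real k * flat_exp (Suc k) t) (at t)"
  proof -
   have a: "((%t. 1 / t) hrd - (1 / t * (1 / t))) (at t)" using 1 by (auto intro!: derivative_eq_intros)
   have b: "((%t. exp (- (1 / t))) hrd exp (- (1 / t)) * (1 / t * (1 / t))) (at t)"
    by (rule DERIV_cong[OF DERIV_fun_exp[OF DERIV_minus[OF a]]]) simp
   show ?thesis by (rule DERIV_cong[OF DERIV_mult[OF DERIV_power[OF a, of k] b]])
     (use 1 in "cases k; simp add: flat_exp_def algebra_simps")
  qed
  then show ?thesis by (rule DERIV_cong_ev[THEN iffD1, rotated -1])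
    (use 1 in \<open>auto simp: flat_exp_def intro: eventually_mono[OF eventually_gt_at_top] order_tendstoD
      eventually_nhds_in_open[of "{0<..}", THEN eventually_mono]\<close>)
 next
  case 2
  have "((%t. 0) hrd flat_exp (Suc (Suc k)) t - real k * flat_exp (Suc k) t) (at t)"
   using 2 by (simp add: flat_exp_def)
  then show ?thesis by (rule DERIV_cong_ev[THEN iffD1, rotated -1]) (use 2 in \<open>auto simp: flat_exp_def
      intro!: eventually_nhds_in_open[of "{..<0}", THEN eventually_mono]\<close>)
 next
  case 3
  \<comment> \<open>At \<open>0\<close> the difference quotient from the right is
    \<open>(1 / t) ^ (k + 1) * exp (- (1 / t))\<close>; substituting \<open>x = 1 / t\<close>
    reduces it to exponentials beating powers.\<close>
  have *: "((%x::real. x ^ Suc k / exp x) ---> 0) at_top" by (rule tendsto_power_div_exp_0)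
  have "((%t. (inverse t) ^ Suc k / exp (inverse t)) ---> 0) (at_right (0::real))"
   by (rule filterlim_compose[OF * filterlim_inverse_at_top_right])
  then have R: "((%t. (flat_exp k t - flat_exp k 0) / (t - 0)) ---> 0) (at_right (0::real))"
   by (rule Lim_transform_eventually) (auto simp: flat_exp_def exp_minus field_simps eventually_at_filter)
  have L: "((%t. (flat_exp k t - flat_exp k 0) / (t - 0)) ---> 0) (at_left (0::real))"
   by (rule Lim_transform_eventually[OF tendsto_const]) (auto simp: flat_exp_def eventually_at_filter)
  have "((%t. (flat_exp k t - flat_exp k 0) / (t - 0)) ---> 0) (at (0::real))"
   using L R by (simp add: filterlim_split_at_real)
  then show ?thesis using 3 by (simp add: has_field_derivative_iff flat_exp_def)
 qed
qed

lemma smooth1_flat_exp: "smooth1 m (flat_exp k)"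
proof (induction m arbitrary: k)
 case 0
 have "cont (flat_exp k)" by (rule DERIV_continuous_on) (rule flat_exp_DERIV)
 then show ?case by simp
next
 case (Suc m)
 have "smooth1 m (%t. flat_exp (Suc (Suc k)) t + (- real k) * flat_exp (Suc k) t)"
  by (intro smooth1_add smooth1_mult smooth1_const Suc)
 then show ?case by (intro smooth1_SucI[OF flat_exp_DERIV]) simp
qed

text \<open>Positive exactly between \<open>-1\<close> and \<open>1\<close>. The arguments are
  written in the form \<open>a * t + c\<close> so that \<open>smooth_affine\<close> applies
  literally.\<close>

definition bump0 :: "real => real" where
 "bump0 t = flat_exp 0 (1 * t + 1) * flat_exp 0 ((-1) * t + 1)"

definition bump :: "real => real" where
 "bump t = bump0 t / integral {-2..2} bump0"

text \<open>The lower limit lies below the support of the bump, so this is the smooth step that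
  rises from \<open>0\<close> to \<open>1\<close> between \<open>-1\<close> and
  \<open>1\<close>.\<close>

definition ramp :: "real => real" where
 "ramp t = integral {-2..t} bump"

lemma smooth_bump0: "smooth bump0"
proof -
 have "smooth (flat_exp 0)" by (simp add: smooth_def smooth1_flat_exp)
 then have "smooth (%t. flat_exp 0 (1 * t + 1) * flat_exp 0 ((-1) * t + 1))"
  by (intro smooth_mult smooth_affine)
 then show ?thesis unfolding bump0_def[abs_def] .
qed

lemma bump0_nonneg: "0 <= bump0 t"
 by (auto simp: bump0_def flat_exp_def)

lemma bump0_pos: "abs(t) < 1 ==> 0 < bump0 t"
 by (auto simp: bump0_def flat_exp_def)

lemma integral_bump0_pos: "0 < integral {-2..2} bump0"
proof -
 have c: "continuous_on {-2..2} bump0" using smooth_continuous[OF smooth_bump0] continuous_on_subset by blast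
 have "integral (cbox (-2) 2) bump0 ~= 0"
  using integral_eq_0_iff[of "-2" 2 bump0] c bump0_nonneg bump0_pos[of 0] by (auto simp: box_real)
 moreover have "0 <= integral {-2..2} bump0"
  by (rule integral_nonneg) (use c bump0_nonneg in "auto intro: integrable_continuous_real")
 ultimately show ?thesis by (simp add: box_real)
qed

lemma smooth_bump: "smooth bump"
 using smooth_mult[OF smooth_bump0 smooth_const[of "1 / integral {-2..2} bump0"]]
 unfolding bump_def[abs_def] by simp

lemma bump_nonneg: "0 <= bump t"
 using bump0_nonneg integral_bump0_pos by (simp add: bump_def)

lemma bump_eq_0: "1 <= abs(t) ==> bump t = 0"
 by (auto simp: bump_def bump0_def flat_exp_def)

lemma bounded_compact_support:
 fixes b :: "real => real"
 assumes "cont b" "!!t. r <= abs(t) ==> b t = 0"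
 obtains C where "C > 0" "!!t. abs(b t) <= C"
proof -
 have "compact (b ` {-r..r})" using assms(1) continuous_on_subset by (intro compact_continuous_image) blast+
 then obtain C where C: "C > 0" "!!t. t \<in> {-r..r} ==> abs(b t) <= C"
  by (metis bounded_pos compact_imp_bounded imageI real_norm_def)
 have "abs(b t) <= C" for t
  using C(1) C(2)[of t] assms(2)[of t] by (cases "abs(t) <= r") (auto simp: abs_le_iff)
 then show ?thesis using C that by blast
qed

text \<open>The bound is taken to be at least one, which makes positivity and comparisons of its
  powers immediate.\<close>

definition bump_max :: real where
 "bump_max = (SOME C. C >= 1 \<and> (\<forall>t. bump t <= C))"

lemma bump_max: "bump_max >= 1" "bump t <= bump_max"
proof -
 obtain C where C: "C > 0" "!!t. abs(bump t) <= C"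
  using bounded_compact_support[OF smooth_continuous[OF smooth_bump] bump_eq_0] by blast
 have "\<exists>C. C >= 1 \<and> (\<forall>t. bump t <= C)"
  by (rule exI[of _ "max 1 C"]) (use C abs_le_D1 in "auto simp: le_max_iff_disj")
 from someI_ex[OF this] show "bump_max >= 1" "bump t <= bump_max" unfolding bump_max_def by auto
qed

lemma ramp_eq_0: "t <= -1 ==> ramp t = 0"
proof -
 assume "t <= -1"
 then have "integral {-2..t} bump = integral {-2..t} (%_. 0)" by (intro integral_cong) (auto simp: bump_eq_0)
 then show ?thesis by (simp add: ramp_def)
qed

lemma ramp_DERIV: "(ramp hrd bump t) (at t)"
proof (cases "t < -1")
 case True
 have "((%t. 0) hrd bump t) (at t)" using True by (simp add: bump_eq_0)
 then show ?thesis by (rule DERIV_cong_ev[THEN iffD1, rotated -1]) (use True in \<open>auto simp: ramp_eq_0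
      intro!: eventually_nhds_in_open[of "{..<-1}", THEN eventually_mono]\<close>)
next
 case False
 have "(ramp hrd bump t) (at t within {-2..t+1})" unfolding ramp_def[abs_def]
  by (rule integral_has_real_derivative)
    (use False continuous_on_subset[OF smooth_continuous[OF smooth_bump]] in auto)
 moreover have "at t within {-2..t+1} = at t" by (rule at_within_interior) (use False in auto)
 ultimately show ?thesis by simp
qed

lemma smooth_ramp: "smooth ramp"
 using smooth_primitive smooth_bump ramp_DERIV by blast

lemma ramp_mono: "s <= t ==> ramp s <= ramp t"
 using DERIV_nonneg_imp_nondecreasing[of s t ramp] ramp_DERIV bump_nonneg by blast

lemma ramp_eq_1: "1 <= t ==> ramp t = 1"
proof -
 assume t: "1 <= t"
 have 1: "ramp 1 = 1"
 proof -
  have "integral {-2..2} bump = integral {-2..2} (%t. bump0 t * (1 / integral {-2..2} bump0))"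
   by (simp add: bump_def[abs_def])
  also have "... = 1" using integral_bump0_pos by (subst integral_mult_left) auto
  finally have "ramp 2 = 1" by (simp add: ramp_def)
  moreover have "ramp 2 = ramp 1" by (rule DERIV_isconst_end[of 1 2 ramp])
    (use ramp_DERIV bump_eq_0 in "auto intro!: continuous_on_subset[OF smooth_continuous[OF smooth_ramp]], metis abs_of_pos less_eq_real_def less_trans zero_less_one")
  ultimately show ?thesis by simp
 qed
 show ?thesis
 proof (cases "t = 1")
  case False
  have "ramp t = ramp 1" by (rule DERIV_isconst_end[of 1 t ramp])
    (use t False ramp_DERIV bump_eq_0 in "auto intro!: continuous_on_subset[OF smooth_continuous[OF smooth_ramp]], metis abs_of_pos less_eq_real_def less_trans zero_less_one")
  then show ?thesis using 1 by simp
 qed (use 1 in simp)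
qed

lemma ramp_range: "0 <= ramp t" "ramp t <= 1"
 using ramp_mono[of "min t (-1)" t] ramp_eq_0[of "min t (-1)"] 
  ramp_mono[of t "max t 1"] ramp_eq_1[of "max t 1"] by auto

section \<open>Product kernels and weak gradients\<close>

text \<open>Kernels of product form: a partial derivative changes a single factor, so the class is
  closed under differentiation.\<close>

definition coord_prod :: "('n::finite => real => real) => real ^ 'n => real" where
 "coord_prod beta y = (\<Prod>l\<in>UNIV. beta l (y $ l))"

lemma coord_prod_has_derivative:
 assumes "!!l t. (beta l hrd beta' l t) (at t)"
 shows "(coord_prod beta has_derivative (%v. \<Sum>j\<in>UNIV. v $ j * coord_prod (beta(j := beta' j)) y)) (at y)"
proof -
 have D: "((%y. beta l (y $ l)) has_derivative (%v. beta' l (y $ l) * v $ l)) (at y)" for l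
  by (rule has_derivative_compose[of "%y. y $ l" "%v. v $ l" y UNIV "beta l" "%v. beta' l (y $ l) * v"])
   (use assms[of l "y $ l"] in "auto simp: has_field_derivative_def
    intro: bounded_linear_imp_has_derivative bounded_linear_vec_nth")
 have P: "coord_prod (beta(j := beta' j)) y = beta' j (y $ j) * (\<Prod>l\<in>UNIV - {j}. beta l (y $ l))" for j
  unfolding coord_prod_def by (subst prod.remove[of _ j]) (auto intro!: prod.cong)
 have "(coord_prod beta has_derivative
   (%v. \<Sum>l\<in>UNIV. beta' l (y $ l) * v $ l * (\<Prod>j\<in>UNIV - {l}. beta j (y $ j)))) (at y)"
  using has_derivative_prod[OF D] unfolding coord_prod_def[abs_def] .
 then show ?thesis by (simp add: P mult_ac)
qed

lemma coord_prod_frechet: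
 assumes "!!l. smooth (beta l)"
 shows "pd (coord_prod beta) y j = coord_prod (beta(j := deriv (beta j))) y"
proof -
 note D = coord_prod_has_derivative[of beta "%l. deriv (beta l)" y, OF smooth_DERIV[OF assms]]
 have "pd (coord_prod beta) y j = (\<Sum>k\<in>UNIV. axis j 1 $ k * coord_prod (beta(k := deriv (beta k))) y)"
  using frechet_derivative_at[OF D] by (metis (no_types))
 also have "... = (\<Sum>k\<in>UNIV. if k = j then coord_prod (beta(j := deriv (beta j))) y else 0)"
  by (rule sum.cong) (auto simp: axis_def)
 finally show ?thesis by simp
qed

lemma Ck_coord_prod:
 assumes "!!l. smooth (beta l)" shows "Ck k (coord_prod beta)"
 using assms
proof (induction k arbitrary: beta)
 case 0
 have "cont (%y. beta l (y $ l))" for l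
  by (rule continuous_on_compose2[OF smooth_continuous[OF 0]]) (auto intro!: continuous_intros)
 then show ?case unfolding coord_prod_def[abs_def] by (auto intro!: continuous_intros)
next
 case (Suc k)
 have "coord_prod beta differentiable at y" for y
  using coord_prod_has_derivative[of beta "%l. deriv (beta l)", OF smooth_DERIV[OF Suc.prems]]
  by (auto simp: differentiable_def)
 moreover have "Ck k (coord_prod (beta(j := deriv (beta j))))" for j
  using Suc.prems smooth_deriv by (intro Suc.IH) auto
 ultimately show ?case using Suc.prems by (simp add: coord_prod_frechet)
qed

lemma coord_prod_continuous:
 assumes "!!l. smooth (beta l)" shows "cont (coord_prod beta)"
 using Ck_coord_prod[OF assms, of 0] by simp

lemma coord_prod_shift_cart: "coord_prod beta (y - c) = coord_prod (%l t. beta l (t - c $ l)) y"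
 by (simp add: coord_prod_def)

lemma coord_prod_abs_le:
 assumes "!!l. abs(beta l (y $ l)) <= C l"
 shows "abs(coord_prod beta y) <= (\<Prod>l\<in>UNIV. C l)"
 unfolding coord_prod_def abs_prod by (rule prod_mono) (use assms in auto)

section \<open>Averages of functions that have a weak gradient\<close>

lemma integrable_mult_continuous_bounded:
 fixes u phi :: "'a::euclidean_space => real"
 assumes "L1 u" "cont phi" "!!y. abs(phi y) <= C"
 shows "L1 (%y. u y * phi y)"
proof (rule int_bound[of _ "%y. C * u y"])
 have "phi \<in> bml" using assms(2) by (simp add: borel_measurable_continuous_onI measurable_completion)
 then show "(%y. u y * phi y) \<in> bml" using assms(1) by simp
 show "AE x in lm. norm (u x * phi x) <= norm (C * u x)"
 proof (rule AE_I2)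
  fix x
  have "abs(phi x) <= abs(C)" using assms(3)[of x] by linarith
  then show "norm (u x * phi x) <= norm (C * u x)"
   by (simp add: abs_mult mult.commute[of "abs(u x)"] mult_right_mono)
 qed
qed (use assms(1) in simp)

text \<open>A weak gradient on \<open>Q\<close> with all integrals over the whole space: the
  functions plugged in later are cut off by the indicator of \<open>Q\<close>, and the test
  functions vanish outside \<open>Q\<close>, where for closed \<open>Q\<close> their derivatives
  vanish as well.\<close>

definition wgrad ::
 "(real ^ 'n) set => (real ^ 'n => real) => ('n => real ^ 'n => real) => bool" where
 "wgrad Q u w \<longleftrightarrow> L1 u \<and> (\<forall>j. L1 (w j)) \<and> (\<forall>psi j. (\<forall>k. Ck k psi) --> (\<forall>x. x ~: Q --> psi x = 0) -->
    (LI x. u x * pd psi x j) =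
    - (LI x. w j x * psi x))"

lemma wgradD:
 assumes "wgrad Q u w" "!!k. Ck k psi" "!!x. x ~: Q ==> psi x = 0"
 shows "(LI x. u x * pd psi x j) =
  - (LI x. w j x * psi x)" using assms unfolding wgrad_def by simp

definition bk :: "real => real => real" where
 "bk r t = bump (t / r) / r"

text \<open>A smooth average of \<open>u\<close> over the cube of half side \<open>r\<close> about
  \<open>c\<close>; for positive \<open>r\<close> the kernel has mass one by
  \<open>integral_kernel\<close>.\<close>

definition avg :: "(real ^ 'n => real) => real ^ 'n::finite => real => real" where
 "avg u c r = (LI y. u y * coord_prod (%l. bk r) (y - c))"

lemma smooth_bk: "smooth (%t. bk r (t - c))"
 unfolding bk_def by (rule smooth_scale[OF smooth_bump])

lemma smooth_bk': "smooth (bk r)"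
 using smooth_bk[of r 0] by simp

lemma bk_eq_0: "r > 0 ==> r <= abs(t) ==> bk r t = 0"
 by (simp add: bk_def bump_eq_0)

lemma bk_bounds: "rho > 0 ==> rho <= r ==> 0 <= bk r t \<and> bk r t <= bump_max / rho"
 unfolding bk_def using bump_nonneg[of "t/r"] bump_max(2)[of "t/r"] bump_max(1) by (auto intro!: frac_le)

lemma ramp_DERIV_bk: assumes "r > 0"
 shows "((%t. ramp ((t - c) / r)) hrd bk r (t - c)) (at t)"
 unfolding bk_def
 by (rule DERIV_cong[OF DERIV_chain2[OF ramp_DERIV]]) (use assms in "auto intro!: derivative_eq_intros")

text \<open>Two product kernels are compared by exchanging one coordinate factor at a time: the difference
 of two one-dimensional bumps of mass one is the derivative of a function that vanishes outside
 the hull of their supports and is bounded by one.\<close>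

lemma avg_step:
 fixes u :: "real ^ 'n::finite => real"
 assumes wg: "wgrad Q u w" and rho: "0 < rho" "rho <= r0" "rho <= r1"
  and S: "cbox lo hi \<subseteq> Q" and c0: "!!l. lo $ l <= c0 $ l - r0 \<and> c0 $ l + r0 <= hi $ l"
  and c1: "!!l. lo $ l <= c1 $ l - r1 \<and> c1 $ l + r1 <= hi $ l" and h: "!!j x. abs(w j x) <= h x" "L1 h"
 shows "abs(avg u c1 r1 - avg u c0 r0) <=
  real CARD('n) * (bump_max / rho) ^ (CARD('n) - 1) * (LINT y:cbox lo hi|lm. h y)"
proof -
 define b0 where "b0 l t = bk r0 (t - c0 $ l)" for l t
 define b1 where "b1 l t = bk r1 (t - c1 $ l)" for l t
 define R where "R l t = ramp ((t - c1 $ l) / r1) - ramp ((t - c0 $ l) / r0)" for l t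
 define kap where "kap A = coord_prod (%l. if l \<in> A then b1 l else b0 l)" for A
 define I where "I = (LINT y:cbox lo hi|lm. h y)"
 define M where "M = (bump_max / rho) ^ (CARD('n) - 1)"
 have r: "0 < r0" "0 < r1" using rho by auto
 have sm: "smooth (b0 l)" "smooth (b1 l)" "smooth (R l)" for l
  unfolding b0_def[abs_def] b1_def[abs_def] R_def[abs_def]
  by (intro smooth_bk smooth_diff smooth_scale' smooth_ramp)+
 have DR: "(R l hrd b1 l t - b0 l t) (at t)" for l t
  unfolding R_def b0_def b1_def by (intro DERIV_diff ramp_DERIV_bk r)
 have dR: "deriv (R l) = (%t. b1 l t - b0 l t)" for l using DERIV_imp_deriv[OF DR] by blast
 have bb: "abs(b0 l t) <= bump_max / rho" "abs(b1 l t) <= bump_max / rho" for l t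
  using bk_bounds[OF rho(1)] rho by (auto simp: b0_def b1_def)
 have bR: "abs(R l t) <= 1" for l t
  unfolding R_def using ramp_range[of "(t - c1 $ l) / r1"] ramp_range[of "(t - c0 $ l) / r0"] by auto
 have z: "b0 l t = 0 \<and> b1 l t = 0 \<and> R l t = 0" if "t ~: {lo $ l..hi $ l}" for l t
 proof -
  consider "t < lo $ l" | "t > hi $ l" using \<open>t ~: _\<close> by force
  then show ?thesis
  proof cases
   case 1
   then have "t - c0 $ l <= - r0" "t - c1 $ l <= - r1" using c0[of l] c1[of l] by auto
   moreover then have "(t - c0 $ l) / r0 <= -1" "(t - c1 $ l) / r1 <= -1" using r by (auto simp: field_simps)
   ultimately show ?thesis using r by (auto simp: b0_def b1_def R_def bk_eq_0 ramp_eq_0)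
  next
   case 2
   then have "t - c0 $ l >= r0" "t - c1 $ l >= r1" using c0[of l] c1[of l] by auto
   moreover then have "(t - c0 $ l) / r0 >= 1" "(t - c1 $ l) / r1 >= 1" using r by (auto simp: field_simps)
   ultimately show ?thesis using r by (auto simp: b0_def b1_def R_def bk_eq_0 ramp_eq_1)
  qed
 qed
 have bm: "0 <= bump_max / rho" using bump_max(1) rho by auto
 have int: "L1 (%y. u y * kap A y)" for A
 proof (rule integrable_mult_continuous_bounded)
  show "L1 u" using wg by (simp add: wgrad_def)
  show "cont (kap A)" unfolding kap_def by (rule coord_prod_continuous) (simp add: sm)
  show "abs(kap A y) <= (\<Prod>l\<in>(UNIV::'n set). bump_max / rho)" for y
   unfolding kap_def by (rule coord_prod_abs_le) (simp add: bb)
 qed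
 have step: "abs((LI y. u y * kap (insert j A) y) - (LI y. u y * kap A y)) <= M * I" if "j ~: A" for j A
 proof -
  define gam where "gam = (%l. if l = j then R l else if l \<in> A then b1 l else b0 l)"
  have sg: "smooth (gam l)" for l by (simp add: gam_def sm)
  have d: "pd (coord_prod gam) y j = kap (insert j A) y - kap A y" for y
  proof -
   have "coord_prod (gam(j := deriv (gam j))) y =
     (b1 j (y $ j) - b0 j (y $ j)) * (\<Prod>l\<in>UNIV - {j}. gam l (y $ l))"
    unfolding coord_prod_def by (subst prod.remove[of _ j]) (auto simp: gam_def dR intro!: prod.cong)
   moreover have "kap (insert j A) y = b1 j (y $ j) * (\<Prod>l\<in>UNIV - {j}. gam l (y $ l))"
    unfolding kap_def coord_prod_def by (subst prod.remove[of _ j]) (auto simp: gam_def intro!: prod.cong)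
   moreover have "kap A y = b0 j (y $ j) * (\<Prod>l\<in>UNIV - {j}. gam l (y $ l))"
    unfolding kap_def coord_prod_def by (subst prod.remove[of _ j]) (use that in "auto simp: gam_def intro!: prod.cong")
   ultimately show ?thesis using coord_prod_frechet[of gam y j, OF sg] by (simp add: left_diff_distrib)
  qed
  have supp: "coord_prod gam y = 0" if "y ~: cbox lo hi" for y
  proof -
   obtain l where "\<not> (lo $ l <= y $ l \<and> y $ l <= hi $ l)"
    using \<open>y ~: cbox lo hi\<close> unfolding mem_box_cart by blast
   then have "gam l (y $ l) = 0" using z[of "y $ l" l] by (auto simp: gam_def)
   then show ?thesis unfolding coord_prod_def by (intro prod_zero) auto
  qed
  have gle: "abs(coord_prod gam y) <= M" for y
  proof -
   have "abs(coord_prod gam y) <= (\<Prod>l\<in>UNIV. if l = j then 1 else bump_max / rho)"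
    by (rule coord_prod_abs_le) (auto simp: gam_def bb bR)
   also have "... = M" by (subst prod.remove[of _ j]) (auto simp: M_def)
   finally show ?thesis .
  qed
  have M0: "0 <= M" using gle abs_ge_zero order_trans by blast
  have "(LI y. u y * kap (insert j A) y) - (LI y. u y * kap A y) = (LI y. u y * pd (coord_prod gam) y j)"
   unfolding d right_diff_distrib by (rule lint_diff[symmetric, OF int int])
  also have "... = - (LI y. w j y * coord_prod gam y)"
   by (rule wgradD[OF wg Ck_coord_prod[OF sg]]) (use supp S in auto)
  finally have "abs((LI y. u y * kap (insert j A) y) - (LI y. u y * kap A y))
    = abs(LI y. w j y * coord_prod gam y)" by simp
  also have "... <= (LI y. M * (ind (cbox lo hi) y * h y))"
  proof (rule integral_abs_bound[THEN order_trans], rule integral_mono)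
   show "L1 (%y. abs(w j y * coord_prod gam y))"
    using wg by (intro integrable_abs integrable_mult_continuous_bounded[OF _ coord_prod_continuous[OF sg] gle])
     (simp add: wgrad_def)
   show "L1 (%y. M * (ind (cbox lo hi) y * h y))"
    using integrable_mult_indicator[of "cbox lo hi" lebesgue h] h(2) by simp
   show "abs(w j y * coord_prod gam y) <= M * (ind (cbox lo hi) y * h y)" for y
    using supp[of y] gle[of y] h(1)[of j y] M0
    by (cases "y \<in> cbox lo hi") (auto simp: abs_mult mult.commute[of M] intro: mult_mono)
  qed
  also have "... = M * I" by (simp add: I_def slint_def)
  finally show ?thesis .
 qed
 have "abs((LI y. u y * kap A y) - (LI y. u y * kap {} y)) <= card A * (M * I)" for A
 proof (induction A rule: finite_induct[OF finite])
  case (2 j A)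
  have "real (card (insert j A)) * (M * I) = card A * (M * I) + M * I" using 2 by (simp add: algebra_simps)
  then show ?case using step[OF 2(2)] 2(3) by linarith
 qed simp
 from this[of UNIV] show ?thesis
  by (simp add: avg_def kap_def b0_def[abs_def] b1_def[abs_def] I_def M_def coord_prod_shift_cart mult.assoc)
qed

lemma coord_prod_bounded:
 assumes "!!l. cont (beta l)" "!!l t. r <= abs(t) ==> beta l t = 0"
 shows "\<exists>C. \<forall>y :: real ^ 'n::finite. abs(coord_prod beta y) <= C"
proof -
 have "\<exists>C. \<forall>t. abs(beta l t) <= C" for l
  by (rule bounded_compact_support[of "beta l" r, OF assms(1) assms(2)]) auto
 then obtain C where C: "!!l t. abs(beta l t) <= C l" by metis
 show ?thesis by (intro exI[of _ "\<Prod>l\<in>UNIV. C l"] allI coord_prod_abs_le C)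
qed

text \<open>The factors need not have mass one: some of them will be differentiated bumps. The
  kernel is centred at \<open>x\<close> without reflection, which is the source of the minus sign in
  its derivatives.\<close>

definition moll :: "('n => real => real) => (real ^ 'n => real) => real ^ 'n::finite => real" where
 "moll beta u x = (LI y. u y * coord_prod beta (y - x))"

lemma avg_eq_moll: "avg u x r = moll (%l. bk r) u x"
 by (simp add: avg_def moll_def)

lemma moll_continuous:
 fixes u :: "real ^ 'n::finite => real"
 assumes u: "L1 u" and beta: "!!l. cont (beta l)" "!!l t. r <= abs(t) ==> beta l t = 0"
 shows "cont (moll beta u)"
proof -
 have "\<exists>C. \<forall>y :: real ^ 'n. abs(coord_prod beta y) <= C"
  by (rule coord_prod_bounded[where r="r"]) (simp_all add: beta)
 then obtain C where C: "!!y :: real ^ 'n. abs(coord_prod beta y) <= C" by auto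
 have c: "cont (coord_prod beta :: real ^ 'n => real)"
 proof -
  have "cont (%y :: real ^ 'n. beta l (y $ l))" for l
   by (rule continuous_on_compose2[OF beta(1)]) (auto intro!: continuous_intros)
  then show ?thesis unfolding coord_prod_def[abs_def] by (auto intro!: continuous_intros)
 qed
 have "isCont (moll beta u) x" for x unfolding continuous_at_sequentially
 proof (intro allI impI)
  fix X assume X: "X ----> x"
  show "(moll beta u \<circ> X) ----> moll beta u x" unfolding moll_def o_def
  proof (rule integral_dominated_convergence[where w="%y. abs(u y) * C"])
   show "L1 (%y. abs(u y) * C)" using u by simp
   have m: "(%y. u y * coord_prod beta (y - x)) \<in> bml" for x
   proof -
    have "cont (%y. coord_prod beta (y - x))"
     by (rule continuous_on_compose2[OF c]) (auto intro!: continuous_intros)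
    then have "(%y. coord_prod beta (y - x)) \<in> bml"
     by (simp add: borel_measurable_continuous_onI measurable_completion)
    then show ?thesis using u by simp
   qed
   show "(%y. u y * coord_prod beta (y - x)) \<in> bml" by (rule m)
   show "(%y. u y * coord_prod beta (y - X i)) \<in> bml" for i by (rule m)
   show "AE y in lm. (%i. u y * coord_prod beta (y - X i)) ----> u y * coord_prod beta (y - x)"
   proof (rule AE_I2)
    fix y
    have "isCont (coord_prod beta) (y - x)" using c by (simp add: continuous_on_eq_continuous_at)
    from isCont_tendsto_compose[OF this tendsto_diff[OF tendsto_const X]]
    show "(%i. u y * coord_prod beta (y - X i)) ----> u y * coord_prod beta (y - x)"
     by (intro tendsto_mult tendsto_const)
   qed
   show "AE y in lm. norm (u y * coord_prod beta (y - X i)) <= abs(u y) * C" for i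
    by (rule AE_I2) (simp add: abs_mult C mult_left_mono)
  qed
 qed
 then show ?thesis by (simp add: continuous_at_imp_continuous_on)
qed

text \<open>Differentiation under the integral by dominated convergence: the difference quotients of
  the kernel are bounded by the supremum \<open>C\<close> of its derivative, so \<open>C\<close>
  times the modulus of \<open>u\<close> dominates.\<close>

lemma moll_DERIV:
 fixes u :: "real ^ 'n::finite => real"
 assumes u: "L1 u" and beta: "!!l. smooth (beta l)" "!!l t. r <= abs(t) ==> beta l t = 0"
 shows "((%s. moll beta u (sh x s j)) hrd
      - moll (beta(j := deriv (beta j))) u x) (at 0)"
proof -
 define beta' where "beta' = beta(j := deriv (beta j))"
 \<comment> \<open>The derivative vanishes at interior points of the zero set of
   \<open>beta j\<close>; enlarging the radius to \<open>r + 1\<close> places \<open>t\<close>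
   there.\<close>
 have d0: "deriv (beta j) t = 0" if "r + 1 <= abs(t)" for t
 proof -
  have "((%_. 0) hrd 0) (at t)" by simp
  then have "(beta j hrd 0) (at t)"
  proof (rule has_field_derivative_transform_within_open[of _ _ _ "{s. r < abs(s)}"])
   show "open {s::real. r < abs(s)}" by (intro open_Collect_less continuous_intros)
  qed (use that beta(2) in auto)
  then show ?thesis by (rule DERIV_imp_deriv)
 qed
 have s': "smooth (beta' l)" for l using beta(1) smooth_deriv by (auto simp: beta'_def)
 have z': "beta' l t = 0" if "r + 1 <= abs(t)" for l t using that d0 beta(2) by (auto simp: beta'_def)
 have "\<exists>C. \<forall>y :: real ^ 'n. abs(coord_prod beta' y) <= C"
  by (rule coord_prod_bounded[where r="r + 1"]) (simp_all add: smooth_continuous s' z')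
 then obtain C where C: "!!y :: real ^ 'n. abs(coord_prod beta' y) <= C" by auto
 have "\<exists>C0. \<forall>y :: real ^ 'n. abs(coord_prod beta y) <= C0"
  by (rule coord_prod_bounded[where r="r"]) (simp_all add: smooth_continuous beta)
 then obtain C0 where C0: "!!y :: real ^ 'n. abs(coord_prod beta y) <= C0" by auto
 have cp: "cont (%y. coord_prod gam (y - z))" if "!!l. smooth (gam l)" for gam and z :: "real ^ 'n"
  by (rule continuous_on_compose2[OF coord_prod_continuous[OF that]]) (auto intro!: continuous_intros)
 have D: "((%s. coord_prod beta (y - (sh x s j))) hrd
   - coord_prod beta' (y - (sh x s j))) (at s)" for y s
 proof -
  have g: "((%s. y - (sh x s j)) has_derivative (%v. - (v *\<^sub>R axis j 1))) (at s)"
   by (auto intro!: derivative_eq_intros)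
  have "((%s. coord_prod beta (y - (sh x s j))) has_derivative
    (%v. \<Sum>k\<in>UNIV. (- (v *\<^sub>R axis j 1)) $ k * coord_prod (beta(k := deriv (beta k))) (y - (sh x s j)))) (at s)"
   using has_derivative_compose[OF g coord_prod_has_derivative[of beta "%l. deriv (beta l)", OF smooth_DERIV[OF beta(1)]]] .
  moreover have "(\<Sum>k\<in>UNIV. (- (v *\<^sub>R axis j 1)) $ k * coord_prod (beta(k := deriv (beta k))) (y - (sh x s j)))
    = - coord_prod beta' (y - (sh x s j)) * v" for v
  proof -
   have "(\<Sum>k\<in>UNIV. (- (v *\<^sub>R axis j 1)) $ k * coord_prod (beta(k := deriv (beta k))) (y - (sh x s j)))
    = (\<Sum>k\<in>UNIV. if k = j then - v * coord_prod beta' (y - (sh x s j)) else 0)"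
    by (rule sum.cong) (auto simp: axis_def beta'_def)
   then show ?thesis by simp
  qed
  ultimately show ?thesis unfolding has_field_derivative_def by (rule has_derivative_eq_rhs[OF _ ext])
 qed
 have lip: "abs(coord_prod beta (y - (sh x s j)) - coord_prod beta (y - x)) <= C * abs(s)" for y s
 proof -
  have "norm (coord_prod beta (y - (sh x s j)) - coord_prod beta (y - (sh x 0 j))) <= C * norm (s - 0)"
   by (rule field_differentiable_bound[of UNIV _ "%s. - coord_prod beta' (y - (sh x s j))"]) (use D C in auto)
  then show ?thesis by simp
 qed
 have int: "L1 (%y. u y * coord_prod beta (y - z))" for z
  by (rule integrable_mult_continuous_bounded[OF u cp[OF beta(1)] C0])
 have meas: "(%y. u y * coord_prod beta' (y - z)) \<in> bml" for z
  using integrable_mult_continuous_bounded[OF u cp[OF s'] C] by (rule borel_measurable_integrable)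
 have "((%s. (moll beta u (sh x s j) - moll beta u x) / s) ---> - moll beta' u x) (at 0)"
  unfolding tendsto_at_iff_sequentially
 proof (intro allI impI)
  fix S :: "nat => real" assume S: "\<forall>i. S i \<in> UNIV - {0}" and S0: "S ----> 0"
  have lim: "(%i. LI y. u y * ((coord_prod beta (y - (x + S i *\<^sub>R axis j 1)) - coord_prod beta (y - x)) / S i))
    ----> (LI y. u y * (- coord_prod beta' (y - x)))"
  proof (rule integral_dominated_convergence[where w="%y. abs(u y) * C"])
   show "L1 (%y. abs(u y) * C)" using u by simp
   show "(%y. u y * (- coord_prod beta' (y - x))) \<in> bml" using meas[of x] by simp
   show "(%y. u y * ((coord_prod beta (y - (x + S i *\<^sub>R axis j 1)) - coord_prod beta (y - x)) / S i)) \<in> bml" for i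
    using int[of "x + S i *\<^sub>R axis j 1", THEN borel_measurable_integrable] int[of x, THEN borel_measurable_integrable]
    by (simp add: right_diff_distrib diff_divide_distrib)
   show "AE y in lm. (%i. u y * ((coord_prod beta (y - (x + S i *\<^sub>R axis j 1)) - coord_prod beta (y - x)) / S i))
     ----> u y * (- coord_prod beta' (y - x))"
   proof (rule AE_I2, intro tendsto_mult tendsto_const)
    fix y
    have "((%s. (coord_prod beta (y - (sh x s j)) - coord_prod beta (y - x)) / s) ---> - coord_prod beta' (y - x)) (at 0)"
     using D[of y 0] by (simp add: has_field_derivative_iff)
    then show "(%i. (coord_prod beta (y - (x + S i *\<^sub>R axis j 1)) - coord_prod beta (y - x)) / S i) ----> - coord_prod beta' (y - x)"
     unfolding tendsto_at_iff_sequentially o_def using S S0 by blast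
   qed
   show "AE y in lm. norm (u y * ((coord_prod beta (y - (x + S i *\<^sub>R axis j 1)) - coord_prod beta (y - x)) / S i)) <= abs(u y) * C" for i
   proof (rule AE_I2)
    fix y
    have "abs((coord_prod beta (y - (x + S i *\<^sub>R axis j 1)) - coord_prod beta (y - x)) / S i) <= C"
     using lip[of y "S i"] S by (simp add: divide_le_eq)
    then show "norm (u y * ((coord_prod beta (y - (x + S i *\<^sub>R axis j 1)) - coord_prod beta (y - x)) / S i)) <= abs(u y) * C"
     by (simp only: real_norm_def abs_mult mult_left_mono abs_ge_zero)
   qed
  qed
  have eq: "(LI y. u y * ((coord_prod beta (y - (x + S i *\<^sub>R axis j 1)) - coord_prod beta (y - x)) / S i))
    = (moll beta u (x + S i *\<^sub>R axis j 1) - moll beta u x) / S i" for i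
   unfolding moll_def by (subst lint_diff[symmetric, OF int int])
    (simp add: right_diff_distrib flip: integral_divide_zero)
  show "((%s. (moll beta u (sh x s j) - moll beta u x) / s) \<circ> S) ----> - moll beta' u x"
   using lim unfolding eq by (simp add: o_def moll_def[of beta'])
 qed
 then show ?thesis by (simp add: has_field_derivative_iff beta'_def)
qed

lemma nn_integral_bk: assumes "r > 0" shows "(\<integral>\<^sup>+t. ennreal (bk r (t - c)) \<partial>lborel) = 1"
proof -
 have "(\<integral>\<^sup>+t. ennreal (bk r (t - c)) \<partial>lborel) = (\<integral>\<^sup>+t. ennreal (bk r (t - c)) * ind {c - r..c + r} t \<partial>lborel)"
  by (rule nn_integral_cong) (use bk_eq_0[OF assms] in "auto simp: indicator_def abs_le_iff not_le")
 also have "... = ramp (((c + r) - c) / r) - ramp (((c - r) - c) / r)"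
 proof (rule nn_integral_FTC_Icc[where F="%t. ramp ((t - c) / r)"])
  show "(%t. bk r (t - c)) \<in> borel_measurable borel"
   using smooth_continuous[OF smooth_bk] by (rule borel_measurable_continuous_onI)
  show "((%t. ramp ((t - c) / r)) hrd bk r (x - c)) (at x)" for x by (rule ramp_DERIV_bk[OF assms])
 qed (use assms bk_bounds[OF assms order_refl] in auto)
 also have "... = 1" using assms by (simp add: ramp_eq_0 ramp_eq_1)
 finally show ?thesis .
qed

text \<open>Fubini in the coordinates, each one-dimensional factor being the derivative of a
  ramp.\<close>

lemma integral_kernel:
 assumes "r > 0"
 shows "(LI y. coord_prod (%l::'n::finite. bk r) (y - c)) = 1"
proof -
 have m: "(%y::real^'n. coord_prod (%l. bk r) (y - c)) \<in> borel_measurable borel"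
  by (intro borel_measurable_continuous_onI continuous_on_compose2[OF coord_prod_continuous])
   (auto intro!: smooth_bk' continuous_intros)
 have nn: "0 <= bk r t" for t using bk_bounds[OF assms order_refl] by auto
 have inj: "inj_on (%l::'n. axis l (1::real)) UNIV" by (auto simp: inj_on_def axis_eq_axis)
 have B: "(Basis :: (real^'n) set) = (%l. axis l 1) ` UNIV" by (auto simp: Basis_vec_def)
 have "(\<integral>\<^sup>+y. ennreal (coord_prod (%l. bk r) (y - c)) \<partial>lborel)
   = (\<integral>\<^sup>+y. (\<Prod>b\<in>Basis. ennreal (bk r (y \<bullet> b - c \<bullet> b))) \<partial>lborel)" unfolding coord_prod_def B
  by (subst prod.reindex[OF inj]) (simp add: prod_ennreal nn inner_axis)
 also have "... = (\<Prod>b\<in>(Basis::(real^'n) set). (\<integral>\<^sup>+t. ennreal (bk r (t - c \<bullet> b)) \<partial>lborel))"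
 proof (rule nn_integral_lborel_prod)
  fix b :: "real^'n"
  show "(%t. ennreal (bk r (t - c \<bullet> b))) \<in> borel_measurable borel"
   using borel_measurable_continuous_onI[OF smooth_continuous[OF smooth_bk[of r "c \<bullet> b"]]] by simp
 qed simp
 also have "... = 1" by (simp add: nn_integral_bk[OF assms])
 finally have 1: "(\<integral>\<^sup>+y. ennreal (coord_prod (%l::'n. bk r) (y - c)) \<partial>lborel) = 1" .
 have m': "(%y::real^'n. coord_prod (%l. bk r) (y - c)) \<in> borel_measurable lborel" using m by simp
 have nnp: "0 <= coord_prod (%l::'n. bk r) y" for y unfolding coord_prod_def by (intro prod_nonneg nn)
 have "integral\<^sup>L lborel (%y::real^'n. coord_prod (%l. bk r) (y - c)) = enn2real 1"
  using integral_eq_nn_integral[OF m' AE_I2[OF nnp]] unfolding 1 .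
 then show ?thesis using integral_completion[OF m'] by simp
qed

section \<open>Averages over small balls\<close>

lemma integrable_restrict:
 fixes g :: "'a => real"
 assumes "integrable M g" "A \<in> sets M"
 shows "integrable M (%x. ind A x * g x)" "(%x. ind A x * g x) \<in> borel_measurable M"
 using integrable_mult_indicator[OF assms(2,1)] borel_measurable_integrable by auto

lemma integrable_ind_const: "S \<in> lmeasurable ==> L1 (%y. ind S y * (z::real))"
 by (intro integrable_mult_left) (simp add: lmeasurable_iff_integrable)

lemma integrable_ind_dist:
 fixes u :: "'a::euclidean_space => real"
 assumes u: "L1 u" and S: "S \<in> lmeasurable"
 shows "L1 (%y. ind S y * abs(u y - z))"
proof (rule int_bound)
 show "L1 (%y. abs(u y) + ind S y * abs(z))" by (intro int_add integrable_ind_const integrable_abs u S)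
 show "(%y. ind S y * abs(u y - z)) \<in> bml"
  using u S by (intro borel_measurable_times borel_measurable_abs borel_measurable_diff borel_measurable_indicator) auto
qed (auto simp: indicator_def)

lemma integral_ball_mono:
 fixes g :: "'a::euclidean_space => real"
 assumes "L1 g" "!!x. 0 <= g x" "A \<subseteq> B" "A \<in> sets lebesgue" "B \<in> sets lebesgue"
 shows "(LINT y:A|lm. g y) <= (LINT y:B|lm. g y)"
 unfolding slint_def by (rule integral_mono)
  (use assms integrable_mult_indicator[OF _ assms(1)] in "auto simp: indicator_def")

lemma set_integral_nonneg':
 fixes g :: "'a => real"
 assumes "!!x. x \<in> A ==> 0 <= g x" shows "0 <= (LINT y:A|M. g y)"
 unfolding slint_def by (rule integral_nonneg_AE) (use assms in "auto simp: indicator_def")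

lemma set_integral_le_integral:
 fixes g :: "'a::euclidean_space => real"
 assumes "L1 g" "!!x. 0 <= g x" "A \<in> sets lebesgue"
 shows "(LINT y:A|lm. g y) <= integral\<^sup>L lebesgue g"
 using integral_ball_mono[OF assms(1,2), of A UNIV] assms(3) by (simp add: slint_def)

text \<open>Truncation at a height \<open>n\<close>: the part of \<open>g\<close> above
  \<open>n\<close> has integral below \<open>e / 2\<close>, and the rest contributes at most
  \<open>n\<close> times the measure of the set.\<close>

lemma integral_absolutely_continuous:
 fixes g :: "'a::euclidean_space => real"
 assumes g: "L1 g" "!!x. 0 <= g x" and "0 < e"
 obtains d where "d > 0" "!!A. A \<in> lmeasurable ==> vol A < d ==> (LINT y:A|lm. g y) < e"
proof -
 have "(%n. LI x. max (g x - real n) 0) ----> (LINT x|(lebesgue::'a measure). 0)"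
 proof (rule integral_dominated_convergence[where w=g])
  show "AE x in lm. (%n. max (g x - real n) 0) ----> 0"
  proof (rule AE_I2)
   fix x
   have "eventually (%n. max (g x - real n) 0 = 0) sequentially"
    using eventually_ge_at_top[of "nat \<lceil>g x\<rceil>"] by eventually_elim linarith
   then show "(%n. max (g x - real n) 0) ----> 0" by (rule tendsto_eventually)
  qed
  show "!!n. AE x in lm. norm (max (g x - real n) 0) <= g x" using g(2) by auto
 qed (use g in auto)
 then have "eventually (%n. (LI x. max (g x - real n) 0) < e / 2) sequentially"
  by (rule order_tendstoD) (use \<open>0 < e\<close> in simp)
 then obtain n where n: "(LI x. max (g x - real n) 0) < e / 2" by (auto simp: eventually_sequentially)
 show ?thesis
 proof (rule that[of "e / (2 * (real n + 1))"])
  fix A :: "'a set" assume A: "A \<in> lmeasurable" "vol A < e / (2 * (real n + 1))"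
  have i1: "L1 (%x. max (g x - real n) 0)" by (rule int_bound[OF g(1)]) (use g in auto)
  have "(LINT y:A|lm. g y) <= (LI y. ind A y * real n + max (g y - real n) 0)" unfolding slint_def
  proof (rule integral_mono)
   show "L1 (%x. ind A x *\<^sub>R g x)" using A g by (intro integrable_mult_indicator) auto
   show "L1 (%y. ind A y * real n + max (g y - real n) 0)"
    using A i1 by (intro int_add) (auto simp: fmeasurable_def)
  qed (auto simp: indicator_def)
  also have "... = vol A * real n + (LI y. max (g y - real n) 0)"
   using A i1 by (subst lint_add) (auto simp: fmeasurable_def)
  also have "vol A * real n <= e / 2"
  proof -
   have "vol A * real n <= vol A * (real n + 1)" by (intro mult_left_mono) auto
   also have "... <= e / 2" using A(2) by (simp add: field_simps)
   finally show ?thesis .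
  qed
  finally show "(LINT y:A|lm. g y) < e" using n by simp
 qed (use \<open>0 < e\<close> in simp)
qed

section \<open>Superlevel sets of the maximal function, and Lebesgue points\<close>

lemma open_average_gt:
 fixes g :: "'a::euclidean_space => real"
 assumes g: "L1 g" "!!x. 0 <= g x"
 shows "open {x. \<exists>r\<in>R. t * vol (ball x r) < (LINT y:ball x r|lm. g y)}"
 unfolding open_dist
proof (safe)
 fix x r assume r: "r \<in> R" and lt: "t * vol (ball x r) < (LINT y:ball x r|lm. g y)"
 have r0: "0 < r"
 proof (rule ccontr)
  assume "\<not> 0 < r"
  then have "ball x r = {}" by simp
  then show False using lt unfolding \<open>ball x r = {}\<close> by (simp add: slint_def)
 qed
 \<comment> \<open>The strict inequality survives a slight shrinking of the ball, and the shrunken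
   ball lies in the ball of radius \<open>r\<close> about every centre that is near enough.\<close>
 have lim: "(%n. LINT y:ball x (r - 1 / Suc n)|lm. g y) ----> (LINT y:ball x r|lm. g y)" unfolding slint_def
 proof (rule integral_dominated_convergence[where w="%y. g y"])
  show "AE y in lm. (%n. ind (ball x (r - 1 / Suc n)) y *\<^sub>R g y) ----> ind (ball x r) y *\<^sub>R g y"
  proof (rule AE_I2)
   fix y
   show "(%n. ind (ball x (r - 1 / Suc n)) y *\<^sub>R g y) ----> ind (ball x r) y *\<^sub>R g y"
   proof (cases "y \<in> ball x r")
    case True
    have "(%n. r - 1 / real (Suc n)) ----> r - 0"
     by (intro tendsto_diff tendsto_const LIMSEQ_Suc[OF lim_1_over_n])
    then have "eventually (%n. dist x y < r - 1 / real (Suc n)) sequentially"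
     using True by (intro order_tendstoD) auto
    then have "eventually (%n. ind (ball x (r - 1 / Suc n)) y *\<^sub>R g y = ind (ball x r) y *\<^sub>R g y) sequentially"
     by eventually_elim (use True in auto)
    then show ?thesis by (rule tendsto_eventually)
   next
    case False
    have "y ~: ball x (r - 1 / Suc n)" for n
    proof -
     have "1 / real (Suc n) > 0" by simp
     then show ?thesis using False unfolding mem_ball by linarith
    qed
    then show ?thesis using False by simp
   qed
  qed
  show "AE y in lm. norm (ind (ball x (r - 1 / Suc n)) y *\<^sub>R g y) <= g y" for n
   using g(2) by (auto simp: indicator_def)
 qed (use g in "auto intro!: integrable_restrict")
 from order_tendstoD(1)[OF this lt] obtain n
  where n: "t * vol (ball x r) < (LINT y:ball x (r - 1 / Suc n)|lm. g y)"
  by (auto simp: eventually_sequentially)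
 show "\<exists>e>0. \<forall>y. dist y x < e --> y \<in> {x. \<exists>r\<in>R. t * vol (ball x r) < (LINT y:ball x r|lm. g y)}"
 proof (intro exI[of _ "1 / Suc n"] conjI allI impI)
  fix z assume z: "dist z x < 1 / Suc n"
  have "ball x (r - 1 / Suc n) \<subseteq> ball z r"
  proof
   fix y assume "y \<in> ball x (r - 1 / Suc n)"
   then show "y \<in> ball z r" using z dist_triangle[of z y x] unfolding mem_ball by linarith
  qed
  then have "(LINT y:ball x (r - 1 / Suc n)|lm. g y) <= (LINT y:ball z r|lm. g y)"
   by (intro integral_ball_mono g) auto
  moreover have "vol (ball z r) = vol (ball x r)" using r0 by (simp add: content_ball)
  ultimately show "z \<in> {x. \<exists>r\<in>R. t * vol (ball x r) < (LINT y:ball x r|lm. g y)}"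
   using n r by (intro CollectI bexI[of _ r]) simp
 qed simp
qed

text \<open>The superlevel set of the centred Hardy-Littlewood maximal function. Working with these
  sets instead of the function avoids the value infinity.\<close>

definition max_set :: "('a::euclidean_space => real) => real => 'a set" where
 "max_set g t = {x. \<exists>r\<in>{0<..}. t * vol (ball x r) < (LINT y:ball x r|lm. g y)}"

lemma open_max_set:
 "L1 g ==> (!!x. 0 <= g x) ==> open (max_set g t)" unfolding max_set_def by (rule open_average_gt)

lemma max_set_notin_D:
 "x ~: max_set g t ==> 0 < r ==> (LINT y:ball x r|lm. g y) <= t * vol (ball x r)"
 unfolding max_set_def by (auto simp: not_less)

lemma max_set_antimono: assumes "s <= t" shows "max_set g t \<subseteq> max_set g s"
 unfolding max_set_def
proof safe
 fix x r assume "t * vol (ball x r) < (LINT y:ball x r|lm. g y)" "0 < (r::real)"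
 moreover have "s * vol (ball x r) <= t * vol (ball x r)" using assms by (intro mult_right_mono) auto
 ultimately show "\<exists>r\<in>{0<..}. s * vol (ball x r) < (LINT y:ball x r|lm. g y)"
  by (intro bexI[of _ r]) (linarith, simp)
qed

lemma disjoint_balls_integral_sum:
 fixes g :: "'a::euclidean_space => real"
 assumes g: "L1 g" "!!x. 0 <= g x" and "finite I" and V: "V \<in> sets lebesgue"
  and B: "!!i. i \<in> I ==> B i \<in> sets lebesgue" "!!i. i \<in> I ==> B i \<subseteq> V"
  and disj: "pairwise (%i j. disjnt (B i) (B j)) I"
 shows "(\<Sum>i\<in>I. (LINT y:B i|lm. g y)) <= (LINT y:V|lm. g y)"
proof -
 have "(\<Sum>i\<in>I. (LINT y:B i|lm. g y)) = (LI y. (\<Sum>i\<in>I. ind (B i) y *\<^sub>R g y))" unfolding slint_def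
  by (rule lint_sum[symmetric]) (intro integrable_mult_indicator B g)
 also have "... <= (LI y. ind V y *\<^sub>R g y)"
 proof (rule integral_mono)
  show "L1 (%y. \<Sum>i\<in>I. ind (B i) y *\<^sub>R g y)" by (intro int_sum integrable_mult_indicator B g)
  show "L1 (%y. ind V y *\<^sub>R g y)" by (intro integrable_mult_indicator V g)
  fix y
  show "(\<Sum>i\<in>I. ind (B i) y *\<^sub>R g y) <= ind V y *\<^sub>R g y"
  proof (cases "\<exists>i\<in>I. y \<in> B i")
   case True
   then obtain i where i: "i \<in> I" "y \<in> B i" by blast
   have "(\<Sum>k\<in>I. ind (B k) y *\<^sub>R g y) = (\<Sum>k\<in>I. if k = i then g y else 0)"
   proof (rule sum.cong[OF refl])
    fix k assume k: "k \<in> I"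
    show "ind (B k) y *\<^sub>R g y = (if k = i then g y else 0)"
     using disj i k by (cases "k = i") (auto simp: pairwise_def disjnt_def indicator_def)
   qed
   then show ?thesis using i B(2)[OF i(1)] \<open>finite I\<close> by auto
  next
   case False
   then have "(\<Sum>i\<in>I. ind (B i) y *\<^sub>R g y) = 0" by (intro sum.neutral) auto
   then show ?thesis using g(2)[of y] by (simp add: indicator_def)
  qed
 qed
 finally show ?thesis by (simp add: slint_def)
qed

lemma content_ball_scale:
 fixes x :: "'a::euclidean_space"
 assumes "0 <= r" "0 <= c" shows "vol (ball x (c * r)) = c ^ DIM('a) * vol (ball x r)"
 using assms by (simp add: content_ball power_mult_distrib)

text \<open>Vitali covering: disjoint balls on which the average of \<open>g\<close> exceeds
  \<open>t\<close>, whose fivefold enlargements cover the set.\<close>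

lemma max_set_weak_type:
 fixes g :: "'a::euclidean_space => real"
 assumes g: "L1 g" "!!x. 0 <= g x" and t: "0 < t"
 shows "max_set g t \<in> lmeasurable" "vol (max_set g t) <= 5 ^ DIM('a) / t * integral\<^sup>L lebesgue g"
proof -
 define I where "I = integral\<^sup>L lebesgue g"
 have "\<forall>x\<in>max_set g t. \<exists>r. 0 < r \<and> t * vol (ball x r) < (LINT y:ball x r|lm. g y)" unfolding max_set_def by auto
 from bchoice[OF this] obtain r where r: "!!x. x \<in> max_set g t ==> 0 < r x \<and>
   t * vol (ball x (r x)) < (LINT y:ball x (r x)|lm. g y)" by auto
 define V where "V = vol (ball (0::'a) 1)"
 have V: "0 < V" by (simp add: V_def content_ball_pos)
 have vol: "vol (ball x s) = s ^ DIM('a) * V" if "0 < s" for x :: 'a and s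
  using that by (simp add: V_def content_ball)
 \<comment> \<open>The covering lemma needs bounded radii. A ball on which the average exceeds
   \<open>t\<close> has volume below \<open>I / t\<close>; since this controls only a power of the
   radius, radii below one are treated separately.\<close>
 have bound: "0 < r x \<and> r x <= max 1 (I / (t * V))" if x: "x \<in> max_set g t" for x
 proof -
  have "t * (r x ^ DIM('a) * V) < I"
   using r[OF x] vol[of "r x" x] set_integral_le_integral[OF g, of "ball x (r x)"] unfolding I_def by auto
  then have 1: "r x ^ DIM('a) < I / (t * V)" using t V by (simp add: field_simps)
  have "r x <= r x ^ DIM('a)" if "1 <= r x" using self_le_power[OF that, of "DIM('a)"] by simp
  then show ?thesis using 1 r[OF x] by (cases "1 <= r x") (auto simp: le_max_iff_disj)
 qed
 obtain C where C: "countable C" "C \<subseteq> max_set g t" "pairwise (%i j. disjnt (ball i (r i)) (ball j (r j))) C"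
   "max_set g t \<subseteq> (\<Union>i\<in>C. ball i (5 * r i))"
  by (rule Vitali_covering_lemma_balls[where S="max_set g t" and K="max_set g t" and a="%i. i" and r=r and B="max 1 (I / (t * V))"])
   (use bound in "auto intro!: UN_I")
 have fin: "vol (\<Union>i\<in>I'. ball i (5 * r i)) <= 5 ^ DIM('a) / t * I" if I': "I' \<subseteq> C" "finite I'" for I'
 proof -
  have "vol (\<Union>i\<in>I'. ball i (5 * r i)) <= (\<Sum>i\<in>I'. vol (ball i (5 * r i)))"
   by (rule measure_UNION_le[OF I'(2)]) auto
  also have "... <= (\<Sum>i\<in>I'. 5 ^ DIM('a) / t * (LINT y:ball i (r i)|lm. g y))"
  proof (rule sum_mono)
   fix i assume "i \<in> I'"
   then have i: "i \<in> max_set g t" using I' C by auto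
   have "vol (ball i (5 * r i)) = 5 ^ DIM('a) / t * (t * vol (ball i (r i)))"
    using r[OF i] t content_ball_scale[of "r i" 5 i] by simp
   also have "... <= 5 ^ DIM('a) / t * (LINT y:ball i (r i)|lm. g y)"
    using r[OF i] t by (intro mult_left_mono) auto
   finally show "vol (ball i (5 * r i)) <= 5 ^ DIM('a) / t * (LINT y:ball i (r i)|lm. g y)" .
  qed
  also have "... = 5 ^ DIM('a) / t * (\<Sum>i\<in>I'. (LINT y:ball i (r i)|lm. g y))" by (simp add: sum_distrib_left)
  also have "... <= 5 ^ DIM('a) / t * (LINT y:UNIV|lm. g y)"
   using t by (intro mult_left_mono disjoint_balls_integral_sum g I' pairwise_subset[OF C(3) I'(1)]) auto
  finally show ?thesis by (simp add: I_def slint_def)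
 qed
 have U: "(\<Union>i\<in>C. ball i (5 * r i)) \<in> lmeasurable" "vol (\<Union>i\<in>C. ball i (5 * r i)) <= 5 ^ DIM('a) / t * I"
  using fmeasurable_UN_bound[OF C(1) _ fin] measure_UN_bound[OF C(1) _ fin] by auto
 have S: "max_set g t \<in> sets lebesgue" using open_max_set[OF g] by (simp add: borel_open)
 show "max_set g t \<in> lmeasurable" using fmeasurableI2[OF U(1) C(4) S] .
 show "vol (max_set g t) <= 5 ^ DIM('a) / t * integral\<^sup>L lebesgue g"
  using measure_mono_fmeasurable[OF C(4) S U(1)] U(2) by (simp add: I_def)
qed

text \<open>Only the part of \<open>g\<close> above \<open>t / 2\<close> matters, since the rest has averages at most \<open>t / 2\<close>.\<close>

lemma max_set_weak_type_truncated:
 fixes g :: "'a::euclidean_space => real"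
 assumes g: "L1 g" "!!x. 0 <= g x" and t: "0 < t"
 shows "vol (max_set g t) <= 2 * 5 ^ DIM('a) / t * (LINT y:{y. t / 2 < g y}|lm. g y)"
proof -
 define g1 where "g1 y = ind {y. t / 2 < g y} y * g y" for y
 have S: "{y. t / 2 < g y} \<in> sets lebesgue"
  using borel_measurable_integrable[OF g(1)] unfolding borel_measurable_iff_greater
  by (simp del: less_divide_eq_numeral1 divide_less_eq_numeral1)
 have g1: "L1 g1" "!!x. 0 <= g1 x"
  using integrable_mult_indicator[OF S g(1)] g(2) by (auto simp: g1_def[abs_def])
 have "max_set g t \<subseteq> max_set g1 (t / 2)" unfolding max_set_def
 proof safe
  fix x r assume r: "t * vol (ball x r) < (LINT y:ball x r|lm. g y)" "0 < r"
  have ib: "L1 (%y. ind (ball x r) y * (t / 2))"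
   using lmeasurable_iff_integrable[of "ball x r"] by (intro integrable_mult_left) simp
  have "(LINT y:ball x r|lm. g y) <= (LI y. ind (ball x r) y * (t / 2) + ind (ball x r) y *\<^sub>R g1 y)"
   unfolding slint_def
  proof (rule integral_mono)
   show "L1 (%y. ind (ball x r) y * (t / 2) + ind (ball x r) y *\<^sub>R g1 y)"
    by (intro int_add integrable_mult_indicator g1 ib) auto
   show "L1 (%y. ind (ball x r) y *\<^sub>R g y)" by (intro integrable_mult_indicator g) auto
  qed (use t in "auto simp: indicator_def g1_def")
  also have "... = vol (ball x r) * (t / 2) + (LINT y:ball x r|lm. g1 y)" unfolding slint_def
   by (subst lint_add[OF ib]) (auto intro!: integrable_restrict g1)
  finally show "\<exists>r\<in>{0<..}. t / 2 * vol (ball x r) < (LINT y:ball x r|lm. g1 y)"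
   using r by (intro bexI[of _ r]) (auto simp: mult.commute)
 qed
 then have "vol (max_set g t) <= vol (max_set g1 (t / 2))"
  using t by (intro measure_mono_fmeasurable max_set_weak_type g1) (auto simp: open_max_set g borel_open)
 also have "... <= 5 ^ DIM('a) / (t / 2) * integral\<^sup>L lebesgue g1" using t by (intro max_set_weak_type g1) auto
 also have "... = 2 * 5 ^ DIM('a) / t * (LINT y:{y. t / 2 < g y}|lm. g y)"
  unfolding g1_def[abs_def] slint_def by simp
 finally show ?thesis .
qed

text \<open>Half of the Lebesgue differentiation theorem. A Vitali covering of the set
  \<open>E\<close> by balls inside an open \<open>V\<close> slightly larger than \<open>E\<close>
  bounds \<open>beta * vol E\<close> by the integral over \<open>V\<close>, hence by
  \<open>alp * vol E\<close> up to an arbitrarily small error; as \<open>alp < beta\<close>, the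
  measure of \<open>E\<close> is zero.\<close>

lemma negligible_upper_density:
 fixes g :: "'a::euclidean_space => real"
 assumes g: "L1 g" "!!x. 0 <= g x" and ab: "0 <= alp" "alp < beta"
 shows "negligible {x. g x < alp \<and>
  (\<forall>d>0. \<exists>r\<in>{0<..<d}. beta * vol (ball x r) < (LINT y:ball x r|lm. g y))}" (is "negligible ?S")
proof -
 define Od where "Od d = {x. \<exists>r\<in>{0<..<d}. beta * vol (ball x r) < (LINT y:ball x r|lm. g y)}" for d
 have Om: "Od d \<in> sets lebesgue" for d unfolding Od_def using open_average_gt[OF g] by (simp add: borel_open)
 have S: "?S = {x. g x < alp} \<inter> (\<Inter>k. Od (1 / real (Suc k)))" (is "_ = ?T")
 proof (intro equalityI subsetI)
  fix x assume "x \<in> ?S"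
  then show "x \<in> ?T" unfolding Od_def by auto
 next
  fix x assume x: "x \<in> ?T"
  have "\<exists>r\<in>{0<..<d}. beta * vol (ball x r) < (LINT y:ball x r|lm. g y)" if d: "d > 0" for d
  proof -
   obtain k where k: "1 / real (Suc k) < d" using nat_approx_posE[OF d] by blast
   have "x \<in> Od (1 / real (Suc k))" using x by blast
   then obtain r where "r \<in> {0<..<1 / real (Suc k)}"
    "beta * vol (ball x r) < (LINT y:ball x r|lm. g y)" unfolding Od_def by blast
   then show ?thesis using k by (intro bexI[of _ r]) auto
  qed
  then show "x \<in> ?S" using x by auto
 qed
 have Sm: "?S \<in> sets lebesgue"
 proof -
  have "{x. g x < alp} \<in> sets lebesgue"
   using borel_measurable_integrable[OF g(1)] unfolding borel_measurable_iff_less by simp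
  then show ?thesis unfolding S using Om by (intro sets.Int sets.countable_INT) auto
 qed
 \<comment> \<open>Cutting with a ball makes the measure finite, without which comparing two
   multiples of it would say nothing.\<close>
 have "negligible (?S \<inter> ball 0 (real m))" for m
 proof -
  define E where "E = ?S \<inter> ball 0 (real m)"
  have Em: "E \<in> lmeasurable" unfolding E_def
   by (subst Int_commute) (intro fmeasurable_Int_fmeasurable lmeasurable_ball Sm)
  have "beta * vol E <= alp * vol E + e" if e: "0 < e" for e
  proof -
   obtain d where d: "d > 0" "!!A. A \<in> lmeasurable ==> vol A < d ==> (LINT y:A|lm. g y) < e"
    using integral_absolutely_continuous[OF g e] by blast
   obtain V where V: "open V" "E \<subseteq> V" "V \<in> lmeasurable" "vol (V - E) < d"
   proof -
    obtain T where T: "open T" "E \<subseteq> T" "T - E \<in> lmeasurable" "emeasure lebesgue (T - E) < ennreal d"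
     using sets_lebesgue_outer_open[of E d] Em d(1) by blast
    have "T = E \<union> (T - E)" using T(2) by auto
    then have "T \<in> lmeasurable" using fmeasurable.Un[OF Em T(3)] by simp
    moreover have "vol (T - E) < d"
     using T(4) emeasure_eq_measure2[OF T(3)] d(1) by (simp add: ennreal_less_iff)
    ultimately show ?thesis using that T by blast
   qed
   define K where "K = {(x, r). x \<in> E \<and> 0 < r \<and> ball x r \<subseteq> V \<and> beta * vol (ball x r) < (LINT y:ball x r|lm. g y)}"
   have cov: "\<exists>i. i \<in> K \<and> x \<in> ball (fst i) (snd i) \<and> snd i < d'" if "x \<in> E" "0 < d'" for x d'
   proof -
    obtain q where q: "q > 0" "ball x q \<subseteq> V" using V \<open>x \<in> E\<close> openE by blast
    have "min q d' > 0" using q that by simp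
    then obtain r where r: "r \<in> {0<..<min q d'}" "beta * vol (ball x r) < (LINT y:ball x r|lm. g y)"
     using \<open>x \<in> E\<close> unfolding E_def by blast
    have "ball x r \<subseteq> V" using r q by (meson ball_subset_ball_iff greaterThanLessThan_iff less_imp_le min_less_iff_conj subset_ball subset_trans)
    then show ?thesis using r that by (intro exI[of _ "(x, r)"]) (auto simp: K_def)
   qed
   obtain C where C: "countable C" "C \<subseteq> K" "pairwise (%i j. disjnt (ball (fst i) (snd i)) (ball (fst j) (snd j))) C"
    "negligible (E - (\<Union>i\<in>C. ball (fst i) (snd i)))"
    using Vitali_covering_theorem_balls[of E K fst snd] cov by blast
   have fin: "vol (\<Union>i\<in>I. ball (fst i) (snd i)) <= (alp * vol E + e) / beta" if I: "I \<subseteq> C" "finite I" for I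
   proof -
    have "beta * vol (\<Union>i\<in>I. ball (fst i) (snd i)) <= beta * (\<Sum>i\<in>I. vol (ball (fst i) (snd i)))"
     using ab by (intro mult_left_mono measure_UNION_le I) auto
    also have "... <= (\<Sum>i\<in>I. (LINT y:ball (fst i) (snd i)|lm. g y))"
     unfolding sum_distrib_left by (rule sum_mono) (use I C(2) in "auto simp: K_def")
    also have "... <= (LINT y:V|lm. g y)"
    proof (rule disjoint_balls_integral_sum[OF g I(2)])
     show "ball (fst i) (snd i) \<subseteq> V" if "i \<in> I" for i
     proof -
      have "i \<in> K" using that I(1) C(2) by blast
      then show ?thesis by (cases i) (simp add: K_def)
     qed
     show "pairwise (%i j. disjnt (ball (fst i) (snd i)) (ball (fst j) (snd j))) I"
      using C(3) I(1) by (rule pairwise_subset)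
    qed (use V in auto)
    also have "... = (LINT y:E|lm. g y) + (LINT y:V - E|lm. g y)"
    proof -
     have "V = E \<union> (V - E)" using V(2) by auto
     moreover have "(LINT y:E \<union> (V - E)|lm. g y) = (LINT y:E|lm. g y) + (LINT y:V - E|lm. g y)"
      by (rule set_integral_Un)
       (use fmeasurableD[OF Em] fmeasurableD[OF V(3)] g in "auto simp: set_integrable_def intro!: integrable_restrict")
     ultimately show ?thesis by simp
    qed
    also have "(LINT y:E|lm. g y) <= (LINT y:E|lm. alp)" unfolding slint_def
    proof (rule integral_mono)
     show "L1 (%x. ind E x *\<^sub>R g x)" using Em g by (intro integrable_mult_indicator) auto
     show "L1 (%x. ind E x *\<^sub>R alp)" using Em by (auto simp: fmeasurable_def)
    qed (auto simp: E_def indicator_def)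
    also have "(LINT y:E|lm. alp) = alp * vol E" by (simp add: slint_def)
    also have "(LINT y:V - E|lm. g y) <= e"
     using d(2)[of "V - E"] V Em by (auto intro: less_imp_le fmeasurable.Diff)
    finally show ?thesis using ab by (simp add: field_simps)
   qed
   have U: "(\<Union>i\<in>C. ball (fst i) (snd i)) \<in> lmeasurable" "vol (\<Union>i\<in>C. ball (fst i) (snd i)) <= (alp * vol E + e) / beta"
    using fmeasurable_UN_bound[OF C(1) _ fin] measure_UN_bound[OF C(1) _ fin] by auto
   have "vol E <= vol ((E - (\<Union>i\<in>C. ball (fst i) (snd i))) \<union> (\<Union>i\<in>C. ball (fst i) (snd i)))"
    using Em U(1) by (intro measure_mono_fmeasurable) (auto intro: fmeasurable.Un fmeasurable.Diff)
   also have "... <= vol (E - (\<Union>i\<in>C. ball (fst i) (snd i))) + vol (\<Union>i\<in>C. ball (fst i) (snd i))"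
    using Em U(1) by (intro measure_Un_le) auto
   also have "vol (E - (\<Union>i\<in>C. ball (fst i) (snd i))) = 0" using C(4) by (simp add: negligible_imp_measure0)
   finally have "vol E <= (alp * vol E + e) / beta" using U(2) by simp
   then show ?thesis using ab by (simp add: field_simps)
  qed
  then have "beta * vol E <= alp * vol E" by (rule field_le_epsilon)
  then have "vol E = 0" using ab by (metis measure_nonneg mult_le_cancel_right not_less order_le_less)
  then show ?thesis using Em unfolding E_def by (simp add: negligible_iff_measure)
 qed
 then have "negligible (\<Union>m. ?S \<inter> ball 0 (real m))" by (intro negligible_countable_Union) auto
 moreover have "?S \<subseteq> (\<Union>m. ?S \<inter> ball 0 (real m))"
 proof
  fix x assume "x \<in> ?S"
  moreover obtain m where "norm x < real m" using reals_Archimedean2 by blast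
  ultimately show "x \<in> (\<Union>m. ?S \<inter> ball 0 (real m))" by (intro UN_I[of m]) auto
 qed
 ultimately show ?thesis by (rule negligible_subset)
qed

text \<open>The property refers to the value \<open>u x\<close> itself, so it identifies limits of
  averages with the given representative.\<close>

definition lebesgue_point :: "('a::euclidean_space => real) => 'a => bool" where
 "lebesgue_point u x \<longleftrightarrow> (\<forall>e>0. \<exists>d>0. \<forall>r. 0 < r \<and> r < d -->
   (LINT y:ball x r|lm. abs(u y - u x)) <= e * vol (ball x r))"

text \<open>The density lemma is applied to the distance of \<open>u\<close> from a rational
  \<open>q\<close>, cut off to a ball to be integrable. Countably many null sets suffice because
  \<open>u x\<close> is a limit of rationals.\<close>

lemma AE_lebesgue_point:
 fixes u :: "'a::euclidean_space => real"
 assumes u: "L1 u"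
 shows "AE x in lm. lebesgue_point u x"
proof -
 define g where "g m q y = ind (ball 0 (real m + 1)) y * abs(u y - of_rat q)" for m :: nat and q :: rat and y :: 'a
 have ib: "L1 (%y. ind (ball z r) y * c :: real)" for z :: 'a and r c
  using lmeasurable_iff_integrable[of "ball z r"] by (intro integrable_mult_left) simp
 have ic: "L1 (%y. ind (ball z r) y *\<^sub>R (abs(u y - c)))" for z :: 'a and r c
 proof (rule int_bound)
  show "L1 (%y. abs(u y) + ind (ball z r) y * abs(c))" using u ib by (intro int_add) auto
  show "(%y. ind (ball z r) y *\<^sub>R (abs(u y - c))) \<in> bml"
   using u by (intro borel_measurable_scaleR borel_measurable_abs borel_measurable_diff borel_measurable_indicator) auto
  show "AE y in lm. norm (ind (ball z r) y *\<^sub>R (abs(u y - c))) <= norm (abs(u y) + ind (ball z r) y * abs(c))"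
   by (rule AE_I2) (auto simp: indicator_def)
 qed
 have g: "L1 (g m q)" "0 <= g m q x" for m q x
  using ic[of 0 "real m + 1" "of_rat q"] by (simp_all add: g_def[abs_def])
 define N where "N m q alp beta = {x. g m q x < of_rat alp \<and>
  (\<forall>d>0. \<exists>r\<in>{0<..<d}. of_rat beta * vol (ball x r) < (LINT y:ball x r|lm. g m q y))}" for m q alp beta
 have "AE x in lm. \<forall>m q alp beta. 0 <= alp \<and> alp < beta --> x ~: N m q alp beta" unfolding AE_all_countable
 proof (intro allI)
  fix m q alp beta
  show "AE x in lm. 0 <= alp \<and> alp < beta --> x ~: N m q alp beta"
  proof (cases "0 <= alp \<and> alp < beta")
   case True
   have "negligible (N m q alp beta)"
    unfolding N_def by (rule negligible_upper_density[OF g]) (use True in "auto simp: of_rat_less")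
   then have "AE x in lm. x ~: N m q alp beta" by (intro AE_not_in) (simp add: negligible_iff_null_sets)
   then show ?thesis by eventually_elim auto
  qed auto
 qed
 then show ?thesis
 proof (rule AE_mp, intro AE_I2 impI)
  fix x assume x: "\<forall>m q alp beta. 0 <= alp \<and> alp < beta --> x ~: N m q alp beta"
  obtain m where m: "norm x < real m" using reals_Archimedean2 by blast
  show "lebesgue_point u x" unfolding lebesgue_point_def
  proof (intro allI impI)
   fix e :: real assume e: "0 < e"
   \<comment> \<open>The budget for \<open>e\<close>: replacing \<open>u x\<close> by
     \<open>q\<close> costs at most \<open>e / 4\<close>, and \<open>beta\<close> stays below
     \<open>3 * e / 4\<close>; \<open>alp\<close> has to exceed \<open>e / 4\<close> so that the
     cut-off distance at \<open>x\<close> lies below it.\<close>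
   obtain q where q: "u x < of_rat q" "of_rat q < u x + e / 4"
    using of_rat_dense[of "u x" "u x + e / 4"] e by auto
   obtain alp where alp: "e / 4 < of_rat alp" "of_rat alp < e / 2" using of_rat_dense[of "e / 4" "e / 2"] e by auto
   obtain beta where beta: "e / 2 < of_rat beta" "of_rat beta < 3 * e / 4" using of_rat_dense[of "e / 2" "3 * e / 4"] e by auto
   have "(0::real) <= of_rat alp" "(of_rat alp::real) < of_rat beta" using alp beta e by linarith+
   then have "0 <= alp \<and> alp < beta" by (simp add: of_rat_less)
   then have "x ~: N m q alp beta" using x by blast
   moreover have "g m q x < of_rat alp" using q alp m by (auto simp: g_def indicator_def)
   ultimately obtain d where d: "d > 0" "!!r. r \<in> {0<..<d} ==> (LINT y:ball x r|lm. g m q y) <= of_rat beta * vol (ball x r)"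
    unfolding N_def by (auto simp: not_less)
   show "\<exists>d>0. \<forall>r. 0 < r \<and> r < d --> (LINT y:ball x r|lm. abs(u y - u x)) <= e * vol (ball x r)"
   proof (intro exI[of _ "min d 1"] conjI allI impI)
    fix r assume r: "0 < r \<and> r < min d 1"
    have sub: "y \<in> ball 0 (real m + 1)" if "y \<in> ball x r" for y
    proof -
     have "norm y <= norm x + dist x y" using norm_triangle_ineq[of x "y - x"] by (simp add: dist_norm norm_minus_commute)
     then show ?thesis using that r m by (simp add: mem_ball)
    qed
    have "(LINT y:ball x r|lm. abs(u y - u x)) <= (LI y. ind (ball x r) y *\<^sub>R g m q y + ind (ball x r) y * (e / 4))"
     unfolding slint_def
    proof (rule integral_mono)
     show "L1 (%y. ind (ball x r) y *\<^sub>R g m q y + ind (ball x r) y * (e / 4))"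
      by (intro int_add integrable_mult_indicator g ib) auto
     fix y
     show "ind (ball x r) y *\<^sub>R (abs(u y - u x)) <= ind (ball x r) y *\<^sub>R g m q y + ind (ball x r) y * (e / 4)"
     proof (cases "y \<in> ball x r")
      case True
      have "g m q y = abs(u y - of_rat q)" using sub[OF True] by (simp add: g_def)
      then show ?thesis using True q by simp
     qed simp
    qed (rule ic)
    also have "... = (LINT y:ball x r|lm. g m q y) + vol (ball x r) * (e / 4)" unfolding slint_def
     by (subst lint_add) (auto intro!: integrable_restrict g ib)
    also have "... <= of_rat beta * vol (ball x r) + vol (ball x r) * (e / 4)" using d(2)[of r] r by auto
    also have "... = (of_rat beta + e / 4) * vol (ball x r)" by (simp add: algebra_simps)
    also have "... <= e * vol (ball x r)" using beta by (intro mult_right_mono) auto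
    finally show "(LINT y:ball x r|lm. abs(u y - u x)) <= e * vol (ball x r)" .
   qed (use d in auto)
  qed
 qed
qed

section \<open>Pointwise estimates by chains of cubes\<close>

definition cube :: "real ^ 'n => real => (real ^ 'n) set" where
 "cube a r = {y. \<forall>l. abs(y $ l - a $ l) <= r}"

lemma cube_eq_cbox: "cube a r = cbox (\<chi> l. a $ l - r) (\<chi> l. a $ l + r)"
 by (auto simp: cube_def mem_box_cart abs_le_iff algebra_simps)

lemma cube_lmeasurable [simp]: "cube a r \<in> lmeasurable"
 by (simp add: cube_eq_cbox)

lemma cube_sets [simp]: "cube a r \<in> sets lebesgue"
 using fmeasurableD[OF cube_lmeasurable] .

lemma measure_cube: "0 <= r ==> vol (cube (a :: real ^ 'n::finite) r) = (2 * r) ^ CARD('n)"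
 by (simp add: cube_eq_cbox content_cbox_cart interval_eq_empty_cart)

lemma compact_cube: "compact (cube a r)"
 by (simp add: cube_eq_cbox)

lemma convex_cube: "convex (cube a r)"
 by (simp add: cube_eq_cbox)

lemma cube_mono: "r <= s ==> cube a r \<subseteq> cube a s"
 unfolding cube_def using order_trans by blast

lemma cube_subset_cube:
 assumes "!!l. abs(c $ l - a $ l) + r <= s" shows "cube c r \<subseteq> cube a s"
proof
 fix y assume y: "y \<in> cube c r"
 have "abs(y $ l - a $ l) <= s" for l
 proof -
  have "abs(y $ l - c $ l) <= r" using y by (simp add: cube_def)
  then show ?thesis using assms[of l] by linarith
 qed
 then show "y \<in> cube a s" by (simp add: cube_def)
qed

lemma cube_subset_ball:
 fixes x c :: "real ^ 'n::finite"
 assumes "!!l. abs(c $ l - x $ l) + r <= s" "real CARD('n) * s < q"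
 shows "cube c r \<subseteq> ball x q"
proof
 fix y assume y: "y \<in> cube c r"
 have "norm (y - x) <= (\<Sum>l\<in>UNIV. abs((y - x) $ l))" by (rule norm_le_l1_cart)
 also have "... <= (\<Sum>l\<in>(UNIV::'n set). s)"
 proof (rule sum_mono)
  fix l
  have "abs(y $ l - c $ l) <= r" using y by (simp add: cube_def)
  then show "abs((y - x) $ l) <= s" using assms(1)[of l] by simp
 qed
 also have "... < q" using assms(2) by simp
 finally show "y \<in> ball x q" by (simp add: dist_norm norm_minus_commute)
qed

lemma measure_ball_scale:
 fixes x :: "real ^ 'n::finite"
 assumes "0 <= c" "0 <= r"
 shows "vol (ball x (c * r)) = unit_ball_vol (real CARD('n)) * c ^ CARD('n) * r ^ CARD('n)"
 using assms by (simp add: content_ball power_mult_distrib)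

lemma kernel_bounds:
 fixes y :: "real ^ 'n::finite"
 assumes "0 < r"
 shows "0 <= coord_prod (%l. bk r) (y - c)" "coord_prod (%l. bk r) (y - c) <= (bump_max / r) ^ CARD('n)"
  "y ~: cube c r ==> coord_prod (%l. bk r) (y - c) = 0"
proof -
 note b = bk_bounds[OF assms order_refl]
 show "0 <= coord_prod (%l. bk r) (y - c)" unfolding coord_prod_def by (rule prod_nonneg) (use b in auto)
 have "(\<Prod>l\<in>(UNIV::'n set). bk r ((y - c) $ l)) <= (\<Prod>l\<in>(UNIV::'n set). bump_max / r)"
  by (rule prod_mono) (use b in auto)
 then show "coord_prod (%l. bk r) (y - c) <= (bump_max / r) ^ CARD('n)" by (simp add: coord_prod_def)
 assume "y ~: cube c r"
 then obtain l where "r < abs((y - c) $ l)" by (auto simp: cube_def not_le)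
 then have "r <= abs((y - c) $ l)" by simp
 then have "bk r ((y - c) $ l) = 0" using assms by (intro bk_eq_0)
 then show "coord_prod (%l. bk r) (y - c) = 0" unfolding coord_prod_def by (intro prod_zero) auto
qed

lemma kernel_continuous: "cont (%y. coord_prod (%l. bk r) (y - c))"
 by (rule continuous_on_compose2[OF coord_prod_continuous]) (auto intro!: continuous_intros smooth_bk')

lemma integrable_mult_kernel:
 fixes c :: "real ^ 'n::finite"
 assumes "L1 u" "0 < r"
 shows "L1 (%y. u y * coord_prod (%l. bk r) (y - c))"
 by (rule integrable_mult_continuous_bounded[OF assms(1) kernel_continuous])
  (use kernel_bounds(1,2)[OF assms(2), where c=c] in "simp add: abs_of_nonneg")

lemma integrable_kernel:
 fixes c :: "real ^ 'n::finite"
 assumes "0 < r"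
 shows "L1 (%y. coord_prod (%l. bk r) (y - c))"
 using integral_kernel[OF assms, of c] not_integrable_integral_eq by fastforce

lemma avg_minus_le:
 fixes c :: "real ^ 'n::finite"
 assumes u: "L1 u" and r: "0 < r" and S: "cube c r \<subseteq> S" "S \<in> lmeasurable"
 shows "abs(avg u c r - z) <= (bump_max / r) ^ CARD('n) * (LINT y:S|lm. abs(u y - z))"
proof -
 define kap where "kap y = coord_prod (%l::'n. bk r) (y - c)" for y
 have i: "L1 (%y. u y * kap y)" "L1 kap"
  using integrable_mult_kernel[OF u r, of c] integrable_kernel[OF r, of c] by (simp_all add: kap_def[abs_def])
 have 1: "integral\<^sup>L lebesgue kap = 1" using integral_kernel[OF r, of c] by (simp add: kap_def[abs_def])
 note iS = integrable_ind_dist[OF u S(2), of z]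
 have "avg u c r - z = (LI y. u y * kap y) - (LI y. z * kap y)"
  using 1 by (simp add: avg_def kap_def[symmetric])
 also have "... = (LI y. (u y - z) * kap y)"
  using i by (subst lint_diff[symmetric]) (auto simp: left_diff_distrib)
 also have "abs(...) <= (LI y. (bump_max / r) ^ CARD('n) * (ind S y * abs(u y - z)))"
 proof (rule integral_abs_bound[THEN order_trans], rule integral_mono)
  show "L1 (%y. abs((u y - z) * kap y))" using i by (auto simp: left_diff_distrib)
  show "L1 (%y. (bump_max / r) ^ CARD('n) * (ind S y * abs(u y - z)))" using iS by simp
  show "abs((u y - z) * kap y) <= (bump_max / r) ^ CARD('n) * (ind S y * abs(u y - z))" for y
  proof (cases "y \<in> S")
   case True
   then show ?thesis using kernel_bounds[OF r, of y c] by (simp add: abs_mult kap_def mult.commute mult_left_mono)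
  next
   case False
   then have "kap y = 0" using kernel_bounds(3)[OF r, of y c] S(1) by (auto simp: kap_def)
   then show ?thesis using False by simp
  qed
 qed
 finally show ?thesis by (simp add: slint_def)
qed

text \<open>Only inclusion in a ball of comparable size matters, so the sets may be off centre and
  need not contain \<open>x\<close>; the tilted cubes below make use of this.\<close>

lemma lebesgue_point_shrink:
 fixes x :: "real ^ 'n::finite"
 assumes u: "L1 u" and x: "lebesgue_point u x"
  and r: "!!k. 0 < r k" "r ----> 0" and q: "0 < q" "!!k. S k \<subseteq> ball x (q * r k)" "!!k. S k \<in> lmeasurable"
 shows "(%k. (LINT y:S k|lm. abs(u y - u x)) / r k ^ CARD('n)) ----> 0"
proof (rule LIMSEQ_I)
 fix e :: real assume e: "0 < e"
 define M where "M = unit_ball_vol (real CARD('n)) * q ^ CARD('n)"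
 have M: "0 < M" unfolding M_def using q unit_ball_vol_pos[of "real CARD('n)"] by simp
 obtain d where d: "d > 0" "!!s. 0 < s ==> s < d ==>
   (LINT y:ball x s|lm. abs(u y - u x)) <= e / (2 * M) * vol (ball x s)"
  using x e M unfolding lebesgue_point_def by (metis divide_pos_pos mult_pos_pos zero_less_numeral)
 obtain N where N: "!!k. N <= k ==> r k < d / q"
  using LIMSEQ_D[OF r(2), of "d / q"] d(1) q r(1) by (auto simp: abs_of_pos)
 show "\<exists>N. \<forall>k\<ge>N. norm ((LINT y:S k|lm. abs(u y - u x)) / r k ^ CARD('n) - 0) < e"
 proof (intro exI[of _ N] allI impI)
  fix k assume k: "N <= k"
  have s: "0 < q * r k" "q * r k < d" using r(1)[of k] q N[OF k] by (auto simp: field_simps)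
  have "(LINT y:S k|lm. abs(u y - u x)) <= (LINT y:ball x (q * r k)|lm. abs(u y - u x))"
   unfolding slint_def real_scaleR_def
   by (intro integral_mono integrable_ind_dist u q(3)) (use q(2)[of k] in "auto simp: indicator_def")
  also have "... <= e / (2 * M) * (M * r k ^ CARD('n))"
   using d(2)[OF s] measure_ball_scale[of q "r k" x] q r(1)[of k] by (simp add: M_def)
  finally have "(LINT y:S k|lm. abs(u y - u x)) / r k ^ CARD('n) <= e / 2" using M r(1)[of k] by (simp add: field_simps)
  moreover have "0 <= (LINT y:S k|lm. abs(u y - u x)) / r k ^ CARD('n)"
   using r(1)[of k] by (intro divide_nonneg_nonneg set_integral_nonneg') auto
  ultimately show "norm ((LINT y:S k|lm. abs(u y - u x)) / r k ^ CARD('n) - 0) < e"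
   using e unfolding real_norm_def by linarith
 qed
qed

lemma avg_tendsto:
 fixes x :: "real ^ 'n::finite"
 assumes u: "L1 u" and x: "lebesgue_point u x"
  and r: "!!k. 0 < r k" "r ----> 0" and q: "0 < q" "!!k. cube (c k) (r k) \<subseteq> ball x (q * r k)"
 shows "(%k. avg u (c k) (r k)) ----> u x"
proof -
 define I where "I k = (LINT y:cube (c k) (r k)|lm. abs(u y - u x)) / r k ^ CARD('n)" for k
 have le: "norm (avg u (c k) (r k) - u x) <= bump_max ^ CARD('n) * I k" for k
  using avg_minus_le[OF u r(1) order_refl, of "c k" k "u x"] by (simp add: I_def power_divide cube_lmeasurable)
 have "I ----> 0" unfolding I_def[abs_def] by (rule lebesgue_point_shrink[OF u x r q]) (simp add: cube_lmeasurable)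
 then have I0: "(%k. bump_max ^ CARD('n) * I k) ----> 0" by (rule tendsto_mult_right_zero)
 show ?thesis by (rule LIM_zero_cancel, rule Lim_null_comparison[OF always_eventually[OF allI[OF le]] I0])
qed

section \<open>Telescoping along cubes that shrink to a point\<close>

definition step_const :: "nat => real" where
 "step_const n = real n * (2 * bump_max) ^ (n - 1)"

lemma step_const_pos: "0 < n ==> 0 < step_const n"
 unfolding step_const_def using bump_max(1) by auto

text \<open>Here \<open>u\<close> stands for one component of the curve on a cube; the pointwise
  estimates derived from these assumptions involve its gradient only through the majorant
  \<open>h\<close>.\<close>

locale gradient_bound =
 fixes a :: "real ^ 'n::finite" and R :: real and u w h
 assumes R: "0 < R" and wg: "wgrad (cube a R) u w"
  and wh: "!!j x. abs(w j x) <= h x" and h: "L1 h"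
begin

lemma h_nonneg: "0 <= h x"
 using wh[of _ x] abs_ge_zero order_trans by blast

lemma u_int: "L1 u"
 using wg by (simp add: wgrad_def)

text \<open>A cube centred at \<open>x\<close> may stick out of the given cube, so its centre is
  moved towards \<open>a\<close> in proportion to \<open>rho\<close>. The cube of half side
  \<open>rho\<close> about the new centre stays inside even for \<open>x\<close> on the boundary,
  remains within a multiple of \<open>rho\<close> of \<open>x\<close>, and for
  \<open>rho = R\<close> is the whole cube.\<close>

definition tilt :: "real ^ 'n => real => real ^ 'n" where
 "tilt x rho = x + (rho / R) *\<^sub>R (a - x)"

lemma tilt_R [simp]: "tilt x R = a"
 using R by (simp add: tilt_def)

lemma tilt_dist: assumes "x \<in> cube a R" "0 <= rho" shows "abs(tilt x rho $ l - x $ l) <= rho"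
proof -
 have "abs(tilt x rho $ l - x $ l) = rho / R * abs(a $ l - x $ l)" using assms R by (simp add: tilt_def abs_mult)
 also have "... <= rho / R * R" using assms R by (intro mult_left_mono) (auto simp: cube_def abs_minus_commute)
 finally show ?thesis using R by simp
qed

lemma tilt_center: assumes "x \<in> cube a R" "0 <= rho" "rho <= R" shows "abs(tilt x rho $ l - a $ l) <= R - rho"
proof -
 have "tilt x rho $ l - a $ l = (1 - rho / R) * (x $ l - a $ l)" by (simp add: tilt_def algebra_simps)
 then have "abs(tilt x rho $ l - a $ l) = (1 - rho / R) * abs(x $ l - a $ l)" using assms R by (simp add: abs_mult)
 also have "... <= (1 - rho / R) * R" using assms R by (intro mult_left_mono) (auto simp: cube_def)
 finally show ?thesis using R by (simp add: algebra_simps)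
qed

lemma tilt_cube_subset: "x \<in> cube a R ==> 0 <= rho ==> rho <= R ==> cube (tilt x rho) rho \<subseteq> cube a R"
 by (rule cube_subset_cube) (use tilt_center[of x rho] in "simp add: le_diff_eq")

lemma tilt_cube_ball: assumes "x \<in> cube a R" "0 < rho" shows "cube (tilt x rho) rho \<subseteq> ball x (3 * real CARD('n) * rho)"
proof (rule cube_subset_ball[of _ _ _ "2 * rho"])
 fix l
 show "abs(tilt x rho $ l - x $ l) + rho <= 2 * rho" using tilt_dist[of x rho l] assms by simp
qed (use assms in simp)

lemma tilt_step:
 assumes x: "x \<in> cube a R" and rho: "0 < rho" "rho <= R"
 shows "abs(avg u (tilt x (rho / 2)) (rho / 2) - avg u (tilt x rho) rho) <=
  step_const CARD('n) / rho ^ (CARD('n) - 1) * (LINT y:cube (tilt x rho) rho|lm. h y)"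
proof -
 have d: "abs(tilt x (rho / 2) $ l - tilt x rho $ l) <= rho / 2" for l
 proof -
  have "tilt x (rho / 2) $ l - tilt x rho $ l = - (tilt x (rho / 2) $ l - x $ l)"
   by (simp add: tilt_def algebra_simps) 
  then have "abs(tilt x (rho / 2) $ l - tilt x rho $ l) = abs(tilt x (rho / 2) $ l - x $ l)" by (metis abs_minus_cancel)
  then show ?thesis using tilt_dist[of x "rho / 2" l] x rho by simp
 qed
 \<comment> \<open>The smaller of the two radii is \<open>rho / 2\<close>, whence the factor
   \<open>2\<close> in \<open>step_const\<close>.\<close>
 have "abs(avg u (tilt x (rho / 2)) (rho / 2) - avg u (tilt x rho) rho) <=
   real CARD('n) * (bump_max / (rho / 2)) ^ (CARD('n) - 1) *
   (LINT y:cbox (\<chi> l. tilt x rho $ l - rho) (\<chi> l. tilt x rho $ l + rho)|lm. h y)"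
 proof (rule avg_step[OF wg _ _ _ _ _ _ wh h])
  show "cbox (\<chi> l. tilt x rho $ l - rho) (\<chi> l. tilt x rho $ l + rho) \<subseteq> cube a R"
   using tilt_cube_subset[OF x] rho by (simp add: cube_eq_cbox)
  fix l
  show "(\<chi> l. tilt x rho $ l - rho) $ l <= tilt x (rho / 2) $ l - rho / 2 \<and>
   tilt x (rho / 2) $ l + rho / 2 <= (\<chi> l. tilt x rho $ l + rho) $ l"
   using abs_le_D1[OF d[of l]] abs_le_D2[OF d[of l]] by (auto simp: field_simps)
 qed (use rho in auto)
 then show ?thesis by (simp add: step_const_def cube_eq_cbox power_divide power_mult_distrib mult_ac)
qed

text \<open>Telescoping over the half sides \<open>rho / 2 ^ k\<close>; at a Lebesgue point the
  averages converge to \<open>u x\<close>. The summable bound \<open>e\<close> is left free because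
  both geometric and inverse quadratic decay occur.\<close>

lemma chain:
 assumes x: "x \<in> cube a R" "lebesgue_point u x" and rho: "0 < rho" "rho <= R" and e: "summable e"
  and le: "!!k. step_const CARD('n) / (rho / 2 ^ k) ^ (CARD('n) - 1) *
    (LINT y:cube (tilt x (rho / 2 ^ k)) (rho / 2 ^ k)|lm. h y) <= e k"
 shows "abs(u x - avg u (tilt x rho) rho) <= suminf e"
proof -
 define v where "v k = avg u (tilt x (rho / 2 ^ k)) (rho / 2 ^ k)" for k
 have r: "0 < rho / 2 ^ k" "rho / 2 ^ k <= R" for k :: nat
  using rho order_trans[OF _ rho(2), of "rho / 2 ^ k"] by (auto simp: divide_le_eq)
 have st: "abs(v (Suc k) - v k) <= e k" for k
  using tilt_step[OF x(1) r[of k]] le[of k] by (simp add: v_def mult.commute)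
 have e0: "0 <= e k" for k using st[of k] abs_ge_zero order_trans by blast
 have part: "abs(v k - v 0) <= suminf e" for k
 proof -
  have "abs(v k - v 0) <= (\<Sum>i<k. e i)"
  proof (induction k)
   case (Suc k)
   then show ?case using st[of k] by simp
  qed simp
  also have "... <= suminf e" by (rule sum_le_suminf[OF e]) (use e0 in auto)
  finally show ?thesis .
 qed
 have lim: "v ----> u x" unfolding v_def
 proof (rule avg_tendsto[OF u_int x(2) r(1)])
  show "(%k. rho / 2 ^ k) ----> 0" by (rule LIMSEQ_divide_realpow_zero) simp
  show "cube (tilt x (rho / 2 ^ k)) (rho / 2 ^ k) \<subseteq> ball x (3 * real CARD('n) * (rho / 2 ^ k))" for k
   using tilt_cube_ball[OF x(1) r(1)[of k]] .
 qed simp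
 have "abs(u x - v 0) <= suminf e"
  by (rule LIMSEQ_le_const2[of "%k. abs(v k - v 0)"]) (use part lim in "auto intro!: tendsto_intros")
 then show ?thesis by (simp add: v_def)
qed

end

text \<open>The number \<open>3 * n\<close> comes from the ball of radius \<open>3 * n * rho\<close>
  about \<open>x\<close> that contains the tilted cube of half side \<open>rho\<close>.\<close>

definition chain_const :: "nat => real" where
 "chain_const n = step_const n * unit_ball_vol (real n) * (3 * real n) ^ n"

text \<open>The chain estimate costs \<open>2 * chain_const\<close> at each of two points; the other
  summand is one comparison of averages inside a ball of radius
  \<open>5 * n ^ 2 * rho\<close>.\<close>

definition lip_const :: "nat => real" where
 "lip_const n = 4 * chain_const n + step_const n * unit_ball_vol (real n) * (5 * real n ^ 2) ^ n"

lemma chain_const_pos: "0 < n ==> 0 < chain_const n"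
 unfolding chain_const_def using step_const_pos[of n] by auto

lemma lip_const_pos: "0 < n ==> 0 < lip_const n"
 unfolding lip_const_def using step_const_pos[of n] chain_const_pos[of n] by (auto intro!: add_pos_nonneg)

context gradient_bound
begin

lemma tilt_integral_le:
 assumes x: "x \<in> cube a R" "x ~: max_set h t" and rho: "0 < rho"
 shows "(LINT y:cube (tilt x rho) rho|lm. h y) <=
  t * (unit_ball_vol (real CARD('n)) * (3 * real CARD('n)) ^ CARD('n) * rho ^ CARD('n))"
proof -
 have "(LINT y:cube (tilt x rho) rho|lm. h y) <= (LINT y:ball x (3 * real CARD('n) * rho)|lm. h y)"
  by (rule integral_ball_mono[OF h h_nonneg tilt_cube_ball[OF x(1) rho]]) auto
 also have "... <= t * vol (ball x (3 * real CARD('n) * rho))"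
  by (rule max_set_notin_D[OF x(2)]) (use rho in auto)
 finally show ?thesis using rho by (subst (asm) measure_ball_scale) auto
qed

text \<open>Off the superlevel set the averages of \<open>h\<close> are at most \<open>t\<close> on
  every scale, so the steps of the chain form a geometric series of ratio one half.\<close>

lemma chain_maximal:
 assumes x: "x \<in> cube a R" "lebesgue_point u x" "x ~: max_set h t" and rho: "0 < rho" "rho <= R"
 shows "abs(u x - avg u (tilt x rho) rho) <= 2 * chain_const CARD('n) * t * rho"
proof -
 define K where "K = chain_const CARD('n)"
 have s: "(%k. K * t * rho * (1 / 2) ^ k) sums (K * t * rho * 2)"
  using sums_mult[OF geometric_sums[of "1/2::real"], of "K * t * rho"] by simp
 have n: "CARD('n) = Suc (CARD('n) - 1)" using zero_less_card_finite[where 'a='n] by simp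
 have "abs(u x - avg u (tilt x rho) rho) <= (\<Sum>k. K * t * rho * (1 / 2) ^ k)"
 proof (rule chain[OF x(1,2) rho sums_summable[OF s]])
  fix k
  define r where "r = rho / 2 ^ k"
  have r: "0 < r" using rho by (simp add: r_def)
  have "step_const CARD('n) / r ^ (CARD('n) - 1) * (LINT y:cube (tilt x r) r|lm. h y)
   <= step_const CARD('n) / r ^ (CARD('n) - 1) *
    (t * (unit_ball_vol (real CARD('n)) * (3 * real CARD('n)) ^ CARD('n) * r ^ CARD('n)))"
   using r step_const_pos[of "CARD('n)"] by (intro mult_left_mono tilt_integral_le x) auto
  also have "... = K * t * r"
  proof -
   have "r ^ CARD('n) = r * r ^ (CARD('n) - 1)" by (metis n power_Suc)
   then show ?thesis using r by (simp add: K_def chain_const_def)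
  qed
  finally show "step_const CARD('n) / (rho / 2 ^ k) ^ (CARD('n) - 1) *
    (LINT y:cube (tilt x (rho / 2 ^ k)) (rho / 2 ^ k)|lm. h y) <= K * t * rho * (1 / 2) ^ k"
   by (simp add: r_def power_divide)
 qed
 then show ?thesis using sums_unique[OF s] by (simp add: K_def mult_ac)
qed

text \<open>The classical pointwise Lipschitz estimate: descend from a common scale comparable to
  the distance to each of the points, and compare the two averages on that scale by
  \<open>avg_step\<close>.\<close>

lemma lipschitz_maximal:
 assumes x: "x \<in> cube a R" "lebesgue_point u x" "x ~: max_set h t"
  and y: "y \<in> cube a R" "lebesgue_point u y" "y ~: max_set h t" and t: "0 <= t"
 shows "abs(u x - u y) <= lip_const CARD('n) * t * norm (x - y)"
proof (cases "x = y")
 case False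
 define n where "n = real CARD('n)"
 have n: "1 <= n" unfolding n_def using zero_less_card_finite[where 'a='n] by simp
 have nS: "CARD('n) = Suc (CARD('n) - 1)" using zero_less_card_finite[where 'a='n] by simp
 \<comment> \<open>The denominator keeps \<open>rho\<close> at most \<open>R\<close>, since points
   of the cube differ by at most \<open>2 * R\<close> in each of the \<open>n\<close>
   coordinates.\<close>
 define rho where "rho = norm (x - y) / (2 * n)"
 have rho0: "0 < rho" using False n by (simp add: rho_def)
 have d: "abs(x $ l - y $ l) <= 2 * n * rho" for l
  using component_le_norm_cart[of "x - y" l] n by (simp add: rho_def)
 have "norm (x - y) <= (\<Sum>l\<in>UNIV. abs((x - y) $ l))" by (rule norm_le_l1_cart)
 also have "... <= (\<Sum>l\<in>(UNIV::'n set). 2 * R)"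
 proof (rule sum_mono)
  fix l
  have "abs(x $ l - a $ l) <= R" "abs(y $ l - a $ l) <= R" using x y by (auto simp: cube_def)
  then show "abs((x - y) $ l) <= 2 * R" by simp
 qed
 also have "... = n * (2 * R)" by (simp add: n_def)
 finally have rhoR: "rho <= R" using n by (simp add: rho_def divide_le_eq mult_ac)
 define lo hi where "lo = (\<chi> l. min (tilt x rho $ l) (tilt y rho $ l) - rho)"
  and "hi = (\<chi> l. max (tilt x rho $ l) (tilt y rho $ l) + rho)"
 have box: "cbox lo hi \<subseteq> cube a R"
 proof
  fix z assume z: "z \<in> cbox lo hi"
  have "abs(z $ l - a $ l) <= R" for l
  proof -
   have "lo $ l <= z $ l" "z $ l <= hi $ l" using z by (auto simp: mem_box_cart)
   moreover have "abs(tilt x rho $ l - a $ l) <= R - rho" "abs(tilt y rho $ l - a $ l) <= R - rho"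
    using tilt_center x(1) y(1) rho0 rhoR by auto
   ultimately show ?thesis unfolding lo_def hi_def by (auto simp: abs_le_iff)
  qed
  then show "z \<in> cube a R" by (simp add: cube_def)
 qed
 have ball: "cbox lo hi \<subseteq> ball x (5 * n\<^sup>2 * rho)"
 proof
  fix z assume z: "z \<in> cbox lo hi"
  have zl: "abs((z - x) $ l) <= 4 * n * rho" for l
  proof -
   have "lo $ l <= z $ l" "z $ l <= hi $ l" using z by (auto simp: mem_box_cart)
   moreover have "abs(tilt x rho $ l - x $ l) <= rho" "abs(tilt y rho $ l - y $ l) <= rho"
    using tilt_dist x(1) y(1) rho0 by auto
   ultimately have "abs((z - x) $ l) <= 2 * n * rho + 2 * rho"
    using d[of l] unfolding lo_def hi_def by (auto simp: abs_le_iff)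
   also have "... <= 4 * n * rho" using n rho0 by simp
   finally show ?thesis .
  qed
  have "norm (z - x) <= (\<Sum>l\<in>UNIV. abs((z - x) $ l))" by (rule norm_le_l1_cart)
  also have "... <= (\<Sum>l\<in>(UNIV::'n set). 4 * n * rho)" by (rule sum_mono) (rule zl)
  also have "... = 4 * n\<^sup>2 * rho" by (simp add: n_def power2_eq_square)
  also have "... < 5 * n\<^sup>2 * rho" using n rho0 by simp
  finally show "z \<in> ball x (5 * n\<^sup>2 * rho)" by (simp add: dist_norm norm_minus_commute)
 qed
 have "abs(avg u (tilt y rho) rho - avg u (tilt x rho) rho) <=
   n * (bump_max / rho) ^ (CARD('n) - 1) * (LINT z:cbox lo hi|lm. h z)" unfolding n_def
  by (rule avg_step[OF wg rho0 order_refl order_refl box _ _ wh h]) (auto simp: lo_def hi_def)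
 also have "... <= n * (bump_max / rho) ^ (CARD('n) - 1) *
   (t * (unit_ball_vol n * (5 * n\<^sup>2) ^ CARD('n) * rho ^ CARD('n)))"
 proof (rule mult_left_mono)
  have "(LINT z:cbox lo hi|lm. h z) <= (LINT z:ball x (5 * n\<^sup>2 * rho)|lm. h z)"
   by (rule integral_ball_mono[OF h h_nonneg ball]) auto
  also have "... <= t * vol (ball x (5 * n\<^sup>2 * rho))" by (rule max_set_notin_D[OF x(3)]) (use rho0 n in auto)
  finally show "(LINT z:cbox lo hi|lm. h z) <= t * (unit_ball_vol n * (5 * n\<^sup>2) ^ CARD('n) * rho ^ CARD('n))"
   using rho0 n by (subst (asm) measure_ball_scale) (auto simp: n_def)
 qed (use rho0 n bump_max(1) in auto)
 also have "... = n * bump_max ^ (CARD('n) - 1) * (unit_ball_vol n * (5 * n\<^sup>2) ^ CARD('n)) * t * rho"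
 proof -
  have "rho ^ CARD('n) = rho * rho ^ (CARD('n) - 1)" by (metis nS power_Suc)
  then show ?thesis using rho0 by (simp add: power_divide)
 qed
 also have "... <= step_const CARD('n) * (unit_ball_vol n * (5 * n\<^sup>2) ^ CARD('n)) * t * rho"
  unfolding step_const_def n_def[symmetric] using bump_max(1) n rho0 t
  by (intro mult_right_mono mult_left_mono power_mono) (auto simp: n_def)
 finally have 1: "abs(avg u (tilt y rho) rho - avg u (tilt x rho) rho) <=
   step_const CARD('n) * (unit_ball_vol n * (5 * n\<^sup>2) ^ CARD('n)) * t * rho" .
 have "abs(u x - u y) <= lip_const CARD('n) * t * rho"
  using 1 chain_maximal[OF x rho0 rhoR] chain_maximal[OF y rho0 rhoR]
  unfolding lip_const_def n_def by (simp add: algebra_simps)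
 also have "... <= lip_const CARD('n) * t * norm (x - y)"
 proof (rule mult_left_mono)
  show "rho <= norm (x - y)" unfolding rho_def using n by (simp add: divide_le_eq mult_le_cancel_left1)
  show "0 <= lip_const CARD('n) * t" using t lip_const_pos[of "CARD('n)"] by simp
 qed
 finally show ?thesis .
qed simp

end

section \<open>Sublinear and logarithmic versions of the chain estimate\<close>

definition power_const :: "nat => real" where
 "power_const n = step_const n * (unit_ball_vol (real n) * (3 * real n) ^ n) powr (1 - 1 / (2 * real n))
   / (1 - 1 / sqrt 2)"

text \<open>From \<open>16\<close> on \<open>2 ^ j\<close> beats \<open>j ^ 4\<close>, so
  \<open>2 ^ j / j ^ 2\<close> is at least the square root of \<open>2 ^ j\<close>; the finitely
  many smaller indices only change the constant.\<close>

lemma log_growth: "\<exists>c>0. \<forall>j\<ge>1. c * real j <= ln (1 + 2 ^ j / (real j)\<^sup>2)"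
proof -
 define f where "f j = ln (1 + 2 ^ j / (real j)\<^sup>2) / real j" for j
 have pos: "0 < f j" if "1 <= j" for j using that unfolding f_def by (intro divide_pos_pos ln_gt_zero) auto
 have four: "j ^ 4 <= 2 ^ j" if "16 <= j" for j :: nat using that
 proof (induction j rule: nat_induct_at_least)
  case (Suc j)
  have "16 * j ^ 3 <= j * j ^ 3" using Suc by (intro mult_right_mono) auto
  moreover have "6 * j ^ 2 <= 6 * j ^ 3 \<and> 4 * j <= 4 * j ^ 3 \<and> 1 <= j ^ 3"
   using Suc by (auto simp: power2_eq_square power3_eq_cube)
  moreover have "Suc j ^ 4 = j * j ^ 3 + 4 * j ^ 3 + 6 * j ^ 2 + 4 * j + 1"
   by (simp add: power4_eq_xxxx power3_eq_cube power2_eq_square algebra_simps)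
  moreover have "j ^ 4 = j * j ^ 3" by (simp add: power4_eq_xxxx power3_eq_cube)
  ultimately have "Suc j ^ 4 <= 2 * j ^ 4" by linarith
  then show ?case using Suc by simp
 qed simp
 have big: "ln 2 / 2 <= f j" if "16 <= j" for j
 proof -
  have "(real j)\<^sup>2 <= sqrt (2 ^ j)"
  proof (rule real_le_rsqrt)
   have "real (j ^ 4) <= real (2 ^ j)" using four[OF that] of_nat_le_iff by blast
   then show "((real j)\<^sup>2)\<^sup>2 <= 2 ^ j" by (simp flip: power_mult)
  qed
  then have "sqrt (2 ^ j) * (real j)\<^sup>2 <= sqrt (2 ^ j) * sqrt (2 ^ j)" by (intro mult_left_mono) auto
  then have "sqrt (2 ^ j) <= 2 ^ j / (real j)\<^sup>2" using that by (simp add: le_divide_eq)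
  then have "ln (sqrt (2 ^ j)) <= ln (1 + 2 ^ j / (real j)\<^sup>2)" by (subst ln_le_cancel_iff) (auto intro!: add_pos_nonneg)
  then have "real j * ln 2 / 2 <= ln (1 + 2 ^ j / (real j)\<^sup>2)" by (simp add: ln_sqrt ln_realpow)
  then show ?thesis using that by (simp add: f_def field_simps)
 qed
 define c where "c = Min (insert (ln 2 / 2) (f ` {1..16}))"
 have "0 < c" unfolding c_def using pos by (subst Min_gr_iff) auto
 moreover have "c <= f j" if "1 <= j" for j
 proof (cases "16 <= j")
  case True
  have "c <= ln 2 / 2" unfolding c_def by (rule Min_le) auto
  then show ?thesis using big[OF True] by simp
 next
  case False
  then show ?thesis unfolding c_def using that by (intro Min_le) auto
 qed
 ultimately show ?thesis by (intro exI[of _ c]) (auto simp: f_def le_divide_eq)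
qed

definition log_const :: real where
 "log_const = (SOME c. c > 0 \<and> (\<forall>j\<ge>1. c * real j <= ln (1 + 2 ^ j / (real j)\<^sup>2)))"

lemma log_const: "0 < log_const" "1 <= j ==> log_const * real j <= ln (1 + 2 ^ j / (real j)\<^sup>2)"
 using someI_ex[OF log_growth] unfolding log_const_def by auto

definition osc_const :: "nat => real" where
 "osc_const n = step_const n * (2 ^ n + 1 / log_const ^ (2 * n)) * (\<Sum>k. 1 / (real (Suc k))\<^sup>2)"

context gradient_bound
begin

text \<open>Interpolation between the maximal bound, of order \<open>t * r ^ n\<close>, and the full
  integral \<open>H\<close>, with weights \<open>1 - 1 / (2 * n)\<close> and
  \<open>1 / (2 * n)\<close>. After division by \<open>r ^ (n - 1)\<close> the square root of
  \<open>r\<close> is left, which is summable along the chain, and the dependence on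
  \<open>t\<close> has become sublinear.\<close>

lemma chain_power:
 assumes x: "x \<in> cube a R" "lebesgue_point u x" "x ~: max_set h t" and t: "0 < t"
  and H: "(LINT y:cube a R|lm. h y) <= H"
 shows "abs(u x - avg u a R) <=
  power_const CARD('n) * sqrt R * H powr (1 / (2 * real CARD('n))) * t powr (1 - 1 / (2 * real CARD('n)))"
proof -
 define n where "n = real CARD('n)"
 have n: "1 <= n" unfolding n_def using zero_less_card_finite[where 'a='n] by simp
 have nS: "CARD('n) = Suc (CARD('n) - 1)" using zero_less_card_finite[where 'a='n] by simp
 define kap where "kap = 1 / (2 * n)"
 have kap: "0 < kap" "kap < 1" "n * kap = 1 / 2" using n by (auto simp: kap_def field_simps)
 define c where "c = unit_ball_vol n * (3 * n) ^ CARD('n)"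
 have c: "0 <= c" unfolding c_def using n by simp
 define A where "A = step_const CARD('n) * c powr (1 - kap) * H powr kap * t powr (1 - kap)"
 have g: "norm (1 / sqrt 2) < 1" by simp
 have s: "(%k. A * sqrt R * (1 / sqrt 2) ^ k) sums (A * sqrt R * (1 / (1 - 1 / sqrt 2)))"
  by (rule sums_mult[OF geometric_sums[OF g]])
 have "abs(u x - avg u (tilt x R) R) <= (\<Sum>k. A * sqrt R * (1 / sqrt 2) ^ k)"
 proof (rule chain[OF x(1,2) R order_refl sums_summable[OF s]])
  fix k
  define r where "r = R / 2 ^ k"
  have r: "0 < r" "r <= R" using R by (auto simp: r_def divide_le_eq)
  define X where "X = (LINT y:cube (tilt x r) r|lm. h y)"
  have X0: "0 <= X" unfolding X_def by (rule set_integral_nonneg') (rule h_nonneg)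
  have X1: "X <= t * (c * r ^ CARD('n))" using tilt_integral_le[OF x(1,3) r(1)] by (simp add: X_def c_def n_def)
  have X2: "X <= H"
   using integral_ball_mono[OF h h_nonneg tilt_cube_subset[OF x(1)], of r] r H by (auto simp: X_def)
  have "X <= (t * (c * r ^ CARD('n))) powr (1 - kap) * H powr kap"
  proof (cases "X = 0")
   case False
   then have "X = X powr (1 - kap) * X powr kap" using X0 by (simp flip: powr_add)
   also have "... <= (t * (c * r ^ CARD('n))) powr (1 - kap) * H powr kap"
    using X0 X1 X2 kap by (intro mult_mono powr_mono2) auto
   finally show ?thesis .
  qed simp
  also have "(t * (c * r ^ CARD('n))) powr (1 - kap) = t powr (1 - kap) * c powr (1 - kap) * (r ^ (CARD('n) - 1) * sqrt r)"
  proof -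
   have "(r ^ CARD('n)) powr (1 - kap) = (r powr n) powr (1 - kap)" using r by (simp add: n_def powr_realpow)
   also have "... = r powr (n * (1 - kap))" by (rule powr_powr)
   also have "n * (1 - kap) = (n - 1) + 1 / 2" using kap(3) by (simp add: right_diff_distrib)
   also have "r powr ((n - 1) + 1 / 2) = r powr (n - 1) * r powr (1 / 2)" by (rule powr_add)
   also have "... = r powr (real (CARD('n) - 1)) * sqrt r"
    using r n by (simp add: powr_half_sqrt n_def of_nat_diff)
   also have "... = r ^ (CARD('n) - 1) * sqrt r" using r by (simp only: powr_realpow)
   finally show ?thesis using t c r by (simp add: powr_mult mult.assoc)
  qed
  finally have "step_const CARD('n) / r ^ (CARD('n) - 1) * X <= step_const CARD('n) / r ^ (CARD('n) - 1) *
    (t powr (1 - kap) * c powr (1 - kap) * (r ^ (CARD('n) - 1) * sqrt r) * H powr kap)"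
   using r step_const_pos[of "CARD('n)"] by (intro mult_left_mono) auto
  also have "... = A * sqrt r" using r by (simp add: A_def)
  also have "sqrt r = sqrt R * (1 / sqrt 2) ^ k"
   by (simp add: r_def real_sqrt_divide real_sqrt_power power_divide)
  finally show "step_const CARD('n) / (R / 2 ^ k) ^ (CARD('n) - 1) *
    (LINT y:cube (tilt x (R / 2 ^ k)) (R / 2 ^ k)|lm. h y) <= A * sqrt R * (1 / sqrt 2) ^ k"
   by (simp add: r_def X_def mult.assoc)
 qed
 then show ?thesis using sums_unique[OF s] by (simp add: A_def power_const_def c_def kap_def n_def mult_ac)
qed

text \<open>At the \<open>j\<close>-th step \<open>h\<close> is split at the height
  \<open>beta = tau / (r * j ^ 2)\<close>. The part below contributes
  \<open>2 ^ n * tau / j ^ 2\<close>. Above, \<open>h\<close> is at most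
  \<open>theta / beta ^ (n - 1)\<close> divided by the logarithm to the power \<open>2 * n\<close>,
  which is at least of order \<open>j ^ (2 * n)\<close>; against the factor
  \<open>j ^ (2 * (n - 1))\<close> from \<open>beta\<close> this leaves \<open>j ^ 2\<close> again.
  The exponent of the logarithm in the density is chosen for this balance.\<close>

lemma chain_orlicz:
 assumes x: "x \<in> cube a R" "lebesgue_point u x"
  and int: "set_integrable lebesgue (cube a R) (%y. h y ^ CARD('n) * ln (1 + h y) ^ (2 * CARD('n)))"
 shows "abs(u x - avg u a R) <= osc_const CARD('n) *
  root CARD('n) (LINT y:cube a R|lm. 1 + h y ^ CARD('n) * ln (1 + h y) ^ (2 * CARD('n)))"
proof -
 define n where "n = CARD('n)"
 have n: "0 < n" unfolding n_def using zero_less_card_finite[where 'a='n] by simp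
 define theta where "theta y = h y ^ n * ln (1 + h y) ^ (2 * n)" for y
 define T where "T = (LINT y:cube a R|lm. 1 + theta y)"
 define tau where "tau = root n T"
 have theta0: "0 <= theta y" for y unfolding theta_def using h_nonneg by auto
 have i1: "L1 (%y. ind S y * (c::real))" if "S \<in> lmeasurable" for c and S :: "(real^'n) set"
  using that by (intro integrable_mult_left) (simp add: lmeasurable_iff_integrable)
 have itheta: "L1 (%y. ind (cube a R) y * theta y)" using int by (simp add: set_integrable_def theta_def n_def)
 have T: "T = (2 * R) ^ n + (LINT y:cube a R|lm. theta y)" unfolding T_def slint_def
  using i1[of "cube a R" 1] itheta R by (simp add: distrib_left measure_cube n_def)
 have th0: "0 <= (LINT y:cube a R|lm. theta y)" by (rule set_integral_nonneg') (rule theta0)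
 \<comment> \<open>The summand \<open>1\<close> in the density gives the lower bound, which keeps
   \<open>beta\<close> above \<open>2 ^ j / j ^ 2\<close> and hence \<open>ln (1 + beta)\<close>
   above a multiple of \<open>j\<close>.\<close>
 have tau: "2 * R <= tau" "tau ^ n = T"
 proof -
  have "root n ((2 * R) ^ n) <= tau" unfolding tau_def using T th0 n by (intro real_root_le_mono) auto
  moreover have "root n ((2 * R) ^ n) = 2 * R" using n R by (intro real_root_power_cancel) auto
  ultimately show "2 * R <= tau" by simp
  have "0 <= T" using T th0 R by simp
  then show "tau ^ n = T" unfolding tau_def using n by simp
 qed
 have tau0: "0 < tau" using tau R by simp
 define S where "S = step_const n * (2 ^ n + 1 / log_const ^ (2 * n)) * tau"
 have sm: "summable (%k. 1 / (real (Suc k))\<^sup>2)"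
  using inverse_power_summable[of 2, where 'a=real] by (subst summable_Suc_iff) (simp add: inverse_eq_divide power_one_over)
 have "abs(u x - avg u (tilt x R) R) <= (\<Sum>k. S * (1 / (real (Suc k))\<^sup>2))"
 proof (rule chain[OF x R order_refl summable_mult[OF sm]])
  fix k
  define j where "j = Suc k"
  define r where "r = R / 2 ^ k"
  have r: "0 < r" "r <= R" using R by (auto simp: r_def divide_le_eq)
  define beta where "beta = tau / (r * (real j)\<^sup>2)"
  have j: "1 <= j" by (simp add: j_def)
  have beta0: "0 < beta" using tau0 r j by (simp add: beta_def)
  have "2 ^ j / (real j)\<^sup>2 <= beta"
  proof -
   have "2 ^ j = 2 * R / r" using R by (simp add: j_def r_def)
   also have "... <= tau / r" using tau r by (intro divide_right_mono) auto
   finally have "2 ^ j / (real j)\<^sup>2 <= tau / r / (real j)\<^sup>2" by (intro divide_right_mono) auto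
   then show ?thesis by (simp add: beta_def)
  qed
  then have "ln (1 + 2 ^ j / (real j)\<^sup>2) <= ln (1 + beta)"
   by (subst ln_le_cancel_iff) (auto intro: add_pos_nonneg simp: beta0 less_imp_le add_pos_pos)
  then have L: "log_const * real j <= ln (1 + beta)" using log_const(2)[OF j] by linarith
  define D where "D = beta ^ (n - 1) * (log_const * real j) ^ (2 * n)"
  have D0: "0 < D" using beta0 log_const(1) j by (simp add: D_def)
  have pt: "h y <= beta + theta y / D" for y
  proof (cases "h y <= beta")
   case True
   then show ?thesis using theta0[of y] D0 by (simp add: add_increasing2)
  next
   case False
   have "ln (1 + beta) <= ln (1 + h y)" using False beta0 by simp
   then have "log_const * real j <= ln (1 + h y)" using L by linarith
   then have "beta ^ (n - 1) * (log_const * real j) ^ (2 * n) <= h y ^ (n - 1) * ln (1 + h y) ^ (2 * n)"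
    using False beta0 log_const(1) by (intro mult_mono power_mono) auto
   then have "h y * D <= h y * (h y ^ (n - 1) * ln (1 + h y) ^ (2 * n))"
    unfolding D_def using h_nonneg by (intro mult_left_mono)
   also have "... = theta y" using n by (cases n) (auto simp: theta_def)
   finally have "h y <= theta y / D" using D0 by (simp add: le_divide_eq)
   then show ?thesis using beta0 by simp
  qed
  have sub: "cube (tilt x r) r \<subseteq> cube a R" using tilt_cube_subset[OF x(1)] r by simp
  have "(LINT y:cube (tilt x r) r|lm. h y) <=
    (LI y. ind (cube (tilt x r) r) y * beta + ind (cube a R) y * theta y / D)" unfolding slint_def
  proof (rule integral_mono)
   show "L1 (%y. ind (cube (tilt x r) r) y *\<^sub>R h y)" using integrable_restrict[OF h] by simp
   show "L1 (%y. ind (cube (tilt x r) r) y * beta + ind (cube a R) y * theta y / D)"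
    using i1[of "cube (tilt x r) r" beta] itheta by simp
   show "ind (cube (tilt x r) r) y *\<^sub>R h y <= ind (cube (tilt x r) r) y * beta + ind (cube a R) y * theta y / D" for y
    using pt[of y] sub theta0[of y] D0 by (auto simp: indicator_def)
  qed
  also have "... = (2 * r) ^ n * beta + (LINT y:cube a R|lm. theta y) / D"
   using i1[of "cube (tilt x r) r" beta] itheta r by (subst lint_add) (auto simp: slint_def measure_cube n_def)
  also have "... <= (2 * r) ^ n * beta + T / D" using T D0 R by (intro add_left_mono divide_right_mono) auto
  finally have X: "(LINT y:cube (tilt x r) r|lm. h y) <= (2 * r) ^ n * beta + T / D" .
  have rb: "r * beta = tau / (real j)\<^sup>2" using r by (simp add: beta_def)
  have "step_const n / r ^ (n - 1) * (LINT y:cube (tilt x r) r|lm. h y) <=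
   step_const n / r ^ (n - 1) * ((2 * r) ^ n * beta + T / D)"
   using X r step_const_pos[OF n] by (intro mult_left_mono) auto
  also have "... = step_const n * (2 ^ n * (r * beta) + tau ^ n / ((r * beta) ^ (n - 1) * (log_const * real j) ^ (2 * n)))"
  proof -
   have "(2 * r) ^ n = 2 ^ n * (r * r ^ (n - 1))" using n by (cases n) (auto simp: power_mult_distrib)
   then show ?thesis using r by (simp add: D_def tau(2) power_mult_distrib field_simps)
  qed
  also have "tau ^ n / ((r * beta) ^ (n - 1) * (log_const * real j) ^ (2 * n)) = tau / (log_const ^ (2 * n) * (real j)\<^sup>2)"
  proof -
   have a: "tau ^ n = tau * tau ^ (n - 1)" using n by (cases n) auto
   have b: "real j ^ (2 * n) = ((real j)\<^sup>2) ^ (n - 1) * (real j)\<^sup>2" using n by (cases n) (auto simp: power_mult power2_eq_square)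
   show ?thesis unfolding rb a power_divide power_mult_distrib[of log_const] b
    using tau0 j log_const(1) by (simp add: field_simps)
  qed
  also have "step_const n * (2 ^ n * (r * beta) + tau / (log_const ^ (2 * n) * (real j)\<^sup>2)) = S * (1 / (real j)\<^sup>2)"
   unfolding rb S_def using log_const(1) j by (simp add: field_simps)
  finally show "step_const CARD('n) / (R / 2 ^ k) ^ (CARD('n) - 1) *
    (LINT y:cube (tilt x (R / 2 ^ k)) (R / 2 ^ k)|lm. h y) <= S * (1 / (real (Suc k))\<^sup>2)"
   by (simp add: n_def r_def j_def)
 qed
 also have "... = S * (\<Sum>k. 1 / (real (Suc k))\<^sup>2)" by (rule suminf_mult[OF sm])
 finally show ?thesis by (simp add: S_def tau_def T_def theta_def osc_const_def n_def mult_ac)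
qed

end

section \<open>Closed forms\<close>

text \<open>The type \<open>'n option\<close> serves as an index type with \<open>n + 1\<close>
  elements. Extending a permutation by the fixed point \<open>None\<close> turns transpositions into
  transpositions, so the sign is kept.\<close>

lemma sign_map_option:
 fixes q :: "'a::finite => 'a"
 assumes "q permutes UNIV"
 shows "map_option q permutes UNIV \<and> sign (map_option q) = sign q"
 using assms finite
proof (induction rule: permutes_induct)
 case id
 show ?case unfolding option.map_id0 by (intro conjI permutes_id) (simp only: sign_id)
next
 case (swap a b p)
 have *: "map_option (Transposition.transpose a b \<circ> p) = Transposition.transpose (Some a) (Some b) \<circ> map_option p"
 proof
  fix x show "map_option (Transposition.transpose a b \<circ> p) x = (Transposition.transpose (Some a) (Some b) \<circ> map_option p) x"
   by (cases x) (auto simp: Transposition.transpose_def)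
 qed
 have p: "permutation p" "permutation (map_option p)" using swap permutation_permutes finite by blast+
 have t: "Transposition.transpose (Some a) (Some b) permutes UNIV" by (rule permutes_swap_id) auto
 have IH: "map_option p permutes UNIV" "sign (map_option p) = sign p" using swap by auto
 have "sign (Transposition.transpose (Some a) (Some b) \<circ> map_option p) = - sign p"
  using sign_compose[OF permutation_swap_id p(2), of "Some a" "Some b"] IH swap(3) by (simp add: sign_swap_id)
 moreover have "sign (Transposition.transpose a b \<circ> p) = - sign p"
  using sign_compose[OF permutation_swap_id p(1), of a b] swap(3) by (simp add: sign_swap_id)
 ultimately show ?case unfolding * using permutes_compose[OF IH(1) t] by (intro conjI) (simp only:)+
qed

text \<open>Expansion along a unit row: only the permutations that fix \<open>None\<close>
  contribute.\<close>

lemma det_option_minor: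
 fixes A :: "real ^ 'n::finite option ^ 'n option"
 assumes "A $ None = axis None 1"
 shows "det A = det (\<chi> k l. A $ Some k $ Some l)"
proof -
 define f where "f p = of_int (sign p) * (\<Prod>i\<in>UNIV. A $ i $ p i)" for p
 have z: "f p = 0" if "p None ~= None" for p
 proof -
  have "A $ None $ p None = 0" using that assms by (simp add: axis_def)
  then have "(\<Prod>i\<in>UNIV. A $ i $ p i) = 0" by (intro prod_zero) auto
  then show ?thesis by (simp add: f_def)
 qed
 have img: "{p. p permutes UNIV \<and> p None = None} = map_option ` {q. q permutes (UNIV :: 'n set)}"
 proof (intro equalityI subsetI)
  fix p :: "'n option => 'n option" assume "p \<in> {p. p permutes UNIV \<and> p None = None}"
  then have p: "bij p" "p None = None" by (auto simp: permutes_bij)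
  define q where "q x = the (p (Some x))" for x
  have pS: "p (Some x) = Some (q x)" for x
  proof -
   have "p (Some x) ~= p None" using p(1) by (metis bij_pointE option.distinct(1))
   then show ?thesis using p(2) by (auto simp: q_def)
  qed
  have "inj q" using p(1) pS by (metis (no_types, lifting) bij_is_inj injD injI option.inject)
  then have "bij q" by (simp add: bij_def finite_UNIV_inj_surj)
  moreover have "p = map_option q"
  proof
   fix x show "p x = map_option q x" using p pS by (cases x) auto
  qed
  ultimately show "p \<in> map_option ` {q. q permutes UNIV}" by (auto intro!: image_eqI bij_imp_permutes simp: bij_betw_def)
 next
  fix p assume "p \<in> map_option ` {q. q permutes (UNIV :: 'n set)}"
  then show "p \<in> {p. p permutes UNIV \<and> p None = None}" using sign_map_option by auto
 qed
 have inj: "inj_on map_option {q. q permutes (UNIV :: 'n set)}"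
  by (metis inj_onI option.inj_map_strong option.map_comp ext option.inject option.map(2))
 have "det A = (\<Sum>p\<in>{p. p permutes UNIV}. f p)" by (simp add: det_def f_def)
 also have "... = (\<Sum>p\<in>{p. p permutes UNIV \<and> p None = None}. f p)"
  by (rule sum.mono_neutral_right) (auto simp: z finite_permutations)
 also have "... = (\<Sum>q\<in>{q. q permutes (UNIV :: 'n set)}. f (map_option q))"
  unfolding img by (subst sum.reindex[OF inj]) simp
 also have "... = (\<Sum>q\<in>{q. q permutes (UNIV :: 'n set)}. of_int (sign q) * (\<Prod>i\<in>UNIV. A $ Some i $ Some (q i)))"
 proof (rule sum.cong[OF refl])
  fix q assume "q \<in> {q. q permutes (UNIV :: 'n set)}"
  then have "sign (map_option q) = sign q" using sign_map_option by blast
  moreover have "(\<Prod>i\<in>UNIV. A $ i $ map_option q i) = (\<Prod>i\<in>UNIV. A $ Some i $ Some (q i))"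
   unfolding UNIV_option_conv using assms by (subst prod.insert) (auto simp: axis_def prod.reindex)
  ultimately show "f (map_option q) = of_int (sign q) * (\<Prod>i\<in>UNIV. A $ Some i $ Some (q i))" by (simp add: f_def)
 qed
 finally show ?thesis by (simp add: det_def)
qed

text \<open>The determinant of this matrix is the value of dx_i wedge dx_I on the
  \<open>n + 1\<close> vectors \<open>v\<close> and \<open>p\<close>; \<open>None\<close> labels the
  extra row and the extra column.\<close>

definition bordered :: "nat => ('n::finite => nat) => (nat => real) => ('n => nat => real) => real ^ 'n option ^ 'n option" where
 "bordered i I v p = (\<chi> a b. case_option v p b (case_option i I a))"

lemma det_bordered:
 fixes I :: "'n::{finite,linorder} => nat"
 shows "det (bordered i I v p) = v i * dx I p - (\<Sum>j\<in>UNIV. p j i * dx I (p(j := v)))"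
proof -
 define A where "A = bordered i I v p"
 define B where "B b = (\<chi> a. if a = None then axis b 1 else A $ a)" for b
 \<comment> \<open>Exchanging the columns \<open>None\<close> and \<open>Some j\<close> puts
   \<open>v\<close> into the \<open>j\<close>-th slot and brings the unit row into the form that
   \<open>det_option_minor\<close> requires; the exchange is the source of the minus sign.\<close>
 have Bj: "det (B (Some j)) = - dx I (p(j := v))" for j
 proof -
  define tau where "tau = Transposition.transpose None (Some j)"
  have "det (\<chi> a b. B (Some j) $ a $ tau b) = of_int (sign tau) * det (B (Some j))"
   by (rule det_permute_columns) (simp add: tau_def permutes_swap_id)
  moreover have "sign tau = -1" by (simp add: tau_def sign_swap_id)
  moreover have "det (\<chi> a b. B (Some j) $ a $ tau b) = dx I (p(j := v))"
  proof (subst det_option_minor)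
   show "(\<chi> a b. B (Some j) $ a $ tau b) $ None = axis None 1"
    by (auto simp: vec_eq_iff B_def axis_def tau_def Transposition.transpose_def)
   have "(\<chi> a b. B (Some j) $ a $ tau b) $ Some k $ Some l = (p(j := v)) l (I k)" for k l
    by (auto simp: B_def A_def bordered_def tau_def Transposition.transpose_def)
   then show "det (\<chi> k l. (\<chi> a b. B (Some j) $ a $ tau b) $ Some k $ Some l) = dx I (p(j := v))"
    by (simp add: dx_def)
  qed
  ultimately show ?thesis by simp
 qed
 have "A = (\<chi> a. if a = None then (\<Sum>b\<in>UNIV. (A $ None $ b) *s axis b 1) else A $ a)"
  by (subst basis_expansion) (simp add: vec_eq_iff)
 then have "det A = (\<Sum>b\<in>UNIV. det (\<chi> a. if a = None then (A $ None $ b) *s axis b 1 else A $ a))"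
  using det_linear_row_sum[of UNIV "None::'n option" "%a b. (A $ None $ b) *s axis b 1" "%a. A $ a"] by simp
 also have "... = (\<Sum>b\<in>UNIV. A $ None $ b * det (B b))" unfolding B_def by (intro sum.cong refl det_row_mul)
 also have "... = A $ None $ None * det (B None) + (\<Sum>j\<in>UNIV. A $ None $ Some j * det (B (Some j)))"
  unfolding UNIV_option_conv by (subst sum.insert) (auto simp: sum.reindex)
 also have "det (B None) = dx I p" by (subst det_option_minor) (auto simp: B_def A_def bordered_def dx_def)
 finally show ?thesis by (simp add: Bj A_def bordered_def sum_negf)
qed

lemma det_bordered_eq_0:
 assumes "i \<in> range I" shows "det (bordered i I v p) = 0"
proof -
 obtain k where "i = I k" using assms by auto
 then show ?thesis by (intro det_identical_rows[of None "Some k"]) (auto simp: row_def bordered_def)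
qed

lemma det_bordered_swap: "det (bordered (I k) (I(k := i)) v p) = - det (bordered i I v p)"
proof -
 define tau where "tau = Transposition.transpose None (Some k)"
 have "bordered (I k) (I(k := i)) v p = (\<chi> a. bordered i I v p $ tau a)"
  by (auto simp: vec_eq_iff bordered_def tau_def Transposition.transpose_def split: option.split)
 moreover have "det (\<chi> a. bordered i I v p $ tau a) = of_int (sign tau) * det (bordered i I v p)"
  by (rule det_permute_rows) (simp add: tau_def permutes_swap_id)
 moreover have "sign tau = -1" by (simp add: tau_def sign_swap_id)
 ultimately show ?thesis by simp
qed

lemma rank_less_card: "card {i. i < (k::'n::{finite,linorder})} < CARD('n)"
 by (rule psubset_card_mono) auto

lemma rank_strict_mono: "strict_mono (%k::'n::{finite,linorder}. card {i. i < k})"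
 by (intro strict_monoI psubset_card_mono) auto

text \<open>Ranks in the linear order number the elements of \<open>'n\<close>; this connects
  functions on \<open>'n\<close> with the faces of a multi-index, which are numbered.\<close>

lemma rank_bij: "bij_betw (%k::'n::{finite,linorder}. card {i. i < k}) UNIV {..<CARD('n)}"
proof -
 have inj: "inj (%k::'n. card {i. i < k})" by (rule strict_mono_imp_inj_on[OF rank_strict_mono])
 have "(%k::'n. card {i. i < k}) ` UNIV = {..<CARD('n)}"
  by (rule card_subset_eq) (use rank_less_card inj in "auto simp: card_image")
 then show ?thesis using inj by (simp add: bij_betw_def)
qed

lemma strict_mono_range_unique:
 fixes I I' :: "'n::{finite,linorder} => nat"
 assumes I: "strict_mono I" "strict_mono I'" and r: "range I = range I'"
 shows "I = I'"
proof
 fix k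
 have c: "card {i. i < k} = card {y \<in> range I. y < I k}" if "strict_mono I" for I :: "'n => nat" and k
 proof -
  have "{y \<in> range I. y < I k} = I ` {i. i < k}" using that by (auto simp: strict_mono_less)
  then show ?thesis using strict_mono_imp_inj_on[OF that] by (simp add: card_image inj_on_subset)
 qed
 obtain k' where k': "I k = I' k'" using r by (metis rangeE rangeI)
 have "card {i. i < k} = card {i. i < k'}" using c[OF I(1), of k] c[OF I(2), of k'] r k' by simp
 then have "k = k'" using strict_mono_eq[OF rank_strict_mono] by blast
 then show "I k = I' k" using k' by simp
qed

lemma face_range:
 assumes "l <= CARD('n)"
 shows "range (face J l :: 'n::{finite,linorder} => nat) = J ` ({..CARD('n)} - {l})"
proof -
 define s where "s r = (if r < l then r else Suc r)" for r
 have "range (face J l :: 'n => nat) = J ` s ` (%k::'n. card {i. i < k}) ` UNIV"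
  by (auto simp: face_def s_def Let_def image_image)
 also have "(%k::'n. card {i. i < k}) ` UNIV = {..<CARD('n)}" using rank_bij[where 'n='n] by (simp add: bij_betw_def)
 also have "s ` {..<CARD('n)} = {..CARD('n)} - {l}"
 proof (intro equalityI subsetI)
  fix x assume x: "x \<in> {..CARD('n)} - {l}"
  show "x \<in> s ` {..<CARD('n)}"
   by (rule image_eqI[of _ _ "if x < l then x else x - 1"]) (use x assms in "auto simp: s_def")
 qed (use assms in "auto simp: s_def")
 finally show ?thesis .
qed

lemma face_strict_mono:
 assumes "strict_mono_on {..CARD('n)} J" "l <= CARD('n)"
 shows "strict_mono (face J l :: 'n::{finite,linorder} => nat)"
proof (rule strict_monoI)
 fix k k' :: 'n assume "k < k'"
 then have "card {i. i < k} < card {i. i < k'}" by (rule strict_monoD[OF rank_strict_mono])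
 then show "face J l k < face J l k'" unfolding face_def Let_def using rank_less_card[of k'] assms(2)
  by (intro strict_mono_onD[OF assms(1)]) auto
qed

text \<open>Passing from \<open>l\<close> to \<open>l + 1\<close> exchanges the omitted index with
  the entry of rank \<open>l\<close>, and each exchange changes the sign. These are the signs in the
  exterior derivative.\<close>

lemma det_bordered_face:
 fixes p :: "'n::{finite,linorder} => nat => real"
 assumes "l <= CARD('n)"
 shows "det (bordered (J l) (face J l) v p) = (-1) ^ l * det (bordered (J 0) (face J 0) v p)"
 using assms
proof (induction l)
 case (Suc l)
 then have "l \<in> {..<CARD('n)}" by auto
 then obtain k :: 'n where k: "card {i. i < k} = l" using bij_betw_imp_surj_on[OF rank_bij[where 'n='n]] by (metis (mono_tags, lifting) imageE)
 have eq: "card {i. i < k'} = l \<longleftrightarrow> k' = k" for k' :: 'n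
  using strict_mono_eq[OF rank_strict_mono, of k' k] k by auto
 have "face J (Suc l) = (face J l)(k := J l)" "face J l k = J (Suc l)"
  using eq by (auto simp: face_def Let_def fun_eq_iff k less_Suc_eq)
 then have "det (bordered (J (Suc l)) (face J (Suc l)) v p) = - det (bordered (J l) (face J l) v p)"
  using det_bordered_swap[of "face J l" k "J l" v p] by simp
 then show ?case using Suc by simp
qed simp

text \<open>The sum is the exterior derivative evaluated on \<open>v\<close> and \<open>p\<close>,
  before any cancellation. Terms with \<open>i\<close> in the range of \<open>I\<close> vanish
  because of equal rows. The other pairs \<open>(I, i)\<close> correspond to sets of
  \<open>n + 1\<close> indices with one element marked, and the terms belonging to one set combine
  to a determinant times one coefficient of the exterior derivative.\<close>

lemma closed_form_identity:
 fixes alp :: "('n::{finite,linorder} => nat) => nat => real"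
 assumes closed: "!!J. strict_mono_on {..CARD('n)} J ==> J ` {..CARD('n)} \<subseteq> {..<m} ==>
   (\<Sum>l\<le>CARD('n). (-1) ^ l * alp (face J l) (J l)) = 0"
 shows "(\<Sum>I\<in>multi_indices m. \<Sum>i<m. alp I i * (v i * dx I p - (\<Sum>j\<in>UNIV. p j i * dx I (p(j := v))))) = 0"
proof -
 define n where "n = CARD('n)"
 define g where "g = (%(I, i). alp I i * det (bordered i I v p))"
 define P where "P = {(I, i). I \<in> multi_indices m \<and> i < m \<and> i ~: range (I :: 'n => nat)}"
 define \<S> where "\<S> = {S. S \<subseteq> {..<m} \<and> card S = Suc n}"
 define J where "J S k = sorted_list_of_set S ! k" for S :: "nat set" and k
 have fin: "finite (multi_indices m :: ('n => nat) set)"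
 proof (rule finite_subset)
  show "multi_indices m \<subseteq> PiE (UNIV :: 'n set) (%_. {..<m})" by (auto simp: multi_indices_def)
 qed (auto intro: finite_PiE)
 have fS: "finite S" if "S \<in> \<S>" for S using that by (auto simp: \<S>_def intro: finite_subset)
 have Jm: "strict_mono_on {..n} (J S)" if "S \<in> \<S>" for S
 proof (rule strict_mono_onI)
  fix r s assume "r \<in> {..n}" "s \<in> {..n}" "r < s"
  then show "J S r < J S s"
   unfolding J_def using that sorted_wrt_nth_less[OF strict_sorted_list_of_set[of S], of r s]
   by (simp add: \<S>_def)
 qed
 have Ji: "J S ` {..n} = S" if "S \<in> \<S>" for S
 proof -
  have "J S ` {..n} = set (sorted_list_of_set S)"
   unfolding J_def set_conv_nth using that by (auto simp: \<S>_def image_def less_Suc_eq_le)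
  then show ?thesis using fS[OF that] by simp
 qed
 have Jin: "inj_on (J S) {..n}" if "S \<in> \<S>" for S by (rule strict_mono_on_imp_inj_on[OF Jm[OF that]])
 have fr: "range (face (J S) l :: 'n => nat) = S - {J S l}" if "S \<in> \<S>" "l <= n" for S l
 proof -
  have "J S ` ({..n} - {l}) = J S ` {..n} - {J S l}"
   using Jin[OF that(1)] that(2) by (subst inj_on_image_set_diff) auto
  then show ?thesis using face_range[of l "J S", where 'n='n] that Ji by (simp add: n_def)
 qed
 have bij: "bij_betw (%(S, l). (face (J S) l :: 'n => nat, J S l)) (\<S> \<times> {..n}) P" unfolding bij_betw_def
 proof
  show "inj_on (%(S, l). (face (J S) l :: 'n => nat, J S l)) (\<S> \<times> {..n})"
  proof (rule inj_onI)
   fix z z'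
   assume zz: "z \<in> \<S> \<times> {..n}" "z' \<in> \<S> \<times> {..n}"
    "(%(S, l). (face (J S) l :: 'n => nat, J S l)) z = (%(S, l). (face (J S) l, J S l)) z'"
   obtain S l S' l' where z: "z = (S, l)" "z' = (S', l')" by fastforce
   have S: "S \<in> \<S>" "S' \<in> \<S>" "l \<in> {..n}" "l' \<in> {..n}"
    and eq: "(face (J S) l :: 'n => nat) = face (J S') l'" "J S l = J S' l'" using zz z by auto
   have "J S l \<in> S" "J S' l' \<in> S'" using S Ji by auto
   moreover have "S - {J S l} = S' - {J S' l'}" using fr[of S l] fr[of S' l'] S eq by simp
   ultimately have SS: "S = S'" using eq(2) by (metis insert_Diff)
   then have "l = l'" using inj_onD[OF Jin[OF S(1)], of l l'] eq(2) S by simp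
   then show "z = z'" using SS z by simp
  qed
  show "(%(S, l). (face (J S) l :: 'n => nat, J S l)) ` (\<S> \<times> {..n}) = P"
  proof (intro equalityI subsetI)
   fix z assume "z \<in> (%(S, l). (face (J S) l :: 'n => nat, J S l)) ` (\<S> \<times> {..n})"
   then obtain S l where S: "S \<in> \<S>" "l <= n" "z = (face (J S) l, J S l)" by auto
   have "S \<subseteq> {..<m}" using S by (simp add: \<S>_def)
   moreover have "J S l \<in> S" using S Ji by auto
   ultimately show "z \<in> P" using S fr[OF S(1,2)] face_strict_mono[of "J S" l, where 'n='n] Jm[OF S(1)]
    by (auto simp: P_def multi_indices_def n_def)
  next
   fix z assume "z \<in> P"
   then obtain I :: "'n => nat" and i where z: "z = (I, i)" "strict_mono I" "range I \<subseteq> {..<m}" "i < m" "i ~: range I"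
    by (auto simp: P_def multi_indices_def)
   define S where "S = insert i (range I)"
   have S: "S \<in> \<S>" using z strict_mono_imp_inj_on[OF z(2)] by (auto simp: \<S>_def S_def card_image n_def)
   obtain l where l: "l <= n" "J S l = i" 
   proof -
    have "i \<in> J S ` {..n}" using Ji[OF S] by (simp add: S_def)
    then show ?thesis using that by auto
   qed
   have "range (face (J S) l :: 'n => nat) = range I" using fr[OF S l(1)] l(2) z(5) by (auto simp: S_def)
   then have "face (J S) l = I" using face_strict_mono[of "J S" l, where 'n='n] Jm[OF S] l z(2)
    by (intro strict_mono_range_unique) (auto simp: n_def)
   then show "z \<in> (%(S, l). (face (J S) l :: 'n => nat, J S l)) ` (\<S> \<times> {..n})"
    using S l z by (intro image_eqI[of _ _ "(S, l)"]) auto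
  qed
 qed
 have "(\<Sum>I\<in>multi_indices m. \<Sum>i<m. alp I i * (v i * dx I p - (\<Sum>j\<in>UNIV. p j i * dx I (p(j := v))))) =
   (\<Sum>z\<in>multi_indices m \<times> {..<m}. g z)"
  by (subst sum.cartesian_product) (simp add: g_def det_bordered case_prod_unfold)
 also have "... = (\<Sum>z\<in>P. g z)"
  by (rule sum.mono_neutral_right) (use fin in "auto simp: P_def g_def det_bordered_eq_0")
 also have "... = (\<Sum>(S, l)\<in>\<S> \<times> {..n}. g (face (J S) l, J S l))"
  unfolding sum.reindex_bij_betw[OF bij, of g, symmetric] by (rule sum.cong) auto
 also have "... = (\<Sum>S\<in>\<S>. \<Sum>l\<le>n. g (face (J S) l, J S l))" by (rule sum.cartesian_product[symmetric])
 also have "... = (\<Sum>S\<in>\<S>. 0)"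
 proof (rule sum.cong[OF refl])
  fix S assume S: "S \<in> \<S>"
  have "(\<Sum>l\<le>n. g (face (J S) l, J S l)) =
    det (bordered (J S 0) (face (J S) 0) v p) * (\<Sum>l\<le>n. (-1) ^ l * alp (face (J S) l) (J S l))"
   unfolding sum_distrib_left
  proof (rule sum.cong[OF refl])
   fix l assume "l \<in> {..n}"
   then have "det (bordered (J S l) (face (J S) l) v p) = (-1) ^ l * det (bordered (J S 0) (face (J S) 0) v p)"
    by (intro det_bordered_face) (simp add: n_def)
   then show "g (face (J S) l, J S l) = det (bordered (J S 0) (face (J S) 0) v p) * ((-1) ^ l * alp (face (J S) l) (J S l))"
    by (simp only: g_def split mult_ac)
  qed
  also have "(\<Sum>l\<le>n. (-1) ^ l * alp (face (J S) l) (J S l)) = 0"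
   using closed[of "J S"] Jm[OF S] Ji[OF S] S by (simp add: n_def \<S>_def)
  finally show "(\<Sum>l\<le>n. g (face (J S) l, J S l)) = 0" by simp
 qed
 finally show ?thesis by simp
qed

section \<open>The homotopy formula\<close>

lemma Rm_iff: "x \<in> Rm m \<longleftrightarrow> (\<forall>i\<ge>m. x i = 0)"
 by (simp add: topspace_Euclidean_space)

text \<open>The topology of \<open>Euclidean_space m\<close> is induced from the product topology,
  so componentwise limits suffice.\<close>

lemma tendsto_Rm_comp:
 assumes u: "continuous_map (Euclidean_space m) euclideanreal u"
  and G: "!!i. ((%y. G y i) ---> x i) F" "!!y. G y \<in> Rm m" and x: "x \<in> Rm m"
 shows "((%y. u (G y)) ---> u x) F"
proof -
 have "limitin (Euclidean_space m) G x F"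
  unfolding Euclidean_space_def limitin_subtopology limitin_componentwise using G x by (auto simp: Rm_iff)
 from continuous_map_limit[OF u this] show ?thesis by (simp add: o_def)
qed

lemma continuous_on_Rm_comp:
 assumes u: "continuous_map (Euclidean_space m) euclideanreal u"
  and G: "!!i. continuous_on S (%y. G y i)" "!!y. G y \<in> Rm m"
 shows "continuous_on S (%y. u (G y))"
 unfolding continuous_on_def
proof
 fix x assume "x \<in> S"
 then show "((%y. u (G y)) ---> u (G x)) (at x within S)"
  using G by (intro tendsto_Rm_comp[OF u]) (auto simp: continuous_on_def)
qed

lemma MVT_between:
 fixes f :: "real => real"
 assumes "!!x. (f hrd f' x) (at x)"
 shows "\<exists>xi. min a b <= xi \<and> xi <= max a b \<and> f b - f a = f' xi * (b - a)"
proof (cases a b rule: linorder_cases)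
 case less
 then obtain z where "a < z" "z < b" "f b - f a = (b - a) * f' z" using MVT2[of a b f f'] assms by auto
 then show ?thesis by (intro exI[of _ z]) (auto simp: mult.commute)
next
 case greater
 then obtain z where "b < z" "z < a" "f a - f b = (a - b) * f' z" using MVT2[of b a f f'] assms by auto
 then show ?thesis by (intro exI[of _ z]) (auto simp: algebra_simps)
qed auto

lemma Rm_upd: "x \<in> Rm m ==> i < m ==> x(i := t) \<in> Rm m"
 by (auto simp: Rm_iff)

lemma partial_DERIV:
 assumes "Ck_Rm m (Suc k) u" "i < m" "x \<in> Rm m"
 shows "((%t. u (x(i := t))) hrd partial i u (x(i := s))) (at s)"
proof -
 have "(%t. u ((x(i := s))(i := t))) field_differentiable at ((x(i := s)) i)"
  using assms Rm_upd[OF assms(3,2)] unfolding Ck_Rm.simps by blast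
 then have "((%t. u ((x(i := s))(i := t))) hrd partial i u (x(i := s))) (at ((x(i := s)) i))"
  unfolding partial_def DERIV_deriv_iff_field_differentiable by simp
 then show ?thesis by simp
qed

text \<open>The chain rule from continuous partial derivatives: pass from \<open>gam t\<close> to
  \<open>gam s\<close> one coordinate at a time, apply the mean value theorem to each change, and
  let the intermediate points tend to \<open>gam t\<close>.\<close>

lemma Ck_Rm_chain:
 assumes u: "Ck_Rm m (Suc 0) u" and gam: "!!s. gam s \<in> Rm m"
  and D: "!!i. i < m ==> ((%s. gam s i) hrd gam' i) (at t)"
 shows "((%s. u (gam s)) hrd (\<Sum>i<m. partial i u (gam t) * gam' i)) (at t)"
proof -
 define mix where "mix k s = (%i. if i < k then gam s i else gam t i)" for k s
 have mixR: "mix k s \<in> Rm m" for k s using gam by (auto simp: mix_def Rm_iff)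
 have "\<exists>xi. min (gam t k) (gam s k) <= xi \<and> xi <= max (gam t k) (gam s k) \<and>
   u (mix (Suc k) s) - u (mix k s) = partial k u ((mix k s)(k := xi)) * (gam s k - gam t k)" if "k < m" for k s
 proof -
  have e: "mix (Suc k) s = (mix k s)(k := gam s k)" "(mix k s)(k := gam t k) = mix k s"
   by (auto simp: mix_def fun_eq_iff less_Suc_eq)
  moreover have "\<exists>xi. min (gam t k) (gam s k) <= xi \<and> xi <= max (gam t k) (gam s k) \<and>
    u ((mix k s)(k := gam s k)) - u ((mix k s)(k := gam t k)) = partial k u ((mix k s)(k := xi)) * (gam s k - gam t k)"
   by (rule MVT_between[of "%t. u ((mix k s)(k := t))"]) (rule partial_DERIV[OF u that mixR])
  ultimately show ?thesis unfolding e by blast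
 qed
 then have ex: "\<exists>xi. k < m --> min (gam t k) (gam s k) <= xi \<and> xi <= max (gam t k) (gam s k) \<and>
   u (mix (Suc k) s) - u (mix k s) = partial k u ((mix k s)(k := xi)) * (gam s k - gam t k)" for k s by blast
 define xi where "xi k s = (SOME xi. k < m --> min (gam t k) (gam s k) <= xi \<and> xi <= max (gam t k) (gam s k) \<and>
   u (mix (Suc k) s) - u (mix k s) = partial k u ((mix k s)(k := xi)) * (gam s k - gam t k))" for k s
 have xi: "min (gam t k) (gam s k) <= xi k s \<and> xi k s <= max (gam t k) (gam s k) \<and>
   u (mix (Suc k) s) - u (mix k s) = partial k u ((mix k s)(k := xi k s)) * (gam s k - gam t k)" if "k < m" for k s
  using someI_ex[OF ex[of k s]] that unfolding xi_def by blast
 have tot: "u (gam s) - u (gam t) = (\<Sum>k<m. partial k u ((mix k s)(k := xi k s)) * (gam s k - gam t k))" for s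
 proof -
  have "mix m s = gam s" "mix 0 s = gam t" using gam[of s] gam[of t] by (auto simp: mix_def Rm_iff fun_eq_iff)
  then have "u (gam s) - u (gam t) = (\<Sum>k<m. u (mix (Suc k) s) - u (mix k s))"
   using sum_lessThan_telescope[of "%k. u (mix k s)" m] by simp
  then show ?thesis using xi by simp
 qed
 have cont: "((%s. gam s i) ---> gam t i) (at t)" for i
 proof (cases "i < m")
  case True
  then show ?thesis using DERIV_isCont[OF D] by (simp add: isCont_def)
 next
  case False
  then show ?thesis using gam by (simp add: Rm_iff)
 qed
 have lim: "((%s. partial k u ((mix k s)(k := xi k s))) ---> partial k u (gam t)) (at t)" if k: "k < m" for k
 proof (rule tendsto_Rm_comp[where u="partial k u" and G="%s. (mix k s)(k := xi k s)" and m=m])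
  show "continuous_map (Euclidean_space m) euclideanreal (partial k u)" using u k by simp
  show "(mix k s)(k := xi k s) \<in> Rm m" for s by (rule Rm_upd[OF mixR k])
  show "gam t \<in> Rm m" by (rule gam)
  fix i
  have "((%s. xi k s) ---> gam t k) (at t)"
  proof (rule tendsto_sandwich)
   show "((%s. min (gam t k) (gam s k)) ---> gam t k) (at t)"
    using tendsto_min[OF tendsto_const cont[of k], of "gam t k"] by simp
   show "((%s. max (gam t k) (gam s k)) ---> gam t k) (at t)"
    using tendsto_max[OF tendsto_const cont[of k], of "gam t k"] by simp
  qed (use xi[OF k] in auto)
  then show "((%s. ((mix k s)(k := xi k s)) i) ---> gam t i) (at t)"
   using cont[of i] by (cases "i = k"; cases "i < k") (simp_all add: mix_def)
 qed
 have "((%s. \<Sum>k<m. partial k u ((mix k s)(k := xi k s)) * ((gam s k - gam t k) / (s - t)))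
   ---> (\<Sum>k<m. partial k u (gam t) * gam' k)) (at t)"
  using D lim by (intro tendsto_sum tendsto_mult) (auto simp: has_field_derivative_iff)
 then show ?thesis unfolding has_field_derivative_iff tot by (simp add: sum_divide_distrib)
qed

text \<open>The determinant is differentiated one column at a time. In a single permutation term the
  product rule runs over the rows, so the sum is reindexed by the permutation.\<close>

lemma dx_DERIV:
 fixes I :: "'n::{finite,linorder} => nat"
 assumes "!!l i. ((%s. p s l i) hrd p' l i) (at t)"
 shows "((%s. dx I (p s)) hrd (\<Sum>j\<in>UNIV. dx I ((p t)(j := p' j)))) (at t)"
proof -
 have one: "((%s. \<Prod>k\<in>UNIV. p s (pp k) (I k)) hrd
   (\<Sum>j\<in>UNIV. \<Prod>k\<in>UNIV. ((p t)(j := p' j)) (pp k) (I k))) (at t)" if pp: "pp permutes (UNIV :: 'n set)" for pp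
 proof -
  have b: "bij pp" using permutes_bij[OF pp] .
  have "(\<Sum>j\<in>UNIV. \<Prod>k\<in>UNIV. ((p t)(j := p' j)) (pp k) (I k)) =
   (\<Sum>k'\<in>UNIV. \<Prod>k\<in>UNIV. ((p t)(pp k' := p' (pp k'))) (pp k) (I k))"
   by (rule sum.reindex_bij_betw[OF b, symmetric])
  also have "... = (\<Sum>k'\<in>UNIV. p' (pp k') (I k') * (\<Prod>k\<in>UNIV - {k'}. p t (pp k) (I k)))"
  proof (rule sum.cong[OF refl])
   fix k'
   show "(\<Prod>k\<in>UNIV. ((p t)(pp k' := p' (pp k'))) (pp k) (I k)) = p' (pp k') (I k') * (\<Prod>k\<in>UNIV - {k'}. p t (pp k) (I k))"
   proof -
    have "pp k ~= pp k'" if "k ~= k'" for k using that bij_is_inj[OF b] by (simp add: inj_eq)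
    then have "(\<Prod>k\<in>UNIV - {k'}. ((p t)(pp k' := p' (pp k'))) (pp k) (I k)) = (\<Prod>k\<in>UNIV - {k'}. p t (pp k) (I k))"
     by (intro prod.cong) auto
    then show ?thesis by (subst prod.remove[of _ k']) auto
   qed
  qed
  finally have eq: "(\<Sum>j\<in>UNIV. \<Prod>k\<in>UNIV. ((p t)(j := p' j)) (pp k) (I k)) =
   (\<Sum>k'\<in>UNIV. p' (pp k') (I k') * (\<Prod>k\<in>UNIV - {k'}. p t (pp k) (I k)))" .
  show ?thesis unfolding eq by (rule has_field_derivative_prod) (rule assms)
 qed
 have "((%s. \<Sum>pp\<in>{pp. pp permutes (UNIV :: 'n set)}. of_int (sign pp) * (\<Prod>k\<in>UNIV. p s (pp k) (I k))) hrd
  (\<Sum>pp\<in>{pp. pp permutes (UNIV :: 'n set)}. of_int (sign pp) * (\<Sum>j\<in>UNIV. \<Prod>k\<in>UNIV. ((p t)(j := p' j)) (pp k) (I k)))) (at t)"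
  by (intro DERIV_sum DERIV_cmult one) auto
 moreover have "(\<Sum>pp\<in>{pp. pp permutes (UNIV :: 'n set)}. of_int (sign pp) * (\<Sum>j\<in>UNIV. \<Prod>k\<in>UNIV. ((p t)(j := p' j)) (pp k) (I k)))
   = (\<Sum>j\<in>UNIV. dx I ((p t)(j := p' j)))"
  unfolding dx_def det_def sum_distrib_left vec_lambda_beta by (rule sum.swap)
 ultimately show ?thesis unfolding dx_def det_def vec_lambda_beta by (simp only:)
qed

lemma dx_continuous:
 assumes "!!l i. continuous_on S (%z. p z l i)" shows "continuous_on S (%z. dx I (p z))"
 unfolding dx_def det_def
 by (intro continuous_on_sum continuous_on_mult continuous_on_const continuous_on_prod) (simp add: assms)

lemma dx_tendsto:
 assumes "!!l i. ((%z. p z l i) ---> q l i) F" shows "((%z. dx I (p z)) ---> dx I q) F"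
 unfolding dx_def det_def by (intro tendsto_sum tendsto_mult tendsto_const tendsto_prod) (simp add: assms)

lemma dx_abs_le:
 fixes I :: "'n::{finite,linorder} => nat"
 assumes "!!l k. abs(v l (I k)) <= c l"
 shows "abs(dx I v) <= fact CARD('n) * (\<Prod>l\<in>UNIV. c l)"
proof -
 have "abs(dx I v) <= (\<Sum>pp\<in>{pp. pp permutes (UNIV :: 'n set)}. \<Prod>l\<in>UNIV. c l)" unfolding dx_def det_def
 proof (rule sum_abs[THEN order_trans], rule sum_mono)
  fix pp assume "pp \<in> {pp. pp permutes (UNIV :: 'n set)}"
  then have b: "bij pp" by (simp add: permutes_bij)
  have "abs(of_int (sign pp) * (\<Prod>k\<in>UNIV. v (pp k) (I k))) = (\<Prod>k\<in>UNIV. abs(v (pp k) (I k)))"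
   by (simp add: abs_mult abs_prod sign_def)
  also have "... <= (\<Prod>k\<in>UNIV. c (pp k))" by (rule prod_mono) (simp add: assms)
  also have "... = (\<Prod>l\<in>UNIV. c l)" by (rule prod.reindex_bij_betw[OF b])
  finally show "abs(of_int (sign pp) * (\<Prod>k\<in>UNIV. (\<chi> k l. v l (I k)) $ k $ pp k)) <= (\<Prod>l\<in>UNIV. c l)"
   unfolding vec_lambda_beta .
 qed
 also have "... = fact CARD('n) * (\<Prod>l\<in>UNIV. c l)" by (simp add: card_permutations[OF refl finite])
 finally show ?thesis .
qed

lemma dx_swap:
 assumes "j ~= k" shows "dx I (p(j := v, k := w)) = - dx I (p(j := w, k := v))"
proof -
 define tau where "tau = Transposition.transpose j k"
 have "det (\<chi> a b. (\<chi> k' l. (p(j := v, k := w)) l (I k')) $ a $ tau b) = of_int (sign tau) * dx I (p(j := v, k := w))"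
  unfolding dx_def by (rule det_permute_columns) (simp add: tau_def permutes_swap_id)
 moreover have "(\<chi> a b. (\<chi> k' l. (p(j := v, k := w)) l (I k')) $ a $ tau b) = (\<chi> k' l. (p(j := w, k := v)) l (I k'))"
  using assms by (auto simp: vec_eq_iff tau_def Transposition.transpose_def)
 moreover have "sign tau = -1" using assms by (simp add: tau_def sign_swap_id)
 ultimately show ?thesis by (simp add: dx_def)
qed

section \<open>Integration by parts along coordinate lines and the homotopy estimate\<close>

lemma integral_line_derivative:
 fixes f :: "real ^ 'n::finite => real"
 assumes f: "cont f" "cont f'"
  and D: "!!x. ((%s. f (sh x s j)) hrd f' x) (at 0)" and z: "!!x. x ~: cbox a b ==> f x = 0"
 shows "integral (cbox a b) f' = 0"
proof -
 define e where "e = (axis j 1 :: real ^ 'n)"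
 define A B where "A = (\<chi> l. a $ l - 1)" and "B = (\<chi> l. b $ l + 1)"
 have el: "abs((s *\<^sub>R e) $ l) <= abs(s)" for s l by (simp add: e_def axis_def)
 have D': "((%s. f (x + s *\<^sub>R e)) hrd f' (x + s *\<^sub>R e)) (at s)" for x s
 proof -
  have "((%t. f (x + s *\<^sub>R e + t *\<^sub>R e)) hrd f' (x + s *\<^sub>R e)) (at (s - s))" using D by (simp add: e_def)
  moreover have "((%t. t - s) hrd 1) (at s)" by (auto intro!: derivative_eq_intros)
  ultimately have "((%t. f (x + s *\<^sub>R e + (t - s) *\<^sub>R e)) hrd f' (x + s *\<^sub>R e) * 1) (at s)"
   by (rule DERIV_chain2[where f="%t. f (x + s *\<^sub>R e + t *\<^sub>R e)" and g="%t. t - s"])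
  moreover have "x + s *\<^sub>R e + (t - s) *\<^sub>R e = x + t *\<^sub>R e" for t by (simp add: scaleR_left_diff_distrib)
  ultimately show ?thesis by simp
 qed
 have z': "f' x = 0" if "x ~: cbox a b" for x
 proof -
  have "open (- cbox a b)" by (intro open_Compl closed_cbox)
  then obtain d where d: "d > 0" "ball x d \<subseteq> - cbox a b" using \<open>x ~: cbox a b\<close> by (meson ComplI openE)
  have "((%_. 0) hrd 0) (at 0)" by simp
  then have "((%s. f (x + s *\<^sub>R e)) hrd 0) (at 0)"
  proof (rule has_field_derivative_transform_within_open[of _ _ _ "{-d<..<d}"])
   fix s assume "s \<in> {-d<..<d}"
   then have "x + s *\<^sub>R e \<in> ball x d" by (simp add: dist_norm e_def abs_less_iff)
   then show "0 = f (x + s *\<^sub>R e)" using d z by auto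
  qed (use d in auto)
  then show ?thesis using D[of x] DERIV_unique[of "%s. f (x + s *\<^sub>R e)" "f' x" 0 0] by (simp add: e_def)
 qed
 have AB: "cbox a b \<subseteq> cbox A B" by (simp add: A_def B_def subset_interval_cart(1))
 \<comment> \<open>The integral over the enlarged box does not notice small translations, so its
   derivative, computed under the integral sign, is zero.\<close>
 have const: "integral (cbox A B) (%x. f (x + s *\<^sub>R e)) = integral (cbox a b) f" if s: "abs(s) < 1" for s
 proof -
  have i: "f integrable_on cbox a b" using f(1) continuous_on_subset by (intro integrable_continuous) blast
  have sub: "cbox a b \<subseteq> cbox (A + s *\<^sub>R e) (B + s *\<^sub>R e)"
  proof
   fix x assume x: "x \<in> cbox a b"
   have "(A + s *\<^sub>R e) $ l <= x $ l \<and> x $ l <= (B + s *\<^sub>R e) $ l" for l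
   proof -
    have "a $ l <= x $ l \<and> x $ l <= b $ l" using x by (simp add: mem_box_cart)
    moreover have "abs((s *\<^sub>R e) $ l) < 1" using el[of s l] s by linarith
    ultimately show ?thesis by (simp add: A_def B_def abs_less_iff del: vector_scaleR_component)
   qed
   then show "x \<in> cbox (A + s *\<^sub>R e) (B + s *\<^sub>R e)" by (simp add: mem_box_cart)
  qed
  have "(f has_integral integral (cbox a b) f) (cbox (A + s *\<^sub>R e) (B + s *\<^sub>R e))"
   by (rule has_integral_on_superset[OF integrable_integral[OF i] z sub])
  then have "((f \<circ> ((+) (s *\<^sub>R e))) has_integral integral (cbox a b) f) (cbox A B)"
   by (simp add: has_integral_shift_cbox_iff)
  then show ?thesis by (simp add: o_def add.commute integral_unique)
 qed
 have "((%s. integral (cbox A B) (%x. f (x + s *\<^sub>R e))) has_field_derivative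
   integral (cbox A B) (%x. f' (x + 0 *\<^sub>R e))) (at 0 within UNIV)"
 proof (rule leibniz_rule_field_derivative)
  show "((%s. f (x + s *\<^sub>R e)) has_field_derivative f' (x + s *\<^sub>R e)) (at s within UNIV)" for x s
   using D' by simp
  show "(%x. f (x + s *\<^sub>R e)) integrable_on cbox A B" for s
   by (intro integrable_continuous continuous_on_compose2[OF f(1)]) (auto intro!: continuous_intros)
  show "continuous_on (UNIV \<times> cbox A B) (%(s, x). f' (x + s *\<^sub>R e))"
   unfolding split_beta by (intro continuous_on_compose2[OF f(2)]) (auto intro!: continuous_intros)
 qed auto
 moreover have "((%s. integral (cbox A B) (%x. f (x + s *\<^sub>R e))) hrd 0) (at 0)"
 proof (rule has_field_derivative_transform_within_open[of "%_. integral (cbox a b) f" _ _ "{-1<..<1}"])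
  show "!!s. s \<in> {- 1<..<1} ==> integral (cbox a b) f = integral (cbox A B) (%x. f (x + s *\<^sub>R e))"
   using const by (simp add: abs_less_iff)
 qed auto
 ultimately have "integral (cbox A B) (%x. f' (x + 0 *\<^sub>R e)) = 0" by (rule DERIV_unique)
 then have "integral (cbox A B) f' = 0" by simp
 moreover have "integral (cbox A B) f' = integral (cbox a b) f'"
  by (metis AB calculation eq_integralD has_integral_iff has_integral_on_superset z')
 ultimately show ?thesis by simp
qed

text \<open>Differentiability is asked for along coordinate lines only, with all derivatives named.
  Symmetry of the second derivatives is part of the definition; for mollifications it can be read
  off the kernels.\<close>

definition C2_map :: "nat => (real ^ 'n::finite => nat => real) => (real ^ 'n => 'n => nat => real) =>
  (real ^ 'n => 'n => 'n => nat => real) => bool" where "C2_map m g g1 g2 \<longleftrightarrow> (\<forall>x. g x \<in> Rm m) \<and>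
   (\<forall>i. cont (%x. g x i)) \<and> (\<forall>j i. cont (%x. g1 x j i)) \<and> (\<forall>j k i. cont (%x. g2 x j k i)) \<and>
   (\<forall>x j i. ((%s. g (sh x s j) i) hrd g1 x j i) (at 0)) \<and>
   (\<forall>x j k i. ((%s. g1 (sh x s k) j i) hrd g2 x j k i) (at 0)) \<and> (\<forall>x j k i. g2 x j k i = g2 x k j i)"

text \<open>The straight homotopy, applied alike to maps and to their derivatives.\<close>

definition mixture :: "real => ('a => real) => ('a => real) => 'a => real" where
 "mixture tau f g i = (1 - tau) * f i + tau * g i"

lemma C2_map_mixture:
 assumes "C2_map m g g1 g2" "C2_map m h h1 h2"
 shows "C2_map m (%x. mixture tau (g x) (h x)) (%x j. mixture tau (g1 x j) (h1 x j))
  (%x j k. mixture tau (g2 x j k) (h2 x j k))" using assms unfolding C2_map_def mixture_def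
 by (auto simp: Rm_iff intro!: continuous_intros DERIV_add DERIV_cmult)

text \<open>What the product and chain rules give for \<open>form_at\<close> when the point
  \<open>q\<close> moves with velocity \<open>v\<close> and the vectors \<open>p\<close> move with
  velocities \<open>p'\<close>.\<close>

definition form_deriv ::
  "nat => 'n::{finite,linorder} form => (nat => real) => (nat => real) => ('n => nat => real) => ('n => nat => real) => real" where
 "form_deriv m phi q v p p' = (\<Sum>I\<in>multi_indices m.
   (\<Sum>i<m. partial i (phi I) q * v i) * dx I p + (\<Sum>j\<in>UNIV. dx I (p(j := p' j))) * phi I q)"

lemma form_at_DERIV:
 fixes phi :: "'n::{finite,linorder} form"
 assumes phi: "!!I. I \<in> multi_indices m ==> Ck_Rm m (Suc 0) (phi I)"
  and gam: "!!s. gam s \<in> Rm m" "!!i. ((%s. gam s i) hrd gam' i) (at t)"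
  and p: "!!l i. ((%s. p s l i) hrd p' l i) (at t)"
 shows "((%s. form_at m phi (gam s) (p s)) hrd form_deriv m phi (gam t) gam' (p t) p') (at t)"
 unfolding form_at_def form_deriv_def by (intro DERIV_sum DERIV_mult Ck_Rm_chain phi gam dx_DERIV p)

text \<open>The derivative of the form along a variation \<open>v\<close> of a map with partial derivatives \<open>p\<close> is a
 divergence: by the symmetry of the second derivatives \<open>s\<close> the terms containing them cancel in
 pairs, and the terms with derivatives of the coefficients cancel because the form is closed.\<close>

lemma form_deriv_divergence:
 fixes phi :: "'n::{finite,linorder} form"
 assumes cl: "closed_form m phi" and q: "q \<in> Rm m" and s: "!!j k i. s j k i = s k j i"
 shows "form_deriv m phi q v p p' =
  (\<Sum>j\<in>UNIV. form_deriv m phi q (p j) (p(j := v)) (%l. if l = j then p' j else s l j))"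
proof -
 define a where "a I i = partial i (phi I) q" for I i
 have z: "(\<Sum>I\<in>multi_indices m. \<Sum>i<m. a I i * (v i * dx I p - (\<Sum>j\<in>UNIV. p j i * dx I (p(j := v))))) = 0"
 proof (rule closed_form_identity)
  fix J assume "strict_mono_on {..CARD('n)} J" "J ` {..CARD('n)} \<subseteq> {..<m}"
  then have "ext_deriv phi J q = 0" using cl q unfolding closed_form_def by blast
  then show "(\<Sum>l\<le>CARD('n). (- 1) ^ l * a (face J l) (J l)) = 0" by (simp add: ext_deriv_def a_def)
 qed
 have W: "(\<Sum>j\<in>UNIV. \<Sum>k\<in>UNIV. if k = j then 0 else dx I (p(j := v, k := s k j))) = 0" (is "?W = 0") for I
 proof -
  have "?W = (\<Sum>j\<in>UNIV. \<Sum>k\<in>UNIV. if k = j then 0 else dx I (p(k := v, j := s k j)))"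
  proof (subst sum.swap, intro sum.cong refl)
   fix j k :: 'n
   have "s j k = s k j" using s by (intro ext)
   then show "(if j = k then 0 else dx I (p(k := v, j := s j k))) = (if k = j then 0 else dx I (p(k := v, j := s k j)))"
    by simp
  qed
  also have "... = - ?W" unfolding sum_negf[symmetric]
  proof (intro sum.cong refl)
   fix j k :: 'n
   show "(if k = j then 0 else dx I (p(k := v, j := s k j))) = - (if k = j then 0 else dx I (p(j := v, k := s k j)))"
    using dx_swap[of k j I p v "s k j"] fun_upd_twist[of k j p "s k j" v] by auto
  qed
  finally show ?thesis by simp
 qed
 have inner: "(\<Sum>j\<in>UNIV. \<Sum>k\<in>UNIV. dx I ((p(j := v))(k := if k = j then p' j else s k j))) = (\<Sum>j\<in>UNIV. dx I (p(j := p' j)))" for I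
 proof -
  have "(\<Sum>j\<in>UNIV. \<Sum>k\<in>UNIV. dx I ((p(j := v))(k := if k = j then p' j else s k j))) =
   (\<Sum>j\<in>UNIV. \<Sum>k\<in>UNIV. (if k = j then dx I (p(j := p' j)) else 0) + (if k = j then 0 else dx I (p(j := v, k := s k j))))"
   by (intro sum.cong refl) auto
  then show ?thesis using W[of I] by (simp add: sum.distrib)
 qed
 have "(\<Sum>j\<in>UNIV. form_deriv m phi q (p j) (p(j := v)) (%l. if l = j then p' j else s l j)) =
   (\<Sum>I\<in>multi_indices m. (\<Sum>j\<in>UNIV. (\<Sum>i<m. a I i * p j i) * dx I (p(j := v))) +
    (\<Sum>j\<in>UNIV. \<Sum>k\<in>UNIV. dx I ((p(j := v))(k := if k = j then p' j else s k j))) * phi I q)"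
  unfolding form_deriv_def a_def unfolding sum_distrib_right sum.distrib[symmetric] by (rule sum.swap)
 also have "... = (\<Sum>I\<in>multi_indices m. (\<Sum>j\<in>UNIV. (\<Sum>i<m. a I i * p j i) * dx I (p(j := v))) +
    (\<Sum>j\<in>UNIV. dx I (p(j := p' j))) * phi I q)" by (simp add: inner)
 also have "... = form_deriv m phi q v p p' - (\<Sum>I\<in>multi_indices m. \<Sum>i<m. a I i * (v i * dx I p - (\<Sum>j\<in>UNIV. p j i * dx I (p(j := v)))))"
 proof -
  have eqI: "(\<Sum>j\<in>UNIV. (\<Sum>i<m. a I i * p j i) * dx I (p(j := v))) =
   (\<Sum>i<m. a I i * v i) * dx I p - (\<Sum>i<m. a I i * (v i * dx I p - (\<Sum>j\<in>UNIV. p j i * dx I (p(j := v)))))" for I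
  proof -
   have "(\<Sum>j\<in>UNIV. (\<Sum>i<m. a I i * p j i) * dx I (p(j := v))) = (\<Sum>i<m. a I i * (\<Sum>j\<in>UNIV. p j i * dx I (p(j := v))))"
    unfolding sum_distrib_left sum_distrib_right mult.assoc by (rule sum.swap)
   then show ?thesis by (simp add: right_diff_distrib sum_subtractf sum_distrib_right mult.assoc)
  qed
  show ?thesis unfolding form_deriv_def a_def[symmetric] eqI by (simp only: sum_subtractf sum.distrib)
 qed
 finally show ?thesis using z by simp
qed

lemma C2_mapD:
 assumes "C2_map m g g1 g2"
 shows "g x \<in> Rm m" "cont (%x. g x i)" "cont (%x. g1 x j i)"
  "cont (%x. g2 x j k i)" "((%s. g (sh x s j) i) hrd g1 x j i) (at 0)"
  "((%s. g1 (sh x s k) j i) hrd g2 x j k i) (at 0)" "g2 x j k i = g2 x k j i"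
 using assms unfolding C2_map_def by auto

lemma form_deriv_continuous:
 fixes phi :: "'n::{finite,linorder} form"
 assumes phi: "!!I. I \<in> multi_indices m ==> Ck_Rm m (Suc 0) (phi I)"
  and q: "!!i. continuous_on S (%z. q z i)" "!!z. q z \<in> Rm m"
  and v: "!!i. continuous_on S (%z. v z i)" and p: "!!l i. continuous_on S (%z. p z l i)"
  and p': "!!l i. continuous_on S (%z. p' z l i)"
 shows "continuous_on S (%z. form_deriv m phi (q z) (v z) (p z) (p' z))"
 unfolding form_deriv_def
proof (intro continuous_on_sum continuous_on_add continuous_on_mult v dx_continuous p)
 fix I :: "'n => nat" assume I: "I \<in> multi_indices m"
 show "continuous_on S (%z. phi I (q z))" using phi[OF I] by (intro continuous_on_Rm_comp[OF _ q]) simp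
 show "continuous_on S (%z. partial i (phi I) (q z))" if "i \<in> {..<m}" for i
  using phi[OF I] that by (intro continuous_on_Rm_comp[OF _ q]) simp
 show "continuous_on S (%z. ((p z)(j := p' z j)) l i)" for j l i using p p' by (cases "l = j") auto
qed

lemma form_at_continuous:
 fixes phi :: "'n::{finite,linorder} form"
 assumes phi: "!!I. I \<in> multi_indices m ==> Ck_Rm m (Suc 0) (phi I)"
  and q: "!!i. continuous_on S (%z. q z i)" "!!z. q z \<in> Rm m" and p: "!!l i. continuous_on S (%z. p z l i)"
 shows "continuous_on S (%z. form_at m phi (q z) (p z))"
 unfolding form_at_def
proof (intro continuous_on_sum continuous_on_mult dx_continuous p)
 fix I :: "'n => nat" assume I: "I \<in> multi_indices m"
 show "continuous_on S (%z. phi I (q z))" using phi[OF I] by (intro continuous_on_Rm_comp[OF _ q]) simp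
qed

lemma form_at_abs_le:
 fixes phi :: "'n::{finite,linorder} form"
 assumes L: "(\<Sum>I\<in>multi_indices m. abs(phi I q)) <= L" and c: "!!l i. i < m ==> abs(v l i) <= c l"
  and c0: "!!l. 0 <= c l"
 shows "abs(form_at m phi q v) <= L * (fact CARD('n) * (\<Prod>l\<in>UNIV. c l))"
proof -
 have d: "abs(dx I v) <= fact CARD('n) * (\<Prod>l\<in>UNIV. c l)" if "I \<in> multi_indices m" for I
  using that by (intro dx_abs_le c) (auto simp: multi_indices_def)
 have "abs(form_at m phi q v) <= (\<Sum>I\<in>multi_indices m. abs(phi I q) * (fact CARD('n) * (\<Prod>l\<in>UNIV. c l)))"
  unfolding form_at_def by (rule sum_abs[THEN order_trans], rule sum_mono) (simp add: abs_mult d mult_left_mono)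
 also have "... = (\<Sum>I\<in>multi_indices m. abs(phi I q)) * (fact CARD('n) * (\<Prod>l\<in>UNIV. c l))"
  by (simp add: sum_distrib_right)
 also have "... <= L * (fact CARD('n) * (\<Prod>l\<in>UNIV. c l))"
  by (intro mult_right_mono L mult_nonneg_nonneg prod_nonneg c0) auto
 finally show ?thesis .
qed

text \<open>The integral is differentiated along the straight homotopy. The derivative of the
  integrand is a divergence, so integration by parts moves it to the cutoff \<open>psi\<close>; what
  remains is the form with one argument equal to the difference of the maps and the other
  \<open>n - 1\<close> bounded by \<open>E\<close>.\<close>

lemma homotopy_estimate:
 fixes phi :: "'n::{finite,linorder} form"
 assumes m: "0 < m" and phi: "!!I. I \<in> multi_indices m ==> Ck_Rm m (Suc 0) (phi I)" and cl: "closed_form m phi"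
  and L: "!!q. q \<in> Rm m ==> (\<Sum>I\<in>multi_indices m. abs(phi I q)) <= L"
  and g: "C2_map m g g1 g2" and h: "C2_map m h h1 h2" and psi: "cont psi" "!!j. cont (psi1 j)"
   "!!x j. ((%s. psi (sh x s j)) hrd psi1 j x) (at 0)" "!!x. x ~: cbox a b ==> psi x = 0"
  and Del: "!!x i. i < m ==> abs(h x i - g x i) <= Del x" and E: "!!x j i. i < m ==> abs(g1 x j i) <= E x \<and> abs(h1 x j i) <= E x"
  and cE: "cont Del" "cont E"
 shows "abs(integral (cbox a b) (%x. psi x * (form_at m phi (h x) (h1 x) - form_at m phi (g x) (g1 x)))) <=
  integral (cbox a b) (%x. L * (fact CARD('n) * ((\<Sum>j\<in>UNIV. abs(psi1 j x)) * (Del x * E x ^ (CARD('n) - 1)))))"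
proof -
 define G where "G tau x = mixture tau (g x) (h x)" for tau x
 define G1 where "G1 tau x = (%j. mixture tau (g1 x j) (h1 x j))" for tau x
 define G2 where "G2 tau x = (%j k. mixture tau (g2 x j k) (h2 x j k))" for tau x
 define v where "v x = (%i. h x i - g x i)" for x
 define v1 where "v1 x = (%j i. h1 x j i - g1 x j i)" for x
 \<comment> \<open>The field whose divergence appears: its \<open>j\<close>-th component has the
   \<open>j\<close>-th partial derivative replaced by the difference \<open>v\<close> of the two
   maps.\<close>
 define V where "V tau j x = form_at m phi (G tau x) ((G1 tau x)(j := v x))" for tau j x
 define V1 where "V1 tau j x = form_deriv m phi (G tau x) (G1 tau x j) ((G1 tau x)(j := v x)) (%l. if l = j then v1 x j else G2 tau x l j)" for tau j x
 define T where "T tau = integral (cbox a b) (%x. psi x * form_at m phi (G tau x) (G1 tau x))" for tau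
 define A where "A tau x = form_deriv m phi (G tau x) (v x) (G1 tau x) (v1 x)" for tau x
 define bd where "bd = integral (cbox a b) (%x. L * (fact CARD('n) * ((\<Sum>j\<in>UNIV. abs(psi1 j x)) * (Del x * E x ^ (CARD('n) - 1)))))"
 have C: "C2_map m (G tau) (G1 tau) (G2 tau)" for tau
  unfolding G_def[abs_def] G1_def[abs_def] G2_def[abs_def] by (rule C2_map_mixture[OF g h])
 note Cd = C2_mapD[OF C]
 have cg: "continuous_on S (%z. g (f z) i)" "continuous_on S (%z. h (f z) i)"
  "continuous_on S (%z. g1 (f z) j i)" "continuous_on S (%z. h1 (f z) j i)"
  if "continuous_on S f" for S i j and f :: "'b::topological_space => real ^ 'n::{finite,linorder}"
  by (rule continuous_on_compose2[OF C2_mapD(2)[OF g] that], simp)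
   (rule continuous_on_compose2[OF C2_mapD(2)[OF h] that], simp,
    rule continuous_on_compose2[OF C2_mapD(3)[OF g] that], simp,
    rule continuous_on_compose2[OF C2_mapD(3)[OF h] that], simp)
 have DG: "((%tau. G tau x i) hrd v x i) (at tau)" for x i tau
  unfolding G_def mixture_def v_def by (auto intro!: derivative_eq_intros)
 have DG1: "((%tau. G1 tau x l i) hrd v1 x l i) (at tau)" for x l i tau
  unfolding G1_def mixture_def v1_def by (auto intro!: derivative_eq_intros)
 have T': "(T has_field_derivative integral (cbox a b) (%x. psi x * A tau x)) (at tau within UNIV)" for tau
  unfolding T_def[abs_def]
 proof (rule leibniz_rule_field_derivative)
  show "((%tau. psi x * form_at m phi (G tau x) (G1 tau x)) has_field_derivative psi x * A tau x) (at tau within UNIV)" for tau x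
  proof -
   have "((%tau. form_at m phi (G tau x) (G1 tau x)) hrd form_deriv m phi (G tau x) (v x) (G1 tau x) (v1 x)) (at tau)"
    by (rule form_at_DERIV) (erule phi, rule Cd(1), rule DG, rule DG1)
   then show ?thesis unfolding A_def by (intro DERIV_cmult) simp
  qed
  show "(%x. psi x * form_at m phi (G tau x) (G1 tau x)) integrable_on cbox a b" for tau
   by (intro integrable_continuous continuous_on_mult form_at_continuous phi Cd(1)
     continuous_on_subset[OF psi(1)] continuous_on_subset[OF Cd(2)] continuous_on_subset[OF Cd(3)]) auto
  show "continuous_on (UNIV \<times> cbox a b) (%(tau, x). psi x * A tau x)"
   unfolding A_def split_beta G_def G1_def v_def v1_def mixture_def
  proof (intro continuous_on_mult form_deriv_continuous phi)
   show "continuous_on (UNIV \<times> cbox a b) (%z. psi (snd z))"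
    by (rule continuous_on_compose2[OF psi(1)]) (auto intro!: continuous_intros)
   show "(%i. (1 - fst z) * g (snd z) i + fst z * h (snd z) i) \<in> Rm m" for z :: "real \<times> (real ^ 'n::{finite,linorder})"
    using C2_mapD(1)[OF g, of "snd z"] C2_mapD(1)[OF h, of "snd z"] by (auto simp: Rm_iff)
  qed (auto intro!: continuous_intros cg)
 qed auto
 have AV: "A tau x = (\<Sum>j\<in>UNIV. V1 tau j x)" for tau x
  unfolding A_def V1_def by (rule form_deriv_divergence[OF cl Cd(1) Cd(7)])
 have cV: "cont (V tau j)" for tau j unfolding V_def[abs_def]
 proof (intro form_at_continuous phi Cd(1) Cd(2))
  show "cont (%z. ((G1 tau z)(j := v z)) l i)" for l i
   using Cd(3) by (cases "l = j") (auto simp: v_def intro!: continuous_intros cg)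
 qed
 have cV1: "cont (V1 tau j)" for tau j unfolding V1_def[abs_def]
 proof (intro form_deriv_continuous phi Cd(1) Cd(2) Cd(3))
  show "cont (%z. ((G1 tau z)(j := v z)) l i)" for l i
   using Cd(3) by (cases "l = j") (auto simp: v_def intro!: continuous_intros cg)
  show "cont (%z. (if l = j then v1 z j else G2 tau z l j) i)" for l i
   using Cd(4) by (cases "l = j") (auto simp: v1_def intro!: continuous_intros cg)
 qed
 have DV: "((%s. V tau j (sh x s j)) hrd V1 tau j x) (at 0)" for tau j x
 proof -
  have "((%s. form_at m phi (G tau (sh x s j)) ((G1 tau (sh x s j))(j := v (sh x s j)))) hrd
    form_deriv m phi (G tau (sh x 0 j)) (G1 tau x j) ((G1 tau (sh x 0 j))(j := v (sh x 0 j)))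
     (%l. if l = j then v1 x j else G2 tau x l j)) (at 0)"
  proof (rule form_at_DERIV)
   show "Ck_Rm m (Suc 0) (phi I)" if "I \<in> multi_indices m" for I by (rule phi[OF that])
   show "G tau (sh x s j) \<in> Rm m" for s by (rule Cd(1))
   show "((%s. G tau (sh x s j) i) hrd G1 tau x j i) (at 0)" for i by (rule Cd(5))
   show "((%s. ((G1 tau (sh x s j))(j := v (sh x s j))) l i) hrd
     (if l = j then v1 x j else G2 tau x l j) i) (at 0)" for l i
   proof (cases "l = j")
    case True
    then show ?thesis unfolding v_def v1_def using DERIV_diff[OF C2_mapD(5)[OF h] C2_mapD(5)[OF g]] by simp
   next
    case False
    then show ?thesis using Cd(6) by simp
   qed
  qed
  then show ?thesis by (simp add: V_def V1_def)
 qed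
 have zero: "integral (cbox a b) (%x. psi1 j x * V tau j x + V1 tau j x * psi x) = 0" for tau j
 proof (rule integral_line_derivative[of "%x. psi x * V tau j x"])
  show "((%s. psi (sh x s j) * V tau j (sh x s j)) hrd psi1 j x * V tau j x + V1 tau j x * psi x) (at 0)" for x
  proof -
   have 1: "((%s. psi (sh x s j)) hrd psi1 j x) (at 0)" by (rule psi(3))
   have 2: "((%s. V tau j (sh x s j)) hrd V1 tau j x) (at 0)" by (rule DV)
   show ?thesis using DERIV_mult[OF 1 2] by simp
  qed
 qed (auto intro!: continuous_on_add continuous_on_mult psi(1) psi(2) cV cV1 simp: psi(4))
 have i1: "(%x. psi1 j x * V tau j x) integrable_on cbox a b" "(%x. V1 tau j x * psi x) integrable_on cbox a b" for j tau
  by (intro integrable_continuous continuous_on_mult continuous_on_subset[OF psi(1)]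
    continuous_on_subset[OF psi(2)] continuous_on_subset[OF cV] continuous_on_subset[OF cV1]; simp)+
 have eq: "integral (cbox a b) (%x. psi x * A tau x) = - integral (cbox a b) (%x. \<Sum>j\<in>UNIV. psi1 j x * V tau j x)" for tau
 proof -
  have "integral (cbox a b) (%x. psi x * A tau x) = (\<Sum>j\<in>UNIV. integral (cbox a b) (%x. V1 tau j x * psi x))"
   by (subst integral_sum[symmetric]) (auto simp: AV sum_distrib_right mult.commute[of "psi _"] i1)
  also have "... = (\<Sum>j\<in>UNIV. - integral (cbox a b) (%x. psi1 j x * V tau j x))"
  proof (rule sum.cong[OF refl])
   fix j
   show "integral (cbox a b) (%x. V1 tau j x * psi x) = - integral (cbox a b) (%x. psi1 j x * V tau j x)"
   proof -
    have "integral (cbox a b) (%x. psi1 j x * V tau j x + V1 tau j x * psi x) =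
     integral (cbox a b) (%x. psi1 j x * V tau j x) + integral (cbox a b) (%x. V1 tau j x * psi x)"
     by (rule integral_add) (rule i1)+
    moreover have "integral (cbox a b) (%x. psi1 j x * V tau j x + V1 tau j x * psi x) = 0" by (rule zero)
    ultimately show ?thesis by simp
   qed
  qed
  also have "... = - integral (cbox a b) (%x. \<Sum>j\<in>UNIV. psi1 j x * V tau j x)"
   by (subst integral_sum) (auto simp: sum_negf i1)
  finally show ?thesis .
 qed
 have V_le: "abs(V tau j x) <= L * (fact CARD('n) * (Del x * E x ^ (CARD('n) - 1)))" if tau: "0 <= tau" "tau <= 1" for tau j x
 proof -
  have "abs(V tau j x) <= L * (fact CARD('n) * (\<Prod>l\<in>UNIV. if l = j then Del x else E x))" unfolding V_def
  proof (rule form_at_abs_le)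
   show "(\<Sum>I\<in>multi_indices m. abs(phi I (G tau x))) <= L" by (rule L[OF Cd(1)])
  next
   fix l i assume i: "i < m"
   show "abs(((G1 tau x)(j := v x)) l i) <= (if l = j then Del x else E x)"
   proof (cases "l = j")
    case False
    have "abs((1 - tau) * g1 x l i + tau * h1 x l i) <= (1 - tau) * abs(g1 x l i) + tau * abs(h1 x l i)"
     using tau abs_triangle_ineq[of "(1 - tau) * g1 x l i" "tau * h1 x l i"] by (simp add: abs_mult)
    also have "... <= (1 - tau) * E x + tau * E x"
     using tau E[OF i, of x l] by (intro add_mono mult_left_mono) auto
    finally show ?thesis using False by (simp add: G1_def mixture_def algebra_simps)
   qed (use Del[OF i] in "simp add: v_def")
  next
   fix l
   show "0 <= (if l = j then Del x else E x)"
    using Del[OF m, of x] E[OF m, of x l] by (auto intro: order_trans[OF abs_ge_zero])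
  qed
  also have "(\<Prod>l\<in>UNIV. if l = j then Del x else E x) = Del x * E x ^ (CARD('n) - 1)"
   by (subst prod.remove[of _ j]) auto
  finally show ?thesis .
 qed
 have T'_le: "abs(integral (cbox a b) (%x. psi x * A tau x)) <= bd" if tau: "0 <= tau" "tau <= 1" for tau
  unfolding eq abs_minus_cancel unfolding bd_def real_norm_def[symmetric]
 proof (rule integral_norm_bound_integral)
  show "(%x. \<Sum>j\<in>UNIV. psi1 j x * V tau j x) integrable_on cbox a b" by (intro integrable_sum i1) auto
  show "(%x. L * (fact CARD('n) * ((\<Sum>j\<in>UNIV. norm (psi1 j x)) * (Del x * E x ^ (CARD('n) - 1))))) integrable_on cbox a b"
   by (intro integrable_continuous continuous_on_mult continuous_on_const continuous_on_sum continuous_on_norm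
     continuous_on_power continuous_on_subset[OF psi(2)] continuous_on_subset[OF cE(1)] continuous_on_subset[OF cE(2)]) auto
  fix x
  have "norm (\<Sum>j\<in>UNIV. psi1 j x * V tau j x) <= (\<Sum>j\<in>UNIV. norm (psi1 j x) * (L * (fact CARD('n) * (Del x * E x ^ (CARD('n) - 1)))))"
   by (rule norm_sum[THEN order_trans], rule sum_mono) (use V_le[OF tau] in "simp add: abs_mult mult_left_mono")
  also have "... = L * (fact CARD('n) * ((\<Sum>j\<in>UNIV. norm (psi1 j x)) * (Del x * E x ^ (CARD('n) - 1))))"
   by (simp add: sum_distrib_right sum_distrib_left mult_ac)
  finally show "norm (\<Sum>j\<in>UNIV. psi1 j x * V tau j x) <= L * (fact CARD('n) * ((\<Sum>j\<in>UNIV. norm (psi1 j x)) * (Del x * E x ^ (CARD('n) - 1))))" .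
 qed
 \<comment> \<open>The mean value theorem takes the place of an integration over the homotopy
   parameter.\<close>
 obtain z where z: "0 < z" "z < 1" "T 1 - T 0 = (1 - 0) * integral (cbox a b) (%x. psi x * A z x)"
  using MVT2[of 0 1 T "%tau. integral (cbox a b) (%x. psi x * A tau x)"] T' by auto
 then have "abs(T 1 - T 0) <= bd" using T'_le[of z] by simp
 moreover have "T 1 - T 0 = integral (cbox a b) (%x. psi x * (form_at m phi (h x) (h1 x) - form_at m phi (g x) (g1 x)))"
 proof -
  have i: "(%x. psi x * form_at m phi (g x) (g1 x)) integrable_on cbox a b" if "C2_map m g g1 g2" for g g1 g2
   by (intro integrable_continuous continuous_on_mult form_at_continuous phi C2_mapD(1)[OF that]
     continuous_on_subset[OF psi(1)] continuous_on_subset[OF C2_mapD(2)[OF that]] continuous_on_subset[OF C2_mapD(3)[OF that]]) auto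
  have "G 1 = h" "G1 1 = h1" "G 0 = g" "G1 0 = g1" by (auto simp: G_def G1_def mixture_def fun_eq_iff)
  then show ?thesis unfolding T_def using integral_diff[OF i[OF h] i[OF g]] by (simp add: right_diff_distrib)
 qed
 ultimately show ?thesis by (simp add: bd_def)
qed

section \<open>Lipschitz truncation\<close>

text \<open>McShane's formula with a pseudometric in place of a multiple of the distance, so that a
  Lipschitz bound and a bound on the oscillation can be imposed together.\<close>

lemma mcshane_extension:
 fixes u :: "'a => real"
 assumes F: "F ~= {}" and u: "!!x y. x \<in> F ==> y \<in> F ==> abs(u x - u y) <= sgm x y"
  and sgm: "!!x. sgm x x = 0" "!!x y. sgm x y = sgm y x" "!!x y z. sgm x z <= sgm x y + sgm y z"
 obtains g where "!!x. x \<in> F ==> g x = u x" "!!x y. abs(g x - g y) <= sgm x y"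
proof -
 define g where "g x = (INF z\<in>F. u z + sgm x z)" for x
 obtain x0 where x0: "x0 \<in> F" using F by blast
 have bdd: "bdd_below ((%z. u z + sgm x z) ` F)" for x
 proof (rule bdd_belowI2)
  fix z assume "z \<in> F"
  then show "u x0 - sgm x0 x <= u z + sgm x z" using u[OF x0, of z] sgm(3)[of x0 z x] by (auto simp: abs_le_iff)
 qed
 have le: "g x <= g y + sgm x y" for x y
 proof -
  have "g x - sgm x y <= g y" unfolding g_def[of y]
  proof (rule cINF_greatest[OF F])
   fix z assume z: "z \<in> F"
   have "g x <= u z + sgm x z" unfolding g_def by (rule cINF_lower[OF bdd z])
   then show "g x - sgm x y <= u z + sgm y z" using sgm(3)[of x z y] by linarith
  qed
  then show ?thesis by simp
 qed
 show ?thesis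
 proof
  fix x assume x: "x \<in> F"
  have "g x <= u x" unfolding g_def using cINF_lower[OF bdd x, of x] sgm(1) by simp
  moreover have "u x <= g x" unfolding g_def
   by (rule cINF_greatest[OF F]) (use u[OF x] in "auto simp: abs_le_iff algebra_simps")
  ultimately show "g x = u x" by simp
 next
  fix x y show "abs(g x - g y) <= sgm x y" using le[of x y] le[of y x] sgm(2)[of x y] by (simp add: abs_le_iff)
 qed
qed

section \<open>Derivatives of mollified functions\<close>

definition dbk :: "real => 'n => 'n => real => real" where
 "dbk r j = (%l. bk r)(j := deriv (bk r))"

lemma deriv_bk: "0 < r ==> deriv (bk r) t = deriv bump (t / r) / r\<^sup>2"
proof (rule DERIV_imp_deriv)
 assume r: "0 < r"
 have "((%t. bump (t / r) / r) hrd deriv bump (t / r) * (1 / r) / r) (at t)"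
  by (intro DERIV_cdivide DERIV_chain2[OF smooth_DERIV[OF smooth_bump]]) (use r in "auto intro!: derivative_eq_intros")
 then show "(bk r hrd deriv bump (t / r) / r\<^sup>2) (at t)" by (simp add: bk_def[abs_def] power2_eq_square)
qed

lemma deriv_bump_eq_0: "1 <= abs(t) ==> deriv bump t = 0"
 by (rule DERIV_local_min[OF smooth_DERIV[OF smooth_bump], of 1]) (auto simp: bump_eq_0 bump_nonneg)

definition dbump_max :: real where
 "dbump_max = (SOME C. C >= 1 \<and> (\<forall>t. abs(deriv bump t) <= C))"

lemma dbump_max: "dbump_max >= 1" "abs(deriv bump t) <= dbump_max"
proof -
 obtain C where C: "C > 0" "!!t. abs(deriv bump t) <= C"
  using bounded_compact_support[of "deriv bump" 1, OF smooth_continuous[OF smooth_deriv[OF smooth_bump]] deriv_bump_eq_0] by auto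
 have "\<exists>C. C >= 1 \<and> (\<forall>t. abs(deriv bump t) <= C)"
  by (rule exI[of _ "max 1 C"]) (use C in "auto simp: le_max_iff_disj")
 from someI_ex[OF this] show "dbump_max >= 1" "abs(deriv bump t) <= dbump_max" unfolding dbump_max_def by auto
qed

lemma dbk_smooth: "smooth (dbk r j l)"
 unfolding dbk_def using smooth_bk' smooth_deriv by auto

lemma dbk_eq_0: "0 < r ==> r <= abs(t) ==> dbk r j l t = 0"
 unfolding dbk_def by (auto simp: bk_eq_0 deriv_bk intro!: deriv_bump_eq_0)

lemma dbk_prod_le:
 fixes y :: "real ^ 'n::finite"
 assumes r: "0 < r"
 shows "abs(coord_prod (dbk r j) y) <= dbump_max * bump_max ^ (CARD('n) - 1) / r ^ (CARD('n) + 1)"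
  "y ~: cube 0 r ==> coord_prod (dbk r j) y = 0"
proof -
 have "abs(coord_prod (dbk r j) y) <= (\<Prod>l\<in>UNIV. if l = j then dbump_max / r\<^sup>2 else bump_max / r)"
 proof (rule coord_prod_abs_le)
  fix l
  show "abs(dbk r j l (y $ l)) <= (if l = j then dbump_max / r\<^sup>2 else bump_max / r)"
   using bk_bounds[OF r order_refl, of "y $ l"] dbump_max(2) r
   by (auto simp: dbk_def deriv_bk abs_mult divide_right_mono)
 qed
 also have "... = dbump_max / r\<^sup>2 * (bump_max / r) ^ (CARD('n) - 1)" by (subst prod.remove[of _ j]) auto
 also have "... = dbump_max * bump_max ^ (CARD('n) - 1) / r ^ (CARD('n) + 1)"
 proof -
  have "CARD('n) + 1 = 2 + (CARD('n) - 1)" using zero_less_card_finite[where 'a='n] by simp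
  then show ?thesis by (simp only: power_add power_divide) simp
 qed
 finally show "abs(coord_prod (dbk r j) y) <= dbump_max * bump_max ^ (CARD('n) - 1) / r ^ (CARD('n) + 1)" .
 assume "y ~: cube 0 r"
 then obtain l where "r < abs(y $ l)" by (auto simp: cube_def not_le)
 then have "dbk r j l (y $ l) = 0" using r by (intro dbk_eq_0) auto
 then show "coord_prod (dbk r j) y = 0" unfolding coord_prod_def by (intro prod_zero) auto
qed

lemma dbk_moll_DERIV:
 fixes u :: "real ^ 'n::finite => real"
 assumes "L1 u" "0 < r"
 shows "((%s. avg u (sh x s j) r) hrd - moll (dbk r j) u x) (at 0)"
 unfolding avg_eq_moll dbk_def by (rule moll_DERIV[OF assms(1) smooth_bk' bk_eq_0[OF assms(2)]])

text \<open>Averages of a constant do not change with the centre. The indicator of a slightly larger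
  cube stands in for the constant, which is not integrable itself.\<close>

lemma integral_dbk:
 fixes x :: "real ^ 'n::finite"
 assumes r: "0 < r"
 shows "(LI y. coord_prod (dbk r j) (y - x)) = 0"
proof -
 define u where "u = (ind (cube x (r + 1)) :: real ^ 'n => real)"
 have u: "L1 u" unfolding u_def using cube_lmeasurable lmeasurable_iff_integrable by blast
 have "avg u z r = 1" if "!!l. abs(z $ l - x $ l) <= 1" for z
 proof -
  have sub: "cube z r \<subseteq> cube x (r + 1)" by (rule cube_subset_cube) (use that in "simp add: add.commute")
  have "avg u z r = (LI y. coord_prod (%l. bk r) (y - z))" unfolding avg_def
  proof (rule lint_cong[OF refl])
   fix y show "u y * coord_prod (%l. bk r) (y - z) = coord_prod (%l. bk r) (y - z)"
    using kernel_bounds(3)[OF r, of y z] sub by (cases "y \<in> cube z r") (auto simp: u_def)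
  qed
  then show ?thesis using integral_kernel[OF r] by simp
 qed
 then have 1: "avg u (sh x s j) r = 1" if "abs(s) <= 1" for s using that by (simp add: axis_def)
 have "((%s. 1) hrd 0) (at 0)" by simp
 then have "((%s. avg u (sh x s j) r) hrd 0) (at 0)"
  by (rule has_field_derivative_transform_within_open[of _ _ _ "{-1<..<1}"]) (auto simp: 1)
 then have "moll (dbk r j) u x = 0" using DERIV_unique[OF _ dbk_moll_DERIV[OF u r]] by fastforce
 moreover have "moll (dbk r j) u x = (LI y. coord_prod (dbk r j) (y - x))" unfolding moll_def
 proof (rule lint_cong[OF refl])
  fix y show "u y * coord_prod (dbk r j) (y - x) = coord_prod (dbk r j) (y - x)"
  proof (cases "y \<in> cube x (r + 1)")
   case False
   then have "y ~: cube x r" using cube_mono[of r "r + 1" x] by auto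
   then have "y - x ~: cube 0 r" by (simp add: cube_def)
   then show ?thesis using dbk_prod_le(2)[OF r, of "y - x" j] by simp
  qed (simp add: u_def)
 qed
 ultimately show ?thesis by simp
qed

definition grad_const :: "nat => real" where
 "grad_const n = dbump_max * bump_max ^ (n - 1)"

text \<open>The differentiated kernel has integral zero, so any constant \<open>z\<close> may be
  subtracted from \<open>u\<close>.\<close>

lemma dbk_moll_le:
 fixes u :: "real ^ 'n::finite => real"
 assumes u: "L1 u" and r: "0 < r"
 shows "abs(moll (dbk r j) u x) <= grad_const CARD('n) / r ^ (CARD('n) + 1) * (LINT y:cube x r|lm. abs(u y - z))"
proof -
 define P where "P y = coord_prod (dbk r j) (y - x)" for y
 define K where "K = grad_const CARD('n) / r ^ (CARD('n) + 1)"
 have Pc: "cont P" unfolding P_def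
  by (rule continuous_on_compose2[OF coord_prod_continuous[OF dbk_smooth]]) (auto intro!: continuous_intros)
 have Pb: "abs(P y) <= K" for y unfolding P_def K_def grad_const_def by (rule dbk_prod_le(1)[OF r])
 have Pz: "P y = 0" if "y ~: cube x r" for y
  unfolding P_def by (rule dbk_prod_le(2)[OF r]) (use that in "auto simp: cube_def")
 have i1: "L1 (%y. u y * P y)" by (rule integrable_mult_continuous_bounded[OF u Pc Pb])
 have ic: "L1 (%y. ind (cube x r) y * c)" for c :: real by (rule integrable_ind_const[OF cube_lmeasurable])
 have iP: "L1 P"
 proof -
  have "L1 (%y. (ind (cube x r) y * 1) * P y)" by (rule integrable_mult_continuous_bounded[OF ic Pc Pb])
  moreover have "(%y. (ind (cube x r) y * 1) * P y) = P" using Pz by (auto simp: fun_eq_iff indicator_def)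
  ultimately show ?thesis by simp
 qed
 note ia = integrable_ind_dist[OF u cube_lmeasurable, of x r z]
 have "moll (dbk r j) u x = (LI y. u y * P y) - (LI y. z * P y)"
  using integral_dbk[OF r, of j x] by (simp add: moll_def P_def)
 also have "... = (LI y. (u y - z) * P y)"
  using i1 iP by (subst lint_diff[symmetric]) (auto simp: left_diff_distrib)
 also have "abs(...) <= (LI y. K * (ind (cube x r) y * abs(u y - z)))"
 proof (rule integral_abs_bound[THEN order_trans], rule integral_mono)
  show "L1 (%y. abs((u y - z) * P y))" using i1 iP by (auto simp: left_diff_distrib)
  show "L1 (%y. K * (ind (cube x r) y * abs(u y - z)))" using ia by simp
  show "abs((u y - z) * P y) <= K * (ind (cube x r) y * abs(u y - z))" for y
   using Pz[of y] Pb[of y] by (cases "y \<in> cube x r") (auto simp: abs_mult mult.commute[of "abs(u y - z)"] mult_right_mono)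
 qed
 finally show ?thesis by (simp add: K_def slint_def)
qed

lemma wgrad_dbk:
 fixes u :: "real ^ 'n::finite => real"
 assumes wg: "wgrad Q u w" and r: "0 < r" and Q: "cube x r \<subseteq> Q"
 shows "- moll (dbk r j) u x = avg (w j) x r"
proof -
 define beta where "beta = (%l t. bk r (t - x $ l))"
 have s: "smooth (beta l)" for l by (simp add: beta_def smooth_bk)
 have "deriv (beta j) t = deriv (bk r) (t - x $ j)" for t
 proof (rule DERIV_imp_deriv)
  have g: "((%t. t - x $ j) hrd 1) (at t)" by (auto intro!: derivative_eq_intros)
  show "(beta j hrd deriv (bk r) (t - x $ j)) (at t)"
   unfolding beta_def by (rule DERIV_cong[OF DERIV_chain2[OF smooth_DERIV[OF smooth_bk'] g]]) simp
 qed
 then have fr: "pd (coord_prod beta) y j = coord_prod (dbk r j) (y - x)" for y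
  unfolding coord_prod_frechet[of beta, OF s] by (auto simp: coord_prod_def dbk_def beta_def intro!: prod.cong)
 have b: "coord_prod beta y = coord_prod (%l. bk r) (y - x)" for y by (simp add: coord_prod_def beta_def)
 have "(LI y. u y * pd (coord_prod beta) y j) = - (LI y. w j y * coord_prod beta y)"
 proof (rule wgradD[OF wg])
  show "Ck k (coord_prod beta)" for k by (rule Ck_coord_prod[OF s])
  show "coord_prod beta y = 0" if "y ~: Q" for y unfolding b using kernel_bounds(3)[OF r] Q that by blast
 qed
 then show ?thesis by (simp add: fr b moll_def avg_def)
qed

text \<open>Differentiating the kernel in the directions \<open>j\<close> and \<open>k\<close> gives
  the same factors in either order, hence symmetric second derivatives.\<close>

lemma C2_map_avg:
 fixes v :: "nat => real ^ 'n::finite => real"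
 assumes v: "!!i. i < m ==> L1 (v i)" and r: "0 < r"
 shows "\<exists>g2. C2_map m (%x i. if i < m then avg (v i) x r else 0) (%x j i. if i < m then - moll (dbk r j) (v i) x else 0) g2"
proof -
 define d2 where "d2 j k = (dbk r j)(k := deriv (dbk r j k))" for j k :: 'n
 have sd2: "smooth (d2 j k l)" for j k l unfolding d2_def using dbk_smooth smooth_deriv[OF dbk_smooth] by auto
 have zd2: "d2 j k l t = 0" if "r + 1 <= abs(t)" for j k l t
 proof (cases "l = k")
  case True
  have "((%_. 0) hrd 0) (at t)" by simp
  then have "(dbk r j k hrd 0) (at t)"
  proof (rule has_field_derivative_transform_within_open[of _ _ _ "{s. r < abs(s)}"])
   show "open {s::real. r < abs(s)}" by (intro open_Collect_less continuous_intros)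
  qed (use that in "auto simp: dbk_eq_0[OF r] less_imp_le")
  then show ?thesis using True by (simp add: d2_def DERIV_imp_deriv)
 next
  case False
  have "r <= abs(t)" using that by simp
  from dbk_eq_0[OF r this, of j l] show ?thesis using False by (simp add: d2_def)
 qed
 have sym: "d2 j k = d2 k j" for j k by (cases "j = k") (auto simp: d2_def dbk_def fun_eq_iff)
 define g2 where "g2 x j k i = (if i < m then moll (d2 j k) (v i) x else 0)" for x j k i
 have D1: "((%s. avg (v i) (sh x s j) r) hrd - moll (dbk r j) (v i) x) (at 0)" if "i < m" for x j i
  by (rule dbk_moll_DERIV[OF v[OF that] r])
 have D2: "((%s. - moll (dbk r j) (v i) (sh x s k)) hrd moll (d2 j k) (v i) x) (at 0)" if "i < m" for x j k i
  using DERIV_minus[OF moll_DERIV[where beta="dbk r j" and r=r and j=k and x=x, OF v[OF that] dbk_smooth dbk_eq_0[OF r]]]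
  by (simp add: d2_def)
 have c: "cont (%x. avg (v i) x r)" "cont (moll (dbk r j) (v i))" "cont (moll (d2 j k) (v i))"
  if "i < m" for i j k
 proof -
  show "cont (%x. avg (v i) x r)"
   unfolding avg_eq_moll by (rule moll_continuous[OF v[OF that] smooth_continuous[OF smooth_bk'] bk_eq_0[OF r]])
  show "cont (moll (dbk r j) (v i))"
   by (rule moll_continuous[where r=r, OF v[OF that] smooth_continuous[OF dbk_smooth] dbk_eq_0[OF r]])
  show "cont (moll (d2 j k) (v i))"
   by (rule moll_continuous[where r="r + 1", OF v[OF that] smooth_continuous[OF sd2] zd2])
 qed
 have "C2_map m (%x i. if i < m then avg (v i) x r else 0) (%x j i. if i < m then - moll (dbk r j) (v i) x else 0) g2"
  unfolding C2_map_def
 proof (intro conjI allI)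
  show "(%i. if i < m then avg (v i) x r else 0) \<in> Rm m" for x by (simp add: Rm_iff)
  show "cont (%x. if i < m then avg (v i) x r else 0)" for i using c(1) by (cases "i < m") auto
  show "cont (%x. if i < m then - moll (dbk r j) (v i) x else 0)" for i j
   using c(2) by (cases "i < m") (auto intro: continuous_on_minus)
  show "cont (%x. g2 x j k i)" for j k i using c(3) by (cases "i < m") (auto simp: g2_def)
  show "((%s. if i < m then avg (v i) (sh x s j) r else 0) hrd (if i < m then - moll (dbk r j) (v i) x else 0)) (at 0)" for x j i
   using D1 by (cases "i < m") auto
  show "((%s. if i < m then - moll (dbk r j) (v i) (sh x s k) else 0) hrd g2 x j k i) (at 0)" for x j k i
   using D2 by (cases "i < m") (auto simp: g2_def)
  show "g2 x j k i = g2 x k j i" for x j k i by (simp add: g2_def sym[of j k])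
 qed
 then show ?thesis by blast
qed

section \<open>A dyadic maximal function\<close>

text \<open>A measurable dyadic majorant of the maximal function: where the latter is finite, the
  geometric sum adds up to the least \<open>2 ^ k\<close> that bounds it. Where it is infinite the
  series diverges and the value has no meaning; that set is null.\<close>

definition dmax :: "('a::euclidean_space => real) => 'a => real" where
 "dmax g x = 1 + (\<Sum>k. 2 ^ k * ind (max_set g (2 ^ k)) x)"

lemma dmax_eq:
 assumes "x ~: max_set g (2 ^ l)"
 shows "\<exists>k\<le>l. dmax g x = 2 ^ k \<and> (\<forall>i. x \<in> max_set g (2 ^ i) \<longleftrightarrow> i < k)"
proof -
 define k where "k = (LEAST k. x ~: max_set g (2 ^ k))"
 have k: "x ~: max_set g (2 ^ k)" "k <= l" unfolding k_def
  using LeastI[of "%k. x ~: max_set g (2 ^ k)" l] Least_le[of "%k. x ~: max_set g (2 ^ k)" l] assms by auto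
 have iff: "x \<in> max_set g (2 ^ i) \<longleftrightarrow> i < k" for i
 proof
  assume i: "x \<in> max_set g (2 ^ i)"
  show "i < k"
  proof (rule ccontr)
   assume "\<not> i < k"
   then have "max_set g (2 ^ i) \<subseteq> max_set g (2 ^ k)" by (intro max_set_antimono) simp
   then show False using i k by auto
  qed
 next
  assume "i < k" then show "x \<in> max_set g (2 ^ i)" unfolding k_def using not_less_Least[of i "%k. x ~: max_set g (2 ^ k)"] by auto
 qed
 have "(\<Sum>i. 2 ^ i * ind (max_set g (2 ^ i)) x) = (\<Sum>i<k. 2 ^ i * ind (max_set g (2 ^ i)) x :: real)"
  by (rule suminf_finite) (auto simp: iff)
 also have "... = (\<Sum>i<k. 2 ^ i)" by (rule sum.cong) (auto simp: iff)
 also have "... = 2 ^ k - 1" by (induction k) auto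
 finally have "dmax g x = 2 ^ k" by (simp add: dmax_def)
 then show ?thesis using k iff by blast
qed

lemma dmax_ge: "x \<in> max_set g (2 ^ k) ==> x ~: max_set g (2 ^ l) ==> 2 ^ Suc k <= dmax g x"
 proof -
 assume k: "x \<in> max_set g (2 ^ k)" and l: "x ~: max_set g (2 ^ l)"
 obtain j where j: "dmax g x = 2 ^ j" "k < j" using dmax_eq[OF l] k by blast
 have "(2::real) ^ Suc k <= 2 ^ j" using j(2) by (intro power_increasing) auto
 then show ?thesis using j(1) by simp
qed

lemma dmax_notin:
 assumes "x ~: max_set g (2 ^ l)"
 shows "1 <= dmax g x" "dmax g x <= 2 ^ l" "x ~: max_set g (dmax g x)"
proof -
 obtain k where k: "k <= l" "dmax g x = 2 ^ k" "x \<in> max_set g (2 ^ k) \<longleftrightarrow> k < k" using dmax_eq[OF assms] by blast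
 show "1 <= dmax g x" "dmax g x <= 2 ^ l" unfolding k(2) using k(1) by (simp_all add: power_increasing)
 show "x ~: max_set g (dmax g x)" unfolding k(2) using k(3) by simp
qed

lemma dmax_measurable:
 assumes "L1 g" "!!x. 0 <= g x" shows "dmax g \<in> bml"
proof -
 have "max_set g (2 ^ k) \<in> sets lebesgue" for k using open_max_set[OF assms] by (simp add: borel_open)
 then show ?thesis unfolding dmax_def[abs_def]
  by (intro borel_measurable_add borel_measurable_const borel_measurable_suminf borel_measurable_times borel_measurable_indicator)
qed

text \<open>Above \<open>t / 2\<close> the function \<open>g\<close> is at most
  \<open>(t / 2) powr (1 - p) * g powr p\<close>, which is inserted into the truncated weak type
  inequality.\<close>

lemma max_set_power_decay:
 fixes g :: "'a::euclidean_space => real"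
 assumes g: "L1 g" "!!x. 0 <= g x" and p: "1 <= p" "L1 (%x. g x powr p)"
 obtains C where "0 <= C" "!!t. 0 < t ==> vol (max_set g t) <= C * t powr (- p)"
proof
 define C where "C = 5 ^ DIM('a) * 2 powr p * (LI x. g x powr p)"
 show "0 <= C" by (simp add: C_def)
 fix t :: real assume t: "0 < t"
 define S where "S = {y. t / 2 < g y}"
 have S: "S \<in> sets lebesgue"
  using borel_measurable_integrable[OF g(1)] unfolding borel_measurable_iff_greater S_def
  by (simp del: less_divide_eq_numeral1 divide_less_eq_numeral1)
 have "(LINT y:S|lm. g y) <= (LI y. (t / 2) powr (1 - p) * g y powr p)" unfolding slint_def
 proof (rule integral_mono)
  show "L1 (%y. ind S y *\<^sub>R g y)" using integrable_restrict[OF g(1) S] by simp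
  show "L1 (%y. (t / 2) powr (1 - p) * g y powr p)" using p by simp
  fix y
  show "ind S y *\<^sub>R g y <= (t / 2) powr (1 - p) * g y powr p"
  proof (cases "y \<in> S")
   case True
   then have y: "t / 2 < g y" by (simp add: S_def)
   have "g y = g y powr (1 - p) * g y powr p" using y t by (simp flip: powr_add)
   also have "... <= (t / 2) powr (1 - p) * g y powr p" using y t p by (intro mult_right_mono powr_mono2') auto
   finally show ?thesis using True by simp
  qed simp
 qed
 then have "(LINT y:S|lm. g y) <= (t / 2) powr (1 - p) * (LI x. g x powr p)" by simp
 then have "2 * 5 ^ DIM('a) / t * (LINT y:S|lm. g y) <= 2 * 5 ^ DIM('a) / t * ((t / 2) powr (1 - p) * (LI x. g x powr p))"
  using t by (intro mult_left_mono) auto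
 then have "vol (max_set g t) <= 2 * 5 ^ DIM('a) / t * ((t / 2) powr (1 - p) * (LI x. g x powr p))"
  using max_set_weak_type_truncated[OF g t] unfolding S_def by (rule order_trans[rotated])
 also have "... = C * t powr (- p)"
 proof -
  have eq: "(t / 2) powr (1 - p) = t * t powr (- p) * (2 powr p / 2)"
  proof -
   have "(t / 2) powr (1 - p) = (t / 2) powr 1 * (t / 2) powr (- p)" by (simp only: powr_add[symmetric]) simp
   also have "(t / 2) powr (- p) = t powr (- p) / 2 powr (- p)" using t by (simp add: powr_divide)
   also have "... = t powr (- p) * 2 powr p" by (simp add: powr_minus field_simps)
   finally show ?thesis using t by simp
  qed
  show ?thesis unfolding C_def eq using t by simp
 qed
 finally show "vol (max_set g t) <= C * t powr (- p)" .
qed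

lemma AE_finite_maximal:
 fixes g :: "'a::euclidean_space => real"
 assumes g: "L1 g" "!!x. 0 <= g x"
 shows "AE x in lm. \<exists>k::nat. x ~: max_set g (2 ^ k)"
proof -
 define N where "N = (\<Inter>k::nat. max_set g (2 ^ k))"
 have N: "N \<in> sets lebesgue"
  unfolding N_def using open_max_set[OF g] by (intro sets.countable_INT) (auto simp: borel_open)
 have le: "vol N <= 5 ^ DIM('a) / 2 ^ k * integral\<^sup>L lebesgue g" for k
 proof -
  have "vol N <= vol (max_set g (2 ^ k))"
   by (rule measure_mono_fmeasurable[OF _ N max_set_weak_type(1)[OF g]]) (auto simp: N_def)
  also have "... <= 5 ^ DIM('a) / 2 ^ k * integral\<^sup>L lebesgue g" by (rule max_set_weak_type(2)[OF g]) simp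
  finally show ?thesis .
 qed
 have "(%k. 5 ^ DIM('a) * integral\<^sup>L lebesgue g / 2 ^ k) ----> 0" by (rule LIMSEQ_divide_realpow_zero) simp
 then have "vol N <= 0" by (rule LIMSEQ_le_const) (use le in "auto simp: mult.commute")
 moreover have "N \<in> lmeasurable"
  by (rule fmeasurableI2[OF max_set_weak_type(1)[OF g, of "2 ^ 0"] _ N]) (auto simp: N_def simp del: power_0)
 ultimately have "N \<in> null_sets lebesgue"
  using measure_nonneg[of lebesgue N] by (simp add: negligible_iff_measure flip: negligible_iff_null_sets)
 from AE_not_in[OF this] show ?thesis by (rule AE_mp) (auto simp: N_def)
qed

text \<open>Decay of order \<open>t powr (- p)\<close> suffices for every exponent
  \<open>q < p\<close>: the dyadic levels form a geometric series of ratio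
  \<open>2 powr (q - p)\<close>.\<close>

lemma dmax_powr_integrable:
 fixes g :: "'a::euclidean_space => real"
 assumes g: "L1 g" "!!x. 0 <= g x" and p: "1 <= p" "L1 (%x. g x powr p)"
  and q: "0 <= q" "q < p" and Q: "Q \<in> lmeasurable"
 shows "L1 (%x. ind Q x * dmax g x powr q)"
proof -
 obtain C where C: "0 <= C" "!!t. 0 < t ==> vol (max_set g t) <= C * t powr (- p)"
  using max_set_power_decay[OF g p] by blast
 \<comment> \<open>The exponent \<open>Suc k\<close> makes the term of the highest level equal to
   \<open>dmax g x powr q\<close>, so the sum dominates it.\<close>
 define b where "b k x = 2 powr (real (Suc k) * q) * ind (max_set g (2 ^ k)) x" for k and x :: 'a
 have bi: "L1 (b k)" for k
  unfolding b_def using max_set_weak_type(1)[OF g, of "2 ^ k"] by (intro integrable_mult_right) (simp add: lmeasurable_iff_integrable)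
 have fin: "AE x in lm. \<exists>k::nat. x ~: max_set g (2 ^ k)" by (rule AE_finite_maximal[OF g])
 have sumf: "summable (%k. b k x)" "dmax g x powr q <= 1 + (\<Sum>k. b k x)" if "x ~: max_set g (2 ^ l)" for x l
 proof -
  obtain k where k: "dmax g x = 2 ^ k" "!!i. x \<in> max_set g (2 ^ i) \<longleftrightarrow> i < k" using dmax_eq[OF \<open>x ~: max_set g (2 ^ l)\<close>] by blast
  show s: "summable (%k. b k x)" by (rule summable_finite[of "{..<k}"]) (auto simp: b_def k)
  have b0: "0 <= b i x" for i by (simp add: b_def)
  show "dmax g x powr q <= 1 + (\<Sum>k. b k x)"
  proof (cases k)
   case 0
   then show ?thesis using k suminf_nonneg[OF s b0] by simp
  next
   case (Suc i)
   have "dmax g x powr q = (2 powr real (Suc i)) powr q" using Suc k by (simp only: powr_realpow zero_less_numeral)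
   then have "dmax g x powr q = b i x" using Suc k(2)[of i] by (simp add: b_def powr_powr)
   moreover have "b i x <= (\<Sum>k. b k x)" using sum_le_suminf[OF s, of "{i}"] b0 by simp
   ultimately show ?thesis by simp
  qed
 qed
 have "L1 (%x. \<Sum>k. b k x)"
 proof (rule integrable_suminf[OF bi])
  show "AE x in lm. summable (%k. norm (b k x))" using fin
  proof eventually_elim
   case (elim x)
   then obtain l where "x ~: max_set g (2 ^ l)" by blast
   moreover have "norm (b k x) = b k x" for k by (simp add: b_def)
   ultimately show ?case using sumf(1)[of x l] by simp
  qed
  show "summable (%k. LI x. norm (b k x))"
  proof (rule summable_comparison_test'[of "%k. C * 2 powr q * (2 powr (q - p)) ^ k"])
   have "2 powr (q - p) < (1::real)" using q by (simp add: powr_less_one)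
   then show "summable (%k. C * 2 powr q * (2 powr (q - p)) ^ k)"
    by (intro summable_mult summable_geometric) simp
   fix k :: nat
   have "(LI x. norm (b k x)) = 2 powr (real (Suc k) * q) * vol (max_set g (2 ^ k))"
    by (simp add: b_def abs_mult)
   also have "... <= 2 powr (real (Suc k) * q) * (C * (2 ^ k) powr (- p))" by (intro mult_left_mono C) auto
   also have "... = C * 2 powr q * (2 powr (q - p)) ^ k"
   proof -
    have 1: "(2 ^ k) powr (- p) = 2 powr (real k * (- p))"
     by (simp only: powr_realpow[symmetric, of "2::real" k] powr_powr zero_less_numeral)
    have 2: "(2 powr (q - p)) ^ k = 2 powr ((q - p) * real k)"
     by (simp only: powr_realpow[symmetric, of "2 powr (q - p)" k] powr_powr powr_gt_zero)
    have "2 powr (real (Suc k) * q) * 2 powr (real k * (- p)) = 2 powr q * 2 powr ((q - p) * real k)"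
     unfolding powr_add[symmetric] by (simp add: algebra_simps)
    then show ?thesis unfolding 1 2 by (simp only: mult_ac)
   qed
   finally show "norm (LI x. norm (b k x)) <= C * 2 powr q * (2 powr (q - p)) ^ k" by simp
  qed
 qed
 then have i: "L1 (%x. ind Q x * (1 + (\<Sum>k. b k x)))" unfolding distrib_left mult_1_right
  by (intro int_add integrable_restrict fmeasurableD[OF Q]) (use Q in "simp add: lmeasurable_iff_integrable")
 show ?thesis
 proof (rule int_bound[OF i])
  show "(%x. ind Q x * dmax g x powr q) \<in> bml" using dmax_measurable[OF g] fmeasurableD[OF Q]
   by (intro borel_measurable_times borel_measurable_indicator) auto
  show "AE x in lm. norm (ind Q x * dmax g x powr q) <= norm (ind Q x * (1 + (\<Sum>k. b k x)))" using fin
  proof eventually_elim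
   case (elim x)
   then obtain l where "x ~: max_set g (2 ^ l)" by blast
   from sumf[OF this] show ?case by (auto simp: indicator_def)
  qed
 qed
qed

section \<open>Comparison of two truncation levels\<close>

lemma lebesgue_point_le:
 fixes h :: "'a::euclidean_space => real"
 assumes h: "L1 h" and x: "lebesgue_point h x" "x ~: max_set h t"
 shows "h x <= t"
proof (rule ccontr)
 assume "\<not> h x <= t"
 then obtain d where d: "d > 0" "!!r. 0 < r ==> r < d ==> (LINT y:ball x r|lm. abs(h y - h x)) <= (h x - t) / 2 * vol (ball x r)"
  using x(1) unfolding lebesgue_point_def by (metis diff_gt_0_iff_gt half_gt_zero not_le)
 define r where "r = d / 2"
 have r: "0 < r" "r < d" using d by (auto simp: r_def)
 define V where "V = vol (ball x r)"
 have V: "0 < V" using r by (simp add: V_def content_ball_pos)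
 have ib: "L1 (%y. ind (ball x r) y * h x)" by (rule integrable_ind_const) simp
 have ih: "L1 (%y. ind (ball x r) y * h y)" by (intro integrable_restrict h) simp
 have ia: "L1 (%y. ind (ball x r) y * abs(h y - h x))" by (rule integrable_ind_dist[OF h]) simp
 have "V * h x = (LI y. ind (ball x r) y * h x)" by (simp add: V_def)
 also have "... <= (LI y. ind (ball x r) y * h y + ind (ball x r) y * abs(h y - h x))"
  using ib ih ia by (intro integral_mono int_add) (auto simp: indicator_def)
 also have "... = (LINT y:ball x r|lm. h y) + (LINT y:ball x r|lm. abs(h y - h x))"
  using ih ia by (simp add: slint_def)
 also have "... <= t * V + (h x - t) / 2 * V"
  using max_set_notin_D[OF x(2) r(1)] d(2)[OF r] by (simp add: V_def)
 finally have "h x * V <= (t + (h x - t) / 2) * V" by (simp add: algebra_simps)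
 then have "h x <= t + (h x - t) / 2" using V by simp
 then show False using \<open>\<not> h x <= t\<close> by (simp add: field_simps)
qed

lemma max_set_mono:
 assumes "L1 H" "!!x. 0 <= h x" "!!x. h x <= H x" "L1 h"
 shows "max_set h t \<subseteq> max_set H t"
 unfolding max_set_def
proof safe
 fix x r assume r: "t * vol (ball x r) < (LINT y:ball x r|lm. h y)" "0 < r"
 have "(LINT y:ball x r|lm. h y) <= (LINT y:ball x r|lm. H y)" unfolding slint_def
 proof (rule integral_mono)
  show "L1 (%y. ind (ball x r) y *\<^sub>R h y)" "L1 (%y. ind (ball x r) y *\<^sub>R H y)"
   unfolding real_scaleR_def by (intro integrable_restrict assms; simp)+
 qed (use assms in "auto simp: indicator_def")
 then show "\<exists>r\<in>{0<..}. t * vol (ball x r) < (LINT y:ball x r|lm. H y)" using r by (intro bexI[of _ r]) auto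
qed

lemma cube_norm_le:
 fixes x :: "real ^ 'n::finite"
 assumes "y \<in> cube x r" shows "norm (y - x) <= real CARD('n) * r"
proof -
 have "norm (y - x) <= (\<Sum>l\<in>UNIV. abs((y - x) $ l))" by (rule norm_le_l1_cart)
 also have "... <= (\<Sum>l\<in>(UNIV::'n set). r)" by (rule sum_mono) (use assms in "simp add: cube_def")
 finally show ?thesis by simp
qed

lemma cube_integral_le:
 fixes x :: "real ^ 'n::finite"
 assumes "!!y. y \<in> cube x r ==> v y <= B" "0 < r" "0 <= B"
 shows "(LINT y:cube x r|lm. v y) <= B * (2 * r) ^ CARD('n)"
proof (cases "set_integrable lebesgue (cube x r) v")
 case True
 have "(LINT y:cube x r|lm. v y) <= (LINT y:cube x r|lm. B)" unfolding slint_def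
 proof (rule integral_mono)
  show "L1 (%y. ind (cube x r) y *\<^sub>R v y)" using True by (simp add: set_integrable_def)
  show "L1 (%y. ind (cube x r) y *\<^sub>R B)"
   using cube_lmeasurable[of x r] lmeasurable_iff_integrable[of "cube x r"] by (simp add: integrable_mult_left)
 qed (use assms in "auto simp: indicator_def")
 also have "... = B * (2 * r) ^ CARD('n)" using assms by (simp add: slint_def measure_cube)
 finally show ?thesis .
next
 case False
 then show ?thesis using assms by (simp add: set_integrable_def slint_def not_integrable_integral_eq)
qed

lemma form_at_cong:
 assumes "!!j i. i < m ==> v j i = v' j i" shows "form_at m phi q v = form_at m phi q v'"
proof -
 have "dx I v = dx I v'" if "I \<in> multi_indices m" for I
  unfolding dx_def using that assms by (auto simp: multi_indices_def image_subset_iff intro!: arg_cong[of _ _ det] simp: vec_eq_iff)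
 then show ?thesis by (simp add: form_at_def)
qed

lemma AE_cube_interior:
 fixes a :: "real ^ 'n::finite"
 shows "AE x in lm. x \<in> cube a R --> (\<exists>rho>0. cube x rho \<subseteq> cube a (R::real))"
proof -
 have "negligible (frontier (cube a R))" unfolding cube_eq_cbox by (rule negligible_convex_frontier[OF convex_box(1)])
 then have "AE x in lm. x ~: frontier (cube a R)" by (intro AE_not_in) (simp add: negligible_iff_null_sets)
 then show ?thesis
 proof (rule AE_mp, intro AE_I2 impI)
  fix x assume "x ~: frontier (cube a R)" "x \<in> cube a R"
  then have "x \<in> interior (cube a R)" using closure_subset[of "cube a R"] by (auto simp: frontier_def)
  then obtain e where e: "e > 0" "ball x e \<subseteq> cube a R" by (auto simp: mem_interior)
  have "cube x (e / (2 * real CARD('n))) \<subseteq> ball x e"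
   by (rule cube_subset_ball[of _ _ _ "e / (2 * real CARD('n))"]) (use e in auto)
  then show "\<exists>rho>0. cube x rho \<subseteq> cube a R" using e by (intro exI[of _ "e / (2 * real CARD('n))"]) auto
 qed
qed

section \<open>Truncating and mollifying the curve on a cube\<close>

definition slope_const :: "nat => real" where
 "slope_const n = grad_const n * lip_const n * real n * 2 ^ n"

text \<open>The data on one cube. Map and differential are multiplied by the indicator of the cube,
  so that averages near its boundary make sense, and \<open>h\<close> dominates all entries of the
  differential.\<close>

locale form_cube =
 fixes m :: nat and phi :: "'n::{finite,linorder} form" and a :: "real ^ 'n::{finite,linorder}" and R :: real
  and f :: "real ^ 'n::{finite,linorder} => nat => real" and D :: "real ^ 'n::{finite,linorder} => 'n => nat => real"
  and h :: "real ^ 'n::{finite,linorder} => real" and L :: real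
 assumes n2: "2 <= CARD('n)" and m: "0 < m" and R: "0 < R"
  and phi: "!!I. I \<in> multi_indices m ==> Ck_Rm m (Suc 0) (phi I)" and cl: "closed_form m phi"
  and L: "!!q. q \<in> Rm m ==> (\<Sum>I\<in>multi_indices m. abs(phi I q)) <= L" and fR: "!!x. f x \<in> Rm m"
  and wg: "!!i. i < m ==> wgrad (cube a R) (%x. ind (cube a R) x * f x i) (%j x. ind (cube a R) x * D x j i)"
  and Dh: "!!i j x. i < m ==> abs(ind (cube a R) x * D x j i) <= h x" and h: "L1 h"
  and J: "L1 (%x. ind (cube a R) x * form_at m phi (f x) (D x))"
begin

text \<open>The exponent gained in \<open>chain_power\<close>: truncations at height
  \<open>t\<close> will oscillate by at most a multiple of \<open>t powr (1 - kap)\<close>.\<close>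

definition kap where "kap = 1 / (2 * real CARD('n))"

lemma h_nonneg: "0 <= h x"
 using Dh[OF m, of x] abs_ge_zero order_trans by blast

lemma L_nonneg: "0 <= L"
 using L[OF fR] by (meson abs_ge_zero order_trans sum_nonneg)

lemma kap: "0 < kap" "kap <= 1 / 4"
 using n2 by (auto simp: kap_def field_simps)

end

text \<open>Two majorants are kept apart: \<open>h\<close> belongs to the cube on which the curve is
  truncated, while \<open>H\<close> is meant to come from a larger cube and carries integrability to
  a power above \<open>n - kap\<close>. One function \<open>H\<close> then serves for all
  intermediate cubes.\<close>

locale truncation = form_cube m phi a R f D h L
 for m and phi :: "'n::{finite,linorder} form" and a R f D h L +
 fixes H and p Cf :: real
 assumes H: "L1 H" "!!x. h x <= H x"
  and p: "real CARD('n) - 1 / (2 * real CARD('n)) < p" "L1 (%x. H x powr p)"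
  and Cf: "0 < Cf" "power_const CARD('n) * sqrt R * (integral\<^sup>L lebesgue h) powr (1 / (2 * real CARD('n))) <= Cf"
begin

definition Q where "Q = cube a R"
definition uu where "uu i x = ind Q x * f x i"
definition ww where "ww i j x = ind Q x * D x j i"
text \<open>Points at which all pointwise estimates apply; the last clause makes the maximal
  function finite, so that \<open>dmax H\<close> is meaningful.\<close>

definition good where "good x \<longleftrightarrow> (\<forall>i<m. lebesgue_point (uu i) x \<and> (\<forall>j. lebesgue_point (ww i j) x)) \<and>
  lebesgue_point h x \<and> (\<exists>k::nat. x ~: max_set H (2 ^ k))"
text \<open>On this set the components of the curve are Lipschitz with a constant of order
  \<open>2 ^ k\<close>, and it is from here that they are extended.\<close>

definition F where "F k = {x \<in> Q. good x \<and> x ~: max_set h (2 ^ k)}" for k :: nat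

lemma H_nonneg: "0 <= H x"
 using h_nonneg H(2) order_trans by blast

lemma p_gt_1: "1 < p"
proof -
 have "2 <= real CARD('n)" using n2 by (simp add: numeral_le_real_of_nat_iff)
 then show ?thesis using p(1) kap unfolding kap_def by linarith
qed

lemma uu_int: "i < m ==> L1 (uu i)" and ww_int: "i < m ==> L1 (ww i j)"
 using wg[of i] unfolding wgrad_def uu_def[abs_def] ww_def[abs_def] Q_def by auto

lemma uu_eq: "x \<in> Q ==> uu i x = f x i" and ww_eq: "x \<in> Q ==> ww i j x = D x j i"
 by (auto simp: uu_def ww_def)

lemma gb: "i < m ==> gradient_bound a R (uu i) (ww i) h"
 using R wg[of i] Dh[of i] h unfolding gradient_bound_def uu_def[abs_def] ww_def[abs_def] Q_def by auto

lemma max_set_hH: "max_set h t \<subseteq> max_set H t"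
 by (rule max_set_mono[OF H(1) h_nonneg H(2) h])

lemma good_finite: "good x ==> \<exists>k::nat. x ~: max_set H (2 ^ k)"
 by (simp add: good_def)

lemma good_notin_dmax:
 assumes "good x" shows "x ~: max_set H (dmax H x)" "x ~: max_set h (dmax H x)" "1 <= dmax H x"
 using good_finite[OF assms] dmax_notin[of x H] max_set_hH by blast+

lemma h_le_dmax: "good x ==> h x <= dmax H x"
 using lebesgue_point_le[OF h] good_notin_dmax(2)[of x] unfolding good_def by blast

lemma AE_good: "AE x in lm. good x"
proof -
 have "AE x in lm. \<forall>i\<in>{..<m}. lebesgue_point (uu i) x"
  by (rule AE_finite_allI) (auto intro: AE_lebesgue_point uu_int)
 moreover have "AE x in lm. \<forall>i\<in>{..<m}. \<forall>j\<in>UNIV. lebesgue_point (ww i j) x"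
  by (intro AE_finite_allI) (auto intro: AE_lebesgue_point ww_int)
 moreover have "AE x in lm. lebesgue_point h x" by (rule AE_lebesgue_point[OF h])
 moreover have "AE x in lm. \<exists>k::nat. x ~: max_set H (2 ^ k)" by (rule AE_finite_maximal[OF H(1) H_nonneg])
 ultimately show ?thesis by eventually_elim (auto simp: good_def)
qed

lemma bad_null: "{x. \<not> good x} \<in> null_sets lebesgue"
proof -
 obtain N where "negligible N" "{x. \<not> good x} \<subseteq> N"
  using AE_good unfolding eventually_ae_filter_negligible by auto
 then show ?thesis using negligible_subset negligible_iff_null_sets by blast
qed

lemma max_set_h_meas: "max_set h t \<in> sets lebesgue"
 using open_max_set[OF h h_nonneg] by (simp add: borel_open)

lemma F_meas: "F k \<in> sets lebesgue"
proof -
 have "F k = (Q - {x. \<not> good x}) - max_set h (2 ^ k)" by (auto simp: F_def)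
 moreover have "{x. \<not> good x} \<in> sets lebesgue" using bad_null by blast
 ultimately show ?thesis using max_set_h_meas cube_sets[of a R] by (auto simp: Q_def intro!: sets.Diff)
qed

lemma F_sub: "F k \<subseteq> Q" by (auto simp: F_def)

lemma F_mono: "k <= l ==> F k \<subseteq> F l"
 using max_set_antimono[of "2 ^ k" "2 ^ l" h] by (auto simp: F_def)

lemma Q_diff_F: "Q - F k \<in> lmeasurable" "vol (Q - F k) <= vol (max_set h (2 ^ k))"
proof -
 show 1: "Q - F k \<in> lmeasurable" using F_meas by (intro fmeasurable_Diff) (auto simp: Q_def)
 have bad_lm: "{x. \<not> good x} \<in> lmeasurable"
  using bad_null by (simp add: negligible_iff_null_sets[symmetric] negligible_imp_measurable)
 have 2: "max_set h (2 ^ k) \<in> lmeasurable" by (rule max_set_weak_type(1)[OF h h_nonneg]) simp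
 have "vol (Q - F k) <= vol ({x. \<not> good x} \<union> max_set h (2 ^ k))"
  using bad_lm 2 by (intro measure_mono_fmeasurable fmeasurableD[OF 1] fmeasurable.Un) (auto simp: F_def)
 also have "... <= vol {x. \<not> good x} + vol (max_set h (2 ^ k))"
  using bad_null max_set_h_meas by (intro measure_Un_le) auto
 also have "vol {x. \<not> good x} = 0" using bad_null by (simp add: null_sets_def measure_eq_emeasure_eq_ennreal)
 finally show "vol (Q - F k) <= vol (max_set h (2 ^ k))" by simp
qed

lemma f_lipschitz:
 assumes "i < m" "x \<in> Q" "y \<in> Q" "good x" "good y" "x ~: max_set h t" "y ~: max_set h t" "0 <= t"
 shows "abs(f x i - f y i) <= lip_const CARD('n) * t * norm (x - y)"
 using gradient_bound.lipschitz_maximal[OF gb[OF assms(1)], of x t y] assms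
 by (simp add: good_def uu_eq Q_def[symmetric])

lemma f_power:
 assumes "i < m" "x \<in> Q" "good x" "x ~: max_set h t" "0 < t"
 shows "abs(f x i - avg (uu i) a R) <= Cf * t powr (1 - kap)"
proof -
 have "(LINT y:cube a R|lm. h y) <= integral\<^sup>L lebesgue h" by (rule set_integral_le_integral[OF h h_nonneg]) simp
 from gradient_bound.chain_power[OF gb[OF assms(1)] _ _ assms(4,5) this]
 have "abs(f x i - avg (uu i) a R) <= power_const CARD('n) * sqrt R * (integral\<^sup>L lebesgue h) powr (1 / (2 * real CARD('n))) * t powr (1 - kap)"
  using assms by (simp add: good_def uu_eq Q_def[symmetric] kap_def)
 also have "... <= Cf * t powr (1 - kap)" by (intro mult_right_mono Cf) auto
 finally show ?thesis .
qed

text \<open>A McShane extension for the minimum of two pseudometrics: the slope stays of order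
  \<open>2 ^ k\<close>, the oscillation of the smaller order
  \<open>(2 ^ k) powr (1 - kap)\<close>.\<close>

definition ext where
 "ext k i = (SOME g. (\<forall>x\<in>F k. g x = f x i) \<and>
   (\<forall>x y. abs(g x - g y) <= min (lip_const CARD('n) * 2 ^ k * norm (x - y)) (2 * Cf * (2 ^ k) powr (1 - kap))))"
 for k i

lemma lip0: "0 < lip_const CARD('n)"
 by (rule lip_const_pos) simp

lemma ext:
 assumes "i < m" "F k ~= {}"
 shows "x \<in> F k ==> ext k i x = f x i"
  "abs(ext k i x - ext k i y) <= lip_const CARD('n) * 2 ^ k * norm (x - y)"
  "abs(ext k i x - ext k i y) <= 2 * Cf * (2 ^ k) powr (1 - kap)"
proof -
 define sgm where "sgm x y = min (lip_const CARD('n) * 2 ^ k * norm (x - y)) (2 * Cf * (2 ^ k) powr (1 - kap))" for x y :: "real ^ 'n::{finite,linorder}"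
 have "\<exists>g. (\<forall>x\<in>F k. g x = f x i) \<and> (\<forall>x y. abs(g x - g y) <= sgm x y)"
 proof (rule mcshane_extension[of "F k" "%x. f x i" sgm])
  show "F k ~= {}" by fact
  fix x y z :: "real ^ 'n::{finite,linorder}"
  have "norm (x - z) <= norm (x - y) + norm (y - z)" using norm_triangle_ineq[of "x - y" "y - z"] by simp
  then have "lip_const CARD('n) * 2 ^ k * norm (x - z) <= lip_const CARD('n) * 2 ^ k * (norm (x - y) + norm (y - z))"
   using lip0 by (intro mult_left_mono) auto
  moreover have "0 <= lip_const CARD('n) * 2 ^ k * norm (x - y)" "0 <= lip_const CARD('n) * 2 ^ k * norm (y - z)" "0 <= 2 * Cf * (2 ^ k) powr (1 - kap)"
   using lip0 Cf by auto
  ultimately show "sgm x z <= sgm x y + sgm y z" unfolding sgm_def distrib_left by linarith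
  show "sgm x x = 0" using Cf by (simp add: sgm_def)
  show "sgm x y = sgm y x" by (simp add: sgm_def norm_minus_commute)
 next
  fix x y assume "x \<in> F k" "y \<in> F k"
  then show "abs(f x i - f y i) <= sgm x y"
   using f_lipschitz[OF assms(1), of x y "2 ^ k"] f_power[OF assms(1), of x "2 ^ k"] f_power[OF assms(1), of y "2 ^ k"]
   unfolding sgm_def F_def by auto
 qed blast
 from someI_ex[OF this[unfolded sgm_def]]
 have "(\<forall>x\<in>F k. ext k i x = f x i) \<and>
   (\<forall>x y. abs(ext k i x - ext k i y) <= min (lip_const CARD('n) * 2 ^ k * norm (x - y)) (2 * Cf * (2 ^ k) powr (1 - kap)))"
  unfolding ext_def .
 then show "x \<in> F k ==> ext k i x = f x i"
  "abs(ext k i x - ext k i y) <= lip_const CARD('n) * 2 ^ k * norm (x - y)"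
  "abs(ext k i x - ext k i y) <= 2 * Cf * (2 ^ k) powr (1 - kap)" by auto
qed

lemma pow_le: "(2 ^ k) powr (1 - kap) <= (2::real) ^ k"
proof -
 have "(2 ^ k) powr (1 - kap) <= ((2::real) ^ k) powr 1" using kap by (intro powr_mono) auto
 then show ?thesis by simp
qed

lemma ext_continuous: assumes "i < m" "F k ~= {}" shows "cont (ext k i)"
proof (rule continuous_onI)
 fix x :: "real ^ 'n::{finite,linorder}" and e :: real assume e: "0 < e"
 define A where "A = lip_const CARD('n) * 2 ^ k"
 have A: "0 < A" using lip0 by (simp add: A_def)
 show "\<exists>d>0. \<forall>x'\<in>UNIV. dist x' x < d --> dist (ext k i x') (ext k i x) <= e"
 proof (intro exI[of _ "e / A"] conjI ballI impI)
  fix y assume "dist y x < e / A"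
  then have "A * norm (y - x) < e" using A by (simp add: dist_norm field_simps)
  then show "dist (ext k i y) (ext k i x) <= e" using ext(2)[OF assms, of y x] by (simp add: dist_norm A_def)
 qed (use e A in simp)
qed

text \<open>The extension is cut off to become integrable. As \<open>eps N\<close> is at most one,
  averages at points of \<open>Q\<close> never see the cut.\<close>

definition vv where "vv k i x = ind (cube a (R + 1)) x * ext k i x" for k i x
definition eps where "eps N = 1 / (real N + 1)" for N :: nat
definition G where "G k N x i = (if i < m then avg (vv k i) x (eps N) else 0)" for k N x i
definition dG where "dG k N x j i = (if i < m then - moll (dbk (eps N) j) (vv k i) x else 0)" for k N x j i

lemma eps: "0 < eps N" "eps N <= 1" "eps ----> 0"
proof -
 show "0 < eps N" "eps N <= 1" by (auto simp: eps_def)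
 show "eps ----> 0" unfolding eps_def[abs_def] using LIMSEQ_inverse_real_of_nat by (simp add: inverse_eq_divide add.commute)
qed

lemma cube_in: "x \<in> Q ==> cube x (eps N) \<subseteq> cube a (R + 1)"
 by (rule cube_subset_cube) (use eps(2)[of N] in "auto simp: Q_def cube_def intro: add_mono")

lemma vv_eq: "x \<in> Q ==> y \<in> cube x (eps N) ==> vv k i y = ext k i y"
 using cube_in[of x N] by (auto simp: vv_def)

lemma vv_int: assumes "i < m" "F k ~= {}" shows "L1 (vv k i)"
 unfolding vv_def[abs_def]
proof (rule integrable_mult_continuous_bounded[OF _ ext_continuous[OF assms]])
 show "L1 (ind (cube a (R + 1)) :: _ => real)" using cube_lmeasurable lmeasurable_iff_integrable by blast
 show "abs(ext k i y) <= abs(ext k i a) + 2 * Cf * (2 ^ k) powr (1 - kap)" for y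
  using ext(3)[OF assms, of y a] by linarith
qed

lemma avg_ext:
 assumes "i < m" "F k ~= {}" "x \<in> Q" "0 <= B" "!!y. y \<in> cube x (eps N) ==> abs(ext k i y - z) <= B"
 shows "abs(avg (vv k i) x (eps N) - z) <= (2 * bump_max) ^ CARD('n) * B"
proof -
 have "abs(avg (vv k i) x (eps N) - z) <= (bump_max / eps N) ^ CARD('n) * (LINT y:cube x (eps N)|lm. abs(vv k i y - z))"
  by (rule avg_minus_le[OF vv_int[OF assms(1,2)] eps(1)]) auto
 also have "... <= (bump_max / eps N) ^ CARD('n) * (B * (2 * eps N) ^ CARD('n))"
  using eps(1)[of N] bump_max(1) assms vv_eq[OF assms(3)] by (intro mult_left_mono cube_integral_le) auto
 also have "... = (2 * bump_max) ^ CARD('n) * B"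
  using eps(1)[of N] by (simp add: power_divide power_mult_distrib)
 finally show ?thesis .
qed

lemma G_tendsto:
 assumes "i < m" "F k ~= {}" "x \<in> Q" shows "(%N. G k N x i) ----> ext k i x"
proof -
 define A where "A = (2 * bump_max) ^ CARD('n) * (lip_const CARD('n) * 2 ^ k * real CARD('n))"
 have le: "norm (G k N x i - ext k i x) <= A * eps N" for N
 proof -
  define B where "B = lip_const CARD('n) * 2 ^ k * (real CARD('n) * eps N)"
  have "abs(avg (vv k i) x (eps N) - ext k i x) <= (2 * bump_max) ^ CARD('n) * B"
  proof (rule avg_ext[OF assms])
   show "0 <= B" using lip0 eps(1)[of N] by (simp add: B_def)
   fix y assume "y \<in> cube x (eps N)"
   then have "lip_const CARD('n) * 2 ^ k * norm (y - x) <= B"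
    using lip0 unfolding B_def by (intro mult_left_mono cube_norm_le) auto
   then show "abs(ext k i y - ext k i x) <= B" using ext(2)[OF assms(1,2), of y x] by linarith
  qed
  also have "(2 * bump_max) ^ CARD('n) * B = A * eps N" unfolding A_def B_def by (simp only: mult.assoc)
  finally show ?thesis unfolding G_def using assms(1) by simp
 qed
 have "(%N. A * eps N) ----> A * 0" by (rule tendsto_mult[OF tendsto_const eps(3)])
 then have "(%N. A * eps N) ----> 0" by (simp only: mult_zero_right)
 from Lim_null_comparison[OF always_eventually[OF allI[OF le]] this] show ?thesis by (rule LIM_zero_cancel)
qed

lemma slope0: "0 < slope_const CARD('n)"
 unfolding slope_const_def grad_const_def using lip0 dbump_max(1) bump_max(1) by simp

lemma dG_bound:
 assumes "F k ~= {}" "x \<in> Q" shows "abs(dG k N x j i) <= slope_const CARD('n) * 2 ^ k"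
proof (cases "i < m")
 case True
 define r where "r = eps N"
 have r: "0 < r" using eps by (simp add: r_def)
 have gc: "0 <= grad_const CARD('n)" unfolding grad_const_def using dbump_max(1) bump_max(1) by simp
 \<comment> \<open>Subtracting the value at \<open>x\<close> leaves a difference of at most the
   slope times \<open>n * r\<close>; this one power of \<open>r\<close> makes the bound independent
   of the scale.\<close>
 have "abs(moll (dbk r j) (vv k i) x) <= grad_const CARD('n) / r ^ (CARD('n) + 1) * (LINT y:cube x r|lm. abs(vv k i y - ext k i x))"
  by (rule dbk_moll_le[OF vv_int[OF True assms(1)] r])
 also have "... <= grad_const CARD('n) / r ^ (CARD('n) + 1) * ((lip_const CARD('n) * 2 ^ k * (real CARD('n) * r)) * (2 * r) ^ CARD('n))"
 proof (intro mult_left_mono cube_integral_le r)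
  fix y assume y: "y \<in> cube x r"
  then have "lip_const CARD('n) * 2 ^ k * norm (y - x) <= lip_const CARD('n) * 2 ^ k * (real CARD('n) * r)"
   using lip0 by (intro mult_left_mono cube_norm_le) auto
  then show "abs(vv k i y - ext k i x) <= lip_const CARD('n) * 2 ^ k * (real CARD('n) * r)"
   using ext(2)[OF True assms(1), of y x] vv_eq[OF assms(2), of y N k i] y by (simp add: r_def)
 qed (use lip0 r gc in auto)
 also have "... = slope_const CARD('n) * 2 ^ k" using r by (simp add: slope_const_def power_mult_distrib)
 finally show ?thesis using True by (simp add: dG_def r_def)
qed (use slope0 in "simp add: dG_def")

lemma C2_G: assumes "F k ~= {}" shows "\<exists>g2. C2_map m (G k N) (dG k N) g2"
 unfolding G_def[abs_def] dG_def[abs_def] by (rule C2_map_avg[OF vv_int[OF _ assms] eps(1)])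

end

lemma form_at_tendsto:
 assumes phi: "!!I. I \<in> multi_indices m ==> continuous_map (Euclidean_space m) euclideanreal (phi I)"
  and q: "!!i. ((%z. q z i) ---> q0 i) F" "!!z. q z \<in> Rm m" "q0 \<in> Rm m"
  and p: "!!l i. ((%z. p z l i) ---> p0 l i) F"
 shows "((%z. form_at m phi (q z) (p z)) ---> form_at m phi q0 p0) F"
 unfolding form_at_def by (intro tendsto_sum tendsto_mult dx_tendsto[OF p] tendsto_Rm_comp[OF phi q])

lemma continuous_cbox_integral:
 fixes g :: "'a::euclidean_space => real"
 assumes "cont g"
 shows "L1 (%x. ind (cbox a b) x * g x)"
  "integral (cbox a b) g = (LI x. ind (cbox a b) x * g x)"
proof -
 have *: "set_integrable lebesgue (cbox a b) g"
  by (rule absolutely_integrable_continuous[OF continuous_on_subset[OF assms]]) simp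
 then show "L1 (%x. ind (cbox a b) x * g x)" by (simp add: set_integrable_def)
 show "integral (cbox a b) g = (LI x. ind (cbox a b) x * g x)"
  using set_lebesgue_integral_eq_integral(2)[OF *] by (simp add: slint_def)
qed

lemma moll_diff:
 fixes u :: "real ^ 'n::finite => real"
 assumes "L1 u" "L1 v" "0 < r"
 shows "moll (dbk r j) (%y. u y - v y) x = moll (dbk r j) u x - moll (dbk r j) v x"
proof -
 have c: "cont (%y. coord_prod (dbk r j) (y - x))"
  by (rule continuous_on_compose2[OF coord_prod_continuous[OF dbk_smooth]]) (auto intro!: continuous_intros)
 have i: "L1 (%y. w y * coord_prod (dbk r j) (y - x))" if "L1 w" for w
  by (rule integrable_mult_continuous_bounded[OF that c dbk_prod_le(1)[OF assms(3)]])
 show ?thesis unfolding moll_def left_diff_distrib by (rule lint_diff[OF i[OF assms(1)] i[OF assms(2)]])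
qed

context truncation begin

lemma phic: "I \<in> multi_indices m ==> continuous_map (Euclidean_space m) euclideanreal (phi I)"
 using phi[of I] by simp

lemma dmax_int: "L1 (%x. ind Q x * dmax H x powr q)" if "0 <= q" "q < p"
 using dmax_powr_integrable[OF H(1) H_nonneg _ p(2) that] p_gt_1 cube_lmeasurable[of a R] by (simp add: Q_def)

lemma Q_diff_F_indicator: "L1 (ind (Q - F k) :: _ => real)"
 using Q_diff_F(1) lmeasurable_iff_integrable by blast

text \<open>The extension and the curve differ only off \<open>F k\<close>, and at a point
  \<open>y\<close> near \<open>x\<close> by at most a multiple of the distance times
  \<open>2 ^ k\<close> plus the maximal function at \<open>y\<close>. The function \<open>K\<close>
  formed by these bounds vanishes on \<open>F k\<close>, so at a Lebesgue point of \<open>K\<close>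
  the derivative of the mollified difference tends to zero, and what remains is the mollified weak
  gradient.\<close>

lemma dG_tendsto:
 assumes i: "i < m" and ne: "F k ~= {}"
 shows "AE x in lm. x \<in> F k --> (%N. dG k N x j i) ----> D x j i"
proof -
 define K where "K y = ind (Q - F k) y * (2 ^ k + dmax H y powr 1)" for y
 have Ki: "L1 K"
 proof -
  have "L1 (%y. 2 ^ k * ind (Q - F k) y + ind (Q - F k) y * (ind Q y * dmax H y powr 1))"
   using Q_diff_F(1) p_gt_1
   by (intro int_add integrable_mult_right Q_diff_F_indicator integrable_restrict dmax_int) auto
  moreover have "(%y. 2 ^ k * ind (Q - F k) y + ind (Q - F k) y * (ind Q y * dmax H y powr 1)) = K"
   by (auto simp: K_def fun_eq_iff indicator_def)
  ultimately show ?thesis by simp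
 qed
 have "AE x in lm. lebesgue_point K x" by (rule AE_lebesgue_point[OF Ki])
 moreover have "AE x in lm. x \<in> cube a R --> (\<exists>rho>0. cube x rho \<subseteq> cube a R)" by (rule AE_cube_interior)
 ultimately show ?thesis
 proof (rule AE_mp[OF AE_conjI], intro AE_I2 impI)
  fix x assume asm: "lebesgue_point K x \<and> (x \<in> cube a R --> (\<exists>rho>0. cube x rho \<subseteq> cube a R))" and xF: "x \<in> F k"
  have xQ: "x \<in> Q" "good x" "x ~: max_set h (2 ^ k)" using xF by (auto simp: F_def)
  obtain rho where rho: "rho > 0" "cube x rho \<subseteq> Q" using asm xQ by (auto simp: Q_def)
  have Kx: "K x = 0" using xF by (simp add: K_def)
  have K0: "0 <= K y" for y by (auto simp: K_def indicator_def)
  obtain N0 where N0: "!!N. N0 <= N ==> eps N < rho"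
   using LIMSEQ_D[OF eps(3) rho(1)] eps(1) by (auto simp: abs_of_pos)
  have cQ: "cube x (eps N) \<subseteq> Q" if "N0 <= N" for N using N0[OF that] rho(2) cube_mono[of "eps N" rho x] by auto
  define A where "A = grad_const CARD('n) * (2 * lip_const CARD('n) * real CARD('n))"
  have gc: "0 <= grad_const CARD('n)" unfolding grad_const_def using dbump_max(1) bump_max(1) by simp
  have le: "norm (dG k N x j i - avg (ww i j) x (eps N)) <= A * ((LINT y:cube x (eps N)|lm. abs(K y - K x)) / eps N ^ CARD('n))"
   if N: "N0 <= N" for N
  proof -
   define r where "r = eps N"
   have r: "0 < r" using eps by (simp add: r_def)
   have wg': "wgrad Q (uu i) (ww i)" using wg[OF i] by (simp add: Q_def uu_def[abs_def] ww_def[abs_def])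
   have "avg (ww i j) x r = - moll (dbk r j) (uu i) x"
    using wgrad_dbk[OF wg' r, of x j] cQ[OF N] by (simp add: r_def)
   then have "dG k N x j i - avg (ww i j) x r = - moll (dbk r j) (%y. vv k i y - uu i y) x"
    using moll_diff[OF vv_int[OF i ne] uu_int[OF i] r, of j x] i by (simp add: dG_def r_def)
   then have "abs(dG k N x j i - avg (ww i j) x r) <= grad_const CARD('n) / r ^ (CARD('n) + 1) * (LINT y:cube x r|lm. abs((vv k i y - uu i y) - 0))"
    using dbk_moll_le[OF int_diff[OF vv_int[OF i ne] uu_int[OF i]] r, of j x 0] by simp
   also have "... <= grad_const CARD('n) / r ^ (CARD('n) + 1) * (2 * lip_const CARD('n) * (real CARD('n) * r) * (LINT y:cube x r|lm. abs(K y - K x)))"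
   proof (intro mult_left_mono)
    have "(LINT y:cube x r|lm. abs((vv k i y - uu i y) - 0)) <= (LI y. 2 * lip_const CARD('n) * (real CARD('n) * r) * (ind (cube x r) y * K y))"
     unfolding slint_def
    proof (rule integral_mono_AE)
     have "L1 (%y. ind (cube x r) y * abs(vv k i y - uu i y))"
      by (intro integrable_restrict integrable_abs int_diff vv_int[OF i ne] uu_int[OF i]) simp
     then show "L1 (%y. ind (cube x r) y *\<^sub>R (abs(vv k i y - uu i y - 0)))" by simp
     show "L1 (%y. 2 * lip_const CARD('n) * (real CARD('n) * r) * (ind (cube x r) y * K y))"
      by (intro integrable_mult_right integrable_restrict Ki) simp
     show "AE y in lm. ind (cube x r) y *\<^sub>R (abs(vv k i y - uu i y - 0)) <= 2 * lip_const CARD('n) * (real CARD('n) * r) * (ind (cube x r) y * K y)"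
      using AE_good
     proof (rule AE_mp, intro AE_I2 impI)
      fix y assume gy: "good y"
      have c0: "0 <= lip_const CARD('n) * (real CARD('n) * r)" using lip0 r by simp
      show "ind (cube x r) y *\<^sub>R (abs(vv k i y - uu i y - 0)) <= 2 * lip_const CARD('n) * (real CARD('n) * r) * (ind (cube x r) y * K y)"
      proof (cases "y \<in> cube x r")
       case True
       then have yQ: "y \<in> Q" using cQ[OF N] by (auto simp: r_def)
       have v: "vv k i y = ext k i y" using vv_eq[OF xQ(1), of y N k i] True by (simp add: r_def)
       have u: "uu i y = f y i" using uu_eq[OF yQ] .
       show ?thesis
       proof (cases "y \<in> F k")
        case True
        have "0 <= lip_const CARD('n) * (real CARD('n) * r) * (ind (cube x r) y * K y)"
          by (rule mult_nonneg_nonneg[OF c0]) (use K0[of y] in simp)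
         then show ?thesis using ext(1)[OF i ne True] v u by (simp add: mult_ac)
       next
        case False
        \<comment> \<open>A height above both the bound at \<open>x\<close> and the one at
          \<open>y\<close>, so that the Lipschitz estimate applies to the pair.\<close>
        define T where "T = 2 ^ k + dmax H y"
        have d1: "1 <= dmax H y" "y ~: max_set h (dmax H y)" using good_notin_dmax[OF gy] by auto
        have nm: "norm (y - x) <= real CARD('n) * r" by (rule cube_norm_le) (use True in simp)
        have T: "2 ^ k <= T" "dmax H y <= T" "0 <= T" using d1 zero_le_power[of "2::real" k] unfolding T_def by linarith+
        have nin: "x ~: max_set h T" "y ~: max_set h T"
         using max_set_antimono[OF T(1), of h] max_set_antimono[OF T(2), of h] xQ(3) d1(2) by auto
        have "abs(f y i - f x i) <= lip_const CARD('n) * T * norm (y - x)"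
         by (rule f_lipschitz[OF i yQ xQ(1) gy xQ(2) nin(2,1) T(3)])
        also have "... <= lip_const CARD('n) * T * (real CARD('n) * r)"
         using lip0 T by (intro mult_left_mono nm) auto
        finally have 1: "abs(f y i - f x i) <= lip_const CARD('n) * T * (real CARD('n) * r)" .
        have "abs(ext k i y - ext k i x) <= lip_const CARD('n) * 2 ^ k * norm (y - x)" by (rule ext(2)[OF i ne])
        also have "... <= lip_const CARD('n) * T * (real CARD('n) * r)"
         using lip0 T nm by (intro mult_mono) auto
        finally have 2: "abs(ext k i y - ext k i x) <= lip_const CARD('n) * T * (real CARD('n) * r)" .
        have "ext k i x = f x i" by (rule ext(1)[OF i ne xF])
        then have "abs(vv k i y - uu i y) <= 2 * (lip_const CARD('n) * T * (real CARD('n) * r))"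
         using 1 2 v u by linarith
        moreover have "K y = T" using False yQ d1 by (simp add: K_def T_def)
        ultimately show ?thesis using True by (simp add: mult_ac)
       qed
      qed simp
     qed
    qed
    then show "(LINT y:cube x r|lm. abs((vv k i y - uu i y) - 0)) <= 2 * lip_const CARD('n) * (real CARD('n) * r) * (LINT y:cube x r|lm. abs(K y - K x))"
     using K0 by (simp add: slint_def Kx abs_of_nonneg)
    show "0 <= grad_const CARD('n) / r ^ (CARD('n) + 1)" using gc r by simp
   qed
   also have "... = A * ((LINT y:cube x r|lm. abs(K y - K x)) / r ^ CARD('n))"
    using r by (simp add: A_def field_simps)
   finally show ?thesis by (simp add: r_def)
  qed
  have "(%N. A * ((LINT y:cube x (eps N)|lm. abs(K y - K x)) / eps N ^ CARD('n))) ----> A * 0"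
  proof (intro tendsto_mult tendsto_const lebesgue_point_shrink[where q = "real CARD('n) + 1"] Ki eps cube_lmeasurable)
   show "cube x (eps N) \<subseteq> ball x ((real CARD('n) + 1) * eps N)" for N
    by (rule cube_subset_ball[where s = "eps N"]) (use eps(1)[of N] in "auto simp: algebra_simps")
  qed (use asm in "auto intro: add_pos_pos")
  then have "(%N. A * ((LINT y:cube x (eps N)|lm. abs(K y - K x)) / eps N ^ CARD('n))) ----> 0" by (simp only: mult_zero_right)
  from Lim_null_comparison[OF eventually_sequentiallyI[OF le] this]
  have 1: "(%N. dG k N x j i - avg (ww i j) x (eps N)) ----> 0" .
  have 2: "(%N. avg (ww i j) x (eps N)) ----> ww i j x"
  proof (rule avg_tendsto[OF ww_int[OF i]])
   show "lebesgue_point (ww i j) x" using xQ(2) i by (simp add: good_def)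
   show "cube x (eps N) \<subseteq> ball x ((real CARD('n) + 1) * eps N)" for N
    by (rule cube_subset_ball[where s = "eps N"]) (use eps(1)[of N] in "auto simp: algebra_simps")
  qed (use eps in "auto intro: add_pos_pos")
  show "(%N. dG k N x j i) ----> D x j i" using tendsto_add[OF 1 2] ww_eq[OF xQ(1)] by simp
 qed
qed

end

section \<open>Pullbacks and boundary terms of the truncated curve\<close>

abbreviation slp :: "nat => nat => real => real"
 where "slp m n t \<equiv> real m * real n * (slope_const n * t)"

context truncation begin

definition J0 where "J0 x = ind Q x * form_at m phi (f x) (D x)" for x
definition P where "P k N x = form_at m phi (G k N x) (dG k N x)" for k N x
definition Pb where "Pb k = L * (fact CARD('n) * (slope_const CARD('n) * 2 ^ k) ^ CARD('n))" for k :: nat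
text \<open>\<open>Cd\<close> bounds the differences of components of truncations, \<open>Ce\<close>
  the sums of their first derivatives; \<open>C0\<close> is the resulting constant of the boundary
  term, with one factor of the first kind and \<open>n - 1\<close> of the second.\<close>

definition Cd where "Cd = 4 * Cf * ((2 * bump_max) ^ CARD('n) + 1)"
definition Ce where "Ce = 2 * (real m * real CARD('n)) * (slope_const CARD('n) + 1)"
definition C0 where "C0 = real m * Cd * Ce ^ (CARD('n) - 1)"

lemma const_pos: "0 < Cd" "0 < Ce" "0 <= C0" "0 <= Pb k"
proof -
 have "0 < (2 * bump_max) ^ CARD('n)" using bump_max(1) by simp
 then show 1: "0 < Cd" using Cf unfolding Cd_def by (intro mult_pos_pos) auto
 show 2: "0 < Ce" using m slope0 unfolding Ce_def by (intro mult_pos_pos) auto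
 show "0 <= C0" using 1 2 unfolding C0_def by simp
 show "0 <= Pb k" using L_nonneg slope0 unfolding Pb_def by simp
qed

lemma G_Rm: "F k ~= {} ==> G k N x \<in> Rm m"
 by (simp add: Rm_iff G_def)

lemma P_continuous: assumes "F k ~= {}" shows "cont (P k N)"
proof -
 obtain g2 where g2: "C2_map m (G k N) (dG k N) g2" using C2_G[OF assms] by blast
 show ?thesis unfolding P_def[abs_def] by (rule form_at_continuous[OF phi C2_mapD(2)[OF g2] C2_mapD(1)[OF g2] C2_mapD(3)[OF g2]])
qed

lemma P_bound: assumes "F k ~= {}" "x \<in> Q" shows "abs(P k N x) <= Pb k"
proof -
 have "abs(P k N x) <= L * (fact CARD('n) * (\<Prod>l\<in>(UNIV::'n set). slope_const CARD('n) * 2 ^ k))" unfolding P_def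
 proof (rule form_at_abs_le)
  show "(\<Sum>I\<in>multi_indices m. abs(phi I (G k N x))) <= L" by (rule L[OF G_Rm[OF assms(1)]])
 qed (use dG_bound[OF assms] slope0 in auto)
 then show ?thesis by (simp add: Pb_def)
qed

lemma P_tendsto:
 assumes ne: "F k ~= {}"
 shows "AE x in lm. x \<in> F k --> (%N. P k N x) ----> J0 x"
proof -
 have "AE x in lm. \<forall>i\<in>{..<m}. \<forall>j\<in>UNIV. x \<in> F k --> (%N. dG k N x j i) ----> D x j i"
  by (intro AE_finite_allI) (auto intro: dG_tendsto[OF _ ne])
 then show ?thesis
 proof (rule AE_mp, intro AE_I2 impI)
  fix x assume d: "\<forall>i\<in>{..<m}. \<forall>j\<in>UNIV. x \<in> F k --> (%N. dG k N x j i) ----> D x j i" and x: "x \<in> F k"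
  have xQ: "x \<in> Q" using x F_sub by auto
  define D' where "D' j i = (if i < m then D x j i else 0)" for j i
  have "(%N. form_at m phi (G k N x) (dG k N x)) ----> form_at m phi (f x) D'"
  proof (rule form_at_tendsto[OF phic _ G_Rm[OF ne] fR])
   show "(%N. G k N x i) ----> f x i" for i
   proof (cases "i < m")
    case True
    then show ?thesis using G_tendsto[OF True ne xQ] ext(1)[OF True ne x] by simp
   next
    case False
    then show ?thesis using fR[of x] by (simp add: G_def Rm_iff)
   qed
   show "(%N. dG k N x j i) ----> D' j i" for j i
   proof (cases "i < m")
    case True
    then show ?thesis using d x by (simp add: D'_def)
   next
    case False
    then show ?thesis by (simp add: D'_def dG_def)
   qed
  qed
  moreover have "form_at m phi (f x) D' = form_at m phi (f x) (D x)" by (rule form_at_cong) (simp add: D'_def)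
  ultimately show "(%N. P k N x) ----> J0 x" using xQ by (simp add: P_def J0_def)
 qed
qed

lemma G_near:
 assumes i: "i < m" and x0: "x0 \<in> F k" and x: "x \<in> Q" and kl: "k <= l"
 shows "abs(G k N x i - f x0 i) <= Cd / 2 * 2 ^ l"
proof -
 have ne: "F k ~= {}" using x0 by auto
 have b: "0 <= (2 * bump_max) ^ CARD('n)" using bump_max(1) by simp
 have e: "abs(ext k i y - ext k i z) <= 2 * Cf * 2 ^ l" for y z
 proof -
  have "abs(ext k i y - ext k i z) <= 2 * Cf * (2 ^ k) powr (1 - kap)" by (rule ext(3)[OF i ne])
  also have "... <= 2 * Cf * 2 ^ l"
   using Cf pow_le[of k] power_increasing[OF kl, of "2::real"] by (intro mult_left_mono order_trans[OF pow_le]) auto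
  finally show ?thesis .
 qed
 have "abs(G k N x i - f x0 i) <= (2 * bump_max) ^ CARD('n) * (2 * Cf * 2 ^ l)"
  using avg_ext[OF i ne x, of "2 * Cf * 2 ^ l" N "f x0 i"] e[of _ x0] ext(1)[OF i ne x0] Cf i by (simp add: G_def)
 also have "... <= Cd / 2 * 2 ^ l" using Cf unfolding Cd_def by (simp add: distrib_left distrib_right)
 finally show ?thesis .
qed

text \<open>Sums over all components rather than maxima; this keeps both quantities visibly
  continuous.\<close>

definition dif where "dif k l N x = (\<Sum>i<m. abs(G l N x i - G k N x i))" for k l N x
definition der where "der k N x = (\<Sum>i<m. \<Sum>j\<in>UNIV. abs(dG k N x j i))" for k N x

lemma der_bound: assumes "F k ~= {}" "x \<in> Q"
 shows "0 <= der k N x" "der k N x <= slp m CARD('n) (2 ^ k)"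
proof -
 show "0 <= der k N x" unfolding der_def by (intro sum_nonneg) auto
 have "der k N x <= (\<Sum>i<m. \<Sum>j\<in>(UNIV::'n set). slope_const CARD('n) * 2 ^ k)"
  unfolding der_def by (intro sum_mono dG_bound[OF assms])
 then show "der k N x <= slp m CARD('n) (2 ^ k)" by simp
qed

lemma dif_bound: assumes "F k ~= {}" "x \<in> Q" "k <= l"
 shows "0 <= dif k l N x" "dif k l N x <= real m * Cd * 2 ^ l"
proof -
 show "0 <= dif k l N x" unfolding dif_def by (intro sum_nonneg) auto
 obtain x0 where x0: "x0 \<in> F k" using assms by auto
 then have x0l: "x0 \<in> F l" using F_mono[OF assms(3)] by auto
 have "dif k l N x <= (\<Sum>i<m. Cd * 2 ^ l)" unfolding dif_def
 proof (rule sum_mono)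
  fix i assume "i \<in> {..<m}"
  then have i: "i < m" by simp
  have "Cd / 2 * 2 ^ l = Cd * 2 ^ l / 2" by simp
  then show "abs(G l N x i - G k N x i) <= Cd * 2 ^ l"
   using G_near[OF i x0 assms(2,3), of N] G_near[OF i x0l assms(2) order_refl, of N] by linarith
 qed
 then show "dif k l N x <= real m * Cd * 2 ^ l" by (simp add: mult.assoc)
qed

lemma dif_der_continuous: assumes "F k ~= {}" "F l ~= {}"
 shows "cont (dif k l N)" "cont (der k N)"
proof -
 obtain g2 where g2: "C2_map m (G k N) (dG k N) g2" using C2_G[OF assms(1)] by blast
 obtain h2 where h2: "C2_map m (G l N) (dG l N) h2" using C2_G[OF assms(2)] by blast
 show "cont (dif k l N)" unfolding dif_def[abs_def]
  by (intro continuous_intros C2_mapD(2)[OF g2] C2_mapD(2)[OF h2])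
 show "cont (der k N)" unfolding der_def[abs_def] by (intro continuous_intros C2_mapD(3)[OF g2])
qed

text \<open>The integrand of the boundary term. The derivatives at the lower level are replaced by
  their uniform bound, so that of the derivatives only those at level \<open>l\<close> have to
  converge.\<close>

definition Ph where
 "Ph k l N x = dif k l N x * (slp m CARD('n) (2 ^ k) + der l N x) ^ (CARD('n) - 1)" for k l N x

lemma n_split: "x * x ^ (CARD('n) - 1) = (x::real) ^ CARD('n)"
 by (simp add: power_eq_if)

lemma Ph_bound: assumes "F k ~= {}" "x \<in> Q" "k <= l"
 shows "0 <= Ph k l N x" "Ph k l N x <= C0 * (2 ^ l) ^ CARD('n)"
proof -
 have nel: "F l ~= {}" using F_mono[OF assms(3)] assms(1) by auto
 have s0: "0 <= slp m CARD('n) (2 ^ k)" using slope0 by simp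
 note d = der_bound[OF nel assms(2), of N] and e = dif_bound[OF assms, of N]
 show "0 <= Ph k l N x" unfolding Ph_def using d e s0 by simp
 have "slp m CARD('n) (2 ^ k) + der l N x <= Ce * 2 ^ l"
 proof -
  have "slp m CARD('n) (2 ^ k) <= real m * real CARD('n) * ((slope_const CARD('n) + 1) * 2 ^ l)"
   using slope0 power_increasing[OF assms(3), of "2::real"] by (intro mult_left_mono mult_mono) auto
  moreover have "slp m CARD('n) (2 ^ l) <= real m * real CARD('n) * ((slope_const CARD('n) + 1) * 2 ^ l)"
   using slope0 by (intro mult_left_mono mult_mono) auto
  moreover have "Ce * 2 ^ l = 2 * (real m * real CARD('n) * ((slope_const CARD('n) + 1) * 2 ^ l))" by (simp add: Ce_def)
  ultimately show ?thesis using d by linarith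
 qed
 then have "Ph k l N x <= (real m * Cd * 2 ^ l) * (Ce * 2 ^ l) ^ (CARD('n) - 1)"
  unfolding Ph_def using d e s0 const_pos(1) by (intro mult_mono power_mono) auto
 also have "... = C0 * (2 ^ l * (2 ^ l) ^ (CARD('n) - 1))" by (simp add: C0_def power_mult_distrib mult_ac)
 finally show "Ph k l N x <= C0 * (2 ^ l) ^ CARD('n)" by (simp only: n_split)
qed

text \<open>The limit of \<open>Ph k l N\<close> on \<open>F l\<close> when the mollification is
  removed. It does not contain \<open>l\<close>, which allows the upper level to tend to infinity
  later.\<close>

definition Phlim where
 "Phlim k x = (\<Sum>i<m. abs(f x i - ext k i x)) * (slp m CARD('n) (2 ^ k) + (\<Sum>i<m. \<Sum>j\<in>UNIV. abs(D x j i))) ^ (CARD('n) - 1)" for k x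

lemma Ph_tendsto: assumes "F k ~= {}" "k <= l"
 shows "AE x in lm. x \<in> F l --> (%N. Ph k l N x) ----> Phlim k x"
proof -
 have nel: "F l ~= {}" using F_mono[OF assms(2)] assms(1) by auto
 have "AE x in lm. \<forall>i\<in>{..<m}. \<forall>j\<in>UNIV. x \<in> F l --> (%N. dG l N x j i) ----> D x j i"
  by (intro AE_finite_allI) (auto intro: dG_tendsto[OF _ nel])
 then show ?thesis
 proof (rule AE_mp, intro AE_I2 impI)
  fix x assume d: "\<forall>i\<in>{..<m}. \<forall>j\<in>UNIV. x \<in> F l --> (%N. dG l N x j i) ----> D x j i" and x: "x \<in> F l"
  have xQ: "x \<in> Q" using x F_sub by auto
  have g: "(%N. G l N x i - G k N x i) ----> f x i - ext k i x" if "i \<in> {..<m}" for i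
   using tendsto_diff[OF G_tendsto[OF _ nel xQ, of i] G_tendsto[OF _ assms(1) xQ, of i]] ext(1)[OF _ nel x, of i] that by simp
  show "(%N. Ph k l N x) ----> Phlim k x" unfolding Ph_def Phlim_def dif_def der_def
   by (intro tendsto_mult tendsto_power tendsto_add tendsto_const tendsto_sum tendsto_rabs g) (use d x in auto)
 qed
qed

text \<open>The expression vanishes on \<open>F k\<close>. Elsewhere the difference of the maps is
  at most a multiple of \<open>M powr (1 - kap)\<close> and each of the \<open>n - 1\<close>
  derivative factors a multiple of \<open>M\<close>, where \<open>M\<close> is the dyadic maximal
  function. The total exponent \<open>n - kap\<close> lies in the range of integrability: here the
  sublinear oscillation of the truncations pays off.\<close>

lemma Phlim_bound:
 assumes k: "F k ~= {}" and x: "x \<in> Q" "good x"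
 shows "Phlim k x <= C0 * (ind (max_set H (2 ^ k)) x * dmax H x powr (real CARD('n) - kap))"
proof (cases "x \<in> F k")
 case True
 then have "(\<Sum>i<m. abs(f x i - ext k i x)) = 0" using ext(1)[OF _ k True] by simp
 then have "Phlim k x = 0" by (simp add: Phlim_def)
 then show ?thesis using const_pos(3) by (simp add: zero_le_mult_iff)
next
 case False
 define M where "M = dmax H x"
 have xk: "x \<in> max_set h (2 ^ k)" using False x by (auto simp: F_def)
 have xH: "x \<in> max_set H (2 ^ k)" using xk max_set_hH by auto
 obtain l where l: "x ~: max_set H (2 ^ l)" using good_finite[OF x(2)] by blast
 have M: "2 ^ k <= M" "0 < M" "x ~: max_set h M"
  using dmax_ge[OF xH l] good_notin_dmax[OF x(2)] zero_le_power[of "2::real" k] unfolding M_def by auto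
 \<comment> \<open>A reference point at which extension and curve agree; through it both are
   compared with the average over the cube.\<close>
 obtain x0 where x0: "x0 \<in> F k" using k by auto
 have "x0 \<in> Q" "good x0" "x0 ~: max_set h (2 ^ k)" using x0 by (auto simp: F_def)
 then have x0M: "x0 \<in> Q" "good x0" "x0 ~: max_set h M" using max_set_antimono[OF M(1), of h] by auto
 have 1: "abs(f x i - ext k i x) <= Cd * M powr (1 - kap)" if i: "i < m" for i
 proof -
  have "abs(ext k i x - ext k i x0) <= 2 * Cf * (2 ^ k) powr (1 - kap)" by (rule ext(3)[OF i k])
  also have "... <= 2 * Cf * M powr (1 - kap)" using Cf M kap by (intro mult_left_mono powr_mono2) auto
  finally have "abs(ext k i x - ext k i x0) <= 2 * Cf * M powr (1 - kap)" .
  moreover have "ext k i x0 = f x0 i" by (rule ext(1)[OF i k x0])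
  ultimately have "abs(f x i - ext k i x) <= 4 * Cf * M powr (1 - kap)"
   using f_power[OF i x(1,2) M(3,2)] f_power[OF i x0M M(2)] by linarith
  also have "... <= Cd * M powr (1 - kap)"
  proof (rule mult_right_mono)
   have "4 * Cf * 1 <= Cd" unfolding Cd_def using Cf bump_max(1) by (intro mult_left_mono) auto
   then show "4 * Cf <= Cd" by simp
  qed simp
  finally show ?thesis .
 qed
 have "(\<Sum>i<m. abs(f x i - ext k i x)) <= (\<Sum>i<m. Cd * M powr (1 - kap))" by (rule sum_mono) (use 1 in auto)
 then have s1: "(\<Sum>i<m. abs(f x i - ext k i x)) <= real m * Cd * M powr (1 - kap)" by (simp add: mult.assoc)
 have D: "abs(D x j i) <= M" if "i < m" for i j
  using Dh[OF that, of x j] x h_le_dmax[OF x(2)] by (simp add: Q_def M_def)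
 have "(\<Sum>i<m. \<Sum>j\<in>UNIV. abs(D x j i)) <= (\<Sum>i<m. \<Sum>j\<in>(UNIV::'n set). M)" by (intro sum_mono) (use D in auto)
 then have s2: "(\<Sum>i<m. \<Sum>j\<in>UNIV. abs(D x j i)) <= real m * real CARD('n) * M" by simp
 have s3: "slp m CARD('n) (2 ^ k) <= slp m CARD('n) M" using slope0 M by (intro mult_left_mono) auto
 have s4: "slp m CARD('n) (2 ^ k) + (\<Sum>i<m. \<Sum>j\<in>UNIV. abs(D x j i)) <= Ce * M"
 proof -
  have "0 <= slp m CARD('n) M" "0 <= real m * real CARD('n) * M" using slope0 M by auto
  moreover have "Ce * M = 2 * (slp m CARD('n) M) + 2 * (real m * real CARD('n) * M)"
   by (simp add: Ce_def algebra_simps)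
  ultimately show ?thesis using s2 s3 by linarith
 qed
 have "Phlim k x <= (real m * Cd * M powr (1 - kap)) * (Ce * M) ^ (CARD('n) - 1)"
  unfolding Phlim_def using s1 s4 slope0 const_pos(1) by (intro mult_mono power_mono) (auto intro!: zero_le_power add_nonneg_nonneg sum_nonneg)
 also have "... = C0 * (M powr (1 - kap) * M powr real (CARD('n) - 1))"
  unfolding powr_realpow[OF M(2), of "CARD('n) - 1"] C0_def power_mult_distrib by (simp only: mult_ac)
 also have "M powr (1 - kap) * M powr real (CARD('n) - 1) = M powr (real CARD('n) - kap)"
  by (simp add: powr_add[symmetric] of_nat_diff)
 finally show ?thesis using xH by (simp add: M_def)
qed

end

context truncation begin

lemma Q_lm: "Q \<in> lmeasurable" "Q \<in> sets lebesgue"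
 using cube_lmeasurable[of a R] by (simp_all add: Q_def)

lemma ind_int: "L1 (%x. ind Q x * (c::real))"
 by (rule integrable_ind_const[OF Q_lm(1)])

context
 fixes psi :: "real ^ 'n::{finite,linorder} => real"
 assumes psic: "cont psi" and psir: "!!x. 0 <= psi x \<and> psi x <= 1"
begin

lemma psiP: assumes "F k ~= {}"
 shows "cont (%x. psi x * P k N x)" "x \<in> Q ==> abs(psi x * P k N x) <= Pb k"
  "L1 (%x. ind Q x * (psi x * P k N x))"
proof -
 show c: "cont (%x. psi x * P k N x)" by (intro continuous_intros psic P_continuous assms)
 show "L1 (%x. ind Q x * (psi x * P k N x))"
  using continuous_cbox_integral(1)[OF c] unfolding Q_def cube_eq_cbox by simp
 show "abs(psi x * P k N x) <= Pb k" if "x \<in> Q"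
 proof -
  have "abs(psi x * P k N x) <= 1 * Pb k" unfolding abs_mult
   using psir[of x] P_bound[OF assms that, of N] by (intro mult_mono) auto
  then show ?thesis by simp
 qed
qed

lemma psiP_restrict: assumes "F k ~= {}" "A \<subseteq> Q" "A \<in> sets lebesgue"
 shows "L1 (%x. ind A x * (psi x * P k N x))"
proof -
 have "L1 (%x. ind A x * (ind Q x * (psi x * P k N x)))" by (intro integrable_restrict psiP assms)
 moreover have "(%x. ind A x * (ind Q x * (psi x * P k N x))) = (%x. ind A x * (psi x * P k N x))"
  using assms(2) by (auto simp: fun_eq_iff indicator_def)
 ultimately show ?thesis by simp
qed

lemma psiP_limit: assumes ne: "F k ~= {}"
 shows "(%N. LI x. ind (F k) x * (psi x * P k N x)) ----> (LI x. ind (F k) x * (psi x * J0 x))"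
proof (rule integral_dominated_convergence[where w = "%x. ind Q x * Pb k"])
 have J0m: "J0 \<in> bml" using J unfolding J0_def[abs_def] Q_def by (rule borel_measurable_integrable)
 have psim: "psi \<in> bml" using psic by (simp add: borel_measurable_continuous_onI measurable_completion)
 have im: "(ind (F k) :: _ => real) \<in> bml" using F_meas[of k] by simp
 show "(%x. ind (F k) x * (psi x * J0 x)) \<in> bml" by (intro borel_measurable_times im psim J0m)
 show "(%x. ind (F k) x * (psi x * P k N x)) \<in> bml" for N
  by (intro borel_measurable_integrable psiP_restrict[OF ne] F_sub F_meas)
 show "L1 (%x. ind Q x * Pb k)" by (rule ind_int)
 show "AE x in lm. (%N. ind (F k) x * (psi x * P k N x)) ----> ind (F k) x * (psi x * J0 x)"
  using P_tendsto[OF ne]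
 proof (rule AE_mp, intro AE_I2 impI)
  fix x assume "x \<in> F k --> (%N. P k N x) ----> J0 x"
  then show "(%N. ind (F k) x * (psi x * P k N x)) ----> ind (F k) x * (psi x * J0 x)"
   by (cases "x \<in> F k") (auto intro!: tendsto_intros)
 qed
 show "AE x in lm. norm (ind (F k) x * (psi x * P k N x)) <= ind Q x * Pb k" for N
 proof (rule AE_I2)
  fix x
  show "norm (ind (F k) x * (psi x * P k N x)) <= ind Q x * Pb k"
   using psiP(2)[OF ne, of x N] F_sub[of k] const_pos(4)[of k] by (cases "x \<in> F k") (auto simp: indicator_def)
 qed
qed

lemma psiP_rest: assumes ne: "F k ~= {}"
 shows "abs((LI x. ind Q x * (psi x * P k N x)) - (LI x. ind (F k) x * (psi x * P k N x)))
  <= Pb k * vol (Q - F k)"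
proof -
 have A: "Q - F k \<in> sets lebesgue" by (rule sets.Diff[OF Q_lm(2) F_meas])
 have i1: "L1 (%x. ind (F k) x * (psi x * P k N x))" by (rule psiP_restrict[OF ne F_sub F_meas])
 have i2: "L1 (%x. ind (Q - F k) x * (psi x * P k N x))" by (rule psiP_restrict[OF ne Diff_subset A])
 have eq: "(%x. ind Q x * (psi x * P k N x)) = (%x. ind (F k) x * (psi x * P k N x) + ind (Q - F k) x * (psi x * P k N x))"
 proof
  fix x
  show "ind Q x * (psi x * P k N x) = ind (F k) x * (psi x * P k N x) + ind (Q - F k) x * (psi x * P k N x)"
   using F_sub[of k] by (cases "x \<in> F k"; cases "x \<in> Q") auto
 qed
 have split: "(LI x. ind Q x * (psi x * P k N x)) - (LI x. ind (F k) x * (psi x * P k N x))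
  = (LI x. ind (Q - F k) x * (psi x * P k N x))" unfolding eq lint_add[OF i1 i2] by (rule add_diff_cancel_left')
 have "abs(LI x. ind (Q - F k) x * (psi x * P k N x)) <= (LI x. ind (Q - F k) x * Pb k)"
 proof (rule integral_abs_bound[THEN order_trans], rule integral_mono)
  show "L1 (%x. abs(ind (Q - F k) x * (psi x * P k N x)))" by (rule integrable_abs[OF i2])
  show "L1 (%x. ind (Q - F k) x * Pb k)" by (intro integrable_mult_left Q_diff_F_indicator)
  fix x
  show "abs(ind (Q - F k) x * (psi x * P k N x)) <= ind (Q - F k) x * Pb k"
   using psiP(2)[OF ne, of x N] by (cases "x \<in> Q - F k") auto
 qed
 also have "... = Pb k * vol (Q - F k)" by simp
 finally show ?thesis unfolding split .
qed

text \<open>The pullbacks under the two mollified truncations are compared by homotopy on the whole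
  cube, and then the mollification is removed. On \<open>F k\<close> and \<open>F l\<close> the
  pullbacks converge to the Jacobian of the curve; on the complements only a bound by the height to
  the power \<open>n\<close> is available, which leaves the terms with \<open>vol (Q - F k)\<close>
  and \<open>vol (Q - F l)\<close>.\<close>

lemma level_pair:
 fixes psi1 :: "'n => real ^ 'n::{finite,linorder} => real"
 assumes kl: "k <= l" and ne: "F k ~= {}"
  and psi1: "!!j. cont (psi1 j)" "!!x j. ((%s. psi (sh x s j)) hrd psi1 j x) (at 0)"
  and psi0: "!!x. x ~: Q ==> psi x = 0" and B: "!!x. (\<Sum>j\<in>UNIV. abs(psi1 j x)) <= B"
 shows "abs((LI x. ind (F l) x * (psi x * J0 x)) - (LI x. ind (F k) x * (psi x * J0 x)))
  <= Pb l * vol (Q - F l) + Pb k * vol (Q - F k) +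
   L * (fact CARD('n) * B) * (C0 * (LI x. ind (max_set H (2 ^ k)) x * (ind Q x * dmax H x powr (real CARD('n) - kap)))
    + C0 * (2 ^ l) ^ CARD('n) * vol (Q - F l))"
proof -
 have nel: "F l ~= {}" using F_mono[OF kl] ne by auto
 have B0: "0 <= B" using B[of 0] by (meson abs_ge_zero order_trans sum_nonneg)
 define c where "c = L * (fact CARD('n) * B)"
 have c0: "0 <= c" using B0 L_nonneg by (simp add: c_def)
 have Pc: "cont (Ph k l N)" for N unfolding Ph_def[abs_def]
  by (intro continuous_intros dif_der_continuous(1)[OF ne nel] dif_der_continuous(2)[OF nel nel])
 have Phi: "L1 (%x. ind Q x * Ph k l N x)" for N
  using continuous_cbox_integral(1)[OF Pc] unfolding Q_def cube_eq_cbox by simp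
 have PhA: "L1 (%x. ind A x * Ph k l N x)" if "A \<subseteq> Q" "A \<in> sets lebesgue" for A N
 proof -
  have "L1 (%x. ind A x * (ind Q x * Ph k l N x))" by (intro integrable_restrict Phi that)
  moreover have "(%x. ind A x * (ind Q x * Ph k l N x)) = (%x. ind A x * Ph k l N x)"
   using that by (auto simp: fun_eq_iff indicator_def)
  ultimately show ?thesis by simp
 qed
 have homot: "abs((LI x. ind Q x * (psi x * P l N x)) - (LI x. ind Q x * (psi x * P k N x)))
   <= c * (LI x. ind Q x * Ph k l N x)" for N
 proof -
  obtain g2 where g2: "C2_map m (G k N) (dG k N) g2" using C2_G[OF ne] by blast
  obtain h2 where h2: "C2_map m (G l N) (dG l N) h2" using C2_G[OF nel] by blast
  obtain a1 b1 where ab: "Q = cbox a1 b1" unfolding Q_def cube_eq_cbox by blast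
  define E where "E x = der k N x + der l N x" for x
  define Tht where "Tht x = L * (fact CARD('n) * ((\<Sum>j\<in>UNIV. abs(psi1 j x)) * (dif k l N x * E x ^ (CARD('n) - 1))))" for x
  have cE: "cont E" unfolding E_def[abs_def]
   by (intro continuous_intros dif_der_continuous(2)[OF ne ne] dif_der_continuous(2)[OF nel nel])
  have cTht: "cont Tht" unfolding Tht_def[abs_def]
   by (intro continuous_intros cE dif_der_continuous(1)[OF ne nel] psi1(1))
  have "abs(integral (cbox a1 b1) (%x. psi x * (form_at m phi (G l N x) (dG l N x) - form_at m phi (G k N x) (dG k N x)))) <=
   integral (cbox a1 b1) (%x. L * (fact CARD('n) * ((\<Sum>j\<in>UNIV. abs(psi1 j x)) * (dif k l N x * E x ^ (CARD('n) - 1)))))"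
  proof (rule homotopy_estimate[OF m phi cl L g2 h2 psic psi1])
   show "psi x = 0" if "x ~: cbox a1 b1" for x using that psi0 ab by auto
   show "abs(G l N x i - G k N x i) <= dif k l N x" if "i < m" for x i
    unfolding dif_def by (rule member_le_sum) (use that in auto)
   show "abs(dG k N x j i) <= E x \<and> abs(dG l N x j i) <= E x" if "i < m" for x j i
   proof -
    have le: "abs(dG k' N x j i) <= der k' N x" for k'
    proof -
     have "abs(dG k' N x j i) <= (\<Sum>j\<in>UNIV. abs(dG k' N x j i))" by (rule member_le_sum) auto
     also have "... <= der k' N x" unfolding der_def by (rule member_le_sum) (use that in "auto intro: sum_nonneg")
     finally show ?thesis .
    qed
    have "0 <= der k' N x" for k' unfolding der_def by (intro sum_nonneg) auto
    then show ?thesis using le[of k] le[of l] unfolding E_def by (meson add_increasing add_increasing2)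
   qed
  qed (use cE dif_der_continuous(1)[OF ne nel] in auto)
  then have "abs(LI x. ind Q x * (psi x * (P l N x - P k N x))) <= (LI x. ind Q x * Tht x)"
   unfolding P_def[symmetric] Tht_def[symmetric] ab
   by (subst (asm) continuous_cbox_integral(2), intro continuous_intros psic P_continuous ne nel)
    (subst (asm) continuous_cbox_integral(2)[OF cTht], simp)
  also have "... <= (LI x. c * (ind Q x * Ph k l N x))"
  proof (rule integral_mono)
   show "L1 (%x. ind Q x * Tht x)" unfolding ab by (rule continuous_cbox_integral(1)[OF cTht])
   show "L1 (%x. c * (ind Q x * Ph k l N x))" by (intro integrable_mult_right Phi)
   fix x
   show "ind Q x * Tht x <= c * (ind Q x * Ph k l N x)"
   proof (cases "x \<in> Q")
    case True
    note d = der_bound[OF ne True, of N] der_bound[OF nel True, of N] dif_bound[OF ne True kl, of N]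
    have "dif k l N x * E x ^ (CARD('n) - 1) <= Ph k l N x"
     unfolding Ph_def E_def using d by (intro mult_left_mono power_mono) auto
    then have "(\<Sum>j\<in>UNIV. abs(psi1 j x)) * (dif k l N x * E x ^ (CARD('n) - 1)) <= B * Ph k l N x"
     using B[of x] B0 Ph_bound(1)[OF ne True kl, of N] d unfolding E_def by (intro mult_mono) (auto intro!: sum_nonneg)
    then have "Tht x <= L * (fact CARD('n) * (B * Ph k l N x))"
     unfolding Tht_def using L_nonneg by (intro mult_left_mono) auto
    then show ?thesis using True by (simp add: c_def mult_ac)
   qed simp
  qed
  finally have "abs(LI x. ind Q x * (psi x * (P l N x - P k N x))) <= c * (LI x. ind Q x * Ph k l N x)" by simp
  moreover have "(LI x. ind Q x * (psi x * (P l N x - P k N x))) =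
    (LI x. ind Q x * (psi x * P l N x)) - (LI x. ind Q x * (psi x * P k N x))"
   by (subst lint_diff[symmetric, OF psiP(3)[OF nel] psiP(3)[OF ne]]) (simp add: right_diff_distrib)
  ultimately show ?thesis by simp
 qed
 define Y where "Y N = (LI x. ind (F l) x * Ph k l N x)" for N
 have Pl: "(LI x. ind Q x * Ph k l N x) <= Y N + C0 * (2 ^ l) ^ CARD('n) * vol (Q - F l)" for N
 proof -
  have "(LI x. ind Q x * Ph k l N x) <= (LI x. ind (F l) x * Ph k l N x + C0 * (2 ^ l) ^ CARD('n) * ind (Q - F l) x)"
  proof (rule integral_mono[OF Phi])
   show "L1 (%x. ind (F l) x * Ph k l N x + C0 * (2 ^ l) ^ CARD('n) * ind (Q - F l) x)"
    by (intro int_add PhA F_sub F_meas integrable_mult_right Q_diff_F_indicator)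
   show "ind Q x * Ph k l N x <= ind (F l) x * Ph k l N x + C0 * (2 ^ l) ^ CARD('n) * ind (Q - F l) x" for x
    using Ph_bound(2)[OF ne _ kl, of x N] F_sub[of l] by (auto simp: indicator_def)
  qed
  also have "... = Y N + C0 * (2 ^ l) ^ CARD('n) * vol (Q - F l)" unfolding Y_def
   by (subst lint_add[OF PhA[OF F_sub F_meas] integrable_mult_right[OF Q_diff_F_indicator]]) simp
  finally show ?thesis .
 qed
 have ae: "AE x in lm. (%N. ind (F l) x * Ph k l N x) ----> ind (F l) x * Phlim k x" using Ph_tendsto[OF ne kl]
 proof (rule AE_mp, intro AE_I2 impI)
  fix x assume "x \<in> F l --> (%N. Ph k l N x) ----> Phlim k x"
  then show "(%N. ind (F l) x * Ph k l N x) ----> ind (F l) x * Phlim k x"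
   by (cases "x \<in> F l") (auto intro!: tendsto_intros)
 qed
 have bd: "AE x in lm. norm (ind (F l) x * Ph k l N x) <= ind Q x * (C0 * (2 ^ l) ^ CARD('n))" for N
 proof (rule AE_I2)
  fix x
  show "norm (ind (F l) x * Ph k l N x) <= ind Q x * (C0 * (2 ^ l) ^ CARD('n))"
   using Ph_bound[OF ne _ kl, of x N] F_sub[of l] const_pos(3) by (cases "x \<in> F l") (auto simp: indicator_def)
 qed
 \<comment> \<open>A measurable version of the limit, taken as a limit of measurable functions, to
   which dominated convergence applies.\<close>
 obtain Z where Z: "Z \<in> bml" "AE x in lm. Z x = ind (F l) x * Phlim k x"
 proof -
  have m: "(%x. ind (F l) x * Ph k l N x) \<in> bml" for N by (intro borel_measurable_integrable PhA F_sub F_meas)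
  have "(%x. lim (%N. ind (F l) x * Ph k l N x)) \<in> bml" by (rule borel_measurable_lim_metric[OF m])
  moreover have "AE x in lm. lim (%N. ind (F l) x * Ph k l N x) = ind (F l) x * Phlim k x"
   using ae by eventually_elim (rule limI)
  ultimately show ?thesis using that by blast
 qed
 have aeZ: "AE x in lm. (%N. ind (F l) x * Ph k l N x) ----> Z x" using ae Z(2) by eventually_elim simp
 have mPh: "(%x. ind (F l) x * Ph k l N x) \<in> bml" for N by (intro borel_measurable_integrable PhA F_sub F_meas)
 have Ylim: "Y ----> integral\<^sup>L lebesgue Z" unfolding Y_def[abs_def]
  by (rule integral_dominated_convergence[OF Z(1) mPh ind_int aeZ bd])
 have Zi: "L1 Z" by (rule integrable_dominated_convergence[OF Z(1) mPh ind_int aeZ bd])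
 have q: "0 <= real CARD('n) - kap" "real CARD('n) - kap < p"
  using kap(2) n2 p(1) unfolding kap_def[symmetric] by auto
 have Mi: "L1 (%x. ind (max_set H (2 ^ k)) x * (ind Q x * dmax H x powr (real CARD('n) - kap)))"
  using open_max_set[OF H(1) H_nonneg] by (intro integrable_restrict dmax_int q) (simp add: borel_open)
 have Zle: "integral\<^sup>L lebesgue Z <= C0 * (LI x. ind (max_set H (2 ^ k)) x * (ind Q x * dmax H x powr (real CARD('n) - kap)))"
 proof -
  have "integral\<^sup>L lebesgue Z <= (LI x. C0 * (ind (max_set H (2 ^ k)) x * (ind Q x * dmax H x powr (real CARD('n) - kap))))"
  proof (rule integral_mono_AE[OF Zi])
   show "AE x in lm. Z x <= C0 * (ind (max_set H (2 ^ k)) x * (ind Q x * dmax H x powr (real CARD('n) - kap)))"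
    using Z(2) AE_good
   proof eventually_elim
    case (elim x)
    have "0 <= C0 * (ind (max_set H (2 ^ k)) x * (ind Q x * dmax H x powr (real CARD('n) - kap)))"
     using const_pos(3) by (intro mult_nonneg_nonneg) auto
    then show ?case using elim(1) Phlim_bound[OF ne, of x] F_sub[of l] elim(2) by (cases "x \<in> F l") auto
   qed
  qed (intro integrable_mult_right Mi)
  then show ?thesis by simp
 qed
 define d where "d = C0 * (2 ^ l) ^ CARD('n) * vol (Q - F l)"
 define e where "e = Pb l * vol (Q - F l) + Pb k * vol (Q - F k)"
 define A where "A N = (LI x. ind (F l) x * (psi x * P l N x)) - (LI x. ind (F k) x * (psi x * P k N x))" for N
 have Ale: "abs(A N) <= e + c * (Y N + d)" for N
 proof -
  have "c * (LI x. ind Q x * Ph k l N x) <= c * (Y N + d)" using Pl[of N] c0 by (intro mult_left_mono) (auto simp: d_def)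
  then show ?thesis using homot[of N] psiP_rest[OF ne, of N] psiP_rest[OF nel, of N] unfolding A_def e_def by linarith
 qed
 have "(%N. abs(A N)) ----> abs((LI x. ind (F l) x * (psi x * J0 x)) - (LI x. ind (F k) x * (psi x * J0 x)))"
  unfolding A_def[abs_def] by (intro tendsto_intros psiP_limit ne nel)
 moreover have "(%N. e + c * (Y N + d)) ----> e + c * (integral\<^sup>L lebesgue Z + d)"
  by (intro tendsto_intros Ylim)
 ultimately have "abs((LI x. ind (F l) x * (psi x * J0 x)) - (LI x. ind (F k) x * (psi x * J0 x))) <= e + c * (integral\<^sup>L lebesgue Z + d)"
  by (rule LIMSEQ_le) (use Ale in auto)
 also have "... <= e + c * (C0 * (LI x. ind (max_set H (2 ^ k)) x * (ind Q x * dmax H x powr (real CARD('n) - kap))) + d)"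
  using c0 Zle by (intro add_left_mono mult_left_mono add_right_mono) auto
 finally show ?thesis unfolding c_def d_def e_def .
qed

end

end

text \<open>The factors come from the bound \<open>Pb\<close> of the pullback and from the truncated
  weak type inequality. They depend on \<open>n\<close> alone, and the constant of the theorem is
  built from them.\<close>

definition level_const :: "nat => real" where
 "level_const n = fact n * slope_const n ^ n * (2 * 5 ^ n)"

context truncation begin

text \<open>The upper level tends to infinity along levels at which the measure of the bad set is
  small even after multiplication by \<open>(2 ^ l) ^ n\<close>; every error term of
  \<open>level_pair\<close> at the upper level disappears.\<close>

lemma level_limit:
 fixes psi :: "real ^ 'n::{finite,linorder} => real" and psi1 :: "'n => real ^ 'n::{finite,linorder} => real"
 assumes psic: "cont psi" and psir: "!!x. 0 <= psi x \<and> psi x <= 1"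
  and ne: "F k ~= {}" and psi1: "!!j. cont (psi1 j)" "!!x j. ((%s. psi (sh x s j)) hrd psi1 j x) (at 0)"
  and psi0: "!!x. x ~: Q ==> psi x = 0" and B: "!!x. (\<Sum>j\<in>UNIV. abs(psi1 j x)) <= B"
  and dec: "!!e K. 0 < e ==> \<exists>l\<ge>K. (2 ^ l) ^ CARD('n) * vol (max_set H (2 ^ l)) < e"
  and Jn: "AE x in lm. 0 <= J0 x"
 shows "(LI x. ind {x. 2 ^ k < h x} x * (psi x * J0 x)) <= Pb k * vol (Q - F k) +
   L * (fact CARD('n) * B) * C0 * (LI x. ind (max_set H (2 ^ k)) x * (ind Q x * dmax H x powr (real CARD('n) - kap)))"
proof -
 define I where "I = (LI x. ind (max_set H (2 ^ k)) x * (ind Q x * dmax H x powr (real CARD('n) - kap)))"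
 define c where "c = L * (fact CARD('n) * B)"
 define S where "S = L * (fact CARD('n) * slope_const CARD('n) ^ CARD('n))"
 have B0: "0 <= B" using B[of 0] by (meson abs_ge_zero order_trans sum_nonneg)
 have c0: "0 <= c" using B0 L_nonneg by (simp add: c_def)
 have S0: "0 <= S" using L_nonneg slope0 by (simp add: S_def)
 have "\<exists>l. \<forall>j::nat. max k j <= l j \<and> (2 ^ l j) ^ CARD('n) * vol (max_set H (2 ^ l j)) < eps j"
  using dec[OF eps(1)] by (intro choice allI) blast
 then obtain l where l: "!!j. k <= l j" "!!j. j <= l j" "!!j. (2 ^ l j) ^ CARD('n) * vol (max_set H (2 ^ l j)) < eps j"
  by (metis max.bounded_iff)
 have Hlm: "max_set H (2 ^ k) \<in> lmeasurable" for k by (rule max_set_weak_type(1)[OF H(1) H_nonneg]) simp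
 have small: "(2 ^ l j) ^ CARD('n) * vol (Q - F (l j)) <= eps j" for j
 proof -
  have "vol (max_set h (2 ^ l j)) <= vol (max_set H (2 ^ l j))"
   by (rule measure_mono_fmeasurable[OF max_set_hH max_set_h_meas Hlm])
  then have "(2 ^ l j) ^ CARD('n) * vol (Q - F (l j)) <= (2 ^ l j) ^ CARD('n) * vol (max_set H (2 ^ l j))"
   using Q_diff_F(2)[of "l j"] by (intro mult_left_mono) auto
  then show ?thesis using l(3)[of j] by linarith
 qed
 have Pbe: "Pb k = S * (2 ^ k) ^ CARD('n)" for k by (simp add: Pb_def S_def power_mult_distrib mult_ac)
 define X where "X j = (LI x. ind (F (l j)) x * (psi x * J0 x))" for j
 define Y where "Y = (LI x. ind (F k) x * (psi x * J0 x))"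
 have le: "X j - Y <= S * eps j + Pb k * vol (Q - F k) + c * (C0 * I + C0 * eps j)" for j
 proof -
  have "X j - Y <= Pb (l j) * vol (Q - F (l j)) + Pb k * vol (Q - F k) +
    c * (C0 * I + C0 * (2 ^ l j) ^ CARD('n) * vol (Q - F (l j)))"
   using level_pair[OF psic psir l(1)[of j] ne psi1 psi0 B] unfolding X_def Y_def I_def c_def by linarith
  moreover have "Pb (l j) * vol (Q - F (l j)) <= S * eps j"
   using mult_left_mono[OF small[of j] S0] by (simp add: Pbe mult.assoc)
  moreover have "c * (C0 * I + C0 * (2 ^ l j) ^ CARD('n) * vol (Q - F (l j))) <= c * (C0 * I + C0 * eps j)"
   using mult_left_mono[OF small[of j] const_pos(3)] c0 by (intro mult_left_mono) (auto simp: mult.assoc)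
  ultimately show ?thesis by linarith
 qed
 have J0i: "L1 J0" using J unfolding J0_def[abs_def] Q_def .
 have psim: "psi \<in> bml" using psic by (simp add: borel_measurable_continuous_onI measurable_completion)
 have psiJ: "L1 (%x. psi x * J0 x)"
  using integrable_mult_continuous_bounded[OF J0i psic, of 1] psir by (simp add: mult.commute abs_of_nonneg)
 have Xlim: "X ----> (LI x. psi x * J0 x)" unfolding X_def
 proof (rule integral_dominated_convergence[where w = "%x. abs(psi x * J0 x)"])
  show "(%x. psi x * J0 x) \<in> bml" using psiJ by (rule borel_measurable_integrable)
  show "(%x. ind (F (l j)) x * (psi x * J0 x)) \<in> bml" for j by (rule integrable_restrict(2)[OF psiJ F_meas])
  show "L1 (%x. abs(psi x * J0 x))" by (rule integrable_abs[OF psiJ])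
  show "AE x in lm. (%j. ind (F (l j)) x * (psi x * J0 x)) ----> psi x * J0 x" using AE_good
  proof (rule AE_mp, intro AE_I2 impI)
   fix x assume g: "good x"
   show "(%j. ind (F (l j)) x * (psi x * J0 x)) ----> psi x * J0 x"
   proof (cases "x \<in> Q")
    case True
    obtain k' where k': "x ~: max_set H (2 ^ k')" using good_finite[OF g] by blast
    have "x \<in> F (l j)" if "k' <= j" for j
    proof -
     have "(2::real) ^ k' <= 2 ^ l j" using that l(2)[of j] by (intro power_increasing) auto
     then show ?thesis using k' max_set_hH max_set_antimono[of "2 ^ k'" "2 ^ l j" h] True g by (auto simp: F_def)
    qed
    then have "\<forall>\<^sub>F j in sequentially. ind (F (l j)) x * (psi x * J0 x) = psi x * J0 x"
     by (intro eventually_sequentiallyI[of k']) simp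
    then show ?thesis by (rule tendsto_eventually)
   qed (simp add: J0_def)
  qed
  show "AE x in lm. norm (ind (F (l j)) x * (psi x * J0 x)) <= abs(psi x * J0 x)" for j
   by (intro AE_I2) (simp add: indicator_def)
 qed
 have "(%j. S * eps j + Pb k * vol (Q - F k) + c * (C0 * I + C0 * eps j)) ---->
   S * 0 + Pb k * vol (Q - F k) + c * (C0 * I + C0 * 0)" by (intro tendsto_intros eps(3))
 moreover have "(%j. X j - Y) ----> (LI x. psi x * J0 x) - Y" by (intro tendsto_intros Xlim)
 ultimately have "(LI x. psi x * J0 x) - Y <= S * 0 + Pb k * vol (Q - F k) + c * (C0 * I + C0 * 0)"
  using le by (intro LIMSEQ_le) auto
 \<comment> \<open>The sets \<open>h > 2 ^ k\<close> and \<open>F k\<close> are disjoint because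
   \<open>h\<close> is bounded by its maximal function at Lebesgue points; nonnegativity of the
   Jacobian takes care of the rest.\<close>
 moreover have "(LI x. ind {x. 2 ^ k < h x} x * (psi x * J0 x)) + Y <= (LI x. psi x * J0 x)"
 proof -
  have hm: "{x. 2 ^ k < h x} \<in> sets lebesgue"
   using borel_measurable_integrable[OF h] unfolding borel_measurable_iff_greater by simp
  note i = integrable_restrict(1)[OF psiJ hm] integrable_restrict(1)[OF psiJ F_meas[of k]]
  have "(LI x. ind {x. 2 ^ k < h x} x * (psi x * J0 x) + ind (F k) x * (psi x * J0 x)) <= (LI x. psi x * J0 x)"
  proof (rule integral_mono_AE[OF int_add[OF i] psiJ])
   show "AE x in lm. ind {x. 2 ^ k < h x} x * (psi x * J0 x) + ind (F k) x * (psi x * J0 x) <= psi x * J0 x"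
    using Jn
   proof eventually_elim
    case (elim x)
    have "h x <= 2 ^ k" if "x \<in> F k" using that lebesgue_point_le[OF h, of x "2 ^ k"] by (auto simp: F_def good_def)
    moreover have "0 <= psi x * J0 x" using elim psir[of x] by simp
    ultimately show ?case by (cases "x \<in> F k") (auto simp: indicator_def)
   qed
  qed
  then show ?thesis unfolding Y_def lint_add[OF i] .
 qed
 ultimately show ?thesis unfolding I_def[symmetric] c_def[symmetric] by (simp add: mult.assoc)
qed

lemma level_weak:
 "Pb k * vol (Q - F k) <= level_const CARD('n) * L * ((2 ^ k) ^ (CARD('n) - 1) * (LI x. ind {y. 2 ^ k / 2 < h y} x * h x))"
proof -
 define I where "I = (LI x. ind {y. 2 ^ k / 2 < h y} x * h x)"
 have "vol (Q - F k) <= 2 * 5 ^ CARD('n) / 2 ^ k * I"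
  using Q_diff_F(2)[of k] max_set_weak_type_truncated[OF h h_nonneg, of "2 ^ k"] by (simp add: I_def slint_def)
 then have "Pb k * vol (Q - F k) <= Pb k * (2 * 5 ^ CARD('n) / 2 ^ k * I)"
  by (intro mult_left_mono const_pos(4))
 also have "(2 ^ k) ^ CARD('n) = 2 ^ k * (2 ^ k :: real) ^ (CARD('n) - 1)" by (simp only: n_split)
 then have "Pb k * (2 * 5 ^ CARD('n) / 2 ^ k * I) = level_const CARD('n) * L * ((2 ^ k) ^ (CARD('n) - 1) * I)"
  by (simp add: Pb_def level_const_def power_mult_distrib)
 finally show ?thesis by (simp add: I_def)
qed

end

section \<open>Cutoff functions and elementary inequalities\<close>

lemma cutoff_1d:
 fixes r R :: real assumes "0 < r" "r < R"
 obtains eta eta1 where "cont eta" "cont eta1" "!!t. (eta hrd eta1 t) (at t)"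
  "!!t. 0 <= eta t \<and> eta t <= 1" "!!t. abs(t) <= r ==> eta t = 1" "!!t. R <= abs(t) ==> eta t = 0"
  "!!t. abs(eta1 t) <= 4 * bump_max / (R - r)"
proof -
 define rho where "rho = (R - r) / 2"
 define c where "c = (R + r) / 2"
 have rho: "0 < rho" using assms by (simp add: rho_def)
 \<comment> \<open>A falling and a rising ramp; each changes over an interval of length
   \<open>R - r\<close> centred at \<open>c\<close> and at \<open>- c\<close> respectively.\<close>
 define eta where "eta t = ramp ((c - t) / rho) * ramp ((c + t) / rho)" for t
 define eta1 where "eta1 t = - bump ((c - t) / rho) / rho * ramp ((c + t) / rho) + ramp ((c - t) / rho) * (bump ((c + t) / rho) / rho)" for t
 have d: "(eta hrd eta1 t) (at t)" for t unfolding eta_def[abs_def] eta1_def using rho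
  by (auto intro!: derivative_eq_intros DERIV_chain2[OF ramp_DERIV])
 have cr: "cont ramp" "cont bump"
  using ramp_DERIV smooth_DERIV[OF smooth_bump] by (auto intro!: DERIV_continuous_on continuous_at_imp_continuous_on DERIV_isCont)
 have c1: "cont eta1" unfolding eta1_def[abs_def] using rho
  by (intro continuous_intros continuous_on_compose2[OF cr(1)] continuous_on_compose2[OF cr(2)]) auto
 have b: "abs(eta1 t) <= 4 * bump_max / (R - r)" for t
 proof -
  have b1: "abs(bump s / rho * ramp s') <= bump_max / rho" for s s'
  proof -
   have "abs(bump s / rho * ramp s') = bump s / rho * ramp s'"
    using bump_nonneg[of s] ramp_range(1)[of s'] rho by simp
   also have "... <= bump_max / rho * 1"
    using bump_max bump_nonneg[of s] ramp_range[of s'] rho by (intro mult_mono divide_right_mono) auto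
   finally show ?thesis by simp
  qed
  have "eta1 t = bump ((c + t) / rho) / rho * ramp ((c - t) / rho) - bump ((c - t) / rho) / rho * ramp ((c + t) / rho)"
   unfolding eta1_def by (simp add: mult.commute)
  then have "abs(eta1 t) <= abs(bump ((c + t) / rho) / rho * ramp ((c - t) / rho)) + abs(bump ((c - t) / rho) / rho * ramp ((c + t) / rho))"
   using abs_triangle_ineq4 by metis
  also have "... <= bump_max / rho + bump_max / rho" by (intro add_mono b1)
  also have "... = 4 * bump_max / (R - r)" by (simp add: rho_def add_divide_distrib[symmetric])
  finally show ?thesis .
 qed
 have one: "eta t = 1" if "abs(t) <= r" for t
 proof -
  have "1 <= (c - t) / rho" "1 <= (c + t) / rho" using that rho by (auto simp: c_def rho_def field_simps)
  then show ?thesis by (simp add: eta_def ramp_eq_1)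
 qed
 have zero: "eta t = 0" if "R <= abs(t)" for t
 proof (cases "0 <= t")
  case True
  then have "(c - t) / rho <= -1" using that rho by (simp add: c_def rho_def field_simps)
  then show ?thesis by (simp add: eta_def ramp_eq_0)
 next
  case False
  then have "(c + t) / rho <= -1" using that rho by (simp add: c_def rho_def field_simps)
  then show ?thesis by (simp add: eta_def ramp_eq_0)
 qed
 have c0: "cont eta" using d by (auto intro!: continuous_at_imp_continuous_on DERIV_isCont)
 show ?thesis by (rule that[OF c0 c1 d _ one zero b]) (use ramp_range in "auto simp: eta_def mult_le_one")
qed

lemma cutoff:
 fixes a :: "real ^ 'n::finite"
 assumes "0 < r" "r < R"
 obtains psi psi1 where "cont psi" "!!j. cont (psi1 j)" "!!x j. ((%s. psi (sh x s j)) hrd psi1 j x) (at 0)"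
  "!!x. 0 <= psi x \<and> psi x <= 1" "!!x. x \<in> cube a r ==> psi x = 1" "!!x. x ~: cube a R ==> psi x = 0"
  "!!x. (\<Sum>j\<in>UNIV. abs(psi1 j x)) <= real CARD('n) * (4 * bump_max / (R - r))"
proof -
 obtain eta eta1 where eta: "cont eta" "cont eta1" "!!t. (eta hrd eta1 t) (at t)"
  "!!t. 0 <= eta t \<and> eta t <= 1" "!!t. abs(t) <= r ==> eta t = 1" "!!t. R <= abs(t) ==> eta t = 0"
  "!!t. abs(eta1 t) <= 4 * bump_max / (R - r)" using cutoff_1d[OF assms] by metis
 define psi where "psi x = (\<Prod>l\<in>UNIV. eta (x $ l - a $ l))" for x
 define psi1 where "psi1 j x = eta1 (x $ j - a $ j) * (\<Prod>l\<in>UNIV - {j}. eta (x $ l - a $ l))" for j x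
 have p1: "0 <= (\<Prod>l\<in>A. eta (x $ l - a $ l)) \<and> (\<Prod>l\<in>A. eta (x $ l - a $ l)) <= 1" for A x
  using eta(4) by (auto intro!: prod_nonneg prod_le_1)
 show ?thesis
 proof (rule that[of psi psi1])
  show "cont psi" unfolding psi_def[abs_def] by (intro continuous_intros continuous_on_compose2[OF eta(1)]) auto
  show "cont (psi1 j)" for j unfolding psi1_def[abs_def]
   by (intro continuous_intros continuous_on_compose2[OF eta(1)] continuous_on_compose2[OF eta(2)]) auto
  show "((%s. psi (sh x s j)) hrd psi1 j x) (at 0)" for x j
  proof -
   have eq: "psi (sh x s j) = eta (x $ j - a $ j + s) * (\<Prod>l\<in>UNIV - {j}. eta (x $ l - a $ l))" for s
   proof -
    have "psi (sh x s j) = eta ((sh x s j) $ j - a $ j) * (\<Prod>l\<in>UNIV - {j}. eta ((sh x s j) $ l - a $ l))"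
     unfolding psi_def by (rule prod.remove) auto
    also have "(\<Prod>l\<in>UNIV - {j}. eta ((sh x s j) $ l - a $ l)) = (\<Prod>l\<in>UNIV - {j}. eta (x $ l - a $ l))"
     by (rule prod.cong) (auto simp: axis_def)
    also have "(sh x s j) $ j - a $ j = x $ j - a $ j + s" by (simp add: axis_def)
    finally show ?thesis .
   qed
   have "((%s. eta (x $ j - a $ j + s)) hrd eta1 (x $ j - a $ j + 0) * 1) (at 0)"
    by (rule DERIV_chain2[OF eta(3)]) (auto intro!: derivative_eq_intros)
   then have "((%s. eta (x $ j - a $ j + s) * (\<Prod>l\<in>UNIV - {j}. eta (x $ l - a $ l))) hrd
     eta1 (x $ j - a $ j) * (\<Prod>l\<in>UNIV - {j}. eta (x $ l - a $ l))) (at 0)" using DERIV_cmult_right by fastforce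
   then show ?thesis unfolding eq psi1_def .
  qed
  show "0 <= psi x \<and> psi x <= 1" for x unfolding psi_def by (rule p1)
  show "psi x = 1" if "x \<in> cube a r" for x
   unfolding psi_def using that by (intro prod.neutral ballI eta(5)) (auto simp: cube_def)
  show "psi x = 0" if "x ~: cube a R" for x
  proof -
   obtain l where "R <= abs(x $ l - a $ l)" using \<open>x ~: cube a R\<close> by (auto simp: cube_def not_le intro: less_imp_le)
   then have "eta (x $ l - a $ l) = 0" by (rule eta(6))
   then show ?thesis unfolding psi_def by (intro prod_zero) auto
  qed
  show "(\<Sum>j\<in>UNIV. abs(psi1 j x)) <= real CARD('n) * (4 * bump_max / (R - r))" for x
  proof -
   have "abs(psi1 j x) <= 4 * bump_max / (R - r) * 1" for j
    unfolding psi1_def abs_mult using p1[of x "UNIV - {j}"] bump_max(1) assms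
    by (intro mult_mono eta(7)) (auto simp: abs_le_iff)
   then have "(\<Sum>j\<in>UNIV. abs(psi1 j x)) <= (\<Sum>j\<in>(UNIV::'n set). 4 * bump_max / (R - r))" by (intro sum_mono) simp
   then show ?thesis by simp
  qed
 qed
qed

lemma frechet_derivative_vanish:
 assumes "closed Q" "!!x. x ~: Q ==> psi x = 0" "x ~: Q" shows "frechet_derivative psi (at x) = (%_. 0)"
proof (rule frechet_derivative_at[symmetric])
 show "(psi has_derivative (%_. 0)) (at x)"
  by (rule has_derivative_transform_within_open[where s = "- Q" and f = "%_. 0"]) (use assms in auto)
qed

lemma wgrad_mono:
 assumes wg: "wgrad Q u w" and sub: "Q' \<subseteq> Q" and Q': "closed Q'"
 shows "wgrad Q' (%x. ind Q' x * u x) (%j x. ind Q' x * w j x)"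
 unfolding wgrad_def
proof (intro conjI allI impI)
 have m: "Q' \<in> sets lebesgue" using Q' by simp
 show "L1 (%x. ind Q' x * u x)" "L1 (%x. ind Q' x * w j x)" for j
  using wg m unfolding wgrad_def by (auto intro: integrable_restrict)
 fix psi j assume psi: "\<forall>k. Ck k psi" "\<forall>x. x ~: Q' --> psi x = 0"
 have d0: "frechet_derivative psi (at x) = (%_. 0)" if "x ~: Q'" for x
  by (rule frechet_derivative_vanish[OF Q' _ that]) (use psi in blast)
 have "(LI x. u x * pd psi x j) = - (LI x. w j x * psi x)" by (rule wgradD[OF wg]) (use psi sub in auto)
 moreover have "(%x. ind Q' x * u x * pd psi x j) = (%x. u x * pd psi x j)"
  "(%x. ind Q' x * w j x * psi x) = (%x. w j x * psi x)" using d0 psi by (auto simp: fun_eq_iff indicator_def)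
 ultimately show "(LI x. ind Q' x * u x * pd psi x j) =
    - (LI x. ind Q' x * w j x * psi x)" by simp
qed

text \<open>A gap between the rates absorbs any power: \<open>t\<close> is at most
  \<open>exp (dlt * t) / dlt\<close>, and \<open>s * dlt\<close> fits into
  \<open>l - b\<close>.\<close>

lemma powr_exp_le:
 fixes s b l :: real
 assumes "0 <= s" "b < l"
 obtains C where "0 <= C" "!!t. 1 <= t ==> t powr s * exp (b * t) <= C * exp (l * t)"
proof
 define dlt where "dlt = (l - b) / (s + 1)"
 have dlt: "0 < dlt" "s * dlt <= l - b" using assms by (auto simp: dlt_def field_simps)
 show "0 <= (1 / dlt) powr s" by simp
 fix t :: real assume t: "1 <= t"
 have "dlt * t <= exp (dlt * t)" using exp_ge_add_one_self[of "dlt * t"] by linarith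
 then have "t <= 1 / dlt * exp (dlt * t)" using dlt by (simp add: field_simps)
 then have "t powr s <= (1 / dlt * exp (dlt * t)) powr s" using t assms by (intro powr_mono2) auto
 also have "... = (1 / dlt) powr s * exp (dlt * t) powr s" by (rule powr_mult)
 also have "exp (dlt * t) powr s = exp (s * dlt * t)" by (simp add: powr_def mult.assoc)
 also have "(1 / dlt) powr s * exp (s * dlt * t) <= (1 / dlt) powr s * exp ((l - b) * t)"
  using dlt t by (intro mult_left_mono) (auto intro!: mult_right_mono)
 finally have "t powr s * exp (b * t) <= (1 / dlt) powr s * exp ((l - b) * t) * exp (b * t)" by (intro mult_right_mono) auto
 then show "t powr s * exp (b * t) <= (1 / dlt) powr s * exp (l * t)"
  by (simp add: mult.assoc exp_add[symmetric] left_diff_distrib)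
qed

lemma dyadic_level:
 fixes h :: real assumes "1 < h"
 obtains m :: nat where "1 <= m" "2 ^ m / 2 < h" "h <= 2 ^ m" "!!k. 2 ^ k / 2 < h ==> k <= m"
proof -
 obtain N where N: "h < 2 ^ N" using real_arch_pow[of 2 h] by auto
 define m where "m = (LEAST m. h <= 2 ^ m)"
 have 1: "h <= 2 ^ m" unfolding m_def using LeastI[of "%m. h <= 2 ^ m" N] N by simp
 have m0: "m ~= 0" using 1 assms by (cases m) auto
 have "\<not> h <= 2 ^ (m - 1)" using not_less_Least[of "m - 1" "%m. h <= 2 ^ m"] m0 unfolding m_def[symmetric] by simp
 moreover have "(2::real) ^ m = 2 * 2 ^ (m - 1)" using m0 by (simp add: power_eq_if)
 ultimately have 2: "2 ^ m / 2 < h" by simp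
 have "k <= m" if "2 ^ k / 2 < h" for k
 proof (rule ccontr)
  assume "\<not> k <= m"
  then have "(2::real) ^ Suc m <= 2 ^ k" by (intro power_increasing) auto
  then show False using that 1 by simp
 qed
 then show ?thesis using that[of m] m0 1 2 by simp
qed

text \<open>In a sum that grows geometrically the last term dominates, and the slowly varying
  denominators change only the constant.\<close>

lemma sum_geometric_over_index:
 fixes y :: real assumes "2 <= y" "1 <= m"
 shows "(\<Sum>k=1..m. y ^ k / real k) <= 4 * y ^ m / real m"
 using assms(2)
proof (induction m rule: dec_induct)
 case base
 then show ?case using assms by simp
next
 case (step m)
 have "4 * y ^ m / real m <= 3 * y ^ Suc m / real (Suc m)" if "2 <= m"
 proof -
  have "4 * y ^ m * real (Suc m) <= 3 * (2 * y ^ m) * real m" using that assms by (simp add: algebra_simps)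
  also have "... <= 3 * (y * y ^ m) * real m" using assms by (intro mult_right_mono mult_left_mono) auto
  finally show ?thesis using that by (simp add: field_simps)
 qed
 moreover have "y ^ 1 / real 1 <= 3 * y ^ Suc 1 / real (Suc 1)" using assms by (simp add: field_simps power2_eq_square)
 ultimately have "(\<Sum>k=1..m. y ^ k / real k) <= 3 * y ^ Suc m / real (Suc m)"
  using step by (cases "m = 1") (auto intro: order_trans)
 then have "(\<Sum>k=1..Suc m. y ^ k / real k) <= 3 * y ^ Suc m / real (Suc m) + y ^ Suc m / real (Suc m)"
  unfolding sum.nat_ivl_Suc'[OF le_SucI[OF step(1)]] by linarith
 also have "... = 4 * y ^ Suc m / real (Suc m)" unfolding add_divide_distrib[symmetric] by simp
 finally show ?case .
qed

text \<open>If the numbers \<open>a l\<close> stayed above \<open>e\<close> from some index on, the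
  harmonic series would converge.\<close>

lemma bounded_harmonic_contradiction:
 assumes "0 < e" "!!N. (\<Sum>k=1..N. a k / real k) <= (B::real)" "!!k. 0 <= a k"
 shows "\<exists>l\<ge>K. a l < e"
proof (rule ccontr)
 assume "\<not> ?thesis"
 then have ge: "!!l. K <= l ==> e <= a l" by (meson not_le)
 have "summable (%k. a (Suc k) / real (Suc k))"
 proof (rule summableI_nonneg_bounded[where x = B])
  show "0 <= a (Suc n) / real (Suc n)" for n using assms(3) by simp
  show "(\<Sum>i<n. a (Suc i) / real (Suc i)) <= B" for n
  proof -
   have "(\<Sum>i<n. a (Suc i) / real (Suc i)) = (\<Sum>k=1..n. a k / real k)" unfolding atLeast1_atMost_eq_remove0
    by (induction n) (auto simp: atMost_Suc lessThan_Suc insert_Diff_if)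
   then show ?thesis using assms(2)[of n] by simp
  qed
 qed
 then have "summable (%k. a (k + Suc K) / real (k + Suc K))"
  using summable_ignore_initial_segment[of "%k. a (Suc k) / real (Suc k)" K] by (simp add: add.commute)
 then have "summable (%k. e / real (k + Suc K))"
  by (rule summable_comparison_test'[where N = 0]) (use ge[of "_ + Suc K"] assms(1) in "auto intro!: divide_right_mono")
 then have "summable (%k. 1 / e * (e / real (k + Suc K)))" by (rule summable_mult)
 then have "summable (%k. inverse (real (k + Suc K)))" using assms(1) by (simp add: inverse_eq_divide)
 then have "summable (%k. inverse (real k))" using summable_iff_shift[of "%k. inverse (real k)" "Suc K"] by simp
 then show False using not_summable_harmonic[where 'a=real] by simp
qed

section \<open>Absorption under exponentially integrable distortion\<close>

text \<open>The number \<open>iota\<close> will be the infimum of the comass, which allows the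
  distortion inequality to be stated for \<open>h\<close> alone; \<open>K\<close> is a real version
  of the distortion function, at least one everywhere.\<close>

locale distortion_cube = form_cube m phi a R f D h L
 for m and phi :: "'n::{finite,linorder} form" and a R f D h L +
 fixes K and iota l :: real
 assumes h0: "!!x. x ~: cube a R ==> h x = 0"
  and K: "!!x. 1 <= K x" and E: "L1 (%x. ind (cube a R) x * exp (l * K x))"
  and Jn: "AE x in lm. 0 <= ind (cube a R) x * form_at m phi (f x) (D x)"
  and dist: "AE x in lm. x \<in> cube a R --> iota * h x ^ CARD('n) <= K x * form_at m phi (f x) (D x)"
  and iota: "0 < iota" and l: "0 < l"
begin

definition J0 where "J0 x = ind (cube a R) x * form_at m phi (f x) (D x)" for x
definition E0 where "E0 x = ind (cube a R) x * exp (l * K x)" for x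
text \<open>The exponents are spaced as \<open>n - kap\<close>, \<open>n - kap / 2\<close>,
  \<open>p\<close>, \<open>n\<close>: the first is that of the boundary term, the second leaves room
  for a factor that decays with the level, and at the third integrability of \<open>h\<close> is
  easy to obtain.\<close>

definition p where "p = real CARD('n) - kap / 4"

lemma J0i: "L1 J0" and E0i: "L1 E0"
 using J E by (simp_all add: J0_def[abs_def] E0_def[abs_def])

lemma E0_nonneg: "0 <= E0 x" by (simp add: E0_def)

lemma AE_dist: "AE x in lm. 0 <= J0 x \<and> iota * h x ^ CARD('n) <= K x * J0 x"
 using Jn dist
proof eventually_elim
 case (elim x)
 then show ?case using h0[of x] n2 by (cases "x \<in> cube a R") (auto simp: J0_def power_0_left)
qed

lemma h_measurable: "h \<in> bml" using h by (rule borel_measurable_integrable)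

lemma p: "1 < p" using n2 kap by (simp add: p_def numeral_le_real_of_nat_iff)

lemma AE_integrable_bound:
 assumes "g \<in> bml" "!!x. 0 <= g x" "!!x. x ~: cube a R ==> g x = 0"
  and "!!x. x \<in> cube a R ==> 0 <= J0 x ==> iota * h x ^ CARD('n) <= K x * J0 x ==> g x <= A * J0 x + B * exp (l * K x)"
 shows "L1 g"
proof (rule int_bound[OF _ assms(1)])
 show "L1 (%x. A * J0 x + B * E0 x)" by (intro int_add integrable_mult_right J0i E0i)
 show "AE x in lm. norm (g x) <= norm (A * J0 x + B * E0 x)" using AE_dist
 proof eventually_elim
  case (elim x)
  then have "g x <= A * J0 x + B * E0 x" using assms(3,4)[of x] by (cases "x \<in> cube a R") (auto simp: E0_def J0_def)
  then show ?case using assms(2)[of x] by simp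
 qed
qed

text \<open>If \<open>K\<close> is at most a small power of \<open>h\<close>, the distortion
  inequality bounds \<open>h powr p\<close> by the Jacobian; otherwise \<open>h\<close> is below a
  power of \<open>K\<close>, which the exponential dominates.\<close>

lemma h_powr_integrable: "L1 (%x. h x powr p)"
proof -
 define dlt where "dlt = kap / 4"
 have dlt: "0 < dlt" using kap by (simp add: dlt_def)
 obtain C where C: "0 <= C" "!!t. 1 <= t ==> t powr (p / dlt) * exp (0 * t) <= C * exp (l * t)"
  using powr_exp_le[of "p / dlt" 0 l] p dlt l by auto
 show ?thesis
 proof (rule AE_integrable_bound[where A = "1 / iota" and B = C])
  show "(%x. h x powr p) \<in> bml" using h_measurable by simp
  fix x assume x: "x \<in> cube a R" "0 <= J0 x" "iota * h x ^ CARD('n) <= K x * J0 x"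
  have J': "0 <= 1 / iota * J0 x" using x iota by simp
  have E': "0 <= C * exp (l * K x)" using C by simp
  show "h x powr p <= 1 / iota * J0 x + C * exp (l * K x)"
  proof (cases "h x = 0")
   case True
   then show ?thesis using J' E' by simp
  next
   case False
   then have hp: "0 < h x" using h_nonneg[of x] by simp
   show ?thesis
   proof (cases "K x <= h x powr dlt")
    case True
    have "iota * (h x powr p * h x powr dlt) = iota * h x ^ CARD('n)"
     using hp by (simp add: powr_add[symmetric] p_def dlt_def powr_realpow)
    also have "... <= h x powr dlt * J0 x" using x(3) mult_right_mono[OF True x(2)] by linarith
    finally have "(iota * h x powr p) * h x powr dlt <= J0 x * h x powr dlt" by (simp add: mult_ac)
    then have "iota * h x powr p <= J0 x" using hp by (simp add: mult_le_cancel_right)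
    then have "h x powr p <= 1 / iota * J0 x" using iota by (simp add: field_simps)
    then show ?thesis using E' by linarith
   next
    case False
    have "h x powr p = (h x powr dlt) powr (p / dlt)" using dlt by (simp add: powr_powr)
    also have "... <= K x powr (p / dlt)" using False p dlt by (intro powr_mono2) auto
    also have "... <= C * exp (l * K x)" using C(2)[OF K[of x]] by simp
    finally show ?thesis using J' by simp
   qed
  qed
 qed (use h0 in auto)
qed

text \<open>The same alternative on the logarithmic scale: either \<open>K\<close> is at most a
  multiple of the logarithm, or \<open>h ^ n\<close> is at most an exponential of \<open>K\<close>.
  The number \<open>A\<close> is chosen to make the rate of the latter exactly
  \<open>l\<close>.\<close>

lemma h_log_integrable: "L1 (%x. h x ^ CARD('n) / log 2 (2 + h x))"
proof -
 define A where "A = l / (real CARD('n) * ln 2)"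
 have n0: "0 < real CARD('n)" by simp
 have A: "0 < A" "real CARD('n) * ln 2 * A = l" using l n0 by (auto simp: A_def)
 show ?thesis
 proof (rule AE_integrable_bound[where A = "1 / (iota * A)" and B = 1])
  show "(%x. h x ^ CARD('n) / log 2 (2 + h x)) \<in> bml" using h_measurable by simp
  have lg: "1 <= log 2 (2 + h x)" for x using h_nonneg[of x] by simp
  show "0 <= h x ^ CARD('n) / log 2 (2 + h x)" for x using lg[of x] h_nonneg[of x] by simp
  show "h x ^ CARD('n) / log 2 (2 + h x) = 0" if "x ~: cube a R" for x using h0[OF that] by simp
  fix x assume x: "x \<in> cube a R" "0 <= J0 x" "iota * h x ^ CARD('n) <= K x * J0 x"
  define g where "g = log 2 (2 + h x)"
  have g: "1 <= g" using lg by (simp add: g_def)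
  have "h x ^ CARD('n) / g <= 1 / (iota * A) * J0 x + 1 * exp (l * K x)"
  proof (cases "K x * A <= g")
   case True
   have "h x ^ CARD('n) * (iota * A) <= K x * A * J0 x" using mult_right_mono[OF x(3), of A] A by (simp add: mult_ac)
   also have "... <= g * J0 x" using True x(2) by (rule mult_right_mono)
   finally have "h x ^ CARD('n) / g <= 1 / (iota * A) * J0 x" using g A iota by (simp add: field_simps)
   then show ?thesis by (simp add: add_increasing2)
  next
   case False
   have "h x ^ CARD('n) / g <= h x ^ CARD('n) / 1" using g h_nonneg[of x] by (intro divide_left_mono) auto
   also have "... <= (2 + h x) ^ CARD('n)" using h_nonneg[of x] by (simp add: power_mono)
   also have "... = exp (real CARD('n) * ln 2 * g)"
    using h_nonneg[of x] by (simp add: g_def log_def exp_of_nat_mult)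
   also have "... <= exp (real CARD('n) * ln 2 * (K x * A))" using False n0 by (auto intro!: mult_left_mono)
   also have "... = exp (l * K x)" using A(2) by (metis mult.assoc mult.commute)
   finally show ?thesis using x(2) A iota by (simp add: add_increasing)
  qed
  then show "h x ^ CARD('n) / log 2 (2 + h x) <= 1 / (iota * A) * J0 x + 1 * exp (l * K x)" by (simp add: g_def)
 qed
qed

text \<open>By the truncated weak type inequality the quantities in question, divided by
  \<open>k\<close>, are bounded by integrals of \<open>b k\<close>; the sum of the functions
  \<open>b k\<close> is controlled by the integrable \<open>h ^ n / log 2 (2 + h)\<close>.
  Divergence of the harmonic series then forces small values arbitrarily far out.\<close>

lemma max_set_decay: assumes e: "0 < e" shows "\<exists>k\<ge>k0. (2 ^ k) ^ CARD('n) * vol (max_set h (2 ^ k)) < e"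
proof (rule bounded_harmonic_contradiction[OF e])
 define g where "g x = h x ^ CARD('n) / log 2 (2 + h x)" for x
 define b where "b k x = (2 ^ k) ^ (CARD('n) - 1) / real k * (ind {y. 2 ^ k / 2 < h y} x * h x)" for k :: nat and x
 have S: "{y. 2 ^ k / 2 < h y} \<in> sets lebesgue" for k :: nat
  using h_measurable unfolding borel_measurable_iff_greater by (simp del: less_divide_eq_numeral1 divide_less_eq_numeral1)
 have bi: "L1 (b k)" for k unfolding b_def by (intro integrable_mult_right integrable_restrict h S)
 have ns: "x * x ^ (CARD('n) - 1) = (x::real) ^ CARD('n)" for x by (simp add: power_eq_if)
 have bsum: "(\<Sum>k=1..N. b k x) <= 8 * 2 ^ (CARD('n) - 1) * g x" for N x
 proof (cases "1 < h x")
  case False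
  have "b k x = 0" if "k \<in> {1..N}" for k
  proof -
   have "(2::real) ^ 1 <= 2 ^ k" using that by (intro power_increasing) auto
   then show ?thesis using False by (simp add: b_def)
  qed
  then have "(\<Sum>k=1..N. b k x) = 0" by simp
  moreover have "0 <= g x" using h_nonneg[of x] by (simp add: g_def)
  ultimately show ?thesis by simp
 next
  case True
  then obtain M :: nat where M: "1 <= M" "2 ^ M / 2 < h x" "h x <= 2 ^ M" "!!k. 2 ^ k / 2 < h x ==> k <= M"
   using dyadic_level by blast
  define y :: real where "y = 2 ^ (CARD('n) - 1)"
  have y: "2 <= y" using n2 power_increasing[of 1 "CARD('n) - 1" "2::real"] by (simp add: y_def)
  have py: "(2 ^ k) ^ (CARD('n) - 1) = y ^ k" for k by (simp add: y_def power_mult[symmetric] mult.commute)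
  have "(\<Sum>k=1..N. b k x) <= (\<Sum>k=1..N. if k <= M then y ^ k / real k * h x else 0)"
   unfolding b_def py using M(4) True y by (intro sum_mono) (auto simp: indicator_def)
  also have "... = (\<Sum>k\<in>{1..N} \<inter> {..M}. y ^ k / real k * h x)" unfolding sum.inter_restrict[OF finite_atLeastAtMost] by simp
  also have "... <= (\<Sum>k=1..M. y ^ k / real k * h x)" using y True by (intro sum_mono2) auto
  also have "... = (\<Sum>k=1..M. y ^ k / real k) * h x" by (simp add: sum_distrib_right)
  also have "... <= 4 * y ^ M / real M * h x" using sum_geometric_over_index[OF y M(1)] True by (intro mult_right_mono) auto
  also have "... <= 8 * 2 ^ (CARD('n) - 1) * g x"
  proof -
   have "y ^ M <= (2 * h x) ^ (CARD('n) - 1)" unfolding py[symmetric] using M(2) by (intro power_mono) auto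
   then have "y ^ M * h x <= (2 * h x) ^ (CARD('n) - 1) * h x" using True by (intro mult_right_mono) auto
   also have "... = 2 ^ (CARD('n) - 1) * (h x * h x ^ (CARD('n) - 1))" unfolding power_mult_distrib by (simp only: mult_ac)
   finally have 1: "y ^ M * h x <= 2 ^ (CARD('n) - 1) * h x ^ CARD('n)" unfolding ns .
   have "2 + h x <= 2 ^ (M + 1)" using M(3) power_increasing[OF M(1), of "2::real"] by simp
   then have "log 2 (2 + h x) <= log 2 (2 ^ (M + 1))" using True by simp
   also have "... = real (M + 1)" by (subst log_nat_power) auto
   finally have 2: "log 2 (2 + h x) <= 2 * real M" using M(1) by simp
   have 3: "0 < log 2 (2 + h x)" using True by simp
   have "4 * y ^ M / real M * h x = 8 * (y ^ M * h x) / (2 * real M)" using M(1) by (simp add: field_simps)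
   also have "... <= 8 * (2 ^ (CARD('n) - 1) * h x ^ CARD('n)) / log 2 (2 + h x)"
    using 1 2 3 True y by (intro frac_le mult_left_mono) auto
   finally show ?thesis by (simp add: g_def)
  qed
  finally show ?thesis .
 qed
 show "(\<Sum>k=1..N. (2 ^ k) ^ CARD('n) * vol (max_set h (2 ^ k)) / real k) <= 2 * 5 ^ CARD('n) * (8 * 2 ^ (CARD('n) - 1) * integral\<^sup>L lebesgue g)" for N
 proof -
  have "(\<Sum>k=1..N. (2 ^ k) ^ CARD('n) * vol (max_set h (2 ^ k)) / real k) <= (\<Sum>k=1..N. 2 * 5 ^ CARD('n) * integral\<^sup>L lebesgue (b k))"
  proof (rule sum_mono)
   fix k assume k: "k \<in> {1..N}"
   define I where "I = (LI x. ind {y. 2 ^ k / 2 < h y} x * h x)"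
   have "vol (max_set h (2 ^ k)) <= 2 * 5 ^ CARD('n) / 2 ^ k * I"
    using max_set_weak_type_truncated[OF h h_nonneg, of "2 ^ k"] by (simp add: I_def slint_def)
   then have "(2 ^ k) ^ CARD('n) * vol (max_set h (2 ^ k)) / real k <= (2 ^ k) ^ CARD('n) * (2 * 5 ^ CARD('n) / 2 ^ k * I) / real k"
    by (intro divide_right_mono mult_left_mono) auto
   also have "... = 2 * 5 ^ CARD('n) * ((2 ^ k) ^ (CARD('n) - 1) / real k * I)" unfolding ns[symmetric] by simp
   also have "... = 2 * 5 ^ CARD('n) * integral\<^sup>L lebesgue (b k)" by (simp add: b_def[abs_def] I_def)
   finally show "(2 ^ k) ^ CARD('n) * vol (max_set h (2 ^ k)) / real k <= 2 * 5 ^ CARD('n) * integral\<^sup>L lebesgue (b k)" .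
  qed
  also have "... = 2 * 5 ^ CARD('n) * (LI x. (\<Sum>k=1..N. b k x))"
   using bi by (simp add: sum_distrib_left lint_sum)
  also have "... <= 2 * 5 ^ CARD('n) * (LI x. 8 * 2 ^ (CARD('n) - 1) * g x)"
  proof (intro mult_left_mono integral_mono)
   show "L1 (%x. \<Sum>k=1..N. b k x)" using bi by simp
   show "L1 (%x. 8 * 2 ^ (CARD('n) - 1) * g x)" unfolding g_def[abs_def] by (intro integrable_mult_right h_log_integrable)
  qed (use bsum in auto)
  finally show ?thesis by simp
 qed
qed simp

end

context distortion_cube begin

lemma cube_le: "R' <= R ==> cube a R' \<subseteq> cube a R" by (rule cube_mono)

text \<open>The basic inequality between concentric cubes, uniform in the radii. Its error contains
  a negative power of \<open>2 ^ k\<close>, so it survives summation with polynomial weights, and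
  the factor \<open>1 / (R' - r)\<close> from the slope of the cutoff.\<close>

lemma level_inequality:
 assumes R1: "0 < R1" "R1 < R"
 shows "\<exists>k0 C. 0 <= C \<and> (\<forall>k\<ge>k0. \<forall>r R'. R1 <= r --> r < R' --> R' <= R -->
  (LI x. ind (cube a r) x * (ind {x. 2 ^ k < h x} x * J0 x)) <=
   level_const CARD('n) * L * ((2 ^ k) ^ (CARD('n) - 1) * (LI x. ind (cube a R') x * (ind {x. 2 ^ k / 2 < h x} x * h x)))
   + C / (R' - r) * (2 ^ k) powr (- kap / 2))"
proof -
 define Cf where "Cf = abs(power_const CARD('n)) * sqrt R * (integral\<^sup>L lebesgue h) powr (1 / (2 * real CARD('n))) + 1"
 define C0 where "C0 = real m * (4 * Cf * ((2 * bump_max) ^ CARD('n) + 1)) * (2 * (real m * real CARD('n)) * (slope_const CARD('n) + 1)) ^ (CARD('n) - 1)"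
 define M where "M = (LI x. ind (cube a R) x * dmax h x powr (real CARD('n) - kap / 2))"
 define C where "C = L * (fact CARD('n) * (real CARD('n) * (4 * bump_max))) * C0 * M"
 have Cf: "0 < Cf" using R unfolding Cf_def by (intro add_nonneg_pos) auto
 have M0: "0 <= M" unfolding M_def by (intro integral_nonneg_AE AE_I2) auto
 have q: "0 <= real CARD('n) - kap / 2" "real CARD('n) - kap / 2 < p" using kap n2 by (auto simp: p_def)
 have Mi: "L1 (%x. ind (cube a R) x * dmax h x powr (real CARD('n) - kap / 2))"
  by (rule dmax_powr_integrable[OF h h_nonneg _ h_powr_integrable q]) (use p in auto)
 have h1: "integral\<^sup>L lebesgue h >= 0" using h_nonneg by (simp add: integral_nonneg_AE)
 \<comment> \<open>From this level on the bad set has smaller measure than the smallest cube, so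
   \<open>F k\<close> is not empty and there are values to extend.\<close>
 obtain k0 :: nat where k0: "5 ^ CARD('n) * integral\<^sup>L lebesgue h < 2 ^ k0 * (2 * R1) ^ CARD('n)"
 proof -
  obtain k0 :: nat where "5 ^ CARD('n) * integral\<^sup>L lebesgue h / (2 * R1) ^ CARD('n) < 2 ^ k0"
   using real_arch_pow[of 2] by auto
  then have "5 ^ CARD('n) * integral\<^sup>L lebesgue h < 2 ^ k0 * (2 * R1) ^ CARD('n)"
   using R1 by (simp add: pos_divide_less_eq)
  then show ?thesis using that by blast
 qed
 have main: "(LI x. ind (cube a r) x * (ind {x. 2 ^ k < h x} x * J0 x)) <=
   level_const CARD('n) * L * ((2 ^ k) ^ (CARD('n) - 1) * (LI x. ind (cube a R') x * (ind {x. 2 ^ k / 2 < h x} x * h x)))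
   + C / (R' - r) * (2 ^ k) powr (- kap / 2)" and C0p: "0 <= C0"
  if k: "k0 <= k" and r: "R1 <= r" "r < R'" "R' <= R" for k r R'
 proof -
  define h' where "h' x = ind (cube a R') x * h x" for x
  have r0: "0 < r" "0 < R'" using r R1 by auto
  have sub: "cube a R' \<subseteq> cube a R" using cube_le[OF r(3)] .
  have h'i: "L1 h'" unfolding h'_def[abs_def] by (intro integrable_restrict h) simp
  have h'h: "h' x <= h x" for x using h_nonneg[of x] by (simp add: h'_def indicator_def)
  have h'int: "integral\<^sup>L lebesgue h' <= integral\<^sup>L lebesgue h" by (rule integral_mono[OF h'i h h'h])
  have h'0: "0 <= integral\<^sup>L lebesgue h'" using h_nonneg by (simp add: integral_nonneg_AE h'_def)
  \<comment> \<open>The curve is truncated on the cube of half side \<open>R'\<close> with the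
    majorant cut off there, while \<open>h\<close> itself plays the part of
    \<open>H\<close>.\<close>
  interpret t: truncation m phi a R' f D h' L h p Cf
  proof unfold_locales
   show "2 <= CARD('n)" "0 < m" "0 < R'" "closed_form m phi" using n2 m r0 cl by auto
   show "Ck_Rm m (Suc 0) (phi I)" if "I \<in> multi_indices m" for I by (rule phi[OF that])
   show "(\<Sum>I\<in>multi_indices m. abs(phi I q)) <= L" if "q \<in> Rm m" for q by (rule L[OF that])
   show "f x \<in> Rm m" for x by (rule fR)
   show "wgrad (cube a R') (%x. ind (cube a R') x * f x i) (%j x. ind (cube a R') x * D x j i)" if "i < m" for i
   proof -
    have "wgrad (cube a R') (%x. ind (cube a R') x * (ind (cube a R) x * f x i)) (%j x. ind (cube a R') x * (ind (cube a R) x * D x j i))"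
     by (rule wgrad_mono[OF wg[OF that] sub]) (simp only: cube_eq_cbox closed_cbox)
    moreover have "ind (cube a R') x * (ind (cube a R) x * z) = ind (cube a R') x * (z::real)" for x z
     using sub by (auto simp: indicator_def)
    ultimately show ?thesis by simp
   qed
   show "abs(ind (cube a R') x * D x j i) <= h' x" if "i < m" for i j x
    using Dh[OF that, of x j] sub by (auto simp: h'_def indicator_def)
   show "L1 h'" by (rule h'i)
   show "L1 h" by (rule h)
   show "h' x <= h x" for x by (rule h'h)
   show "real CARD('n) - 1 / (2 * real CARD('n)) < p" using kap(1) unfolding p_def kap_def[symmetric] by simp
   show "L1 (%x. h x powr p)" by (rule h_powr_integrable)
   show "L1 (%x. ind (cube a R') x * form_at m phi (f x) (D x))"
   proof -
    have "L1 (%x. ind (cube a R') x * (ind (cube a R) x * form_at m phi (f x) (D x)))"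
     by (intro integrable_restrict J) simp
    moreover have "(%x. ind (cube a R') x * (ind (cube a R) x * form_at m phi (f x) (D x))) = (%x. ind (cube a R') x * form_at m phi (f x) (D x))"
     using sub by (auto simp: indicator_def fun_eq_iff)
    ultimately show ?thesis by simp
   qed
   show "0 < Cf" by (rule Cf)
   have "power_const CARD('n) * sqrt R' * (integral\<^sup>L lebesgue h') powr (1 / (2 * real CARD('n))) <=
    abs(power_const CARD('n)) * sqrt R * (integral\<^sup>L lebesgue h) powr (1 / (2 * real CARD('n)))"
    using r0 r h'int h'0 by (intro mult_mono powr_mono2) auto
   then show "power_const CARD('n) * sqrt R' * (integral\<^sup>L lebesgue h') powr (1 / (2 * real CARD('n))) <= Cf"
    by (simp add: Cf_def)
  qed
  have tC: "t.C0 = C0" by (simp add: t.C0_def t.Cd_def t.Ce_def C0_def)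
  show "0 <= C0" using t.const_pos(3) tC by simp
  have tJ: "t.J0 x = ind (cube a R') x * J0 x" for x
   using sub by (auto simp: t.J0_def J0_def t.Q_def indicator_def)
  have ne: "t.F k ~= {}"
  proof
   assume F: "t.F k = {}"
   have "(2 * R1) ^ CARD('n) <= (2 * R') ^ CARD('n)" using R1 r by (intro power_mono) auto
   also have "... = vol (t.Q - t.F k)" using r0 by (simp add: F t.Q_def measure_cube)
   also have "... <= 5 ^ CARD('n) / 2 ^ k * integral\<^sup>L lebesgue h'"
    using t.Q_diff_F(2)[of k] max_set_weak_type(2)[OF h'i t.h_nonneg, of "2 ^ k"] by simp
   also have "... <= 5 ^ CARD('n) / 2 ^ k0 * integral\<^sup>L lebesgue h"
    using h'int h'0 k by (intro mult_mono divide_left_mono power_increasing) auto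
   also have "... < (2 * R1) ^ CARD('n)" using k0 by (simp add: field_simps)
   finally show False by simp
  qed
  obtain psi psi1 where psi: "cont psi" "!!j. cont (psi1 j)" "!!x j. ((%s. psi (sh x s j)) hrd psi1 j x) (at 0)"
   "!!x. 0 <= psi x \<and> psi x <= 1" "!!x. x \<in> cube a r ==> psi x = 1" "!!x. x ~: cube a R' ==> psi x = 0"
   "!!x. (\<Sum>j\<in>UNIV. abs(psi1 j x)) <= real CARD('n) * (4 * bump_max / (R' - r))"
   by (rule cutoff[OF r0(1) r(2), of a]) (rule that; assumption)
  define I where "I = (LI x. ind (max_set h (2 ^ k)) x * (ind t.Q x * dmax h x powr (real CARD('n) - kap)))"
  have lim: "(LI x. ind {x. 2 ^ k < h' x} x * (psi x * t.J0 x)) <= t.Pb k * vol (t.Q - t.F k) +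
   L * (fact CARD('n) * (real CARD('n) * (4 * bump_max / (R' - r)))) * C0 * I" unfolding I_def tC[symmetric]
  proof (rule t.level_limit[OF psi(1) psi(4) ne psi(2,3) _ psi(7)])
   show "psi x = 0" if "x ~: t.Q" for x using that psi(6) by (simp add: t.Q_def)
   show "\<exists>l\<ge>K. (2 ^ l) ^ CARD('n) * vol (max_set h (2 ^ l)) < e" if "0 < e" for e K by (rule max_set_decay[OF that])
   show "AE x in lm. 0 <= t.J0 x" using AE_dist by eventually_elim (simp add: tJ indicator_def)
  qed
  \<comment> \<open>Where the maximal function exceeds \<open>2 ^ k\<close>, half of the gain
    \<open>kap\<close> is traded for decay in \<open>k\<close>; the other half keeps the remaining
    power integrable.\<close>
  have Ile: "I <= (2 ^ k) powr (- kap / 2) * M"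
  proof -
   have "I <= (LI x. (2 ^ k) powr (- kap / 2) * (ind (cube a R) x * dmax h x powr (real CARD('n) - kap / 2)))"
    unfolding I_def
   proof (rule integral_mono_AE)
    have q': "0 <= real CARD('n) - t.kap" "real CARD('n) - t.kap < p" using kap n2 by (auto simp: p_def)
    show "L1 (%x. ind (max_set h (2 ^ k)) x * (ind t.Q x * dmax h x powr (real CARD('n) - kap)))"
     using open_max_set[OF h h_nonneg] by (intro integrable_restrict t.dmax_int q') (simp add: borel_open)
    show "L1 (%x. (2 ^ k) powr (- kap / 2) * (ind (cube a R) x * dmax h x powr (real CARD('n) - kap / 2)))"
     by (intro integrable_mult_right Mi)
    show "AE x in lm. ind (max_set h (2 ^ k)) x * (ind t.Q x * dmax h x powr (real CARD('n) - kap))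
      <= (2 ^ k) powr (- kap / 2) * (ind (cube a R) x * dmax h x powr (real CARD('n) - kap / 2))"
     using AE_finite_maximal[OF h h_nonneg]
    proof eventually_elim
     case (elim x)
     then obtain l where l: "x ~: max_set h (2 ^ l)" by blast
     show ?case
     proof (cases "x \<in> max_set h (2 ^ k) \<and> x \<in> t.Q")
      case True
      define T where "T = dmax h x"
      have "2 ^ Suc k <= T" unfolding T_def using dmax_ge[OF _ l, of k] True by blast
      then have "2 ^ k <= T" using zero_le_power[of "2::real" k] unfolding power_Suc by linarith
      moreover have T1: "1 <= T" using dmax_notin[OF l] by (simp add: T_def)
      ultimately have "T powr (- kap / 2) <= (2 ^ k) powr (- kap / 2)" using kap by (intro powr_mono2') auto
      then have "T powr (- kap / 2) * T powr (real CARD('n) - kap / 2) <= (2 ^ k) powr (- kap / 2) * T powr (real CARD('n) - kap / 2)"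
       by (intro mult_right_mono) auto
      moreover have "T powr (- kap / 2) * T powr (real CARD('n) - kap / 2) = T powr (real CARD('n) - kap)"
       by (simp add: powr_add[symmetric])
      moreover have "x \<in> cube a R" using True sub by (auto simp: t.Q_def)
      ultimately show ?thesis using True by (simp add: T_def)
     next
      case False
      then show ?thesis by (auto simp: indicator_def)
     qed
    qed
   qed
   then show ?thesis by (simp add: M_def)
  qed
  have "L * (fact CARD('n) * (real CARD('n) * (4 * bump_max / (R' - r)))) * C0 * I <=
   L * (fact CARD('n) * (real CARD('n) * (4 * bump_max / (R' - r)))) * C0 * ((2 ^ k) powr (- kap / 2) * M)"
   using Ile L_nonneg bump_max(1) r t.const_pos(3) unfolding tC by (intro mult_left_mono) auto
  also have "... = C / (R' - r) * (2 ^ k) powr (- kap / 2)" by (simp add: C_def)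
  finally have 1: "L * (fact CARD('n) * (real CARD('n) * (4 * bump_max / (R' - r)))) * C0 * I <= C / (R' - r) * (2 ^ k) powr (- kap / 2)" .
  have eq: "ind {y. 2 ^ k / 2 < h' y} x * h' x = ind (cube a R') x * (ind {x. 2 ^ k / 2 < h x} x * h x)" for x
   by (auto simp: h'_def indicator_def)
  have 2: "t.Pb k * vol (t.Q - t.F k) <=
   level_const CARD('n) * L * ((2 ^ k) ^ (CARD('n) - 1) * (LI x. ind (cube a R') x * (ind {x. 2 ^ k / 2 < h x} x * h x)))"
   using t.level_weak[of k] unfolding eq .
  have hm: "{x. 2 ^ k < h x} \<in> sets lebesgue" "{x. 2 ^ k < h' x} \<in> sets lebesgue"
   using h_measurable borel_measurable_integrable[OF h'i] unfolding borel_measurable_iff_greater by auto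
  have tJi: "L1 t.J0" unfolding tJ[abs_def] by (intro integrable_restrict J0i) simp
  have "(LI x. ind (cube a r) x * (ind {x. 2 ^ k < h x} x * J0 x)) <=
   (LI x. ind {x. 2 ^ k < h' x} x * (psi x * t.J0 x))"
  proof (rule integral_mono_AE)
   show "L1 (%x. ind (cube a r) x * (ind {x. 2 ^ k < h x} x * J0 x))" by (intro integrable_restrict J0i hm) simp
   have "L1 (%x. psi x * t.J0 x)"
    using integrable_mult_continuous_bounded[OF tJi psi(1), of 1] psi(4) by (simp add: mult.commute abs_of_nonneg)
   then show "L1 (%x. ind {x. 2 ^ k < h' x} x * (psi x * t.J0 x))" by (intro integrable_restrict hm)
   show "AE x in lm. ind (cube a r) x * (ind {x. 2 ^ k < h x} x * J0 x) <= ind {x. 2 ^ k < h' x} x * (psi x * t.J0 x)"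
    using AE_dist
   proof eventually_elim
    case (elim x)
    show ?case
    proof (cases "x \<in> cube a r")
     case True
     then have "x \<in> cube a R'" using cube_mono[of r R' a] r by auto
     then show ?thesis using True psi(5)[OF True] by (simp add: h'_def tJ indicator_def)
    next
     case False
     then show ?thesis using elim psi(4)[of x] by (simp add: tJ indicator_def)
    qed
   qed
  qed
  then show "(LI x. ind (cube a r) x * (ind {x. 2 ^ k < h x} x * J0 x)) <=
   level_const CARD('n) * L * ((2 ^ k) ^ (CARD('n) - 1) * (LI x. ind (cube a R') x * (ind {x. 2 ^ k / 2 < h x} x * h x)))
   + C / (R' - r) * (2 ^ k) powr (- kap / 2)" using lim 1 2 by linarith
 qed
 have "0 <= C" using C0p[of k0 R1 R] R1 L_nonneg bump_max(1) M0 unfolding C_def by auto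
 then show ?thesis using main by blast
qed

end

section \<open>Sums over dyadic levels and the pointwise absorption\<close>

lemma sum_power_le:
 fixes y :: real assumes "2 <= y" shows "(\<Sum>k\<le>m. y ^ k) <= 2 * y ^ m"
proof (induction m)
 case (Suc m)
 have "2 * y ^ m <= y * y ^ m" using assms by (intro mult_right_mono) auto
 then show ?case using Suc by simp
qed simp

text \<open>For large \<open>h\<close> and \<open>k1\<close> this has the order of the logarithm of
  \<open>h\<close> to the power \<open>q\<close>; multiplied by the Jacobian it is what the left
  sides of the level inequalities add up to.\<close>

definition low_sum :: "nat => nat => nat => real => real" where
 "low_sum q k0 k1 h = (\<Sum>k=k0..k1. real k ^ (q - 1) * (if 2 ^ k < h then 1 else 0))"

text \<open>The geometric factor concentrates the sum at the top level, so for large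
  \<open>k1\<close> its order is \<open>h ^ n\<close> times the logarithm to the power
  \<open>q - 1\<close>: one logarithm fewer than in \<open>low_sum\<close>.\<close>

definition up_sum :: "nat => nat => nat => nat => real => real" where
 "up_sum n q k0 k1 h = (\<Sum>k=k0..k1. real k ^ (q - 1) * ((2 ^ k) ^ (n - 1) * (if 2 ^ k / 2 < h then h else 0)))"

lemma low_sum_nonneg: "0 <= low_sum q k0 k1 h"
 unfolding low_sum_def by (intro sum_nonneg) auto

text \<open>Only the upper half of the levels below \<open>m\<close> is counted; there are at least
  \<open>m / 4\<close> of them, each index is at least \<open>m / 4\<close>, and
  \<open>2 * k0 <= m\<close> keeps them in the range of summation.\<close>

lemma low_sum_ge:
 assumes m: "2 * k0 <= m" "2 <= m" "m <= k1" "2 ^ m / 2 < h" and q: "1 <= q"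
 shows "(real m / 4) ^ q <= low_sum q k0 k1 h"
proof -
 define S where "S = {m - m div 2..<m}"
 have cS: "real (card S) >= real m / 4"
 proof -
  have "card S = m div 2" by (simp add: S_def)
  moreover have "m <= 4 * (m div 2)" using m(2) by presburger
  ultimately show ?thesis by linarith
 qed
 have "(real m / 4) ^ q = real m / 4 * (real m / 4) ^ (q - 1)" using q by (simp add: power_eq_if)
 also have "... <= real (card S) * (real m / 4) ^ (q - 1)" using cS by (intro mult_right_mono) auto
 also have "... = (\<Sum>k\<in>S. (real m / 4) ^ (q - 1))" by simp
 also have "... <= (\<Sum>k\<in>S. real k ^ (q - 1) * (if 2 ^ k < h then 1 else 0))"
 proof (rule sum_mono)
  fix k assume k: "k \<in> S"
  then have "real m / 4 <= real k" by (auto simp: S_def)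
  moreover have "2 ^ k < h"
  proof -
   have "(2::real) ^ Suc k <= 2 ^ m" using k by (intro power_increasing) (auto simp: S_def)
   then show ?thesis using m(4) by simp
  qed
  ultimately show "(real m / 4) ^ (q - 1) <= real k ^ (q - 1) * (if 2 ^ k < h then 1 else 0)"
   by (simp add: power_mono)
 qed
 also have "... <= low_sum q k0 k1 h" unfolding low_sum_def by (rule sum_mono2) (use m in "auto simp: S_def")
 finally show ?thesis .
qed

text \<open>The constant must not depend on the cap \<open>k1\<close>. With \<open>m\<close> the
  highest level that counts, the sum is of order \<open>m ^ (q - 1) * 2 ^ (m * (n - 1)) * h\<close>.
  If \<open>K <= eps * m\<close>, the distortion inequality turns this into the Jacobian times
  \<open>eps * m ^ q\<close>, which \<open>low_sum\<close> absorbs. Otherwise \<open>m\<close> is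
  below \<open>K / eps\<close> and the exponential pays, except that the cap may let
  \<open>h\<close> exceed \<open>2 ^ m\<close> by far; then the Jacobian alone suffices.\<close>

lemma up_sum_absorbed:
 fixes iota eps A l :: real
 assumes n: "2 <= n" and q: "1 <= q" and iota: "0 < iota" and eps: "0 < eps" and A: "0 <= A"
  and abs: "4 * A * 2 ^ n * 4 ^ q * eps <= iota" and l: "real n * ln 2 / eps < l" and k0: "1 <= k0"
 obtains C where "0 <= C" "!!h J K k1. 0 <= h ==> 0 <= J ==> 1 <= K ==> iota * h ^ n <= K * J ==>
  A * up_sum n q k0 k1 h <= 1 / 4 * (J * low_sum q k0 k1 h) + C * (h + J + exp (l * K))"
proof -
 \<comment> \<open>The rate of \<open>(2 ^ m) ^ n\<close> as an exponential of \<open>K\<close> when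
   \<open>m\<close> is at most \<open>K / eps\<close>.\<close>
 define b where "b = real n * ln 2 / eps"
 obtain C2 where C2: "0 <= C2" "!!t. 1 <= t ==> t powr real (2 * (q - 1) + 1) * exp (b * t) <= C2 * exp (l * t)"
  using powr_exp_le[of "real (2 * (q - 1) + 1)" b l] l by (auto simp: b_def)
 define c1 where "c1 = A * (2 * (real (2 * k0) ^ (q - 1) * (2 ^ (2 * k0)) ^ (n - 1)))"
 define c2 where "c2 = 2 * A * (1 / eps) ^ (2 * (q - 1)) * C2"
 define c3 where "c3 = 2 * A / iota"
 have c: "0 <= c1" "0 <= c2" "0 <= c3" using A C2 eps iota by (auto simp: c1_def c2_def c3_def)
 define C where "C = c1 + c2 + c3"
 have "A * up_sum n q k0 k1 h <= 1 / 4 * (J * low_sum q k0 k1 h) + C * (h + J + exp (l * K))"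
  if h: "0 <= h" and J: "0 <= J" and K: "1 <= K" and hJ: "iota * h ^ n <= K * J" for h J K k1
 proof -
  define Low where "Low = 1 / 4 * (J * low_sum q k0 k1 h)"
  have Low: "0 <= Low" unfolding Low_def using J low_sum_nonneg[of q k0 k1 h] by simp
  have CC: "z <= Low + C * (h + J + exp (l * K))"
   if "z <= Low \<or> z <= c1 * h \<or> z <= c2 * exp (l * K) \<or> z <= c3 * J" for z
  proof -
   have "C * (h + J + exp (l * K)) = c1 * h + c2 * exp (l * K) + c3 * J + (c1 * (J + exp (l * K)) + c2 * (h + J) + c3 * (h + exp (l * K)))"
    by (simp add: C_def algebra_simps)
   moreover have "0 <= c1 * h" "0 <= c2 * exp (l * K)" "0 <= c3 * J" "0 <= c1 * (J + exp (l * K)) + c2 * (h + J) + c3 * (h + exp (l * K))"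
    using c h J by (auto intro!: add_nonneg_nonneg mult_nonneg_nonneg)
   ultimately show ?thesis using that Low by linarith
  qed
  show ?thesis unfolding Low_def[symmetric]
  proof (rule CC, cases "\<exists>k\<in>{k0..k1}. 2 ^ k / 2 < h")
   case False
   then have "up_sum n q k0 k1 h = 0" unfolding up_sum_def by (intro sum.neutral) auto
   then show "A * up_sum n q k0 k1 h <= Low \<or> A * up_sum n q k0 k1 h <= c1 * h \<or> A * up_sum n q k0 k1 h <= c2 * exp (l * K) \<or> A * up_sum n q k0 k1 h <= c3 * J"
    using Low by simp
  next
   case True
   define S where "S = {k\<in>{k0..k1}. 2 ^ k / 2 < h}"
   have S: "finite S" "S ~= {}" using True by (auto simp: S_def)
   define m where "m = Max S"
   have m: "m \<in> S" "!!k. k \<in> S ==> k <= m" using S by (auto simp: m_def)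
   have mk: "k0 <= m" "m <= k1" "2 ^ m / 2 < h" using m(1) by (auto simp: S_def)
   define y :: real where "y = 2 ^ m"
   have y: "1 <= y" "y < 2 * h" using mk by (auto simp: y_def)
   have hp: "0 < h" using y by simp
   define w :: real where "w = 2 ^ (n - 1)"
   have w: "2 <= w" using n power_increasing[of 1 "n - 1" "2::real"] by (simp add: w_def)
   have pw: "(2 ^ k) ^ (n - 1) = w ^ k" for k by (simp add: w_def power_mult[symmetric] mult.commute)
   have up: "up_sum n q k0 k1 h <= 2 * (real m ^ (q - 1) * (y ^ (n - 1) * h))"
   proof -
    have "up_sum n q k0 k1 h <= (\<Sum>k=k0..k1. if k <= m then real m ^ (q - 1) * (w ^ k * h) else 0)"
     unfolding up_sum_def pw
    proof (rule sum_mono)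
     fix k assume k: "k \<in> {k0..k1}"
     show "real k ^ (q - 1) * (w ^ k * (if 2 ^ k / 2 < h then h else 0)) <= (if k <= m then real m ^ (q - 1) * (w ^ k * h) else 0)"
     proof (cases "2 ^ k / 2 < h")
      case True
      then have "k <= m" using m(2) k by (auto simp: S_def)
      then show ?thesis using True w h by (auto intro!: mult_right_mono power_mono)
     next
      case False
      then show ?thesis using w h by simp
     qed
    qed
    also have "... = (\<Sum>k\<in>{k0..k1} \<inter> {..m}. real m ^ (q - 1) * (w ^ k * h))"
     unfolding sum.inter_restrict[OF finite_atLeastAtMost] by simp
    also have "... <= (\<Sum>k\<le>m. real m ^ (q - 1) * (w ^ k * h))" using w h by (intro sum_mono2) auto
    also have "... = real m ^ (q - 1) * ((\<Sum>k\<le>m. w ^ k) * h)" by (simp add: sum_distrib_left sum_distrib_right)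
    also have "... <= real m ^ (q - 1) * ((2 * w ^ m) * h)" using sum_power_le[OF w, of m] h by (intro mult_left_mono mult_right_mono) auto
    also have "w ^ m = y ^ (n - 1)" by (simp only: pw[symmetric] y_def)
    finally show ?thesis by (simp add: mult_ac)
   qed
   define P where "P = real m ^ (q - 1) * (y ^ (n - 1) * h)"
   have up': "A * up_sum n q k0 k1 h <= 2 * A * P" using mult_left_mono[OF up A] by (simp add: P_def mult_ac)
   have ns: "z * z ^ (n - 1) = (z::real) ^ n" for z using n by (simp add: power_eq_if)
   show "A * up_sum n q k0 k1 h <= Low \<or> A * up_sum n q k0 k1 h <= c1 * h \<or> A * up_sum n q k0 k1 h <= c2 * exp (l * K) \<or> A * up_sum n q k0 k1 h <= c3 * J"
   proof (cases "m < 2 * k0")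
    case True
    have "y <= 2 ^ (2 * k0)" unfolding y_def using True by (intro power_increasing) auto
    then have "P <= real (2 * k0) ^ (q - 1) * ((2 ^ (2 * k0)) ^ (n - 1) * h)"
     unfolding P_def using True h y by (intro mult_mono power_mono) auto
    then have "2 * A * P <= 2 * A * (real (2 * k0) ^ (q - 1) * ((2 ^ (2 * k0)) ^ (n - 1) * h))" using A by (intro mult_left_mono) auto
    also have "... = c1 * h" by (simp add: c1_def)
    finally show ?thesis using up' by auto
   next
    case False
    then have m2: "2 * k0 <= m" "2 <= m" using k0 by auto
    show ?thesis
    proof (cases "K <= eps * real m")
     case True
     have "y ^ (n - 1) <= (2 * h) ^ (n - 1)" using y by (intro power_mono) auto
     then have "P <= real m ^ (q - 1) * ((2 * h) ^ (n - 1) * h)" unfolding P_def using h by (intro mult_left_mono mult_right_mono) auto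
     also have "(2 * h) ^ (n - 1) * h = 2 ^ (n - 1) * h ^ n" unfolding power_mult_distrib ns[symmetric] by (simp only: mult_ac)
     finally have "2 * A * P <= 2 * A * (real m ^ (q - 1) * (2 ^ (n - 1) * h ^ n))" using A by (intro mult_left_mono) auto
     also have "... = A * (2 * 2 ^ (n - 1)) * real m ^ (q - 1) * h ^ n" by simp
     also have "2 * 2 ^ (n - 1) = (2::real) ^ n" by (rule ns)
     finally have 1: "2 * A * P <= A * 2 ^ n * real m ^ (q - 1) * h ^ n" .
     have "iota * h ^ n <= eps * real m * J" using hJ mult_right_mono[OF True J] by linarith
     then have "(A * 2 ^ n * real m ^ (q - 1)) * (iota * h ^ n) <= (A * 2 ^ n * real m ^ (q - 1)) * (eps * real m * J)"
      using A by (intro mult_left_mono) auto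
     also have "... = (4 * A * 2 ^ n * 4 ^ q * eps) * (1 / 4 * (J * ((real m * real m ^ (q - 1)) / 4 ^ q)))"
      by simp
     also have "... <= iota * (1 / 4 * (J * ((real m * real m ^ (q - 1)) / 4 ^ q)))"
      using abs J by (intro mult_right_mono) auto
     also have "real m * real m ^ (q - 1) / 4 ^ q = (real m / 4) ^ q" using q by (cases q) (auto simp: power_divide)
     also have "iota * (1 / 4 * (J * (real m / 4) ^ q)) <= iota * Low"
      unfolding Low_def using low_sum_ge[OF m2 mk(2,3) q] J iota by (intro mult_left_mono) auto
     finally have "iota * (A * 2 ^ n * real m ^ (q - 1) * h ^ n) <= iota * Low" by (simp add: mult_ac)
     then have "A * 2 ^ n * real m ^ (q - 1) * h ^ n <= Low" using iota by simp
     then show ?thesis using 1 up' by linarith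
    next
     case False
     \<comment> \<open>The threshold between the last two cases: up to \<open>y * Z\<close>
       everything is bounded by a function of \<open>K\<close>; beyond it, since \<open>n\<close> is
       at least two, the spare powers of \<open>h\<close> swallow both \<open>K\<close> and the
       weight.\<close>
     define Z where "Z = K * real m ^ (q - 1)"
     have mq: "1 <= real m ^ (q - 1)" using m2 by simp
     have Z: "1 <= Z" unfolding Z_def using mult_mono[OF K mq] K by simp
     show ?thesis
     proof (cases "h <= y * Z")
      case True
      have mK: "real m <= K / eps" using False eps by (simp add: field_simps)
      have em: "exp (real n * ln 2 * real m) <= exp (real n * ln 2 * (K / eps))"
      unfolding exp_le_cancel_iff by (rule mult_left_mono[OF mK]) simp
      have "P <= real m ^ (q - 1) * (y ^ (n - 1) * (y * Z))" unfolding P_def using True y by (intro mult_left_mono) auto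
      also have "... = (real m ^ (q - 1) * real m ^ (q - 1)) * (y * y ^ (n - 1)) * K" by (simp add: Z_def)
      also have "... = real m ^ (2 * (q - 1)) * y ^ n * K" unfolding ns by (simp add: power_add[symmetric] mult_2)
      also have "y ^ n = exp (real n * ln 2 * real m)"
       by (simp add: y_def power_mult[symmetric] exp_of_nat2_mult[symmetric] exp_of_nat_mult mult.commute)
      also have "real m ^ (2 * (q - 1)) * exp (real n * ln 2 * real m) * K <= (K / eps) ^ (2 * (q - 1)) * exp (real n * ln 2 * (K / eps)) * K"
       using mK K em by (intro mult_mono power_mono) auto
      also have "... = (1 / eps) ^ (2 * (q - 1)) * ((K ^ (2 * (q - 1)) * K) * exp (b * K))"
       by (simp add: b_def power_divide)
      also have "K ^ (2 * (q - 1)) * K = K powr real (2 * (q - 1) + 1)" using K by (subst powr_realpow) auto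
      also have "(1 / eps) ^ (2 * (q - 1)) * (K powr real (2 * (q - 1) + 1) * exp (b * K)) <= (1 / eps) ^ (2 * (q - 1)) * (C2 * exp (l * K))"
       using C2(2)[OF K] eps by (intro mult_left_mono) auto
      finally have "2 * A * P <= 2 * A * ((1 / eps) ^ (2 * (q - 1)) * (C2 * exp (l * K)))" using A by (intro mult_left_mono) auto
      also have "... = c2 * exp (l * K)" by (simp add: c2_def)
      finally show ?thesis using up' by auto
     next
      case False
      have "Z * y ^ (n - 1) <= Z ^ (n - 1) * y ^ (n - 1)"
       using power_increasing[of 1 "n - 1" Z] Z n y by (intro mult_right_mono) auto
      also have "... = (y * Z) ^ (n - 1)" by (simp add: power_mult_distrib)
      also have "... <= h ^ (n - 1)" using False y Z by (intro power_mono) auto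
      finally have "Z * y ^ (n - 1) * h <= h ^ (n - 1) * h" using h by (intro mult_right_mono) auto
      also have "... = h ^ n" using ns[of h] by (simp only: mult.commute)
      finally have "iota * (K * P) <= iota * h ^ n" using iota by (simp add: Z_def P_def mult_ac)
      then have "K * (iota * P) <= K * J" using hJ by (simp add: mult_ac)
      then have "iota * P <= J" using K by simp
      then have "2 * A * (iota * P) <= 2 * A * J" using A by (intro mult_left_mono) auto
      then have "2 * A * P <= c3 * J" using iota by (simp add: c3_def field_simps)
      then show ?thesis using up' by auto
     qed
    qed
   qed
  qed
 qed
 moreover have "0 <= C" using c by (simp add: C_def)
 ultimately show ?thesis using that by blast
qed

text \<open>The same alternative without a cap: \<open>S\<close> bounds all partial sums. Of the
  \<open>2 * n + 1\<close> logarithms in \<open>low_sum\<close>, \<open>2 * n\<close> are those of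
  the density and the last one pays for \<open>K\<close>.\<close>

lemma orlicz_pointwise:
 fixes iota eps l :: real
 assumes n: "2 <= n" and iota: "0 < iota" and eps: "0 < eps" and l: "real n * ln 2 / eps < l" and k0: "1 <= k0"
 obtains C where "0 <= C" "!!h J K S. 0 <= h ==> 0 <= J ==> 1 <= K ==> iota * h ^ n <= K * J ==>
  (!!k1. low_sum (2 * n + 1) k0 k1 h <= S) ==> h ^ n * ln (1 + h) ^ (2 * n) <= C * (1 + J * S + exp (l * K))"
proof -
 define b where "b = real n * ln 2 / eps"
 obtain C2 where C2: "0 <= C2" "!!t. 1 <= t ==> t powr real (2 * n) * exp (b * t) <= C2 * exp (l * t)"
  using powr_exp_le[of "real (2 * n)" b l] l by (auto simp: b_def)
 define c1 :: real where "c1 = (2 ^ (2 * k0)) ^ n * (2 * real (2 * k0)) ^ (2 * n)"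
 define c2 where "c2 = (2 / eps) ^ (2 * n) * C2"
 define c3 where "c3 = eps * 4 ^ n * 4 ^ (2 * n + 1) / iota"
 have c: "0 <= c1" "0 <= c2" "0 <= c3" using C2 eps iota by (auto simp: c1_def c2_def c3_def)
 define C where "C = 1 + c1 + c2 + c3"
 have "h ^ n * ln (1 + h) ^ (2 * n) <= C * (1 + J * S + exp (l * K))"
  if h: "0 <= h" and J: "0 <= J" and K: "1 <= K" and hJ: "iota * h ^ n <= K * J" and S: "!!k1. low_sum (2 * n + 1) k0 k1 h <= S" for h J K S
 proof -
  have S0: "0 <= S" using S[of 0] low_sum_nonneg order_trans by blast
  have CC: "z <= C * (1 + J * S + exp (l * K))"
   if "z <= 1 \<or> z <= c1 \<or> z <= c2 * exp (l * K) \<or> z <= c3 * (J * S)" for z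
  proof -
   have "C * (1 + J * S + exp (l * K)) = 1 + c1 + c2 * exp (l * K) + c3 * (J * S) + ((J * S + exp (l * K)) + c1 * (J * S + exp (l * K)) + c2 * (1 + J * S) + c3 * (1 + exp (l * K)))"
    by (simp add: C_def algebra_simps)
   moreover have "0 <= c2 * exp (l * K)" "0 <= c3 * (J * S)" "0 <= (J * S + exp (l * K)) + c1 * (J * S + exp (l * K)) + c2 * (1 + J * S) + c3 * (1 + exp (l * K))"
    using c J S0 by (auto intro!: add_nonneg_nonneg mult_nonneg_nonneg)
   ultimately show ?thesis using that c by linarith
  qed
  define theta where "theta = h ^ n * ln (1 + h) ^ (2 * n)"
  show ?thesis unfolding theta_def[symmetric]
  proof (rule CC, cases "1 < h")
   case False
   have "ln (1 + h) <= 1" using False h ln_add_one_self_le_self[of h] by linarith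
   then have "ln (1 + h) ^ (2 * n) <= 1" using h by (intro power_le_one) auto
   moreover have "h ^ n <= 1" using h False by (intro power_le_one) auto
   ultimately have "theta <= 1" unfolding theta_def using h by (intro mult_le_one) auto
   then show "theta <= 1 \<or> theta <= c1 \<or> theta <= c2 * exp (l * K) \<or> theta <= c3 * (J * S)" by simp
  next
   case True
   then obtain m :: nat where m: "1 <= m" "2 ^ m / 2 < h" "h <= 2 ^ m" "!!k. 2 ^ k / 2 < h ==> k <= m"
    using dyadic_level by blast
   have lnm: "ln (1 + h) <= 2 * real m"
   proof -
    have "1 + h <= 2 ^ (m + 1)" using m(3) one_le_power[of "2::real" m] unfolding power_add power_one_right by linarith
    then have "ln (1 + h) <= ln (2 ^ (m + 1))" using h by simp
    also have "... = real (m + 1) * ln 2" by (subst ln_realpow) auto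
    also have "... <= real (m + 1) * 1" using ln_2_less_1 by (intro mult_left_mono) auto
    finally show ?thesis using m(1) by simp
   qed
   then have lnp: "ln (1 + h) ^ (2 * n) <= (2 * real m) ^ (2 * n)" using h by (intro power_mono) auto
   show "theta <= 1 \<or> theta <= c1 \<or> theta <= c2 * exp (l * K) \<or> theta <= c3 * (J * S)"
   proof (cases "m < 2 * k0")
    case True
    have "h <= 2 ^ (2 * k0)" by (rule order_trans[OF m(3)], rule power_increasing) (use True in auto)
    then have "h ^ n <= (2 ^ (2 * k0)) ^ n" using h by (intro power_mono) auto
    moreover have "ln (1 + h) ^ (2 * n) <= (2 * real (2 * k0)) ^ (2 * n)"
     using lnm True h by (intro power_mono) auto
    ultimately have "theta <= c1" unfolding theta_def c1_def using h by (intro mult_mono) auto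
    then show ?thesis by simp
   next
    case False
    then have m2: "2 * k0 <= m" "2 <= m" using k0 by auto
    have Sm: "(real m / 4) ^ (2 * n + 1) <= S"
     using low_sum_ge[OF m2 order_refl m(2), of "2 * n + 1"] S[of m] by linarith
    show ?thesis
    proof (cases "K <= eps * real m")
     case True
     have "iota * h ^ n <= eps * real m * J" using hJ mult_right_mono[OF True J] by linarith
     then have "(iota * h ^ n) * ln (1 + h) ^ (2 * n) <= (eps * real m * J) * (2 * real m) ^ (2 * n)"
      by (rule mult_mono) (use lnp h J eps in auto)
     also have "... = eps * 4 ^ n * 4 ^ (2 * n + 1) * (J * (real m / 4) ^ (2 * n + 1))"
      by (simp add: power_mult_distrib power_divide power_mult power_add)
     also have "... <= eps * 4 ^ n * 4 ^ (2 * n + 1) * (J * S)" using Sm J eps by (intro mult_left_mono) auto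
     finally have "theta <= c3 * (J * S)" using iota by (simp add: theta_def c3_def field_simps)
     then show ?thesis by simp
    next
     case False
     have mK: "real m <= K / eps" using False eps by (simp add: field_simps)
     have em: "exp (real n * ln 2 * real m) <= exp (real n * ln 2 * (K / eps))"
      unfolding exp_le_cancel_iff by (rule mult_left_mono[OF mK]) simp
     have "theta <= (2 ^ m) ^ n * (2 * real m) ^ (2 * n)" unfolding theta_def
     proof (rule mult_mono)
      show "h ^ n <= (2 ^ m) ^ n" using m(3) h by (intro power_mono)
     qed (use lnp h in auto)
     also have "(2 ^ m) ^ n = exp (real n * ln 2 * real m)"
      by (simp add: power_mult[symmetric] exp_of_nat2_mult[symmetric] exp_of_nat_mult mult.commute)
     also have "exp (real n * ln 2 * real m) * (2 * real m) ^ (2 * n) <= exp (real n * ln 2 * (K / eps)) * (2 * (K / eps)) ^ (2 * n)"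
      using mK K em eps by (intro mult_mono power_mono) auto
     also have "... = (2 / eps) ^ (2 * n) * (K ^ (2 * n) * exp (b * K))"
      by (simp add: b_def power_divide power_mult_distrib)
     also have "K ^ (2 * n) = K powr real (2 * n)" using K by (subst powr_realpow) auto
     also have "(2 / eps) ^ (2 * n) * (K powr real (2 * n) * exp (b * K)) <= (2 / eps) ^ (2 * n) * (C2 * exp (l * K))"
      using C2(2)[OF K] eps by (intro mult_left_mono) auto
     finally have "theta <= c2 * exp (l * K)" by (simp add: c2_def)
     then show ?thesis by simp
    qed
   qed
  qed
 qed
 moreover have "0 <= C" using c by (simp add: C_def)
 ultimately show ?thesis using that by blast
qed

text \<open>Iteration over radii that approach \<open>R\<close> geometrically: the gaps halve, so
  the errors double, which the factor \<open>1 / 4\<close> outweighs. The bound \<open>B\<close>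
  only has to exist, as it disappears in the limit.\<close>

lemma radius_iteration:
 fixes Ph :: "real => real"
 assumes R: "R1 < R" and c: "0 <= c" "0 <= d"
  and step: "!!r R'. R1 <= r ==> r < R' ==> R' <= R ==> Ph r <= 1 / 4 * Ph R' + c + d / (R' - r)"
  and bd: "!!r. R1 <= r ==> r <= R ==> Ph r <= B"
 shows "Ph R1 <= 2 * c + 4 * d / (R - R1)"
proof -
 define dlt where "dlt = R - R1"
 have dlt: "0 < dlt" using R by (simp add: dlt_def)
 define r where "r i = R - dlt * (1 / 2) ^ i" for i :: nat
 have r0: "r 0 = R1" by (simp add: r_def dlt_def)
 have ri: "R1 <= r i" "r i <= R" for i
 proof -
  have "dlt * (1 / 2) ^ i <= dlt * 1" using dlt by (intro mult_left_mono power_le_one) auto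
  then show "R1 <= r i" by (simp add: r_def dlt_def)
  show "r i <= R" using dlt by (simp add: r_def)
 qed
 have diff: "r (Suc i) - r i = dlt * (1 / 2) ^ i / 2" for i by (simp add: r_def)
 have claim: "Ph R1 <= (1 / 4) ^ N * Ph (r N) + c * (\<Sum>i<N. (1 / 4) ^ i) + 2 * d / dlt * (\<Sum>i<N. (1 / 2) ^ i)" for N
 proof (induction N)
  case 0
  then show ?case by (simp add: r0)
 next
  case (Suc N)
  have "0 < dlt * (1 / 2) ^ N / 2" using dlt by simp
  then have lt: "r N < r (Suc N)" using diff[of N] by linarith
  have "Ph (r N) <= 1 / 4 * Ph (r (Suc N)) + c + d / (dlt * (1 / 2) ^ N / 2)"
   using step[OF ri(1) lt ri(2)] diff[of N] by simp
  then have "(1 / 4) ^ N * Ph (r N) <= (1 / 4) ^ N * (1 / 4 * Ph (r (Suc N)) + c + d / (dlt * (1 / 2) ^ N / 2))"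
   by (intro mult_left_mono) auto
  also have "... = (1 / 4) ^ Suc N * Ph (r (Suc N)) + c * (1 / 4) ^ N + 2 * d / dlt * (1 / 2) ^ N"
  proof -
   have "(1 / 4) ^ N = (1 / 2) ^ N * ((1 / 2) ^ N :: real)" by (simp add: power_mult_distrib[symmetric])
   then have "(1 / 4) ^ N * (d / (dlt * (1 / 2) ^ N / 2)) = 2 * d / dlt * (1 / 2) ^ N" using dlt by (simp add: field_simps)
   then show ?thesis by (simp add: distrib_left)
  qed
  finally show ?case using Suc by (simp add: distrib_left)
 qed
 have le: "Ph R1 <= (1 / 4) ^ N * B + (2 * c + 4 * d / dlt)" for N
 proof -
  have g: "(\<Sum>i<N. (1 / 4 :: real) ^ i) <= 2" "(\<Sum>i<N. (1 / 2 :: real) ^ i) <= 2"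
   unfolding sum_gp_strict by (simp_all add: divide_simps) (smt (verit) zero_le_power)
  have "(1 / 4) ^ N * Ph (r N) <= (1 / 4) ^ N * B" using bd[OF ri] by (intro mult_left_mono) auto
  moreover have "c * (\<Sum>i<N. (1 / 4) ^ i) <= c * 2" using g c by (intro mult_left_mono) auto
  moreover have "2 * d / dlt * (\<Sum>i<N. (1 / 2) ^ i) <= 2 * d / dlt * 2" using g c dlt by (intro mult_left_mono) auto
  moreover have "2 * d / dlt * 2 = 4 * d / dlt" by simp
  ultimately show ?thesis using claim[of N] by linarith
 qed
 have "(%N. (1 / 4 :: real) ^ N * B + (2 * c + 4 * d / dlt)) ----> 0 * B + (2 * c + 4 * d / dlt)"
  by (intro tendsto_intros LIMSEQ_realpow_zero) auto
 then have "Ph R1 <= 0 * B + (2 * c + 4 * d / dlt)" by (rule LIMSEQ_le_const) (use le in auto)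
 then show ?thesis by (simp add: dlt_def)
qed

text \<open>As \<open>k < 2 ^ k\<close>, levels with \<open>k\<close> beyond \<open>h\<close> are
  not counted; rounding \<open>h\<close> up gives a crude but explicit index from which the sum is
  constant.\<close>

lemma low_sum_stable:
 assumes "nat \<lceil>h\<rceil> <= k1" shows "low_sum q k0 k1 h = low_sum q k0 (nat \<lceil>h\<rceil>) h"
 unfolding low_sum_def
proof (rule sum.mono_neutral_right)
 show "{k0..nat \<lceil>h\<rceil>} \<subseteq> {k0..k1}" using assms by auto
 show "\<forall>k\<in>{k0..k1} - {k0..nat \<lceil>h\<rceil>}. real k ^ (q - 1) * (if 2 ^ k < h then 1 else 0) = 0"
 proof
  fix k assume "k \<in> {k0..k1} - {k0..nat \<lceil>h\<rceil>}"
  then have "h <= real k" by (auto simp: not_le nat_less_iff) linarith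
  moreover have "real k < 2 ^ k" by (rule of_nat_less_two_power)
  ultimately have "\<not> 2 ^ k < h" by linarith
  then show "real k ^ (q - 1) * (if 2 ^ k < h then 1 else 0) = 0" by simp
 qed
qed simp

lemma low_sum_mono: "k1 <= k2 ==> low_sum q k0 k1 h <= low_sum q k0 k2 h"
 unfolding low_sum_def by (rule sum_mono2) auto

lemma low_sum_le_stable: "low_sum q k0 k1 h <= low_sum q k0 (nat \<lceil>h\<rceil>) h"
 using low_sum_mono[of k1 "max k1 (nat \<lceil>h\<rceil>)" q k0 h] low_sum_stable[of h "max k1 (nat \<lceil>h\<rceil>)" q k0] by simp

lemma weighted_geometric_bound:
 fixes s :: real assumes s: "0 < s"
 obtains W where "0 <= W" "!!k0 k1. 1 <= k0 ==> (\<Sum>k=k0..k1. real k ^ q * (2 ^ k) powr (- s)) <= W"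
proof -
 obtain C where C: "0 <= C" "!!t. 1 <= t ==> t powr real q * exp ((- s * ln 2) * t) <= C * exp ((- s * ln 2 / 2) * t)"
  using powr_exp_le[of "real q" "- s * ln 2" "- s * ln 2 / 2"] s by auto
 define z where "z = exp (- s * ln 2 / 2)"
 have z: "0 < z" "z < 1" using s by (auto simp: z_def)
 have "(\<Sum>k=k0..k1. real k ^ q * (2 ^ k) powr (- s)) <= C / (1 - z)" if k0: "1 <= k0" for k0 k1
 proof -
  have "(\<Sum>k=k0..k1. real k ^ q * (2 ^ k) powr (- s)) <= (\<Sum>k=k0..k1. C * z ^ k)"
  proof (rule sum_mono)
   fix k assume "k \<in> {k0..k1}"
   then have k: "1 <= real k" "k ~= 0" using k0 by auto
   have "real k ^ q * (2 ^ k) powr (- s) = real k powr real q * exp ((- s * ln 2) * real k)"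
   proof -
    have "real k ^ q = real k powr real q" using k by (simp add: powr_realpow)
    moreover have "(2 ^ k) powr (- s) = exp ((- s * ln 2) * real k)" by (simp add: powr_def ln_realpow mult_ac)
    ultimately show ?thesis by simp
   qed
   also have "... <= C * exp ((- s * ln 2 / 2) * real k)" by (rule C(2)[OF k(1)])
   also have "exp ((- s * ln 2 / 2) * real k) = z ^ k" unfolding z_def by (simp add: exp_of_nat2_mult[symmetric])
   finally show "real k ^ q * (2 ^ k) powr (- s) <= C * z ^ k" .
  qed
  also have "... = C * (\<Sum>k=k0..k1. z ^ k)" by (simp add: sum_distrib_left)
  also have "... <= C * (\<Sum>k. z ^ k)" using z C(1) by (intro mult_left_mono sum_le_suminf) auto
  also have "... = C / (1 - z)" using z by (simp add: suminf_geometric)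
  finally show ?thesis .
 qed
 moreover have "0 <= C / (1 - z)" using C(1) z by simp
 ultimately show ?thesis using that by blast
qed

context distortion_cube begin

text \<open>The level inequalities are summed with weights \<open>k ^ (2 * n)\<close> up to a cap
  \<open>k1\<close>, absorbed pointwise and iterated over the radii. The cap makes every integral
  finite, so that the absorption is legitimate; the bound obtained is independent of it, and
  monotone convergence removes it.\<close>

lemma orlicz_integrable:
 assumes R1: "0 < R1" "R1 < R" and eps: "0 < eps" "real CARD('n) * ln 2 / eps < l"
  and abs: "4 * (level_const CARD('n) * L) * 2 ^ CARD('n) * 4 ^ (2 * CARD('n) + 1) * eps <= iota"
 shows "L1 (%x. ind (cube a R1) x * (h x ^ CARD('n) * ln (1 + h x) ^ (2 * CARD('n))))"
proof -
 define n where "n = CARD('n)"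
 define q where "q = 2 * n + 1"
 define A where "A = level_const n * L"
 have A: "0 <= A" using slope_const_def[of n] L_nonneg bump_max(1) dbump_max(1) lip_const_pos[of n]
  unfolding A_def level_const_def slope_const_def grad_const_def n_def by auto
 obtain k0' C where C: "0 <= C" and level: "!!k r R'. k0' <= k ==> R1 <= r ==> r < R' ==> R' <= R ==>
  (LI x. ind (cube a r) x * (ind {x. 2 ^ k < h x} x * J0 x)) <=
   A * ((2 ^ k) ^ (n - 1) * (LI x. ind (cube a R') x * (ind {x. 2 ^ k / 2 < h x} x * h x)))
   + C / (R' - r) * (2 ^ k) powr (- kap / 2)" using level_inequality[OF R1] unfolding A_def n_def by blast
 define k0 where "k0 = max 1 k0'"
 have k0: "1 <= k0" "k0' <= k0" by (auto simp: k0_def)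
 have n2': "2 <= n" using n2 by (simp add: n_def)
 obtain Cu where Cu: "0 <= Cu" "!!h J K k1. 0 <= h ==> 0 <= J ==> 1 <= K ==> iota * h ^ n <= K * J ==>
  A * up_sum n q k0 k1 h <= 1 / 4 * (J * low_sum q k0 k1 h) + Cu * (h + J + exp (l * K))"
  using up_sum_absorbed[of n q iota eps A l k0] n2' iota eps A abs k0 unfolding q_def A_def n_def by auto
 obtain Co where Co: "0 <= Co" "!!h J K S. 0 <= h ==> 0 <= J ==> 1 <= K ==> iota * h ^ n <= K * J ==>
  (!!k1. low_sum q k0 k1 h <= S) ==> h ^ n * ln (1 + h) ^ (2 * n) <= Co * (1 + J * S + exp (l * K))"
  using orlicz_pointwise[OF n2' iota eps(1) _ k0(1), of l] eps(2) unfolding q_def n_def by metis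
 obtain W where W: "0 <= W" "!!k0 k1. 1 <= k0 ==> (\<Sum>k=k0..k1. real k ^ (q - 1) * (2 ^ k) powr (- (kap / 2))) <= W"
  using weighted_geometric_bound[of "kap / 2" "q - 1"] kap by auto
 have S1: "{x. t < h x} \<in> sets lebesgue" for t using h_measurable unfolding borel_measurable_iff_greater by simp
 have cm: "cube a r \<in> sets lebesgue" for r by simp
 have Ji: "L1 (%x. ind (cube a r) x * (ind {x. 2 ^ k < h x} x * J0 x))" for r and k :: nat
  by (intro integrable_restrict J0i S1 cm)
 have hi: "L1 (%x. ind (cube a r) x * (ind {x. 2 ^ k / 2 < h x} x * h x))" for r and k :: nat
  by (intro integrable_restrict h S1 cm)
 have Jeq: "ind (cube a r) x * (J0 x * low_sum q k0 k1 (h x)) = (\<Sum>k=k0..k1. real k ^ (q - 1) * (ind (cube a r) x * (ind {x. 2 ^ k < h x} x * J0 x)))" for r x k1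
  unfolding low_sum_def sum_distrib_left by (intro sum.cong refl) (simp add: indicator_def)
 have heq: "ind (cube a r) x * up_sum n q k0 k1 (h x) = (\<Sum>k=k0..k1. real k ^ (q - 1) * ((2 ^ k) ^ (n - 1) * (ind (cube a r) x * (ind {x. 2 ^ k / 2 < h x} x * h x))))" for r x k1
  unfolding up_sum_def sum_distrib_left by (intro sum.cong refl) (simp add: indicator_def)
 define Ph where "Ph k1 r = (LI x. ind (cube a r) x * (J0 x * low_sum q k0 k1 (h x)))" for k1 r
 have Li: "L1 (%x. ind (cube a r) x * (J0 x * low_sum q k0 k1 (h x)))" for r k1
  unfolding Jeq by (intro int_sum integrable_mult_right Ji)
 have Ui: "L1 (%x. ind (cube a r) x * up_sum n q k0 k1 (h x))" for r k1
  unfolding heq by (intro int_sum integrable_mult_right hi)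
 define I where "I = integral\<^sup>L lebesgue h + integral\<^sup>L lebesgue J0 + integral\<^sup>L lebesgue E0"
 have Ii: "L1 (%x. h x + J0 x + E0 x)" by (intro int_add h J0i E0i)
 have I: "I = (LI x. h x + J0 x + E0 x)" using h J0i E0i by (simp add: I_def)
 have AEI: "AE x in lm. 0 <= h x + J0 x + E0 x"
  using AE_dist by eventually_elim (use h_nonneg E0_nonneg in "auto intro: add_nonneg_nonneg")
 have I0: "0 <= I" unfolding I by (rule integral_nonneg_AE[OF AEI])
 have step: "Ph k1 r <= 1 / 4 * Ph k1 R' + Cu * I + C * W / (R' - r)" if r: "R1 <= r" "r < R'" "R' <= R" for k1 r R'
 proof -
  have "Ph k1 r = (\<Sum>k=k0..k1. real k ^ (q - 1) * (LI x. ind (cube a r) x * (ind {x. 2 ^ k < h x} x * J0 x)))"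
   unfolding Ph_def Jeq by (subst lint_sum) (use Ji in auto)
  also have "... <= (\<Sum>k=k0..k1. real k ^ (q - 1) * (A * ((2 ^ k) ^ (n - 1) * (LI x. ind (cube a R') x * (ind {x. 2 ^ k / 2 < h x} x * h x)))
   + C / (R' - r) * (2 ^ k) powr (- kap / 2)))" by (intro sum_mono mult_left_mono level r) (use k0 in auto)
  also have "... = A * (\<Sum>k=k0..k1. real k ^ (q - 1) * ((2 ^ k) ^ (n - 1) * (LI x. ind (cube a R') x * (ind {x. 2 ^ k / 2 < h x} x * h x))))
   + C / (R' - r) * (\<Sum>k=k0..k1. real k ^ (q - 1) * (2 ^ k) powr (- (kap / 2)))"
   by (simp add: sum.distrib sum_distrib_left distrib_left mult_ac)
  also have "(\<Sum>k=k0..k1. real k ^ (q - 1) * ((2 ^ k) ^ (n - 1) * (LI x. ind (cube a R') x * (ind {x. 2 ^ k / 2 < h x} x * h x))))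
    = (LI x. ind (cube a R') x * up_sum n q k0 k1 (h x))" unfolding heq by (subst lint_sum) (use hi in auto)
  also have "A * (LI x. ind (cube a R') x * up_sum n q k0 k1 (h x)) + C / (R' - r) * (\<Sum>k=k0..k1. real k ^ (q - 1) * (2 ^ k) powr (- (kap / 2)))
   <= (1 / 4 * Ph k1 R' + Cu * I) + C / (R' - r) * W"
  proof (intro add_mono mult_left_mono W(2) k0)
   have "A * (LI x. ind (cube a R') x * up_sum n q k0 k1 (h x)) = (LI x. A * (ind (cube a R') x * up_sum n q k0 k1 (h x)))"
    by simp
   also have "... <= (LI x. 1 / 4 * (ind (cube a R') x * (J0 x * low_sum q k0 k1 (h x))) + Cu * (h x + J0 x + E0 x))"
   proof (rule integral_mono_AE)
    show "L1 (%x. A * (ind (cube a R') x * up_sum n q k0 k1 (h x)))" by (intro integrable_mult_right Ui)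
    show "L1 (%x. 1 / 4 * (ind (cube a R') x * (J0 x * low_sum q k0 k1 (h x))) + Cu * (h x + J0 x + E0 x))"
     by (intro int_add[OF integrable_mult_right[OF Li] integrable_mult_right[OF Ii]])
    show "AE x in lm. A * (ind (cube a R') x * up_sum n q k0 k1 (h x)) <= 1 / 4 * (ind (cube a R') x * (J0 x * low_sum q k0 k1 (h x))) + Cu * (h x + J0 x + E0 x)"
     using AE_dist AEI
    proof eventually_elim
     case (elim x)
     show ?case
     proof (cases "x \<in> cube a R'")
      case True
      then have "x \<in> cube a R" using cube_le[OF r(3)] by auto
      then show ?thesis using Cu(2)[OF h_nonneg, of "J0 x" "K x" x k1] elim K[of x] True by (simp add: E0_def n_def)
     next
      case False
      then show ?thesis using elim Cu(1) by simp
     qed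
    qed
   qed
   also have "... = 1 / 4 * Ph k1 R' + Cu * I" unfolding Ph_def I
    by (subst lint_add[OF integrable_mult_right[OF Li] integrable_mult_right[OF Ii]]) simp
   finally show "A * (LI x. ind (cube a R') x * up_sum n q k0 k1 (h x)) <= 1 / 4 * Ph k1 R' + Cu * I" .
  qed (use C r in auto)
  finally show ?thesis by simp
 qed
 have mono_r: "Ph k1 r <= Ph k1 R" if "r <= R" for k1 r unfolding Ph_def
 proof (rule integral_mono_AE[OF Li Li])
  show "AE x in lm. ind (cube a r) x * (J0 x * low_sum q k0 k1 (h x)) <= ind (cube a R) x * (J0 x * low_sum q k0 k1 (h x))"
   using AE_dist
  proof eventually_elim
   case (elim x)
   then have "0 <= J0 x * low_sum q k0 k1 (h x)" using low_sum_nonneg by simp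
   then show ?case using cube_le[OF that] by (auto simp: indicator_def)
  qed
 qed
 define B where "B = 2 * (Cu * I) + 4 * (C * W) / (R - R1)"
 \<comment> \<open>The a priori bound \<open>Ph k1 R\<close> used here depends on the cap, the
   conclusion does not.\<close>
 have bound: "Ph k1 R1 <= B" for k1 unfolding B_def
  by (rule radius_iteration[where B = "Ph k1 R"]) (use R1 Cu I0 C W step mono_r in auto)
 define g where "g k1 x = ind (cube a R1) x * (J0 x * low_sum q k0 k1 (h x))" for k1 x
 define S where "S x = low_sum q k0 (nat \<lceil>h x\<rceil>) (h x)" for x
 define u where "u x = ind (cube a R1) x * (J0 x * S x)" for x
 have lim: "(%k1. g k1 x) ----> u x" for x
 proof (rule tendsto_eventually, rule eventually_sequentiallyI)
  fix k1 assume "nat \<lceil>h x\<rceil> <= k1"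
  then show "g k1 x = u x" unfolding g_def u_def S_def using low_sum_stable[of "h x" k1 q k0] by simp
 qed
 have mono_g: "AE x in lm. mono (%k1. g k1 x)" using AE_dist
 proof eventually_elim
  case (elim x)
  show ?case
  proof (rule monoI)
   fix k k' :: nat assume "k <= k'"
   then show "g k x <= g k' x" unfolding g_def using low_sum_mono[of k k' q k0 "h x"] elim by (intro mult_left_mono) auto
  qed
 qed
 have inc: "incseq (%k1. Ph k1 R1)"
 proof (rule incseq_SucI)
  fix k
  show "Ph k R1 <= Ph (Suc k) R1" unfolding Ph_def
   by (rule integral_mono_AE[OF Li Li]) (use mono_g in eventually_elim, auto simp: g_def mono_def)
 qed
 obtain z where z: "(%k1. Ph k1 R1) ----> z" using incseq_convergent[OF inc] bound by blast
 have gi: "L1 (g k1)" for k1 unfolding g_def[abs_def] by (rule Li)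
 have um: "u \<in> bml" by (rule borel_measurable_LIMSEQ_real[OF lim]) (use gi in auto)
 have ui: "L1 u"
  by (rule integrable_monotone_convergence[OF gi mono_g AE_I2[OF lim] _ um, of z]) (use z in "simp add: Ph_def g_def")
 have "L1 (%x. ind (cube a R1) x * (h x ^ n * ln (1 + h x) ^ (2 * n)))"
 proof (rule int_bound)
  have "L1 (%x. ind (cube a R1) x * (1::real))" by (rule integrable_ind_const[OF cube_lmeasurable])
  then show "L1 (%x. Co * (ind (cube a R1) x * 1 + u x + E0 x))" by (intro integrable_mult_right int_add ui E0i)
  have "(%x. h x ^ n * ln (1 + h x) ^ (2 * n)) \<in> bml" using h_measurable by simp
  then show "(%x. ind (cube a R1) x * (h x ^ n * ln (1 + h x) ^ (2 * n))) \<in> bml"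
   by (rule borel_measurable_times[OF borel_measurable_indicator[OF cm]])
  show "AE x in lm. norm (ind (cube a R1) x * (h x ^ n * ln (1 + h x) ^ (2 * n))) <= norm (Co * (ind (cube a R1) x * 1 + u x + E0 x))"
   using AE_dist
  proof eventually_elim
   case (elim x)
   show ?case
   proof (cases "x \<in> cube a R1")
    case True
    have xR: "x \<in> cube a R" using True cube_le[of R1] R1 by auto
    have "h x ^ n * ln (1 + h x) ^ (2 * n) <= Co * (1 + J0 x * S x + exp (l * K x))"
     using elim K[of x] low_sum_le_stable by (intro Co(2) h_nonneg) (auto simp: S_def n_def)
    moreover have "0 <= h x ^ n * ln (1 + h x) ^ (2 * n)" using h_nonneg[of x] by simp
    ultimately show ?thesis using True xR by (simp add: u_def E0_def)
   qed simp
  qed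
 qed
 then show ?thesis by (simp add: n_def)
qed

end

section \<open>Oscillation control and its consequences\<close>

text \<open>A Rado-Reichelderfer condition off a null set: on every subcube the \<open>n\<close>-th
  power of the oscillation is at most the integral of a fixed density. Continuity and Lusin's
  condition are drawn from it.\<close>

definition osc_control ::
  "nat => (real ^ 'n::finite) set => (real ^ 'n => nat => real) => (real ^ 'n => real) => (real ^ 'n) set => bool" where
 "osc_control m Q f theta N \<longleftrightarrow> negligible N \<and> (\<forall>x. 0 <= theta x) \<and> L1 theta \<and>
   (\<forall>b r. 0 < r \<and> cube b r \<subseteq> Q --> (\<forall>x\<in>cube b r - N. \<forall>y\<in>cube b r - N. \<forall>i<m.
    abs(f x i - f y i) <= root CARD('n) (LINT z:cube b r|lm. theta z)))"

context gradient_bound begin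

lemma oscillation_1d:
 assumes n1: "CARD('n) = 1" and x: "x \<in> cube a R" "lebesgue_point u x" and y: "y \<in> cube a R" "lebesgue_point u y"
 shows "abs(u x - u y) <= (LINT z:cube a R|lm. h z)"
proof -
 define tau where "tau k = R / real (Suc k)" for k
 have tau: "0 < tau k" "tau k <= R" for k using R by (auto simp: tau_def field_simps)
 have "(%k. R * inverse (real (Suc k))) ----> R * 0" by (intro tendsto_intros LIMSEQ_inverse_real_of_nat)
 then have tau0: "tau ----> 0" by (simp add: tau_def[abs_def] divide_inverse)
 have lim: "(%k. avg u (tilt z (tau k)) (tau k)) ----> u z" if z: "z \<in> cube a R" "lebesgue_point u z" for z
  by (rule avg_tendsto[OF u_int z(2) tau(1) tau0 _ tilt_cube_ball[OF z(1) tau(1)]]) simp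
 have step: "abs(avg u (tilt x (tau k)) (tau k) - avg u (tilt y (tau k)) (tau k)) <= (LINT z:cube a R|lm. h z)" for k
 proof -
  have b: "a $ l - R <= tilt z (tau k) $ l - tau k \<and> tilt z (tau k) $ l + tau k <= a $ l + R" if "z \<in> cube a R" for z l
   using tilt_center[OF that, of "tau k" l] tau[of k] by (auto simp: abs_le_iff)
  \<comment> \<open>In dimension one the factor with exponent \<open>n - 1\<close> equals one, so
    averages on arbitrarily small scales can be compared over the whole cube without loss.\<close>
  have "abs(avg u (tilt x (tau k)) (tau k) - avg u (tilt y (tau k)) (tau k)) <= real CARD('n) * (bump_max / tau k) ^ (CARD('n) - 1) *
    (LINT z:cbox (\<chi> l. a $ l - R) (\<chi> l. a $ l + R)|lm. h z)"
   by (rule avg_step[OF wg tau(1) order_refl order_refl _ _ _ wh h]) (use b x(1) y(1) in "auto simp: cube_eq_cbox")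
  then show ?thesis using n1 by (simp add: cube_eq_cbox)
 qed
 have "(%k. abs(avg u (tilt x (tau k)) (tau k) - avg u (tilt y (tau k)) (tau k))) ----> abs(u x - u y)"
  by (intro tendsto_intros lim x y)
 then show ?thesis by (rule LIMSEQ_le_const2) (use step in auto)
qed

end

lemma negligible_not_lebesgue_points:
 fixes m :: nat
 assumes "!!i. i < m ==> L1 (u i)"
 shows "negligible {x. \<not> (\<forall>i<m. lebesgue_point (u i :: 'a::euclidean_space => real) x)}"
proof -
 have "AE x in lm. \<forall>i\<in>{..<m}. lebesgue_point (u i) x"
  by (rule AE_finite_allI) (use assms in "auto intro: AE_lebesgue_point")
 then obtain N' where N': "negligible N'" "{x. \<not> (\<forall>i\<in>{..<m}. lebesgue_point (u i) x)} \<subseteq> N'"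
  unfolding eventually_ae_filter_negligible by auto
 show ?thesis by (rule negligible_subset[OF N'(1)]) (use N'(2) in auto)
qed

lemma gradient_bound_subcube:
 assumes "wgrad Q u w" "cube b r \<subseteq> Q" "0 < r" "!!j x. abs(w j x) <= h x" "L1 h"
 shows "gradient_bound b r u w h"
proof
 show "wgrad (cube b r) u w" using assms(1,2) unfolding wgrad_def by blast
qed (use assms in auto)

lemma osc_control_cong:
 fixes u f :: "real ^ 'n::finite => nat => real"
 assumes "osc_control m Q u theta N" "!!x i. x \<in> Q ==> i < m ==> u x i = f x i"
 shows "osc_control m Q f theta N"
 unfolding osc_control_def
proof (intro conjI allI impI ballI)
 fix b r x y i assume b: "0 < r \<and> cube b r \<subseteq> Q" and xy: "x \<in> cube b r - N" "y \<in> cube b r - N" and i: "i < m"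
 have "abs(u x i - u y i) <= root CARD('n) (LINT z:cube b r|lm. theta z)"
  using assms(1) b xy i unfolding osc_control_def by blast
 moreover have "u x i = f x i" "u y i = f y i" using assms(2) b xy i by auto
 ultimately show "abs(f x i - f y i) <= root CARD('n) (LINT z:cube b r|lm. theta z)" by simp
qed (use assms(1) in "auto simp: osc_control_def")

lemma osc_control_1d:
 fixes u :: "real ^ 'n::finite => nat => real"
 assumes n1: "CARD('n) = 1" and wg: "!!i. i < m ==> wgrad Q (%x. u x i) (%j x. w x j i)"
  and wh: "!!i j x. i < m ==> abs(w x j i) <= h x" and h: "L1 h" "!!x. 0 <= h x"
 shows "\<exists>theta N. osc_control m Q u theta N"
proof -
 define N where "N = {x. \<not> (\<forall>i<m. lebesgue_point (%x. u x i) x)}"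
 have N: "negligible N" unfolding N_def using wg by (intro negligible_not_lebesgue_points) (simp add: wgrad_def)
 have "osc_control m Q u h N" unfolding osc_control_def
 proof (intro conjI allI impI ballI N h)
  fix b r x y i assume b: "0 < r \<and> cube b r \<subseteq> Q" and xy: "x \<in> cube b r - N" "y \<in> cube b r - N" and i: "i < m"
  interpret gradient_bound b r "%x. u x i" "%j x. w x j i" h
   by (rule gradient_bound_subcube[OF wg[OF i]]) (use b wh[OF i] h in auto)
  show "abs(u x i - u y i) <= root CARD('n) (LINT z:cube b r|lm. h z)"
   using oscillation_1d[OF n1, of x y] xy i n1 by (auto simp: N_def)
 qed
 then show ?thesis by blast
qed

text \<open>On each subcube \<open>chain_orlicz\<close> compares both points with the same average;
  the constant is moved under the root, whence its \<open>n\<close>-th power in the density.\<close>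

lemma osc_control_orlicz:
 fixes u :: "real ^ 'n::finite => nat => real"
 assumes wg: "!!i. i < m ==> wgrad Q (%x. u x i) (%j x. w x j i)"
  and wh: "!!i j x. i < m ==> abs(w x j i) <= h x" and h: "L1 h" "!!x. 0 <= h x"
  and Q': "Q' \<subseteq> Q" "Q' \<in> lmeasurable"
  and int: "L1 (%x. ind Q' x * (h x ^ CARD('n) * ln (1 + h x) ^ (2 * CARD('n))))"
 shows "\<exists>theta N. osc_control m Q' u theta N"
proof -
 define C where "C = 2 * osc_const CARD('n)"
 define theta0 where "theta0 x = h x ^ CARD('n) * ln (1 + h x) ^ (2 * CARD('n))" for x
 define theta where "theta x = abs(C) ^ CARD('n) * (ind Q' x * (1 + theta0 x))" for x
 define N where "N = {x. \<not> (\<forall>i<m. lebesgue_point (%x. u x i) x)}"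
 have N: "negligible N" unfolding N_def using wg by (intro negligible_not_lebesgue_points) (simp add: wgrad_def)
 have theta00: "0 <= theta0 x" for x using h(2)[of x] by (simp add: theta0_def)
 have i1: "L1 (%x. ind Q' x * (1 + theta0 x))"
 proof -
  have "L1 (%x. ind Q' x * 1 + ind Q' x * theta0 x)" using Q'(2) int unfolding theta0_def
   by (intro int_add integrable_ind_const) auto
  then show ?thesis by (simp add: distrib_left)
 qed
 have "osc_control m Q' u theta N" unfolding osc_control_def
 proof (intro conjI allI impI ballI N)
  show "0 <= theta x" for x using theta00[of x] by (simp add: theta_def)
  show "L1 theta" unfolding theta_def[abs_def] by (intro integrable_mult_right i1)
  fix b r x y i assume b: "0 < r \<and> cube b r \<subseteq> Q'" and xy: "x \<in> cube b r - N" "y \<in> cube b r - N" and i: "i < m"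
  interpret gradient_bound b r "%x. u x i" "%j x. w x j i" h
   by (rule gradient_bound_subcube[OF wg[OF i]]) (use b Q' wh[OF i] h in auto)
  have int_b: "set_integrable lebesgue (cube b r) (%y. h y ^ CARD('n) * ln (1 + h y) ^ (2 * CARD('n)))"
  proof -
   have "L1 (%x. ind (cube b r) x * (ind Q' x * (h x ^ CARD('n) * ln (1 + h x) ^ (2 * CARD('n)))))"
    by (intro integrable_restrict int) simp
   moreover have "(%x. ind (cube b r) x * (ind Q' x * (h x ^ CARD('n) * ln (1 + h x) ^ (2 * CARD('n))))) =
    (%x. ind (cube b r) x *\<^sub>R (h x ^ CARD('n) * ln (1 + h x) ^ (2 * CARD('n))))"
    using b by (auto simp: fun_eq_iff indicator_def)
   ultimately show ?thesis by (simp add: set_integrable_def)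
  qed
  define I where "I = (LINT y:cube b r|lm. 1 + theta0 y)"
  have I0: "0 <= I" unfolding I_def by (rule set_integral_nonneg') (use theta00 in "simp add: add_nonneg_nonneg")
  have c: "abs(u z i - avg (%x. u x i) b r) <= osc_const CARD('n) * root CARD('n) I" if "z \<in> cube b r - N" for z
   unfolding I_def theta0_def by (rule chain_orlicz) (use that i int_b in "auto simp: N_def")
  have "abs(u x i - u y i) <= C * root CARD('n) I" using c[OF xy(1)] c[OF xy(2)] unfolding C_def by linarith
  also have "... <= abs(C) * root CARD('n) I" using I0 by (intro mult_right_mono) auto
  also have "... = root CARD('n) (abs(C) ^ CARD('n) * I)" by (simp add: real_root_mult real_root_power_cancel)
  also have "abs(C) ^ CARD('n) * I = (LINT z:cube b r|lm. theta z)"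
  proof -
   have "(%z. ind (cube b r) z *\<^sub>R theta z) = (%z. abs(C) ^ CARD('n) * (ind (cube b r) z *\<^sub>R (1 + theta0 z)))"
    using b by (auto simp: fun_eq_iff indicator_def theta_def)
   then show ?thesis by (simp add: I_def slint_def)
  qed
  finally show "abs(u x i - u y i) <= root CARD('n) (LINT z:cube b r|lm. theta z)" .
 qed
 then show ?thesis by blast
qed

section \<open>A continuous representative and its differentiability almost everywhere\<close>

lemma representative_exists:
 fixes f :: "'a::euclidean_space => real"
 assumes Om: "open Om" and N: "negligible N"
  and osc: "!!x e. x \<in> Om ==> 0 < e ==> \<exists>d>0. \<forall>y\<in>ball x d - N. \<forall>z\<in>ball x d - N. abs(f y - f z) <= e"
 shows "\<exists>g. continuous_on Om g \<and> (\<forall>x\<in>Om - N. g x = f x)"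
proof -
 \<comment> \<open>Each point, also one in \<open>N\<close>, is approached by a sequence that avoids
   \<open>N\<close>, because balls are not negligible; the representative is the limit of
   \<open>f\<close> along it.\<close>
 have "\<exists>s. \<forall>k. s k \<in> ball x (1 / real (Suc k)) - N" for x
 proof (intro choice allI)
  fix k
  have "\<not> negligible (ball x (1 / real (Suc k)))" by (rule open_not_negligible) auto
  then show "\<exists>s. s \<in> ball x (1 / real (Suc k)) - N" using negligible_subset[OF N, of "ball x (1 / real (Suc k))"] by blast
 qed
 then obtain s where s: "!!x k. s x k \<in> ball x (1 / real (Suc k)) - N" by metis
 have ev: "\<exists>k0. \<forall>k\<ge>k0. s x k \<in> ball x d - N" if "0 < d" for x d
 proof -
  obtain k0 where k0: "1 / real (Suc k0) < d" using nat_approx_posE[OF \<open>0 < d\<close>] by blast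
  have "s x k \<in> ball x d - N" if "k0 <= k" for k
  proof -
   have "1 / real (Suc k) <= 1 / real (Suc k0)" using that by (simp add: frac_le)
   then show ?thesis using s[of x k] k0 by auto
  qed
  then show ?thesis by blast
 qed
 define g where "g x = lim (%k. f (s x k))" for x
 have lim: "(%k. f (s x k)) ----> g x" if x: "x \<in> Om" for x
 proof -
  have "Cauchy (%k. f (s x k))"
  proof (rule metric_CauchyI)
   fix e :: real assume e: "0 < e"
   obtain d where d: "d > 0" "\<forall>y\<in>ball x d - N. \<forall>z\<in>ball x d - N. abs(f y - f z) <= e / 2"
    using osc[OF x, of "e / 2"] e by auto
   obtain k0 where "!!k. k >= k0 ==> s x k \<in> ball x d - N" using ev[OF d(1)] by blast
   then have "abs(f (s x k) - f (s x k')) <= e / 2" if "k >= k0" "k' >= k0" for k k' using d(2) that by blast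
   then have "dist (f (s x k)) (f (s x k')) < e" if "k >= k0" "k' >= k0" for k k'
    using that e by (fastforce simp: dist_real_def)
   then show "\<exists>M. \<forall>m\<ge>M. \<forall>n\<ge>M. dist (f (s x m)) (f (s x n)) < e" by blast
  qed
  then show ?thesis unfolding g_def by (simp add: Cauchy_convergent_iff convergent_LIMSEQ_iff)
 qed
 have near: "abs(f z - g y) <= e"
  if d: "\<forall>y\<in>ball x d - N. \<forall>z\<in>ball x d - N. abs(f y - f z) <= e" and z: "z \<in> ball x d - N" and y: "y \<in> ball x d" "y \<in> Om" for x d e z y
 proof -
  have "0 < d - dist x y" using y by simp
  then obtain k0 where k0: "!!k. k >= k0 ==> s y k \<in> ball y (d - dist x y) - N" using ev by blast
  have le: "abs(f z - f (s y k)) <= e" if "k >= k0" for k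
  proof -
   have "dist x (s y k) < d" using k0[OF that] dist_triangle[of x "s y k" y] by simp
   then show ?thesis using d z k0[OF that] by auto
  qed
  have "(%k. abs(f z - f (s y k))) ----> abs(f z - g y)" by (intro tendsto_intros lim y)
  then show ?thesis by (rule LIMSEQ_le_const2) (use le in blast)
 qed
 have eq: "g x = f x" if x: "x \<in> Om - N" for x
 proof -
  have "abs(f x - g x) <= e" if "0 < e" for e
  proof -
   obtain d where d: "d > 0" "\<forall>y\<in>ball x d - N. \<forall>z\<in>ball x d - N. abs(f y - f z) <= e" using osc[of x e] x \<open>0 < e\<close> by auto
   show ?thesis by (rule near[OF d(2)]) (use x d in auto)
  qed
  then have "abs(f x - g x) <= 0" by (rule field_le_epsilon[OF _]) simp
  then show ?thesis by simp
 qed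
 have "continuous_on Om g"
 proof (rule continuous_onI)
  fix x e assume x: "x \<in> Om" and e: "0 < (e::real)"
  obtain d where d: "d > 0" "\<forall>y\<in>ball x d - N. \<forall>z\<in>ball x d - N. abs(f y - f z) <= e / 2" using osc[OF x, of "e / 2"] e by auto
  obtain z where z: "z \<in> ball x d - N" using ev[OF d(1)] by blast
  have "dist (g y) (g x) <= e" if "y \<in> Om" "dist y x < d" for y
  proof -
   have "abs(f z - g y) <= e / 2" "abs(f z - g x) <= e / 2"
    using near[OF d(2) z, of y] near[OF d(2) z, of x] that x d(1) by (auto simp: dist_commute)
   then show ?thesis unfolding dist_real_def by linarith
  qed
  then show "\<exists>d>0. \<forall>x'\<in>Om. dist x' x < d --> dist (g x') (g x) <= e" using d(1) by blast
 qed
 then show ?thesis using eq by blast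
qed

text \<open>The path from \<open>x\<close> to \<open>y\<close> runs along edges parallel to the axes
  and stays in the box spanned by the two points, where the derivatives are assumed to be close to
  \<open>c\<close>.\<close>

lemma coordinate_telescope:
 fixes x y :: "real ^ 'n::finite"
 assumes d: "!!j z. ((%s. g (sh z s j)) hrd g1 j z) (at 0)"
  and M: "!!j z. (!!l. min (x $ l) (y $ l) <= z $ l \<and> z $ l <= max (x $ l) (y $ l)) ==> abs(g1 j z - c j) <= M"
 shows "abs(g y - g x - (\<Sum>j\<in>UNIV. (y - x) $ j * c j)) <= (\<Sum>j\<in>UNIV. abs((y - x) $ j) * M)"
proof -
 define p where "p S = (\<chi> l. if l \<in> S then y $ l else x $ l)" for S
 have "abs(g (p S) - g x - (\<Sum>j\<in>S. (y - x) $ j * c j)) <= (\<Sum>j\<in>S. abs((y - x) $ j) * M)" if "finite S" for S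
  using that
 proof (induction S rule: finite_induct)
  case empty
  have "p {} = x" by (simp add: p_def vec_eq_iff)
  then show ?case by simp
 next
  case (insert j S)
  define t where "t = (y - x) $ j"
  have pj: "p (insert j S) = p S + t *\<^sub>R axis j 1"
   using insert(2) by (auto simp: p_def vec_eq_iff axis_def t_def)
  have dd: "((%s. g (p S + s *\<^sub>R axis j 1)) hrd g1 j (p S + s *\<^sub>R axis j 1)) (at s)" for s
  proof -
   have "((%v. g ((p S + s *\<^sub>R axis j 1) + v *\<^sub>R axis j 1)) hrd g1 j (p S + s *\<^sub>R axis j 1)) (at (s + - s))"
    using d by simp
   then have "((%v. g ((p S + s *\<^sub>R axis j 1) + (v + - s) *\<^sub>R axis j 1)) hrd g1 j (p S + s *\<^sub>R axis j 1)) (at s)"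
    unfolding DERIV_shift by (simp add: o_def)
   then show ?thesis by (simp add: scaleR_left_diff_distrib add.assoc)
  qed
  obtain xi where xi: "min 0 t <= xi" "xi <= max 0 t" "g (p S + t *\<^sub>R axis j 1) - g (p S + 0 *\<^sub>R axis j 1) = g1 j (p S + xi *\<^sub>R axis j 1) * (t - 0)"
   using MVT_between[OF dd, of 0 t] by blast
  have "abs(g1 j (p S + xi *\<^sub>R axis j 1) - c j) <= M"
  proof (rule M)
   fix l
   show "min (x $ l) (y $ l) <= (p S + xi *\<^sub>R axis j 1) $ l \<and> (p S + xi *\<^sub>R axis j 1) $ l <= max (x $ l) (y $ l)"
    using xi(1,2) insert(2) by (auto simp: p_def axis_def t_def)
  qed
  then have "abs(t) * abs(g1 j (p S + xi *\<^sub>R axis j 1) - c j) <= abs(t) * M" by (rule mult_left_mono) simp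
  moreover have "abs(g (p (insert j S)) - g (p S) - t * c j) = abs(t) * abs(g1 j (p S + xi *\<^sub>R axis j 1) - c j)"
   using xi(3) by (simp add: pj abs_mult[symmetric] algebra_simps)
  ultimately have "abs(g (p (insert j S)) - g (p S) - t * c j) <= abs(t) * M" by simp
  then show ?case using insert by (simp add: t_def)
 qed
 from this[of UNIV] show ?thesis by (simp add: p_def)
qed

text \<open>The function \<open>g\<close> is compared with a mollification on the scale
  \<open>s = dlt * r\<close>, where \<open>r\<close> is the distance to \<open>x0\<close>. At a
  Lebesgue point of \<open>theta\<close> the oscillation on cubes of half side \<open>s\<close> near
  \<open>x0\<close> is of order \<open>s\<close>, a small multiple of \<open>r\<close>; at a
  Lebesgue point of the weak gradient the derivatives of the mollification are close to
  \<open>w j x0\<close>.\<close>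

lemma osc_differentiable:
 fixes u g :: "real ^ 'n::finite => real"
 assumes wg: "wgrad Q u w" and theta: "L1 theta" "!!x. 0 <= theta x"
  and osc: "!!b r y z. 0 < r ==> cube b r \<subseteq> Q ==> y \<in> cube b r ==> z \<in> cube b r ==>
   abs(g y - g z) <= root CARD('n) (LINT v:cube b r|lm. theta v)"
  and u: "negligible N" "!!y. y \<in> Q ==> y ~: N ==> u y = g y"
  and x0: "0 < rho0" "ball x0 rho0 \<subseteq> Q" and lp: "lebesgue_point theta x0" "!!j. lebesgue_point (w j) x0" and e: "0 < e"
 shows "\<exists>d>0. \<forall>y. norm (y - x0) < d --> abs(g y - g x0 - (\<Sum>j\<in>UNIV. (y - x0) $ j * w j x0)) <= e * norm (y - x0)"
proof -
 define n where "n = CARD('n)"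
 have n0: "0 < n" unfolding n_def by simp
 define V where "V = unit_ball_vol (real n)"
 define q where "q = 2 * real n + 1"
 have q: "0 < q" by (simp add: q_def)
 have V: "0 < V" by (simp add: V_def)
 define B where "B = (2 * bump_max) ^ n * (root n (theta x0 + 1) * 2)"
 have bm: "0 < bump_max" using bump_max(1) by simp
 have B: "0 < B" using theta(2)[of x0] n0 bm unfolding B_def by (intro mult_pos_pos) (auto intro: add_nonneg_pos)
 \<comment> \<open>Replacing \<open>g\<close> by its mollification at two points costs
   \<open>2 * (B * dlt) * r\<close>, which is at most half of the admissible error.\<close>
 define dlt where "dlt = min 1 (e / (4 * B))"
 have dlt: "0 < dlt" "dlt <= 1" "2 * (B * dlt) <= e / 2"
 proof -
  show "0 < dlt" "dlt <= 1" using e B by (auto simp: dlt_def)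
  have "B * dlt <= B * (e / (4 * B))" using B by (intro mult_left_mono) (auto simp: dlt_def)
  then show "2 * (B * dlt) <= e / 2" using B by simp
 qed
 \<comment> \<open>Integrals over cubes of half side \<open>s\<close> are estimated by integrals
   over the ball of radius \<open>q * r\<close>; the accuracies \<open>e1\<close> and
   \<open>e2\<close> compensate for the ratio of the volumes.\<close>
 define e1 where "e1 = (2 * dlt) ^ n / (V * q ^ n)"
 have e1: "0 < e1" using dlt V q by (simp add: e1_def)
 define e2 where "e2 = e / (2 * real n * ((bump_max * q / dlt) ^ n * V))"
 have e2: "0 < e2" using dlt V q e bm n0 by (simp add: e2_def)
 obtain d1 where d1: "d1 > 0" "!!r. 0 < r ==> r < d1 ==> (LINT y:ball x0 r|lm. abs(theta y - theta x0)) <= e1 * vol (ball x0 r)"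
  using lp(1) e1 unfolding lebesgue_point_def by blast
 have "\<forall>j. \<exists>d>0. \<forall>r. 0 < r \<and> r < d --> (LINT y:ball x0 r|lm. abs(w j y - w j x0)) <= e2 * vol (ball x0 r)"
  using lp(2) e2 unfolding lebesgue_point_def by blast
 then obtain d2 where d2: "!!j. d2 j > 0" "!!j r. 0 < r ==> r < d2 j ==> (LINT y:ball x0 r|lm. abs(w j y - w j x0)) <= e2 * vol (ball x0 r)"
  by metis
 define d where "d = min (min d1 rho0) (Min (range d2)) / q"
 have dpos: "0 < Min (range d2)" using d2(1) by (subst Min_gr_iff) auto
 have d: "0 < d" using d1(1) x0(1) dpos q by (simp add: d_def)
 have ui: "L1 u" and wi: "!!j. L1 (w j)" using wg by (auto simp: wgrad_def)
 have main: "abs(g y - g x0 - (\<Sum>j\<in>UNIV. (y - x0) $ j * w j x0)) <= e * norm (y - x0)" if y: "norm (y - x0) < d" "y ~= x0" for y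
 proof -
  define r where "r = norm (y - x0)"
  have r: "0 < r" using y by (simp add: r_def)
  have qr: "q * r < d1" "q * r < rho0" "!!j. q * r < d2 j" "0 < q * r"
  proof -
   have "q * r < min (min d1 rho0) (Min (range d2))" using y(1) q by (simp add: r_def d_def pos_less_divide_eq mult.commute)
   moreover have "Min (range d2) <= d2 j" for j by (rule Min_le) auto
   ultimately show "q * r < d1" "q * r < rho0" "!!j. q * r < d2 j" by (auto intro: less_le_trans)
   show "0 < q * r" using q r by simp
  qed
  define s where "s = dlt * r"
  have s: "0 < s" "s <= r" using dlt r by (auto simp: s_def mult_left_le_one_le)
  have bQ: "ball x0 (q * r) \<subseteq> Q" using x0(2) qr(2) by auto
  have cb: "cube z s \<subseteq> ball x0 (q * r)" if "!!l. abs(z $ l - x0 $ l) <= r" for z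
  proof (rule cube_subset_ball[where s = "2 * r"])
   show "abs(z $ l - x0 $ l) + s <= 2 * r" for l using that[of l] s(2) by linarith
   show "real CARD('n) * (2 * r) < q * r" using r by (simp add: q_def n_def algebra_simps)
  qed
  have meas: "vol (ball x0 (q * r)) = V * q ^ n * r ^ n"
   using measure_ball_scale[of q r x0] q r by (simp add: V_def n_def)
  have bi: "L1 (%v. ind (ball x0 (q * r)) v * abs(k v - c))" if "L1 k" for k :: "real ^ 'n => real" and c
   by (rule integrable_ind_dist[OF that]) simp
  have thetacube: "root n (LINT v:cube z s|lm. theta v) <= root n (theta x0 + 1) * (2 * s)" if z: "!!l. abs(z $ l - x0 $ l) <= r" for z
  proof -
   have ic: "L1 (%v. ind (cube z s) v * theta x0)" by (rule integrable_ind_const[OF cube_lmeasurable])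
   have "(LINT v:cube z s|lm. theta v) <= (LI v. ind (cube z s) v * theta x0 + ind (ball x0 (q * r)) v * abs(theta v - theta x0))"
    unfolding slint_def
   proof (rule integral_mono)
    show "L1 (%v. ind (cube z s) v *\<^sub>R theta v)" using integrable_restrict(1)[OF theta(1), of "cube z s"] by simp
    show "L1 (%v. ind (cube z s) v * theta x0 + ind (ball x0 (q * r)) v * abs(theta v - theta x0))"
     by (intro int_add ic bi theta)
    show "ind (cube z s) v *\<^sub>R theta v <= ind (cube z s) v * theta x0 + ind (ball x0 (q * r)) v * abs(theta v - theta x0)" for v
     using cb[OF z] by (auto simp: indicator_def)
   qed
   also have "... = (2 * s) ^ n * theta x0 + (LINT v:ball x0 (q * r)|lm. abs(theta v - theta x0))"
    using s by (subst lint_add[OF ic bi[OF theta(1)]]) (simp add: measure_cube slint_def n_def)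
   also have "... <= (2 * s) ^ n * theta x0 + e1 * (V * q ^ n * r ^ n)" using d1(2)[OF qr(4,1)] meas by simp
   also have "e1 * (V * q ^ n * r ^ n) = (2 * s) ^ n" using V q by (simp add: e1_def s_def power_mult_distrib)
   finally have "(LINT v:cube z s|lm. theta v) <= (theta x0 + 1) * (2 * s) ^ n" by (simp add: algebra_simps)
   then have "root n (LINT v:cube z s|lm. theta v) <= root n ((theta x0 + 1) * (2 * s) ^ n)" using n0 by (rule real_root_le_mono[rotated])
   also have "... = root n (theta x0 + 1) * (2 * s)" using n0 s by (simp add: real_root_mult real_root_power_cancel)
   finally show ?thesis .
  qed
  have near: "abs(avg u z s - g z) <= B * s" if z: "!!l. abs(z $ l - x0 $ l) <= r" for z
  proof -
   define T where "T = root n (theta x0 + 1) * (2 * s)"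
   have T: "0 <= T" using theta(2)[of x0] s n0 by (simp add: T_def)
   have zc: "z \<in> cube z s" using s by (simp add: cube_def)
   have "abs(avg u z s - g z) <= (bump_max / s) ^ CARD('n) * (LINT v:cube z s|lm. abs(u v - g z))"
    by (rule avg_minus_le[OF ui s(1)]) auto
   also have "(LINT v:cube z s|lm. abs(u v - g z)) = (LINT v:cube z s|lm. (if v \<in> N then 0 else abs(u v - g z)))"
   proof -
    have N': "AE v in lm. v ~: N" using u(1) by (intro AE_not_in) (simp add: negligible_iff_null_sets)
    have im: "(ind (cube z s) :: _ => real) \<in> bml" by (rule borel_measurable_indicator) simp
    have um: "(%v. abs(u v - g z)) \<in> bml"
     by (intro borel_measurable_abs borel_measurable_diff borel_measurable_const borel_measurable_integrable[OF ui])
    have bm1: "(%v. ind (cube z s) v *\<^sub>R (abs(u v - g z))) \<in> bml" by (rule borel_measurable_scaleR[OF im um])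
    have "N \<in> sets lebesgue" using u(1) negligible_imp_sets by blast
    then have "(%v. if v \<in> N then 0 else abs(u v - g z)) \<in> bml"
     by (intro measurable_If_set um borel_measurable_const) simp
    then have bm2: "(%v. ind (cube z s) v *\<^sub>R (if v \<in> N then 0 else abs(u v - g z))) \<in> bml"
     by (rule borel_measurable_scaleR[OF im])
    show ?thesis unfolding slint_def by (rule integral_cong_AE[OF bm1 bm2]) (use N' in eventually_elim, simp)
   qed
   also have "(bump_max / s) ^ CARD('n) * ... <= (bump_max / s) ^ CARD('n) * (T * (2 * s) ^ CARD('n))"
   proof (intro mult_left_mono cube_integral_le s T)
    fix v assume v: "v \<in> cube z s"
    have vQ: "v \<in> Q" using v cb[OF z] bQ by auto
    have "abs(g v - g z) <= root n (LINT v:cube z s|lm. theta v)"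
     unfolding n_def by (rule osc[OF s(1) _ v zc]) (use cb[OF z] bQ in auto)
    then have "abs(g v - g z) <= T" using thetacube[OF z] by (simp add: T_def)
    then show "(if v \<in> N then 0 else abs(u v - g z)) <= T" using u(2)[OF vQ] T by auto
   qed (use bm s in auto)
   also have "... = B * s" using s by (simp add: B_def T_def n_def power_divide power_mult_distrib)
   finally show ?thesis .
  qed
  define M where "M = e / (2 * real n)"
  have comp: "abs((y - x0) $ l) <= r" for l unfolding r_def by (rule component_le_norm_cart)
  have der: "abs(- moll (dbk s j) u z - w j x0) <= M"
   if z: "!!l. min (x0 $ l) (y $ l) <= z $ l \<and> z $ l <= max (x0 $ l) (y $ l)" for j z
  proof -
   have z': "abs(z $ l - x0 $ l) <= r" for l using z[of l] comp[of l] by auto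
   have "- moll (dbk s j) u z = avg (w j) z s" by (rule wgrad_dbk[OF wg s(1)]) (use cb[OF z'] bQ in auto)
   also have "abs(avg (w j) z s - w j x0) <= (bump_max / s) ^ CARD('n) * (LINT v:ball x0 (q * r)|lm. abs(w j v - w j x0))"
    by (rule avg_minus_le[OF wi s(1) cb[OF z']]) simp
   also have "... <= (bump_max / s) ^ CARD('n) * (e2 * (V * q ^ n * r ^ n))"
    using d2(2)[OF qr(4,3)] meas bm s by (intro mult_left_mono) auto
   also have "... = e2 * ((bump_max * q / dlt) ^ n * V)" using r dlt by (simp add: s_def n_def power_divide power_mult_distrib)
   also have "... = M" using V q dlt bm n0 by (simp add: e2_def M_def)
   finally show ?thesis .
  qed
  have "abs(avg u y s - avg u x0 s - (\<Sum>j\<in>UNIV. (y - x0) $ j * w j x0)) <= (\<Sum>j\<in>UNIV. abs((y - x0) $ j) * M)"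
   by (rule coordinate_telescope[where ?g1.0 = "%j z. - moll (dbk s j) u z"]) (rule dbk_moll_DERIV[OF ui s(1)], rule der)
  also have "... <= (\<Sum>j\<in>(UNIV::'n set). r * M)" using comp e n0 by (intro sum_mono mult_right_mono) (auto simp: M_def)
  also have "... = e / 2 * r" using n0 by (simp add: M_def n_def[symmetric])
  finally have 1: "abs(avg u y s - avg u x0 s - (\<Sum>j\<in>UNIV. (y - x0) $ j * w j x0)) <= e / 2 * r" .
  have 2: "abs(avg u y s - g y) <= B * s" by (rule near) (use comp in simp)
  have 3: "abs(avg u x0 s - g x0) <= B * s" by (rule near) (use r in simp)
  have "2 * (B * s) <= e / 2 * r" using mult_right_mono[OF dlt(3), of r] r by (simp add: s_def mult_ac)
  then have "abs(g y - g x0 - (\<Sum>j\<in>UNIV. (y - x0) $ j * w j x0)) <= e / 2 * r + e / 2 * r" using 1 2 3 by linarith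
  then show ?thesis by (simp add: r_def)
 qed
 show ?thesis
 proof (intro exI[of _ d] conjI d allI impI)
  fix y assume "norm (y - x0) < d"
  then show "abs(g y - g x0 - (\<Sum>j\<in>UNIV. (y - x0) $ j * w j x0)) <= e * norm (y - x0)"
   using main[of y] by (cases "y = x0") auto
 qed
qed

section \<open>Vanishing Hausdorff measure of images of null sets\<close>

definition small_cover :: "nat => nat => real => real => (nat => real) set => bool" where
 "small_cover m n dlt e E \<longleftrightarrow> (\<exists>A :: nat => (nat => real) set. E \<subseteq> (\<Union>i. A i) \<and>
   (\<forall>i. A i \<subseteq> Rm m \<and> diam_Rm m (A i) <= ennreal dlt) \<and>
   (\<Sum>i. ennreal (unit_ball_vol (real n) / 2 ^ n) * diam_Rm m (A i) ^ n) <= ennreal e)"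

text \<open>The scale in the Hausdorff measure is an extended real. For the infinite scale a cover
  with scale one is used, since finer covers are admissible for coarser scales.\<close>

lemma hausdorff_null:
 assumes "!!dlt e. 0 < dlt ==> 0 < e ==> small_cover m n dlt e E"
 shows "hausdorff_measure m n E = 0"
proof -
 define F where "F dlt = (INF A\<in>{A :: nat => (nat => real) set.
     E \<subseteq> (\<Union>i. A i) \<and> (\<forall>i. A i \<subseteq> Rm m \<and> diam_Rm m (A i) <= dlt)}.
    \<Sum>i. ennreal (unit_ball_vol (real n) / 2 ^ n) * diam_Rm m (A i) ^ n)" for dlt
 have "F dlt <= 0" if dlt: "0 < dlt" for dlt
 proof (rule ennreal_le_epsilon)
  fix e :: real assume e: "0 < e"
  obtain dlt' :: real where dlt': "0 < dlt'" "ennreal dlt' <= dlt"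
  proof (cases dlt)
   case (real r)
   then show ?thesis using that[of r] dlt by simp
  next
   case top
   then show ?thesis using that[of 1] by simp
  qed
  obtain A where A: "E \<subseteq> (\<Union>i. A i)" "!!i. A i \<subseteq> Rm m \<and> diam_Rm m (A i) <= ennreal dlt'"
   "(\<Sum>i. ennreal (unit_ball_vol (real n) / 2 ^ n) * diam_Rm m (A i) ^ n) <= ennreal e"
   using assms[OF dlt'(1) e] unfolding small_cover_def by blast
  have "F dlt <= (\<Sum>i. ennreal (unit_ball_vol (real n) / 2 ^ n) * diam_Rm m (A i) ^ n)"
   unfolding F_def by (rule INF_lower) (use A dlt' in "auto intro: order_trans")
  then show "F dlt <= 0 + ennreal e" using A(3) by simp
 qed
 then have "(SUP dlt\<in>{0<..}. F dlt) <= 0" by (intro SUP_least) auto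
 then show ?thesis unfolding hausdorff_measure_def F_def by simp
qed

lemma small_cover_empty: "0 < n ==> small_cover m n dlt e {}"
 unfolding small_cover_def by (intro exI[of _ "%_. {}"]) (simp add: diam_Rm_def bot_ennreal power_0_left)

lemma small_cover_mono: "small_cover m n dlt e E ==> E' \<subseteq> E ==> small_cover m n dlt e E'"
 unfolding small_cover_def by (meson order_trans)

text \<open>Countable subadditivity: the \<open>k\<close>-th set gets the budget
  \<open>e / 2 ^ (k + 1)\<close>, and the double sequence of covering sets is enumerated by
  \<open>prod_decode\<close>.\<close>

lemma small_cover_UN:
 assumes "!!k e. 0 < e ==> small_cover m n dlt e (E k)" and e: "0 < e"
 shows "small_cover m n dlt e (\<Union>k::nat. E k)"
proof -
 define c where "c = ennreal (unit_ball_vol (real n) / 2 ^ n)"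
 have "\<forall>k. \<exists>A :: nat => (nat => real) set. E k \<subseteq> (\<Union>i. A i) \<and> (\<forall>i. A i \<subseteq> Rm m \<and> diam_Rm m (A i) <= ennreal dlt) \<and>
   (\<Sum>i. c * diam_Rm m (A i) ^ n) <= ennreal (e * (1 / 2) ^ Suc k)"
  using assms(1)[of "e * (1 / 2) ^ Suc _"] e unfolding small_cover_def c_def by simp
 from choice[OF this] obtain A :: "nat => nat => (nat => real) set" where A: "!!k. E k \<subseteq> (\<Union>i. A k i)" "!!k i. A k i \<subseteq> Rm m \<and> diam_Rm m (A k i) <= ennreal dlt"
  "!!k. (\<Sum>i. c * diam_Rm m (A k i) ^ n) <= ennreal (e * (1 / 2) ^ Suc k)" by blast
 define B where "B i = A (fst (prod_decode i)) (snd (prod_decode i))" for i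
 have sums: "(%k. e * (1 / 2) ^ Suc k) sums e" using sums_mult[OF power_half_series, of e] by simp
 have "(\<Sum>i. c * diam_Rm m (B i) ^ n) = (\<Sum>k. \<Sum>i. c * diam_Rm m (A k i) ^ n)"
  using suminf_ennreal_2dimen[of "%k. \<Sum>i. c * diam_Rm m (A k i) ^ n" "%p. c * diam_Rm m (A (fst p) (snd p)) ^ n"]
  by (simp add: B_def)
 also have "... <= (\<Sum>k. ennreal (e * (1 / 2) ^ Suc k))" by (intro suminf_le A(3) summableI)
 also have "... = ennreal e" using sums e by (subst suminf_ennreal2) (auto simp: sums_iff)
 finally have "(\<Sum>i. c * diam_Rm m (B i) ^ n) <= ennreal e" .
 moreover have "(\<Union>k. E k) \<subseteq> (\<Union>i. B i)"
 proof
  fix x assume "x \<in> (\<Union>k. E k)"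
  then obtain k i where "x \<in> A k i" using A(1) by blast
  then have "x \<in> B (prod_encode (k, i))" by (simp add: B_def)
  then show "x \<in> (\<Union>i. B i)" by blast
 qed
 ultimately show ?thesis unfolding small_cover_def c_def using A(2) by (intro exI[of _ B]) (auto simp: B_def)
qed

lemma diam_Rm_image_le:
 assumes "!!x y i. x \<in> K ==> y \<in> K ==> i < m ==> abs(g x i - g y i) <= t"
 shows "diam_Rm m (g ` K) <= ennreal (real m * t)"
 unfolding diam_Rm_def
proof (intro SUP_least)
 fix p q assume "p \<in> g ` K" "q \<in> g ` K"
 then obtain x y where xy: "x \<in> K" "y \<in> K" "p = g x" "q = g y" by blast
 have "L2_set (%i. p i - q i) {..<m} <= (\<Sum>i<m. abs(p i - q i))" by (rule L2_set_le_sum_abs)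
 also have "... <= (\<Sum>i<m. t)" using assms xy by (intro sum_mono) auto
 finally show "ennreal (L2_set (%i. p i - q i) {..<m}) <= ennreal (real m * t)" by (simp add: ennreal_leI)
qed

text \<open>The frontier of a cube is negligible. Interiors enter because the cubes of the covering
  below are disjoint only up to their boundaries.\<close>

lemma cube_integral_interior:
 assumes "L1 theta"
 shows "(LINT z:cube b r|lm. theta z) = (LINT z:interior (cube b r)|lm. (theta z :: real))"
 unfolding slint_def
proof (rule integral_cong_AE)
 have "negligible (frontier (cube b r))" unfolding cube_eq_cbox by (rule negligible_convex_frontier[OF convex_box(1)])
 then have "AE x in lm. x ~: frontier (cube b r)" by (intro AE_not_in) (simp add: negligible_iff_null_sets)
 then show "AE x in lm. ind (cube b r) x *\<^sub>R theta x = ind (interior (cube b r)) x *\<^sub>R theta x"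
 proof eventually_elim
  case (elim x)
  then have "x \<in> cube b r \<longleftrightarrow> x \<in> interior (cube b r)"
   using closure_subset[of "cube b r"] interior_subset[of "cube b r"] by (auto simp: frontier_def)
  then show ?case by (simp add: indicator_def)
 qed
qed (use integrable_restrict(2)[OF assms, of "cube b r"] integrable_restrict(2)[OF assms, of "interior (cube b r)"] in "auto simp: borel_open")

text \<open>The null set is covered by cubes with disjoint interiors inside an open set of small
  measure. The oscillation bound makes the sum of the \<open>n\<close>-th powers of the diameters of
  their images at most a constant times the integral of the density over that open set.\<close>

lemma osc_small_cover:
 fixes g :: "real ^ 'n::finite => nat => real"
 assumes R: "0 < R" and theta: "L1 theta" "!!x. 0 <= theta x"
  and osc: "!!b r y z i. 0 < r ==> cube b r \<subseteq> cube a R ==> y \<in> cube b r ==> z \<in> cube b r ==> i < m ==>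
   abs(g y i - g z i) <= root CARD('n) (LINT v:cube b r|lm. theta v)" and gR: "!!x. x \<in> cube a R ==> g x \<in> Rm m"
  and Z: "Z \<subseteq> ball a R" "negligible Z" and pos: "0 < dlt" "0 < e"
 shows "small_cover m CARD('n) dlt e (g ` Z)"
proof -
 define n where "n = CARD('n)"
 have n0: "0 < n" unfolding n_def by simp
 define c where "c = unit_ball_vol (real n) / 2 ^ n"
 have c: "0 < c" by (simp add: c_def)
 define M where "M = real m + 1"
 have M: "0 < M" "real m <= M" by (auto simp: M_def)
 \<comment> \<open>The first term keeps every single diameter at most \<open>dlt\<close>, the second
   the total at most \<open>e\<close>.\<close>
 define eta where "eta = min ((dlt / M) ^ n) (e / (c * M ^ n))"
 have eta: "0 < eta" "eta <= (dlt / M) ^ n" "eta <= e / (c * M ^ n)" using pos M c by (auto simp: eta_def)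
 obtain d where d: "d > 0" "!!A. A \<in> lmeasurable ==> vol A < d ==> (LINT y:A|lm. theta y) < eta"
  using integral_absolutely_continuous[OF theta eta(1)] by blast
 have Zs: "Z \<in> sets lebesgue" using Z(2) negligible_imp_sets by blast
 obtain U0 where U0: "open U0" "Z \<subseteq> U0" "U0 - Z \<in> lmeasurable" "emeasure lebesgue (U0 - Z) < ennreal d"
  using sets_lebesgue_outer_open[OF Zs d(1)] by blast
 define U where "U = U0 \<inter> ball a R"
 have U: "open U" "Z \<subseteq> U" "U \<subseteq> ball a R" using U0 Z(1) by (auto simp: U_def)
 have Ulm: "U \<in> lmeasurable" using U(1) by (simp add: U_def bounded_Int lmeasurable_open)
 have Usm: "vol U < d"
 proof -
  have "vol (U0 - Z) < d" using U0(3,4) d(1) by (simp add: emeasure_eq_measure2 ennreal_less_iff)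
  moreover have "vol U <= vol ((U0 - Z) \<union> Z)"
   by (rule measure_mono_fmeasurable[OF _ fmeasurableD[OF Ulm] fmeasurable.Un[OF U0(3) negligible_imp_measurable[OF Z(2)]]])
    (auto simp: U_def)
  moreover have "vol ((U0 - Z) \<union> Z) <= vol (U0 - Z) + vol Z" using U0(3) Zs by (intro measure_Un_le) auto
  moreover have "vol Z = 0" using Z(2) by (simp add: negligible_imp_measure0)
  ultimately show ?thesis by linarith
 qed
 have IU: "(LINT y:U|lm. theta y) < eta" by (rule d(2)[OF Ulm Usm])
 define lo where "lo = (\<chi> l. a $ l - R)"
 define hi where "hi = (\<chi> l. a $ l + R)"
 have Qe: "cube a R = cbox lo hi" by (simp add: cube_eq_cbox lo_def hi_def)
 have bR: "ball a R \<subseteq> cube a R"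
 proof
  fix x assume "x \<in> ball a R"
  then show "x \<in> cube a R" using component_le_norm_cart[of "x - a"] by (auto simp: cube_def dist_norm norm_minus_commute intro: order_trans less_imp_le)
 qed
 \<comment> \<open>The tags lie in \<open>Z\<close>, so this gauge forces every cube of the covering
   into \<open>U\<close>; off \<open>U\<close> its values are a dummy.\<close>
 define gam where "gam x = (if x \<in> U then U else ball x 1)" for x
 have gam: "gauge gam" unfolding gauge_def gam_def using U(1) by auto
 have ne: "box lo hi ~= {}" using R by (simp add: lo_def hi_def interval_ne_empty_cart)
 obtain \<D> where \<D>: "countable \<D>" "\<Union>\<D> \<subseteq> cbox lo hi" "!!K. K \<in> \<D> ==> interior K ~= {} \<and> (\<exists>c d. K = cbox c d)"
  "pairwise (%A B. interior A \<inter> interior B = {}) \<D>" "!!K. K \<in> \<D> ==> \<exists>x \<in> Z \<inter> K. K \<subseteq> gam x"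
  "!!u v. cbox u v \<in> \<D> ==> \<exists>n. \<forall>i \<in> Basis. v \<bullet> i - u \<bullet> i = (hi \<bullet> i - lo \<bullet> i) / 2^n" "Z \<subseteq> \<Union>\<D>"
  by (rule covering_lemma[OF _ ne gam, of Z]) (use Z(1) bR Qe in auto)
 have cub: "\<exists>b r. 0 < r \<and> K = cube b r" if K: "K \<in> \<D>" for K
 proof -
  obtain u v where uv: "K = cbox u v" using \<D>(3)[OF K] by blast
  obtain k where k: "\<forall>i\<in>Basis. v \<bullet> i - u \<bullet> i = (hi \<bullet> i - lo \<bullet> i) / 2 ^ k" using \<D>(6)[of u v] K uv by blast
  have vu: "v $ l - u $ l = 2 * R / 2 ^ k" for l
   using k[rule_format, of "axis l 1"] by (simp add: axis_in_Basis_iff inner_axis hi_def lo_def)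
  define r where "r = R / 2 ^ k"
  define b where "b = (\<chi> l. (u $ l + v $ l) / 2)"
  have u': "u $ l = b $ l - r" and v': "v $ l = b $ l + r" for l
   using vu[of l] by (simp_all add: b_def r_def field_simps)
  have "u = (\<chi> l. b $ l - r)" "v = (\<chi> l. b $ l + r)" by (simp_all add: vec_eq_iff u' v')
  then have "K = cube b r" unfolding uv cube_eq_cbox by simp
  then show ?thesis using R by (auto simp: r_def intro!: exI[of _ b] exI[of _ r])
 qed
 then obtain bb rr where br: "!!K. K \<in> \<D> ==> 0 < rr K \<and> K = cube (bb K) (rr K)" by metis
 have KU: "K \<subseteq> U" if "K \<in> \<D>" for K using \<D>(5)[OF that] U(2) unfolding gam_def by (auto split: if_splits)
 have KQ: "K \<subseteq> cube a R" if "K \<in> \<D>" for K using \<D>(2) that Qe by auto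
 define I where "I K = (LINT v:K|lm. theta v)" for K
 have I0: "0 <= I K" for K unfolding I_def by (rule set_integral_nonneg') (use theta in simp)
 have IK: "I K = (LINT v:interior K|lm. theta v)" if "K \<in> \<D>" for K
  unfolding I_def using cube_integral_interior[OF theta(1)] br[OF that] by metis
 have Isum: "(\<Sum>K\<in>S. I K) <= eta" if S: "finite S" "S \<subseteq> \<D>" for S
 proof -
  have "(\<Sum>K\<in>S. I K) = (\<Sum>K\<in>S. (LINT v:interior K|lm. theta v))" using IK S by (intro sum.cong) auto
  also have "... <= (LINT v:U|lm. theta v)"
  proof (rule disjoint_balls_integral_sum[OF theta S(1)])
   show "U \<in> sets lebesgue" using Ulm by auto
   show "interior K \<in> sets lebesgue" for K :: "(real ^ 'n) set" by (simp add: borel_open)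
   show "interior K \<subseteq> U" if "K \<in> S" for K using KU[of K] that S interior_subset[of K] by auto
   show "pairwise (%A B. disjnt (interior A) (interior B)) S"
    using pairwise_subset[OF \<D>(4) S(2)] by (simp add: disjnt_def)
  qed
  finally show ?thesis using IU by simp
 qed
 have dia: "diam_Rm m (g ` K) <= ennreal (M * root n (I K))" if K: "K \<in> \<D>" for K
 proof -
  have "diam_Rm m (g ` K) <= ennreal (real m * root n (I K))"
  proof (rule diam_Rm_image_le)
   fix x y i assume "x \<in> K" "y \<in> K" "i < m"
   then show "abs(g x i - g y i) <= root n (I K)"
    unfolding I_def n_def using osc[of "rr K" "bb K" x y i] br[OF K] KQ[OF K] by auto
  qed
  also have "... <= ennreal (M * root n (I K))" using M I0[of K] n0 by (intro ennreal_leI mult_right_mono) auto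
  finally show ?thesis .
 qed
 define X where "X = to_nat_on \<D> ` \<D>"
 define kk where "kk = from_nat_into \<D>"
 have kkD: "kk i \<in> \<D>" if "i \<in> X" for i using that \<D>(1) by (auto simp: X_def kk_def)
 have kinj: "inj_on kk X" by (rule inj_onI) (use \<D>(1) in "auto simp: X_def kk_def")
 define A where "A i = (if i \<in> X then g ` kk i else {})" for i
 have d0: "diam_Rm m {} = 0" by (simp add: diam_Rm_def bot_ennreal)
 show ?thesis unfolding small_cover_def
 proof (intro exI[of _ A] conjI allI)
  show "g ` Z \<subseteq> (\<Union>i. A i)"
  proof safe
   fix z assume "z \<in> Z"
   then obtain K where K: "K \<in> \<D>" "z \<in> K" using \<D>(7) by blast
   have "to_nat_on \<D> K \<in> X" "kk (to_nat_on \<D> K) = K" using K \<D>(1) by (auto simp: X_def kk_def)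
   then have "g z \<in> A (to_nat_on \<D> K)" using K by (auto simp: A_def)
   then show "g z \<in> (\<Union>i. A i)" by blast
  qed
  show "A i \<subseteq> Rm m" for i using kkD[of i] KQ gR by (auto simp: A_def)
  show "diam_Rm m (A i) <= ennreal dlt" for i
  proof (cases "i \<in> X")
   case True
   have "I (kk i) <= eta" using Isum[of "{kk i}"] kkD[OF True] by simp
   then have "root n (I (kk i)) <= root n ((dlt / M) ^ n)" using eta n0 by (intro real_root_le_mono) auto
   also have "... = dlt / M" using pos M n0 by (simp add: real_root_power_cancel)
   finally have "M * root n (I (kk i)) <= dlt" using M by (simp add: field_simps)
   then show ?thesis using dia[OF kkD[OF True]] True by (auto simp: A_def intro: order_trans ennreal_leI)
  qed (simp add: A_def d0)
  show "(\<Sum>i. ennreal (unit_ball_vol (real CARD('n)) / 2 ^ CARD('n)) * diam_Rm m (A i) ^ CARD('n)) <= ennreal e"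
   unfolding n_def[symmetric] c_def[symmetric]
  proof (rule suminf_le_const[OF summableI])
   fix N
   have t: "ennreal c * diam_Rm m (A i) ^ n <= (if i \<in> X then ennreal (c * M ^ n * I (kk i)) else 0)" for i
   proof (cases "i \<in> X")
    case True
    have "diam_Rm m (A i) ^ n <= ennreal (M * root n (I (kk i))) ^ n"
     using dia[OF kkD[OF True]] True by (intro power_mono) (auto simp: A_def)
    also have "... = ennreal ((M * root n (I (kk i))) ^ n)" using M I0 n0 by (intro ennreal_power) auto
    also have "(M * root n (I (kk i))) ^ n = M ^ n * I (kk i)" using I0 n0 by (simp add: power_mult_distrib)
    finally have "ennreal c * diam_Rm m (A i) ^ n <= ennreal c * ennreal (M ^ n * I (kk i))" by (intro mult_left_mono) auto
    also have "... = ennreal (c * M ^ n * I (kk i))" using c M I0 by (simp add: ennreal_mult'[symmetric] mult.assoc)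
    finally show ?thesis using True by simp
   next
    case False
    then show ?thesis using n0 by (simp add: A_def d0 power_0_left)
   qed
   have "(\<Sum>i<N. ennreal c * diam_Rm m (A i) ^ n) <= (\<Sum>i<N. if i \<in> X then ennreal (c * M ^ n * I (kk i)) else 0)"
    by (rule sum_mono) (rule t)
   also have "... = (\<Sum>i\<in>{..<N} \<inter> X. ennreal (c * M ^ n * I (kk i)))" by (simp add: sum.inter_restrict)
   also have "... = ennreal (\<Sum>i\<in>{..<N} \<inter> X. c * M ^ n * I (kk i))" using c M I0 by (intro sum_ennreal) auto
   also have "(\<Sum>i\<in>{..<N} \<inter> X. c * M ^ n * I (kk i)) = c * M ^ n * (\<Sum>K\<in>kk ` ({..<N} \<inter> X). I K)"
    using inj_on_subset[OF kinj, of "{..<N} \<inter> X"] by (simp add: sum.reindex sum_distrib_left)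
   also have "... <= c * M ^ n * eta" using kkD c M by (intro mult_left_mono Isum) auto
   also have "... <= e" using eta(3) c M by (simp add: field_simps)
   finally show "(\<Sum>i<N. ennreal c * diam_Rm m (A i) ^ n) <= ennreal e" by (simp add: ennreal_leI)
  qed
 qed
qed

lemma ball_subset_cube:
 fixes x :: "real ^ 'n::finite" shows "ball x r \<subseteq> cube x r"
proof
 fix y assume "y \<in> ball x r"
 then show "y \<in> cube x r" using component_le_norm_cart[of "y - x"]
  by (auto simp: cube_def dist_norm norm_minus_commute intro: order_trans less_imp_le)
qed

lemma cube_dense_complement:
 fixes y :: "real ^ 'n::finite"
 assumes r: "0 < r" and y: "y \<in> cube b r" and N: "negligible N" and e: "0 < e"
 shows "\<exists>z\<in>cube b r - N. dist z y < e"
proof -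
 have "interior (cube b r) ~= {}" using r by (auto simp: cube_eq_cbox interval_ne_empty_cart)
 then have "y \<in> closure (interior (cube b r))"
  using convex_closure_interior[OF convex_cube] y closure_subset by blast
 then have "interior (cube b r) \<inter> ball y e ~= {}"
  using e unfolding closure_approachable by (metis IntI dist_commute empty_iff mem_ball)
 then have "\<not> negligible (interior (cube b r) \<inter> ball y e)" by (intro open_not_negligible) auto
 then obtain z where "z \<in> interior (cube b r) \<inter> ball y e" "z ~: N" using negligible_subset[OF N] by blast
 then show ?thesis using interior_subset by (intro bexI[of _ z]) (auto simp: dist_commute)
qed

lemma cube_integral_small:
 fixes theta :: "real ^ 'n::finite => real"
 assumes theta: "L1 theta" "!!x. 0 <= theta x" and e: "0 < e"
 shows "\<exists>d>0. \<forall>r x. 0 < r --> r < d --> root CARD('n) (LINT z:cube x r|lm. theta z) <= e"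
proof -
 have n0: "0 < CARD('n)" by simp
 have en: "0 < e ^ CARD('n)" using e by simp
 obtain d where d: "d > 0" "!!A. A \<in> lmeasurable ==> vol A < d ==> (LINT y:A|lm. theta y) < e ^ CARD('n)"
  using integral_absolutely_continuous[OF theta en] by blast
 have "((%r::real. (2 * r) ^ CARD('n)) ---> (2 * 0) ^ CARD('n)) (at 0)" by (intro tendsto_intros)
 then have "\<forall>\<^sub>F r::real in at 0. (2 * r) ^ CARD('n) < d" using d(1) by (intro order_tendstoD(2)) (auto simp: power_0_left)
 then obtain d' where d': "d' > 0" "!!r::real. r ~= 0 ==> dist r 0 < d' ==> (2 * r) ^ CARD('n) < d"
  unfolding eventually_at by blast
 show ?thesis
 proof (intro exI[of _ d'] conjI d'(1) allI impI)
  fix r and x :: "real ^ 'n" assume r: "0 < r" "r < d'"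
  have "(LINT z:cube x r|lm. theta z) < e ^ CARD('n)"
   by (rule d(2)) (use r d'(2)[of r] in "auto simp: measure_cube")
  then have "root CARD('n) (LINT z:cube x r|lm. theta z) <= root CARD('n) (e ^ CARD('n))"
   by (intro real_root_le_mono) auto
  then show "root CARD('n) (LINT z:cube x r|lm. theta z) <= e" using e n0 by (simp add: real_root_power_cancel)
 qed
qed

lemma continuous_map_Euclidean_space:
 assumes "!!i. i < m ==> continuous_on S (%x. g x i)" "!!x i. m <= i ==> g x i = 0"
 shows "continuous_map (top_of_set S) (Euclidean_space m) g"
 unfolding Euclidean_space_def continuous_map_in_subtopology continuous_map_componentwise_UNIV
proof (intro conjI allI)
 show "continuous_map (top_of_set S) euclideanreal (%x. g x i)" for i using assms by (cases "i < m") auto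
qed (use assms(2) in auto)

text \<open>Countably many of the local balls cover the domain, so the union of the exceptional sets
  is still negligible and one global representative can be formed; its regularity is then checked
  ball by ball.\<close>

theorem regular_representative:
 fixes f :: "real ^ 'n::finite => nat => real" and D :: "real ^ 'n => 'n => nat => real"
 assumes Om: "open Om" and fR: "f ` Om \<subseteq> Rm m"
  and loc: "!!x. x \<in> Om ==> \<exists>R theta N. 0 < R \<and> cube x R \<subseteq> Om \<and> osc_control m (cube x R) f theta N \<and>
   (\<forall>i<m. wgrad (cube x R) (%y. ind (cube x R) y * f y i) (%j y. ind (cube x R) y * D y j i))"
 shows "\<exists>g. (AE x in lebesgue_on Om. g x = f x) \<and> continuous_map (top_of_set Om) (Euclidean_space m) g \<and>
  (AE x in lebesgue_on Om. differentiable_Rm m g x) \<and> lusin_N Om m g"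
proof -
 have "\<forall>x. \<exists>p. x \<in> Om --> (case p of (R, theta, N) => 0 < R \<and> cube x R \<subseteq> Om \<and> osc_control m (cube x R) f theta N \<and>
   (\<forall>i<m. wgrad (cube x R) (%y. ind (cube x R) y * f y i) (%j y. ind (cube x R) y * D y j i)))"
  using loc by fastforce
 from choice[OF this] obtain p where p: "!!x. x \<in> Om ==> (case p x of (R, theta, N) => 0 < R \<and> cube x R \<subseteq> Om \<and> osc_control m (cube x R) f theta N \<and>
   (\<forall>i<m. wgrad (cube x R) (%y. ind (cube x R) y * f y i) (%j y. ind (cube x R) y * D y j i)))" by blast
 define R where "R x = fst (p x)" for x
 define theta where "theta x = fst (snd (p x))" for x
 define N0 where "N0 x = snd (snd (p x))" for x
 have R: "0 < R x" "cube x (R x) \<subseteq> Om" and oc: "osc_control m (cube x (R x)) f (theta x) (N0 x)"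
  and wg: "!!i. i < m ==> wgrad (cube x (R x)) (%y. ind (cube x (R x)) y * f y i) (%j y. ind (cube x (R x)) y * D y j i)"
  if "x \<in> Om" for x using p[OF that] by (auto simp: R_def theta_def N0_def case_prod_beta)
 have bQ: "ball x (R x) \<subseteq> cube x (R x)" for x by (rule ball_subset_cube)
 obtain X where X: "countable X" "X \<subseteq> Om" "Om = (\<Union>x\<in>X. ball x (R x))"
 proof -
  have op: "open S" if "S \<in> (%x. ball x (R x)) ` Om" for S using that by auto
  have "\<exists>\<F>'\<subseteq>(%x. ball x (R x)) ` Om. countable \<F>' \<and> \<Union>\<F>' = \<Union>((%x. ball x (R x)) ` Om)"
  proof (rule Lindelof[of "(%x. ball x (R x)) ` Om"])
   show "open S" if "S \<in> (%x. ball x (R x)) ` Om" for S by (rule op[OF that])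
  qed blast
  then obtain \<F>' where F: "\<F>' \<subseteq> (%x. ball x (R x)) ` Om" "countable \<F>'" "\<Union>\<F>' = \<Union>((%x. ball x (R x)) ` Om)"
   by blast
  obtain X where X: "countable X" "X \<subseteq> Om" "\<F>' = (%x. ball x (R x)) ` X"
   using F(1,2) countable_subset_image[of \<F>' "%x. ball x (R x)" Om] by blast
  have "Om \<subseteq> \<Union>((%x. ball x (R x)) ` Om)" using R(1) by force
  moreover have "\<Union>((%x. ball x (R x)) ` Om) \<subseteq> Om" using R(2) bQ by blast
  ultimately have "Om = (\<Union>x\<in>X. ball x (R x))" using F(3) X(3) by auto
  then show ?thesis using that X by blast
 qed
 define N where "N = (\<Union>x\<in>X. N0 x)"
 have theta: "L1 (theta x)" "!!z. 0 <= theta x z" and N0: "negligible (N0 x)"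
  and osc0: "!!b r y z i. 0 < r ==> cube b r \<subseteq> cube x (R x) ==> y \<in> cube b r - N0 x ==> z \<in> cube b r - N0 x ==> i < m ==>
    abs(f y i - f z i) <= root CARD('n) (LINT v:cube b r|lm. theta x v)" if "x \<in> X" for x
  using oc[of x] that X(2) unfolding osc_control_def by blast+
 have N: "negligible N" unfolding N_def using X(1) N0 by (intro negligible_countable_Union) auto
 have "\<exists>g. continuous_on Om g \<and> (\<forall>x\<in>Om - N. g x = f x i)" if i: "i < m" for i
 proof (rule representative_exists[OF Om N])
  fix x :: "real ^ 'n" and e :: real assume "x \<in> Om" and e: "0 < e"
  then obtain x0 where x0: "x0 \<in> X" "x \<in> ball x0 (R x0)" using X(3) by blast
  obtain d where d: "d > 0" "!!r x. 0 < r ==> r < d ==> root CARD('n) (LINT z:cube x r|lm. theta x0 z) <= e"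
   using cube_integral_small[OF theta[OF x0(1)] e] by blast
  define rho where "rho = R x0 - dist x0 x"
  have rho: "0 < rho" using x0(2) by (simp add: rho_def)
  define r where "r = min (d / 2) rho"
  have r: "0 < r" "r < d" "r <= rho" using d(1) rho by (auto simp: r_def)
  have sub: "cube x r \<subseteq> cube x0 (R x0)"
  proof (rule cube_subset_cube)
   fix l
   have "abs(x $ l - x0 $ l) <= dist x0 x" using component_le_norm_cart[of "x - x0" l] by (simp add: dist_norm norm_minus_commute)
   then show "abs(x $ l - x0 $ l) + r <= R x0" using r(3) by (simp add: rho_def)
  qed
  show "\<exists>d>0. \<forall>y\<in>ball x d - N. \<forall>z\<in>ball x d - N. abs(f y i - f z i) <= e"
  proof (intro exI[of _ r] conjI r(1) ballI)
   fix y z assume "y \<in> ball x r - N" "z \<in> ball x r - N"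
   then have "y \<in> cube x r - N0 x0" "z \<in> cube x r - N0 x0" using ball_subset_cube[of x r] x0(1) by (auto simp: N_def)
   then have "abs(f y i - f z i) <= root CARD('n) (LINT v:cube x r|lm. theta x0 v)"
    by (rule osc0[OF x0(1) r(1) sub _ _ i])
   then show "abs(f y i - f z i) <= e" using d(2)[OF r(1,2), of x] by linarith
  qed
 qed
 then obtain G where G: "!!i. i < m ==> continuous_on Om (G i)" "!!i x. i < m ==> x \<in> Om - N ==> G i x = f x i" by metis
 define g where "g x i = (if i < m then G i x else 0)" for x i
 have gc: "continuous_on Om (%x. g x i)" if "i < m" for i using G(1)[OF that] that by (simp add: g_def)
 have gR: "g x \<in> Rm m" for x by (simp add: Rm_iff g_def)
 have gf: "g x = f x" if "x \<in> Om - N" for x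
 proof
  fix i
  show "g x i = f x i" using G(2)[of i x] that fR by (cases "i < m") (auto simp: g_def Rm_iff)
 qed
 have AEN: "AE x in lm. x ~: N" using N by (intro AE_not_in) (simp add: negligible_iff_null_sets)
 have Oms: "Om \<inter> space lebesgue \<in> sets lebesgue" using Om by (simp add: borel_open)
 have eq: "AE x in lebesgue_on Om. g x = f x"
  unfolding AE_restrict_space_iff[OF Oms] using AEN by eventually_elim (use gf in auto)
 have cm: "continuous_map (top_of_set Om) (Euclidean_space m) g"
  by (rule continuous_map_Euclidean_space, erule gc, simp add: g_def)
 \<comment> \<open>Every point of a cube is a limit of points of the cube outside \<open>N\<close>,
   so by continuity the oscillation bound for \<open>f\<close> passes to \<open>g\<close> at all
   points.\<close>
 have osc: "abs(g y i - g z i) <= root CARD('n) (LINT v:cube b r|lm. theta x v)"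
  if x: "x \<in> X" and r: "0 < r" and sub: "cube b r \<subseteq> cube x (R x)" and y: "y \<in> cube b r" and z: "z \<in> cube b r" and i: "i < m" for x b r y z i
 proof (rule field_le_epsilon)
  fix e :: real assume e: "0 < e"
  have near: "\<exists>y'\<in>cube b r - N. abs(g y i - f y' i) <= e / 2" if "y \<in> cube b r" for y
  proof -
   have yOm: "y \<in> Om" using that sub R(2)[of x] x X(2) by blast
   have "0 < e / 2" using e by simp
   then obtain d where d: "d > 0" "\<forall>y'\<in>Om. dist y' y < d --> dist (g y' i) (g y i) < e / 2"
    using gc[OF i] yOm unfolding continuous_on_iff by blast
   obtain y' where y': "y' \<in> cube b r - N" "dist y' y < d" using cube_dense_complement[OF r \<open>y \<in> cube b r\<close> N d(1)] by blast
   have "y' \<in> Om - N" using y' sub R(2)[of x] x X(2) by blast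
   then have "abs(g y i - f y' i) <= e / 2" using d(2) y'(2) gf[of y'] by (auto simp: dist_real_def abs_minus_commute)
   then show ?thesis using y' by blast
  qed
  obtain y' where y': "y' \<in> cube b r - N" "abs(g y i - f y' i) <= e / 2" using near[OF y] by blast
  obtain z' where z': "z' \<in> cube b r - N" "abs(g z i - f z' i) <= e / 2" using near[OF z] by blast
  have "abs(f y' i - f z' i) <= root CARD('n) (LINT v:cube b r|lm. theta x v)"
   by (rule osc0[OF x r sub _ _ i]) (use y' z' x in "auto simp: N_def")
  then show "abs(g y i - g z i) <= root CARD('n) (LINT v:cube b r|lm. theta x v) + e" using y'(2) z'(2) by linarith
 qed
 have diff: "AE x in lebesgue_on Om. differentiable_Rm m g x"
 proof -
  have lpae: "AE z in lm. lebesgue_point (theta x) z \<and> (\<forall>i\<in>{..<m}. \<forall>j\<in>UNIV. lebesgue_point (%y. ind (cube x (R x)) y * D y j i) z)" if x: "x \<in> X" for x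
  proof (rule AE_conjI)
   show "AE z in lm. lebesgue_point (theta x) z" by (rule AE_lebesgue_point[OF theta(1)[OF x]])
   show "AE z in lm. \<forall>i\<in>{..<m}. \<forall>j\<in>UNIV. lebesgue_point (%y. ind (cube x (R x)) y * D y j i) z"
    using wg[of x] x X(2) by (intro AE_finite_allI AE_lebesgue_point) (auto simp: wgrad_def)
  qed
  have "AE z in lm. \<forall>x\<in>X. lebesgue_point (theta x) z \<and> (\<forall>i\<in>{..<m}. \<forall>j\<in>UNIV. lebesgue_point (%y. ind (cube x (R x)) y * D y j i) z)"
   by (subst AE_ball_countable[OF X(1)]) (use lpae in blast)
  then show ?thesis unfolding AE_restrict_space_iff[OF Oms]
  proof (rule AE_mp, intro AE_I2 impI)
   fix z assume lp: "\<forall>x\<in>X. lebesgue_point (theta x) z \<and> (\<forall>i\<in>{..<m}. \<forall>j\<in>UNIV. lebesgue_point (%y. ind (cube x (R x)) y * D y j i) z)"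
    and z: "z \<in> Om"
   obtain x where x: "x \<in> X" "z \<in> ball x (R x)" using z X(3) by blast
   define rho where "rho = R x - dist x z"
   have rho: "0 < rho" using x(2) by (simp add: rho_def)
   have zQ: "z \<in> cube x (R x)" using x(2) bQ by blast
   have brho: "ball z rho \<subseteq> cube x (R x)"
   proof (rule order_trans[OF _ bQ])
    show "ball z rho \<subseteq> ball x (R x)"
    proof
     fix v assume "v \<in> ball z rho"
     then show "v \<in> ball x (R x)" using dist_triangle[of x v z] by (simp add: rho_def)
    qed
   qed
   have comp: "\<exists>d>0. \<forall>y. norm (y - z) < d --> abs(g y i - g z i - (\<Sum>j\<in>UNIV. (y - z) $ j * D z j i)) <= e * norm (y - z)"
    if i: "i < m" and e: "0 < e" for i e
   proof -
    have xOm: "x \<in> Om" using x X(2) by blast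
    have "\<exists>d>0. \<forall>y. norm (y - z) < d --> abs(g y i - g z i - (\<Sum>j\<in>UNIV. (y - z) $ j * (ind (cube x (R x)) z * D z j i))) <= e * norm (y - z)"
    proof (rule osc_differentiable[OF wg[OF xOm i] theta[OF x(1)] osc[OF x(1) _ _ _ _ i] N _ rho brho])
     show "ind (cube x (R x)) y * f y i = g y i" if "y \<in> cube x (R x)" "y ~: N" for y
      using that R(2)[OF xOm] gf[of y] by auto
    qed (use lp x(1) i e in auto)
    then show ?thesis using zQ by simp
   qed
   show "differentiable_Rm m g z" unfolding differentiable_Rm_def
   proof (intro exI[of _ "%j i. D z j i"] tendstoI)
    fix e :: real assume e: "0 < e"
    define e' where "e' = e / (real m + 1)"
    have e': "0 < e'" "real m * e' < e" using e by (auto simp: e'_def field_simps)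
    have "\<forall>i\<in>{..<m}. \<exists>d>0. \<forall>y. norm (y - z) < d --> abs(g y i - g z i - (\<Sum>j\<in>UNIV. (y - z) $ j * D z j i)) <= e' * norm (y - z)"
     using comp[OF _ e'(1)] by simp
    from bchoice[OF this] obtain d where d: "!!i. i < m ==> 0 < d i"
     "!!i y. i < m ==> norm (y - z) < d i ==> abs(g y i - g z i - (\<Sum>j\<in>UNIV. (y - z) $ j * D z j i)) <= e' * norm (y - z)"
     by auto
    define d0 where "d0 = Min (insert 1 (d ` {..<m}))"
    have d0: "0 < d0" "!!i. i < m ==> d0 <= d i" using d(1) by (auto simp: d0_def)
    show "\<forall>\<^sub>F y in at z. dist (L2_set (%i. g y i - g z i - (\<Sum>j\<in>UNIV. (y - z) $ j * D z j i)) {..<m} / norm (y - z)) 0 < e"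
     unfolding eventually_at
    proof (intro exI[of _ d0] conjI d0(1) ballI impI)
     fix y assume "y ~= z \<and> dist y z < d0"
     then have y: "0 < norm (y - z)" "norm (y - z) < d0" by (auto simp: dist_norm)
     have "L2_set (%i. g y i - g z i - (\<Sum>j\<in>UNIV. (y - z) $ j * D z j i)) {..<m} <= (\<Sum>i<m. abs(g y i - g z i - (\<Sum>j\<in>UNIV. (y - z) $ j * D z j i)))"
      by (rule L2_set_le_sum_abs)
     also have "... <= (\<Sum>i<m. e' * norm (y - z))"
     proof (rule sum_mono)
      fix i assume "i \<in> {..<m}"
      then have i: "i < m" by simp
      show "abs(g y i - g z i - (\<Sum>j\<in>UNIV. (y - z) $ j * D z j i)) <= e' * norm (y - z)"
       by (rule d(2)[OF i]) (use y(2) d0(2)[OF i] in linarith)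
     qed
     also have "... = (real m * e') * norm (y - z)" by simp
     also have "... < e * norm (y - z)" using e'(2) y(1) by (rule mult_strict_right_mono)
     finally have "L2_set (%i. g y i - g z i - (\<Sum>j\<in>UNIV. (y - z) $ j * D z j i)) {..<m} / norm (y - z) < e"
      using y(1) by (simp add: pos_divide_less_eq)
     moreover have "0 <= L2_set (%i. g y i - g z i - (\<Sum>j\<in>UNIV. (y - z) $ j * D z j i)) {..<m} / norm (y - z)"
      by (simp add: L2_set_nonneg)
     ultimately show "dist (L2_set (%i. g y i - g z i - (\<Sum>j\<in>UNIV. (y - z) $ j * D z j i)) {..<m} / norm (y - z)) 0 < e"
      unfolding dist_real_def by linarith
    qed
   qed
  qed
 qed
 have "lusin_N Om m g" unfolding lusin_N_def
 proof (intro allI impI)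
  fix Z assume Z: "Z \<subseteq> Om \<and> Z \<in> null_sets lebesgue"
  show "hausdorff_measure m CARD('n) (g ` Z) = 0"
  proof (rule hausdorff_null)
   fix dlt e :: real assume dlt: "0 < dlt" and e: "0 < e"
   show "small_cover m CARD('n) dlt e (g ` Z)"
   proof (cases "X = {}")
    case True
    then have "g ` Z = {}" using Z X(3) by auto
    then show ?thesis by (simp add: small_cover_empty)
   next
    case False
    define x where "x = from_nat_into X"
    have xX: "x k \<in> X" for k unfolding x_def using False by (rule from_nat_into)
    have rx: "range x = X" unfolding x_def using False X(1) by (rule range_from_nat_into)
    have "small_cover m CARD('n) dlt e (\<Union>k. g ` (Z \<inter> ball (x k) (R (x k))))"
    proof (rule small_cover_UN[OF _ e])
     fix k and e :: real assume e: "0 < e"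
     have xOm: "x k \<in> Om" using xX X(2) by blast
     show "small_cover m CARD('n) dlt e (g ` (Z \<inter> ball (x k) (R (x k))))"
     proof (rule osc_small_cover[OF R(1)[OF xOm] theta[OF xX] _ gR _ _ dlt e])
      show "negligible (Z \<inter> ball (x k) (R (x k)))"
       by (rule negligible_subset[of Z]) (use Z in "auto simp: negligible_iff_null_sets")
      show "abs(g y i - g z i) <= root CARD('n) (LINT v:cube b r|lm. theta (x k) v)"
       if "0 < r" "cube b r \<subseteq> cube (x k) (R (x k))" "y \<in> cube b r" "z \<in> cube b r" "i < m" for b r y z i
       by (rule osc[OF xX that])
     qed auto
    qed
    moreover have "g ` Z \<subseteq> (\<Union>k. g ` (Z \<inter> ball (x k) (R (x k))))"
    proof safe
     fix z assume z: "z \<in> Z"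
     then obtain x0 where x0: "x0 \<in> X" "z \<in> ball x0 (R x0)" using Z X(3) by blast
     then obtain k where "x0 = x k" using rx by blast
     then have "z \<in> ball (x k) (R (x k))" using x0 by simp
     then show "g z \<in> (\<Union>k. g ` (Z \<inter> ball (x k) (R (x k))))" using z by blast
    qed
    ultimately show ?thesis by (rule small_cover_mono)
   qed
  qed
 qed
 then show ?thesis using eq cm diff by blast
qed

section \<open>Norms of bounded volume forms and reduction to a cube\<close>

lemma finite_multi_indices: "finite (multi_indices m :: ('n::{finite,linorder} => nat) set)"
proof (rule finite_subset)
 show "multi_indices m \<subseteq> (\<Pi>\<^sub>E k\<in>(UNIV::'n set). {..<m})" by (auto simp: multi_indices_def PiE_def)
qed (auto intro: finite_PiE)

lemma l1_norm_bound:
 fixes phi :: "'n::{finite,linorder} form"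
 assumes "bounded_volume_form m phi" "q \<in> Rm m"
 shows "(\<Sum>I\<in>multi_indices m. abs(phi I q)) <= l1_norm m phi"
 unfolding l1_norm_def
proof (rule cSUP_upper[OF assms(2)])
 have "\<forall>I\<in>multi_indices m. \<exists>B. \<forall>x\<in>Rm m. abs(phi I x) <= B"
  using assms(1) unfolding bounded_volume_form_def bounded_iff by fastforce
 from bchoice[OF this] obtain B where "!!I x. I \<in> multi_indices m ==> x \<in> Rm m ==> abs(phi I x) <= B I" by blast
 then show "bdd_above ((%x. \<Sum>I\<in>multi_indices m. abs(phi I x)) ` Rm m)"
  by (intro bdd_aboveI2[where M = "\<Sum>I\<in>multi_indices m. B I"] sum_mono) auto
qed

text \<open>Distinct multi-indices have distinct ranges of equal size, so in the off-diagonal case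
  the matrix has a zero row.\<close>

lemma dx_basis:
 fixes I J :: "'n::{finite,linorder} => nat"
 assumes "I \<in> multi_indices m" "J \<in> multi_indices m"
 shows "dx J (%k i. if i = I k then 1 else 0) = (if J = I then 1 else 0)"
proof (cases "J = I")
 case True
 have "inj I" using assms(1) by (simp add: multi_indices_def strict_mono_imp_inj_on)
 then have "((\<chi> k l. if I k = I l then 1 else 0) :: real ^ 'n::{finite,linorder} ^ 'n::{finite,linorder}) = mat 1" by (simp add: vec_eq_iff mat_def inj_eq)
 then show ?thesis using True by (simp add: dx_def)
next
 case False
 have "\<exists>k. J k ~: range I"
 proof (rule ccontr)
  assume "\<not> ?thesis"
  then have sub: "range J \<subseteq> range I" by auto
  have "card (range J) = card (range I)"
   using assms by (simp add: multi_indices_def card_image strict_mono_imp_inj_on)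
  then have "range J = range I" using card_subset_eq[OF _ sub] by simp
  then have "J = I" using assms strict_mono_range_unique[of J I] by (auto simp: multi_indices_def)
  then show False using False by simp
 qed
 then obtain k where k: "!!l. J k ~= I l" by auto
 have "det ((\<chi> k l. if J k = I l then 1 else 0) :: real ^ 'n::{finite,linorder} ^ 'n::{finite,linorder}) = 0"
  by (rule det_zero_row(1)[of k]) (simp add: row_def vec_eq_iff k)
 then show ?thesis using False by (simp add: dx_def)
qed

text \<open>The basis vectors numbered by \<open>I\<close> are admissible in the supremum, and the
  form takes on them the coefficient of \<open>dx I\<close>. The supremum is finite because the
  coefficients are bounded.\<close>

lemma comass_ge:
 fixes phi :: "'n::{finite,linorder} form"
 assumes bv: "bounded_volume_form m phi" and p: "p \<in> Rm m" and I: "I \<in> multi_indices m"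
 shows "abs(phi I p) <= comass m phi p"
proof -
 define v :: "'n => nat => real" where "v k i = (if i = I k then 1 else 0)" for k i
 have "form_at m phi p v = (\<Sum>J\<in>multi_indices m. if J = I then phi J p else 0)"
  unfolding form_at_def v_def[abs_def] by (intro sum.cong refl) (use dx_basis[OF I] in simp)
 also have "... = phi I p" using I by (simp add: finite_multi_indices)
 finally have eq: "form_at m phi p v = phi I p" .
 have "I k < m" for k using I by (auto simp: multi_indices_def)
 then have vR: "v k \<in> Rm m" for k by (auto simp: v_def Rm_iff not_le[symmetric])
 have vL: "L2_set (v k) {..<m} <= 1" for k
 proof -
  have "(\<Sum>i<m. (v k i)\<^sup>2) = (\<Sum>i<m. if i = I k then 1 else 0)" by (intro sum.cong) (auto simp: v_def)
  also have "... <= 1" by simp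
  finally show ?thesis by (simp add: L2_set_def)
 qed
 have "abs(form_at m phi p v) <= comass m phi p" unfolding comass_def
 proof (rule cSUP_upper)
  show "v \<in> {v. \<forall>k. v k \<in> Rm m \<and> L2_set (v k) {..<m} <= 1}" using vR vL by simp
  show "bdd_above ((%v. abs(form_at m phi p v)) ` {v. \<forall>k. v k \<in> Rm m \<and> L2_set (v k) {..<m} <= 1})"
  proof (rule bdd_aboveI2)
   fix v :: "'n => nat => real" assume v: "v \<in> {v. \<forall>k. v k \<in> Rm m \<and> L2_set (v k) {..<m} <= 1}"
   show "abs(form_at m phi p v) <= l1_norm m phi * (fact CARD('n) * (\<Prod>l\<in>(UNIV::'n set). 1))"
   proof (rule form_at_abs_le)
    show "(\<Sum>I\<in>multi_indices m. abs(phi I p)) <= l1_norm m phi" by (rule l1_norm_bound[OF bv p])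
    show "abs(v l i) <= 1" if "i < m" for l i
    proof -
     have "abs(v l i) = L2_set (v l) {i}" by (simp add: L2_set_def)
     also have "... <= L2_set (v l) {..<m}"
      unfolding L2_set_def using that by (intro real_sqrt_le_mono sum_mono2) auto
     finally show ?thesis using v by (auto intro: order_trans)
    qed
   qed simp
  qed
 qed
 then show ?thesis using eq by simp
qed

lemma zero_Rm: "(%_. 0) \<in> Rm m" by (simp add: Rm_iff)

text \<open>The uniform lower bound on some coefficient at every point passes to the comass by
  \<open>comass_ge\<close> and to the sum of all coefficients.\<close>

lemma inf_norm_bounds:
 fixes phi :: "'n::{finite,linorder} form"
 assumes bv: "bounded_volume_form m phi"
 shows "0 < inf_norm m phi" "!!p. p \<in> Rm m ==> inf_norm m phi <= comass m phi p" "0 < l1_norm m phi"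
proof -
 obtain c where c: "c > 0" "!!x. x \<in> Rm m ==> \<exists>I\<in>multi_indices m. abs(phi I x) > c"
  using bv unfolding bounded_volume_form_def by blast
 have ge: "c <= comass m phi p" if p: "p \<in> Rm m" for p
  using c(2)[OF p] comass_ge[OF bv p] by (meson less_imp_le order_trans)
 have "c <= inf_norm m phi" unfolding inf_norm_def
 proof (rule cINF_greatest)
  show "Rm m ~= {}" using zero_Rm by blast
 qed (rule ge)
 then show "0 < inf_norm m phi" using c(1) by simp
 show "inf_norm m phi <= comass m phi p" if "p \<in> Rm m" for p
  unfolding inf_norm_def using that ge by (intro cINF_lower bdd_belowI2[where m = c]) auto
 obtain I where I: "I \<in> multi_indices m" "c < abs(phi I (%_. 0))" using c(2)[OF zero_Rm] by blast
 have "abs(phi I (%_. 0)) <= (\<Sum>I\<in>multi_indices m. abs(phi I (%_. 0)))"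
  by (rule member_le_sum) (use I finite_multi_indices in auto)
 then show "0 < l1_norm m phi" using l1_norm_bound[OF bv zero_Rm] I(2) c(1) by linarith
qed

lemma entry_le_op_norm:
 fixes A :: "'n::finite => nat => real"
 assumes "i < m" shows "abs(A j i) <= op_norm m A"
proof -
 have "abs(A j i) <= L2_set (%i. A j i) {..<m}"
 proof -
  have "abs(A j i) = L2_set (A j) {i}" by (simp add: L2_set_def)
  also have "... <= L2_set (A j) {..<m}" unfolding L2_set_def using assms by (intro real_sqrt_le_mono sum_mono2) auto
  finally show ?thesis by simp
 qed
 also have "... = L2_set (%i. \<Sum>k\<in>UNIV. axis j 1 $ k * A k i) {..<m}"
 proof -
  have "(\<Sum>k\<in>UNIV. axis j 1 $ k * A k i) = A j i" for i
  proof -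
   have "(\<Sum>k\<in>UNIV. axis j 1 $ k * A k i) = (\<Sum>k\<in>UNIV. if k = j then A k i else 0)"
    by (intro sum.cong) (auto simp: axis_def)
   then show ?thesis by simp
  qed
  then show ?thesis by simp
 qed
 also have "... <= op_norm m A" unfolding op_norm_def
 proof (rule cSUP_upper)
  show "axis j 1 \<in> {v :: real ^ 'n. norm v <= 1}" by (simp add: norm_axis_1)
  show "bdd_above ((%v :: real ^ 'n. L2_set (%i. \<Sum>j\<in>UNIV. v $ j * A j i) {..<m}) ` {v. norm v <= 1})"
  proof (rule bdd_aboveI2)
   fix v :: "real ^ 'n" assume v: "v \<in> {v. norm v <= 1}"
   have "L2_set (%i. \<Sum>j\<in>UNIV. v $ j * A j i) {..<m} <= (\<Sum>i<m. abs(\<Sum>j\<in>UNIV. v $ j * A j i))" by (rule L2_set_le_sum_abs)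
   also have "... <= (\<Sum>i<m. \<Sum>j\<in>UNIV. abs(A j i))"
   proof (intro sum_mono order_trans[OF sum_abs])
    fix i j
    have "abs(v $ j) <= 1" using component_le_norm_cart[of v j] v by simp
    then show "abs(v $ j * A j i) <= abs(A j i)" by (simp add: abs_mult mult_left_le_one_le)
   qed
   finally show "L2_set (%i. \<Sum>j\<in>UNIV. v $ j * A j i) {..<m} <= (\<Sum>i<m. \<Sum>j\<in>UNIV. abs(A j i))" .
  qed
 qed
 finally show ?thesis .
qed

text \<open>A smooth function that vanishes off the compact set \<open>Q\<close> has compact support
  inside \<open>Om\<close>, so it is a test function on \<open>Om\<close>.\<close>

lemma weak_partial_wgrad:
 fixes u :: "real ^ 'n::finite => real"
 assumes u: "L1_loc Om u" "!!j. L1_loc Om (w j)" and wp: "!!j. weak_partial Om j u (w j)"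
  and Q: "compact Q" "Q \<subseteq> Om"
 shows "wgrad Q (%x. ind Q x * u x) (%j x. ind Q x * w j x)"
 unfolding wgrad_def
proof (intro conjI allI impI)
 show "L1 (%x. ind Q x * u x)" "L1 (%x. ind Q x * w j x)" for j
  using u Q unfolding L1_loc_def set_integrable_def by auto
 fix psi j assume psi: "\<forall>k. Ck k psi" "\<forall>x. x ~: Q --> psi x = 0"
 have clQ: "closed Q" using Q(1) by (rule compact_imp_closed)
 have cl: "closure {x. psi x ~= 0} \<subseteq> Q" using psi(2) clQ by (intro closure_minimal) auto
 have "compact (closure {x. psi x ~= 0})"
  using compact_Int_closed[OF Q(1) closed_closure[of "{x. psi x ~= 0}"]] cl by (simp add: inf.absorb2)
 then have tf: "test_function Om psi" unfolding test_function_def using psi(1) cl Q(2) by blast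
 have d0: "frechet_derivative psi (at x) = (%_. 0)" if "x ~: Q" for x
  by (rule frechet_derivative_vanish[OF clQ _ that]) (use psi in blast)
 have "(LINT x:Om|lm. u x * pd psi x j) = - (LINT x:Om|lm. w j x * psi x)"
  using wp[of j] tf unfolding weak_partial_def by blast
 moreover have "(%x. ind Om x *\<^sub>R (u x * pd psi x j)) = (%x. ind Q x * u x * pd psi x j)"
  "(%x. ind Om x *\<^sub>R (w j x * psi x)) = (%x. ind Q x * w j x * psi x)"
  using d0 psi(2) Q(2) by (auto simp: fun_eq_iff indicator_def)
 ultimately show "(LI x. ind Q x * u x * pd psi x j) = - (LI x. ind Q x * w j x * psi x)"
  by (simp add: slint_def)
qed

text \<open>Where the distortion is finite, the inequality with nonnegative left side and a factor
  \<open>K\<close> of at least one forces the Jacobian to be nonnegative. The maximum with one makes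
  the real factor at least one also at points where \<open>K\<close> is infinite or that lie outside
  \<open>Om\<close>.\<close>

lemma finite_distortion_real:
 fixes phi :: "'n::{finite,linorder} form"
 assumes bv: "bounded_volume_form m phi" and fd: "finite_distortion_curve Om m phi f D K" and Om: "open Om" and m: "0 < m"
 shows "AE x in lm. x \<in> Om --> 0 <= form_at m phi (f x) (D x) \<and>
  inf_norm m phi * op_norm m (D x) ^ CARD('n) <= max 1 (real_of_ereal (K x)) * form_at m phi (f x) (D x)"
proof -
 have Oms: "Om \<inter> space lebesgue \<in> sets lebesgue" using Om by (simp add: borel_open)
 have 1: "AE x in lm. x \<in> Om --> K x < \<infinity>"
  and 2: "AE x in lm. x \<in> Om --> ereal (comass m phi (f x) * op_norm m (D x) ^ CARD('n)) <= K x * ereal (star_pullback m phi f D x)"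
  using fd unfolding finite_distortion_curve_def AE_restrict_space_iff[OF Oms] by auto
 have K1: "1 <= K x" if "x \<in> Om" for x using fd that unfolding finite_distortion_curve_def by blast
 have fR: "f x \<in> Rm m" if "x \<in> Om" for x using fd that unfolding finite_distortion_curve_def W11_loc_def by blast
 show ?thesis using 1 2
 proof eventually_elim
  case (elim x)
  show ?case
  proof (intro impI)
   assume x: "x \<in> Om"
   obtain k where k: "K x = ereal k" using elim(1) x K1[OF x] by (cases "K x") auto
   have k1: "1 <= k" using K1[OF x] k by simp
   define J where "J = form_at m phi (f x) (D x)"
   have le: "comass m phi (f x) * op_norm m (D x) ^ CARD('n) <= k * J"
    using elim(2) x by (simp add: k J_def star_pullback_def)
   have "0 < inf_norm m phi" "inf_norm m phi <= comass m phi (f x)" using inf_norm_bounds[OF bv] fR[OF x] by auto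
   moreover have "0 <= op_norm m (D x) ^ CARD('n)"
    using entry_le_op_norm[OF m, of "D x" undefined] by (intro zero_le_power) linarith
   ultimately have le2: "inf_norm m phi * op_norm m (D x) ^ CARD('n) <= k * J" and "0 <= k * J"
    using le mult_right_mono[of "inf_norm m phi" "comass m phi (f x)" "op_norm m (D x) ^ CARD('n)"]
    by (auto intro: order_trans[OF mult_nonneg_nonneg[of "comass m phi (f x)"]])
   then have "0 <= J" using k1 by (simp add: zero_le_mult_iff)
   moreover have "max 1 (real_of_ereal (K x)) = k" using k k1 by simp
   ultimately show "0 <= form_at m phi (f x) (D x) \<and>
     inf_norm m phi * op_norm m (D x) ^ CARD('n) <= max 1 (real_of_ereal (K x)) * form_at m phi (f x) (D x)"
    using le2 by (simp add: J_def)
  qed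
 qed
qed

text \<open>Only the choice of the constant is global, and it involves nothing but \<open>n\<close>;
  the rest happens on a cube about each point, from where \<open>regular_representative\<close>
  takes over.\<close>

theorem theorem1p5:
  shows "\<exists>c1 :: real. c1 > 0 \<and>
    (\<forall>m (\<Omega> :: (real ^ 'n::{finite,linorder}) set) (\<phi> :: 'n form) f D K (l :: real).
       CARD('n) \<le> m \<longrightarrow>
       open \<Omega> \<longrightarrow> connected \<Omega> \<longrightarrow> \<Omega> \<noteq> {} \<longrightarrow>
       bounded_volume_form m \<phi> \<longrightarrow>
       finite_distortion_curve \<Omega> m \<phi> f D K \<longrightarrow>
       condition_D \<Omega> m \<phi> D \<longrightarrow>
       l > real CARD('n) * l1_norm m \<phi> / (c1 * inf_norm m \<phi>) \<longrightarrow>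
       L1_loc \<Omega> (\<lambda>x. exp (l * real_of_ereal (K x))) \<longrightarrow>
       (\<exists>g. (AE x in lebesgue_on \<Omega>. g x = f x) \<and>
            continuous_map (top_of_set \<Omega>) (Euclidean_space m) g \<and>
            (AE x in lebesgue_on \<Omega>. differentiable_Rm m g x) \<and>
            lusin_N \<Omega> m g))"
proof -
 define n where "n = CARD('n)"
 have n0: "0 < n" by (simp add: n_def)
 define A where "A = level_const n"
 have A: "0 < A" using bump_max(1) dbump_max(1) lip_const_pos[OF n0] n0
  unfolding A_def level_const_def slope_const_def grad_const_def by (intro mult_pos_pos zero_less_power) auto
 define q where "q = 2 * n + 1"
 \<comment> \<open>Solved from the two demands on \<open>eps\<close>: the absorption allows at most
   \<open>iota / (4 * (A * L) * 2 ^ n * 4 ^ q)\<close>, and for this value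
   \<open>n * ln 2 / eps\<close> is exactly \<open>n * L / (c1 * iota)\<close>, the threshold for
   \<open>l\<close>.\<close>
 define c1 where "c1 = 1 / (ln 2 * A * 2 ^ (n + 2) * 4 ^ q)"
 have c1: "0 < c1" using A by (simp add: c1_def)
 have "\<exists>g. (AE x in lebesgue_on Om. g x = f x) \<and> continuous_map (top_of_set Om) (Euclidean_space m) g \<and>
      (AE x in lebesgue_on Om. differentiable_Rm m g x) \<and> lusin_N Om m g"
  if nm: "n <= m" and Om: "open Om" and bv: "bounded_volume_form m phi" and fd: "finite_distortion_curve Om m phi f D K"
   and l_gt: "l > real n * l1_norm m phi / (c1 * inf_norm m phi)" and E: "L1_loc Om (%x. exp (l * real_of_ereal (K x)))"
  for m and Om :: "(real ^ 'n::{finite,linorder}) set" and phi :: "'n form" and f D K l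
 proof (rule regular_representative[OF Om])
  have m: "0 < m" using nm n0 by simp
  define L where "L = l1_norm m phi"
  define iota where "iota = inf_norm m phi"
  have Lpos: "0 < L" and iotapos: "0 < iota" using inf_norm_bounds[OF bv] by (auto simp: L_def iota_def)
  have l0: "0 < l" using l_gt Lpos iotapos c1 n0 unfolding L_def[symmetric] iota_def[symmetric]
   by (meson divide_pos_pos less_trans mult_pos_pos of_nat_0_less_iff)
  have W: "W11_loc Om m f D" and JL: "L1_loc Om (star_pullback m phi f D)"
   using fd unfolding finite_distortion_curve_def by auto
  show fR: "f ` Om \<subseteq> Rm m" using W unfolding W11_loc_def by blast
  fix a assume a: "a \<in> Om"
  obtain R where RQ: "0 < R" "cube a R \<subseteq> Om"
  proof -
   obtain e where e: "e > 0" "ball a e \<subseteq> Om" using Om a by (auto simp: open_contains_ball)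
   have "cube a (e / (2 * real CARD('n))) \<subseteq> ball a e"
    by (rule cube_subset_ball[of _ _ _ "e / (2 * real CARD('n))"]) (use e in auto)
   then show ?thesis using that[of "e / (2 * real CARD('n))"] e by auto
  qed
  define Q where "Q = cube a R"
  have cQ: "compact Q" by (simp add: Q_def compact_cube)
  \<comment> \<open>Off the domain the values of \<open>f\<close> are arbitrary; the zero vector
    makes the map take values in the target space everywhere and changes nothing on cubes inside
    \<open>Om\<close>.\<close>
  define f' where "f' x = (if x \<in> Om then f x else (%_. 0))" for x
  have f'R: "f' x \<in> Rm m" for x using fR zero_Rm by (auto simp: f'_def)
  have wgr: "wgrad (cube a r) (%x. ind (cube a r) x * f x i) (%j x. ind (cube a r) x * D x j i)"
   if i: "i < m" and r: "r <= R" for i r by (rule weak_partial_wgrad[of Om "%x. f x i" "%j x. D x j i"])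
    (use W i RQ(2) cube_mono[OF r, of a] compact_cube in "auto simp: W11_loc_def")
  have ff: "ind (cube a r) x * f' x i = ind (cube a r) x * f x i" if "r <= R" for x i r
   using RQ(2) cube_mono[OF that, of a] by (auto simp: f'_def indicator_def)
  define S where "S = {..<m} \<times> (UNIV :: 'n set)"
  have S: "finite S" "S ~= {}" using m by (auto simp: S_def)
  define h where "h x = Max ((%(i, j). abs(ind Q x * D x j i)) ` S)" for x
  have Dh: "abs(ind Q x * D x j i) <= h x" if "i < m" for i j x
   unfolding h_def using S that by (intro Max_ge) (auto simp: S_def intro!: image_eqI[where x = "(i, j)"])
  have hD: "\<exists>i j. i < m \<and> h x = abs(ind Q x * D x j i)" for x
  proof -
   have "h x \<in> (%(i, j). abs(ind Q x * D x j i)) ` S" unfolding h_def using S by (intro Max_in) auto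
   then show ?thesis by (auto simp: S_def)
  qed
  have h0: "0 <= h x" for x using Dh[OF m, of x] abs_ge_zero order_trans by blast
  have hout: "h x = 0" if "x ~: Q" for x using hD[of x] that by auto
  have Di: "L1 (%x. ind Q x * D x j i)" if "i < m" for i j
   using wgr[OF that order_refl] by (auto simp: wgrad_def Q_def)
  have hi: "L1 h"
  proof (rule int_bound)
   show "L1 (%x. \<Sum>(i, j)\<in>S. abs(ind Q x * D x j i))"
    unfolding case_prod_beta by (intro int_sum integrable_abs Di) (auto simp: S_def)
   have "(%x. Max ((%p. abs(ind Q x * D x (snd p) (fst p))) ` S)) \<in> bml"
    by (intro borel_measurable_Max S borel_measurable_abs borel_measurable_integrable Di) (auto simp: S_def)
   then show "h \<in> bml" unfolding h_def[abs_def] case_prod_beta .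
   show "AE x in lm. norm (h x) <= norm (\<Sum>(i, j)\<in>S. abs(ind Q x * D x j i))"
   proof (rule AE_I2)
    fix x
    obtain i j where ij: "i < m" "h x = abs(ind Q x * D x j i)" using hD by blast
    have "(%(i, j). abs(ind Q x * D x j i)) (i, j) <= (\<Sum>(i, j)\<in>S. abs(ind Q x * D x j i))"
     by (rule member_le_sum) (use S ij in "auto simp: S_def")
    then show "norm (h x) <= norm (\<Sum>(i, j)\<in>S. abs(ind Q x * D x j i))" using ij h0[of x] by auto
   qed
  qed
  show "\<exists>R theta N. 0 < R \<and> cube a R \<subseteq> Om \<and> osc_control m (cube a R) f theta N \<and>
   (\<forall>i<m. wgrad (cube a R) (%y. ind (cube a R) y * f y i) (%j y. ind (cube a R) y * D y j i))"
  proof (cases "n = 1")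
   case True
   have "\<exists>theta N. osc_control m Q (%x i. ind Q x * f x i) theta N"
    by (rule osc_control_1d[where w = "%x j i. ind Q x * D x j i" and h = h])
     (use True n_def wgr[OF _ order_refl] Dh hi h0 in "auto simp: Q_def[symmetric]")
   then obtain theta N where "osc_control m Q (%x i. ind Q x * f x i) theta N" by blast
   then have "osc_control m Q f theta N" by (rule osc_control_cong) simp
   then show ?thesis using RQ wgr[OF _ order_refl] unfolding Q_def by blast
  next
   case False
   then have n2: "2 <= n" using n0 by simp
   \<comment> \<open>The conversion sends an infinite distortion to zero, and the maximum restores a
     factor of at least one; the exponential of \<open>k\<close> is dominated by that of
     \<open>K\<close> and a constant.\<close>
   define k where "k x = max 1 (real_of_ereal (K x))" for x
   have "distortion_cube m phi a R f' D h L k iota l"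
   proof unfold_locales
    show "2 <= CARD('n)" using n2 by (simp add: n_def)
    show "0 < m" "0 < R" "0 < iota" "0 < l" by fact+
    show "Ck_Rm m (Suc 0) (phi I)" if "I \<in> multi_indices m" for I
     using bv that unfolding bounded_volume_form_def volume_form_def smooth_Rm_def by blast
    show "closed_form m phi" using bv unfolding bounded_volume_form_def volume_form_def by blast
    show "(\<Sum>I\<in>multi_indices m. abs(phi I x)) <= L" if "x \<in> Rm m" for x
     unfolding L_def by (rule l1_norm_bound[OF bv that])
    show "f' x \<in> Rm m" for x by (rule f'R)
    show "wgrad (cube a R) (%x. ind (cube a R) x * f' x i) (%j x. ind (cube a R) x * D x j i)" if "i < m" for i
     unfolding ff[OF order_refl] by (rule wgr[OF that order_refl])
    show "abs(ind (cube a R) x * D x j i) <= h x" if "i < m" for i j x using Dh[OF that] by (simp add: Q_def)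
    show "L1 h" by (rule hi)
    show "h x = 0" if "x ~: cube a R" for x using hout that by (simp add: Q_def)
    have fpull: "(%x. ind (cube a R) x * form_at m phi (f' x) (D x)) = (%x. ind Q x *\<^sub>R star_pullback m phi f D x)"
     using RQ(2) by (auto simp: fun_eq_iff Q_def f'_def star_pullback_def indicator_def)
    show "L1 (%x. ind (cube a R) x * form_at m phi (f' x) (D x))"
     unfolding fpull using JL cQ RQ(2) unfolding L1_loc_def set_integrable_def Q_def by blast
    show "1 <= k x" for x by (simp add: k_def)
    show "L1 (%x. ind (cube a R) x * exp (l * k x))"
    proof -
     have "L1 (%x. max (ind Q x * exp l) (ind Q x * exp (l * real_of_ereal (K x))))"
     proof (rule int_max)
      show "L1 (%x. ind Q x * exp l)" unfolding Q_def by (rule integrable_ind_const[OF cube_lmeasurable])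
      show "L1 (%x. ind Q x * exp (l * real_of_ereal (K x)))"
       using E cQ RQ(2) unfolding L1_loc_def set_integrable_def Q_def by simp
     qed
     moreover have "max (ind Q x * exp l) (ind Q x * exp (l * real_of_ereal (K x))) = ind (cube a R) x * exp (l * k x)" for x
      using l0 by (auto simp: k_def Q_def indicator_def max_def)
     ultimately show ?thesis by simp
    qed
    show "AE x in lm. 0 <= ind (cube a R) x * form_at m phi (f' x) (D x)"
     using finite_distortion_real[OF bv fd Om m] by eventually_elim (use RQ(2) in "auto simp: f'_def indicator_def")
    show "AE x in lm. x \<in> cube a R --> iota * h x ^ CARD('n) <= k x * form_at m phi (f' x) (D x)"
     using finite_distortion_real[OF bv fd Om m]
    proof eventually_elim
     case (elim x)
     show ?case
     proof
      assume x: "x \<in> cube a R"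
      then have xOm: "x \<in> Om" using RQ(2) by auto
      obtain i j where "i < m" "h x = abs(ind Q x * D x j i)" using hD by blast
      then have "h x <= op_norm m (D x)" using entry_le_op_norm[of i m "D x" j] x by (simp add: Q_def)
      then have "iota * h x ^ CARD('n) <= iota * op_norm m (D x) ^ CARD('n)"
       using iotapos h0[of x] by (intro mult_left_mono power_mono) auto
      then show "iota * h x ^ CARD('n) <= k x * form_at m phi (f' x) (D x)"
       using elim xOm by (simp add: iota_def k_def f'_def)
     qed
    qed
   qed
   then interpret distortion_cube m phi a R f' D h L k iota l .
   define eps where "eps = iota / (4 * (A * L) * 2 ^ n * 4 ^ q)"
   have eps: "0 < eps" using iotapos A Lpos by (simp add: eps_def)
   have abs: "4 * (level_const CARD('n) * L) * 2 ^ CARD('n) * 4 ^ (2 * CARD('n) + 1) * eps <= iota"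
    using A Lpos by (simp add: eps_def A_def n_def q_def)
   have "real n * ln 2 / eps = real n * L / (c1 * iota)"
    using A Lpos iotapos by (simp add: eps_def c1_def power_add field_simps)
   then have epsl: "real CARD('n) * ln 2 / eps < l" using l_gt by (simp add: n_def L_def iota_def)
   \<comment> \<open>The gain of integrability is an interior one: the cutoffs need the room between
     the two cubes.\<close>
   have R2: "0 < R / 2" "R / 2 < R" using RQ by auto
   have "\<exists>theta N. osc_control m (cube a (R / 2)) (%x i. ind Q x * f x i) theta N"
   proof (rule osc_control_orlicz[where w = "%x j i. ind Q x * D x j i" and h = h and Q = Q])
    show "L1 (%x. ind (cube a (R / 2)) x * (h x ^ CARD('n) * ln (1 + h x) ^ (2 * CARD('n))))"
     by (rule orlicz_integrable[OF R2 eps epsl abs])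
    show "wgrad Q (%x. ind Q x * f x i) (%j x. ind Q x * D x j i)" if "i < m" for i
     using wgr[OF that order_refl] by (simp add: Q_def)
    show "cube a (R / 2) \<subseteq> Q" unfolding Q_def by (rule cube_mono) (use RQ in simp)
    show "cube a (R / 2) \<in> lmeasurable" by (rule cube_lmeasurable)
    show "abs(ind Q x * D x j i) <= h x" if "i < m" for i j x using Dh[OF that] by (simp add: Q_def)
   qed (rule h h_nonneg)+
   then obtain theta N where "osc_control m (cube a (R / 2)) (%x i. ind Q x * f x i) theta N" by blast
   moreover have sub: "cube a (R / 2) \<subseteq> cube a R" by (rule cube_mono) (use RQ in simp)
   ultimately have "osc_control m (cube a (R / 2)) f theta N" by (elim osc_control_cong) (auto simp: Q_def)
   moreover have "cube a (R / 2) \<subseteq> Om" using sub RQ(2) by blast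
   moreover have "\<forall>i<m. wgrad (cube a (R / 2)) (%y. ind (cube a (R / 2)) y * f y i) (%j y. ind (cube a (R / 2)) y * D y j i)"
    using wgr RQ(1) by simp
   ultimately show ?thesis using R2(1) by blast
  qed
 qed
 then show ?thesis using c1 unfolding n_def by blast
qed

end
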